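(* Let $\ell\ge 2$ (with the root of unity $\varepsilon$, $\varepsilon^{2\ell}=1$, fixed as in the context) and let $\mathfrak a\in\{0,1\}$. Then any simple module of $U_\varepsilon^{\mathrm{res}}(L\mathfrak{sl}_{n+1})$ in the category $\mathcal C_{\mathcal X_{\mathfrak a}}$ can be converted to a snake module; that is, for every simple object $L(m)$ of $\mathcal C_{\mathcal X_{\mathfrak a}}$ there is a snake $(i_t,k_t)_{1\le t\le z}$ of points of $\mathcal X_{\mathfrak a}$ such that $m=\prod_{t=1}^z Y_{i_t,k_t}$ (as monomials in the variables $Y_{i,b}$, $b\in\mathbb C^\times$, where $Y_{i,s}=Y_{i,a\varepsilon^s}$), so that $L(m)=L\big(\prod_{t=1}^zY_{i_t,k_t}\big)$ is a snake module.
   Context: Fix $n\ge1$, $I=\{1,\dots,n\}$, an integer $\ell\ge 2$, and $\varepsilon=\exp(\pi\sqrt{-1}/\ell)$ if $\ell$ is even, $\varepsilon=\exp(2\pi\sqrt{-1}/\ell)$ if $\ell$ is odd; so $\varepsilon^{2\ell}=1$ and $\varepsilon^2$ has order $\ell$. $U_q(L\mathfrak{sl}_{n+1})$ is the quantum loop algebra over $\mathbb C(q)$ (the quotient of the quantum affine algebra in which the central charge is mapped to $1$), with Chevalley generators $e_i^\pm,k_i^{\pm1}$, $0\le i\le n$; $U_q^{\mathrm{res}}(L\mathfrak{sl}_{n+1})$ is its $\mathbb C[q,q^{-1}]$-subalgebra generated by all $k_i^{\pm1}$ and the divided powers $(e_i^\pm)^{r}/[r]_q!$, $r>0$; and $U_\varepsilon^{\mathrm{res}}(L\mathfrak{sl}_{n+1})=U_q^{\mathrm{res}}(L\mathfrak{sl}_{n+1})\otimes_{\mathbb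 C[q,q^{-1}]}\mathbb C$ via $q\mapsto\varepsilon$. Finite-dimensional (type 1) simple $U_\varepsilon^{\mathrm{res}}(L\mathfrak{sl}_{n+1})$-modules are classified by $I$-tuples $(P_i(u))_{i\in I}$ of Drinfeld polynomials $P_i(u)\in\mathbb C[u]$ with constant term $1$, equivalently by dominant monomials $m$ in formal variables $Y_{i,b}$ ($i\in I$, $b\in\mathbb C^\times$), i.e. monomials with nonnegative exponents (a root factor $1-bu$ of $P_i$ corresponds to $Y_{i,b}$). $L(m)$ is the simple module corresponding to $m$. Fix $a\in\mathbb C^\times$ and write $Y_{i,s}=Y_{i,a\varepsilon^s}$ for $s\in\mathbb Z$; thus $Y_{i,s+2\ell}=Y_{i,s}$. For $\mathfrak a\in\{0,1\}$ let $\mathcal X_{\mathfrak a}=\{(i,k)\in I\times\mathbb Z: i-k\equiv\mathfrak a \pmod 2\}$. $\mathcal C_{\mathcal X_{\mathfrak a}}$ is the full subcategory of finite-dimensional $U_\varepsilon^{\mathrm{res}}(L\mathfrak{sl}_{n+1})$-modules all of whose composition factors are of the form $L(m)$ with $m$ a dominant monomial in the $Y_{i,s}$, $(i,s)\in\mathcal X_{\mathfrak a}$. For $(i,k)\in\mathcal X_{\mathfrak a}$, a point $(i',k')$ is in snake position with respect to $(i,k)$ if $k'-k\ge|i'-i|+2$ and $k'-k\equiv|i'-i|\pmod 2$. A finite sequence $(i_t,k_t)_{1\le t\le z}$ of points of $\mathcal X_{\mathfrak a}$ is a snake if $(i_t,k_t)$ is in snake position with respect to $(i_{t-1},k_{t-1})$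 for all $2\le t\le z$ (the empty sequence, $z=0$, is allowed and corresponds to the trivial monomial). A simple module $L(m)$ is a snake module if $m=\prod_{t=1}^zY_{i_t,k_t}$ for some snake $(i_t,k_t)_{1\le t\le z}$. *)

theory Defs
  imports
    "HOL-Computational_Algebra.Polynomial"
    "HOL-Computational_Algebra.Fraction_Field"
    "HOL-Library.Poly_Mapping"
    "HOL-Library.Multiset"
    "HOL-Analysis.Complex_Transcendental"
    "HOL-Algebra.QuotRing"
    "HOL-Algebra.Generated_Rings"
    "HOL-Algebra.Module"
begin

section \<open>The field of rational functions and quantum integers\<close>

type_synonym ratfun = "complex poly fract"

definition ratfun_of_poly :: "complex poly \<Rightarrow> ratfun" where
  "ratfun_of_poly p = Fraction_Field.Fract p 1"

definition qq :: ratfun where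
  "qq = ratfun_of_poly [:0, 1:]"

definition qint :: "int \<Rightarrow> ratfun" where
  "qint r = (qq powi r - qq powi (- r)) / (qq - inverse qq)"

definition qfact :: "nat \<Rightarrow> ratfun" where
  "qfact r = (\<Prod>s = 1..r. qint (int s))"

text \<open>The Gaussian binomial coefficient; it is \<open>0\<close> for \<open>d < r\<close>.\<close>

definition qbinom :: "nat \<Rightarrow> nat \<Rightarrow> ratfun" where
  "qbinom d r = (\<Prod>s = 1..r. qint (int d + 1 - int s) / qint (int s))"

definition laurent_polys :: "ratfun set" where
  "laurent_polys = {ratfun_of_poly p / qq ^ k | p k. True}"

text \<open>The kernel of the evaluation \<open>\<complex>[q, 1/q] \<rightarrow> \<complex>\<close>, \<open>q \<mapsto> z\<close>, for \<open>z \<noteq> 0\<close>.\<close>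

definition laurent_vanishing :: "complex \<Rightarrow> ratfun set" where
  "laurent_vanishing z = {ratfun_of_poly p / qq ^ k | p k. poly p z = 0}"


section \<open>The free algebra on the Chevalley generators\<close>

datatype sign = Pos | Neg

fun sgn_int :: "sign \<Rightarrow> int" where
  "sgn_int Pos = 1"
| "sgn_int Neg = - 1"

fun opp :: "sign \<Rightarrow> sign" where
  "opp Pos = Neg"
| "opp Neg = Pos"

text \<open>\<open>E Pos i\<close>, \<open>E Neg i\<close>, \<open>K Pos i\<close> and \<open>K Neg i\<close> stand for \<open>e\<^sub>i\<^sup>+\<close>, \<open>e\<^sub>i\<^sup>-\<close>, \<open>k\<^sub>i\<close>
  and the inverse of \<open>k\<^sub>i\<close>.\<close>

datatype gen = E sign nat | K sign nat

fun gen_index :: "gen \<Rightarrow> nat" where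
  "gen_index (E s i) = i"
| "gen_index (K s i) = i"

text \<open>Words form the free monoid, written additively, since multiplication of finitely supported
  functions is convolution along the addition of the index type.  Hence \<open>falg\<close> is the free
  associative (noncommutative) algebra.\<close>

datatype word = Word (letters: "gen list")

instantiation word :: monoid_add
begin
definition zero_word :: word where "0 = Word []"
definition plus_word :: "word \<Rightarrow> word \<Rightarrow> word" where "v + w = Word (letters v @ letters w)"
instance by standard (simp_all add: zero_word_def plus_word_def)
end

type_synonym falg = "word \<Rightarrow>\<^sub>0 ratfun"

definition gen :: "gen \<Rightarrow> falg" where
  "gen g = Poly_Mapping.single (Word [g]) 1"

abbreviation ce :: "sign \<Rightarrow> nat \<Rightarrow> falg" where
  "ce s i \<equiv> gen (E s i)"

abbreviation ck :: "sign \<Rightarrow> nat \<Rightarrow> falg" where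
  "ck s i \<equiv> gen (K s i)"

definition scal :: "ratfun \<Rightarrow> falg" where
  "scal c = Poly_Mapping.single 0 c"

definition cscal :: "complex \<Rightarrow> falg" where
  "cscal c = scal (ratfun_of_poly [:c:])"

definition free_alg :: "nat \<Rightarrow> falg ring" where
  "free_alg n =
    \<lparr>carrier = {f. \<forall>w \<in> Poly_Mapping.keys f. \<forall>g \<in> set (letters w). gen_index g \<le> n},
     mult = (*), one = 1, zero = 0, add = (+)\<rparr>"

definition comm :: "falg \<Rightarrow> falg \<Rightarrow> falg" where
  "comm x y = x * y - y * x"

definition qcomm :: "ratfun \<Rightarrow> falg \<Rightarrow> falg \<Rightarrow> falg" where
  "qcomm c x y = x * y - scal c * y * x"

definition div_pow :: "falg \<Rightarrow> nat \<Rightarrow> falg" where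
  "div_pow x r = scal (1 / qfact r) * x ^ r"


section \<open>The quantum loop algebra, its restricted form and the specialisation\<close>

text \<open>Cartan matrix of affine type \<open>A\<close>: the off-diagonal entry is minus the number of edges of the
  cycle of length \<open>n + 1\<close> joining \<open>i\<close> and \<open>j\<close>, so it is \<open>-2\<close> when \<open>n = 1\<close>.\<close>

definition cartan :: "nat \<Rightarrow> nat \<Rightarrow> nat \<Rightarrow> int" where
  "cartan n i j = (if i = j then 2 else 0)
     - of_bool (j = (i + 1) mod (n + 1)) - of_bool (i = (j + 1) mod (n + 1))"

text \<open>The last relation says that the central element \<open>k\<^sub>0 k\<^sub>1 \<dots> k\<^sub>n\<close> is mapped to \<open>1\<close>.\<close>

definition relations :: "nat \<Rightarrow> falg set" where
  "relations n =
     {ck s i * ck (opp s) i - 1 | s i. i \<le> n}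
   \<union> {comm (ck Pos i) (ck Pos j) | i j. i \<le> n \<and> j \<le> n}
   \<union> {ck Pos i * ce s j * ck Neg i - scal (qq powi (sgn_int s * cartan n i j)) * ce s j
        | s i j. i \<le> n \<and> j \<le> n}
   \<union> {comm (ce Pos i) (ce Neg j)
        - (if i = j then scal (1 / (qq - inverse qq)) * (ck Pos i - ck Neg i) else 0)
        | i j. i \<le> n \<and> j \<le> n}
   \<union> {\<Sum>r \<le> nat (1 - cartan n i j).
        scal ((- 1) ^ r * qbinom (nat (1 - cartan n i j)) r)
          * ce s i ^ r * ce s j * ce s i ^ (nat (1 - cartan n i j) - r)
        | s i j. i \<le> n \<and> j \<le> n \<and> i \<noteq> j}
   \<union> {prod_list (map (ck Pos) [0..<Suc n]) - 1}"

definition Uq_ideal :: "nat \<Rightarrow> falg set" where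
  "Uq_ideal n = genideal (free_alg n) (relations n)"

definition Uq :: "nat \<Rightarrow> falg set ring" where
  "Uq n = free_alg n Quot Uq_ideal n"

definition Uq_class :: "nat \<Rightarrow> falg \<Rightarrow> falg set" where
  "Uq_class n f = Uq_ideal n +>\<^bsub>free_alg n\<^esub> f"

definition res_generators :: "nat \<Rightarrow> falg set" where
  "res_generators n =
     {ck s i | s i. i \<le> n} \<union> {div_pow (ce s i) r | s i r. i \<le> n \<and> 0 < r}"

definition Ures :: "nat \<Rightarrow> falg set ring" where
  "Ures n = (Uq n)\<lparr>carrier :=
     generate_ring (Uq n) (Uq_class n ` (scal ` laurent_polys \<union> res_generators n))\<rparr>"

definition epsilon :: "nat \<Rightarrow> complex" where
  "epsilon l = (if even l then exp (of_real pi * \<i> / of_nat l)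
                else exp (2 * of_real pi * \<i> / of_nat l))"

text \<open>Base change along the surjection \<open>A = \<complex>[q, 1/q] \<rightarrow> \<complex>\<close>, \<open>q \<mapsto> \<epsilon>\<close>, with kernel \<open>\<mm>\<close>:
  \<open>U \<otimes>\<^sub>A \<complex> = U / \<mm> U\<close>.  As \<open>A\<close> is central in \<open>U\<close>, \<open>\<mm> U\<close> is the two-sided ideal generated by \<open>\<mm>\<close>.\<close>

definition Ueps_ideal :: "nat \<Rightarrow> nat \<Rightarrow> falg set set" where
  "Ueps_ideal n l = genideal (Ures n) (Uq_class n ` scal ` laurent_vanishing (epsilon l))"

definition Ueps :: "nat \<Rightarrow> nat \<Rightarrow> falg set set ring" where
  "Ueps n l = Ures n Quot Ueps_ideal n l"

text \<open>The image in \<open>Ueps n l\<close> of an element \<open>f\<close> of the free algebra; meaningful when the class of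
  \<open>f\<close> in \<open>Uq n\<close> lies in \<open>Ures n\<close>.\<close>

definition Ueps_class :: "nat \<Rightarrow> nat \<Rightarrow> falg \<Rightarrow> falg set set" where
  "Ueps_class n l f = Ueps_ideal n l +>\<^bsub>Ures n\<^esub> Uq_class n f"


section \<open>Drinfeld's loop generators\<close>

text \<open>Drinfeld's generators, as representatives in the free algebra, for \<open>1 \<le> i \<le> n\<close>.  In the
  normalisation
  \<open>[x\<^sup>+\<^bsub>i,r\<^esub>, x\<^sup>-\<^bsub>j,s\<^esub>] = \<delta>\<^bsub>ij\<^esub> (\<psi>\<^sup>+\<^bsub>i,r+s\<^esub> - \<psi>\<^sup>-\<^bsub>i,r+s\<^esub>) / (q - 1/q)\<close>,
  \<open>\<Sum>\<^bsub>r\<ge>0\<^esub> \<psi>\<^sup>\<plusminus>\<^bsub>i,\<plusminus>r\<^esub> u\<^sup>r = k\<^sub>i\<^sup>\<plusminus>\<^sup>1 exp (\<plusminus>(q - 1/q) \<Sum>\<^bsub>s\<ge>1\<^esub> h\<^bsub>i,\<plusminus>s\<^esub> u\<^sup>s)\<close>,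
  \<open>[h\<^bsub>i,r\<^esub>, x\<^sup>\<plusminus>\<^bsub>j,s\<^esub>] = \<plusminus> [r a\<^bsub>ij\<^esub>]\<^sub>q / r x\<^sup>\<plusminus>\<^bsub>j,r+s\<^esub>\<close>,
  one has \<open>x\<^sup>\<plusminus>\<^bsub>i,0\<^esub> = e\<^sub>i\<^sup>\<plusminus>\<close>, and \<open>x\<^sup>-\<^bsub>i,1\<^esub>\<close>, \<open>x\<^sup>+\<^bsub>i,-1\<^esub>\<close> are, up to \<open>k\<^sub>i\<^sup>\<plusminus>\<^sup>1\<close>, root vectors of weight
  \<open>\<plusminus>(\<delta> - \<alpha>\<^sub>i)\<close>, obtained from \<open>e\<^sub>0\<^sup>\<plusminus>\<close> by walking around the cycle from both sides of \<open>0\<close> up to the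
  neighbours of \<open>i\<close>.  The sign \<open>(-1)\<^sup>i\<close> is forced by the relations between different nodes.\<close>

definition node_path :: "nat \<Rightarrow> nat \<Rightarrow> nat list" where
  "node_path n i = [1..<i] @ rev [Suc i..<Suc n]"

definition xminus_one :: "nat \<Rightarrow> nat \<Rightarrow> falg" where
  "xminus_one n i =
     (- 1) ^ i * foldl (\<lambda>y j. qcomm (inverse qq) y (ce Pos j)) (ce Pos 0) (node_path n i) * ck Pos i"

definition xplus_minus_one :: "nat \<Rightarrow> nat \<Rightarrow> falg" where
  "xplus_minus_one n i =
     (- 1) ^ i * (ck Neg i * foldl (\<lambda>y j. qcomm qq (ce Neg j) y) (ce Neg 0) (node_path n i))"

text \<open>\<open>h_one n Pos i\<close> and \<open>h_one n Neg i\<close> are \<open>h\<^bsub>i,1\<^esub>\<close> and \<open>h\<^bsub>i,-1\<^esub>\<close>.\<close>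

fun h_one :: "nat \<Rightarrow> sign \<Rightarrow> nat \<Rightarrow> falg" where
  "h_one n Pos i = ck Neg i * comm (ce Pos i) (xminus_one n i)"
| "h_one n Neg i = ck Pos i * comm (xplus_minus_one n i) (ce Neg i)"

definition xplus :: "nat \<Rightarrow> nat \<Rightarrow> int \<Rightarrow> falg" where
  "xplus n i r = ((\<lambda>y. scal (1 / qint 2) * comm (h_one n (if 0 \<le> r then Pos else Neg) i) y)
                    ^^ nat \<bar>r\<bar>) (ce Pos i)"

text \<open>\<open>loop_P n s i r\<close> is the coefficient \<open>P\<^bsub>i,\<plusminus>r\<^esub>\<close> of
  \<open>P\<^sub>i\<^sup>\<plusminus>(u) = \<Sum>\<^bsub>r\<ge>0\<^esub> P\<^bsub>i,\<plusminus>r\<^esub> u\<^sup>r = exp (- \<Sum>\<^bsub>s\<ge>1\<^esub> h\<^bsub>i,\<plusminus>s\<^esub> u\<^sup>s / [s]\<^sub>q)\<close>.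
  The recursion compares coefficients in
  \<open>k\<^sub>i\<^sup>\<minusplus>\<^sup>1 \<Psi>\<^sub>i\<^sup>\<plusminus>(u) P\<^sub>i\<^sup>\<plusminus>(q\<^sup>\<plusminus>\<^sup>1 u) = P\<^sub>i\<^sup>\<plusminus>(q\<^sup>\<minusplus>\<^sup>1 u)\<close>, where \<open>\<Psi>\<^sub>i\<^sup>\<plusminus>(u) = \<Sum>\<^bsub>r\<ge>0\<^esub> \<psi>\<^sup>\<plusminus>\<^bsub>i,\<plusminus>r\<^esub> u\<^sup>r\<close>,
  using \<open>\<psi>\<^sup>\<plusminus>\<^bsub>i,\<plusminus>r\<^esub> = \<plusminus>(q - 1/q) [x\<^sup>+\<^bsub>i,\<plusminus>r\<^esub>, x\<^sup>-\<^bsub>i,0\<^esub>]\<close> for \<open>r > 0\<close>.\<close>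

fun loop_P :: "nat \<Rightarrow> sign \<Rightarrow> nat \<Rightarrow> nat \<Rightarrow> falg" where
  "loop_P n s i 0 = 1"
| "loop_P n s i (Suc r) =
     - scal (1 / qint (int (Suc r))) *
       (\<Sum>t \<le> r. scal (qq powi (sgn_int s * int (r - t)))
          * ck (opp s) i * comm (xplus n i (sgn_int s * int (Suc t))) (ce Neg i)
          * loop_P n s i (r - t))"

text \<open>Lusztig's element \<open>[k\<^sub>i; 0 choose r]\<close>.\<close>

definition k_binom :: "nat \<Rightarrow> nat \<Rightarrow> falg" where
  "k_binom i r = prod_list (map (\<lambda>s. scal (1 / (qq powi int s - qq powi (- int s))) *
     (scal (qq powi (1 - int s)) * ck Pos i - scal (qq powi (int s - 1)) * ck Neg i)) [1..<Suc r])"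


section \<open>Modules over a possibly noncommutative ring\<close>

locale left_module = R?: ring R + M?: abelian_group M
  for R :: "('r, 'x) ring_scheme" (structure) and M :: "('r, 'v, 'y) module_scheme" (structure) +
  assumes smult_closed:
      "\<lbrakk>a \<in> carrier R; x \<in> carrier M\<rbrakk> \<Longrightarrow> a \<odot>\<^bsub>M\<^esub> x \<in> carrier M"
    and smult_l_distr:
      "\<lbrakk>a \<in> carrier R; b \<in> carrier R; x \<in> carrier M\<rbrakk> \<Longrightarrow>
       (a \<oplus>\<^bsub>R\<^esub> b) \<odot>\<^bsub>M\<^esub> x = a \<odot>\<^bsub>M\<^esub> x \<oplus>\<^bsub>M\<^esub> b \<odot>\<^bsub>M\<^esub> x"
    and smult_r_distr:
      "\<lbrakk>a \<in> carrier R; x \<in> carrier M; y \<in> carrier M\<rbrakk> \<Longrightarrow>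
       a \<odot>\<^bsub>M\<^esub> (x \<oplus>\<^bsub>M\<^esub> y) = a \<odot>\<^bsub>M\<^esub> x \<oplus>\<^bsub>M\<^esub> a \<odot>\<^bsub>M\<^esub> y"
    and smult_assoc:
      "\<lbrakk>a \<in> carrier R; b \<in> carrier R; x \<in> carrier M\<rbrakk> \<Longrightarrow>
       (a \<otimes>\<^bsub>R\<^esub> b) \<odot>\<^bsub>M\<^esub> x = a \<odot>\<^bsub>M\<^esub> (b \<odot>\<^bsub>M\<^esub> x)"
    and smult_one:
      "x \<in> carrier M \<Longrightarrow> \<one>\<^bsub>R\<^esub> \<odot>\<^bsub>M\<^esub> x = x"

definition simple_module :: "('r, 'x) ring_scheme \<Rightarrow> ('r, 'v) module \<Rightarrow> bool" where
  "simple_module R M \<longleftrightarrow> left_module R M \<and> carrier M \<noteq> {\<zero>\<^bsub>M\<^esub>} \<and>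
     (\<forall>N. submodule N R M \<longrightarrow> N = {\<zero>\<^bsub>M\<^esub>} \<or> N = carrier M)"

text \<open>The fields \<open>mult\<close> and \<open>one\<close> of a module record carry no meaning.\<close>

definition subquotient :: "('r, 'v) module \<Rightarrow> 'v set \<Rightarrow> 'v set \<Rightarrow> ('r, 'v set) module" where
  "subquotient M W N = (let M' = M\<lparr>carrier := W\<rparr> in
     \<lparr>carrier = a_rcosets\<^bsub>M'\<^esub> N, mult = rcoset_mult M' N, one = N +>\<^bsub>M'\<^esub> \<one>\<^bsub>M\<^esub>,
      zero = N, add = set_add M', smult = (\<lambda>r X. \<Union>x \<in> X. N +>\<^bsub>M'\<^esub> (r \<odot>\<^bsub>M\<^esub> x))\<rparr>)"

definition composition_series ::
  "('r, 'x) ring_scheme \<Rightarrow> ('r, 'v) module \<Rightarrow> 'v set list \<Rightarrow> bool" where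
  "composition_series R M Ns \<longleftrightarrow> Ns \<noteq> [] \<and> hd Ns = {\<zero>\<^bsub>M\<^esub>} \<and> last Ns = carrier M \<and>
     (\<forall>N \<in> set Ns. submodule N R M) \<and>
     (\<forall>j. Suc j < length Ns \<longrightarrow>
        Ns ! j \<subseteq> Ns ! Suc j \<and> simple_module R (subquotient M (Ns ! Suc j) (Ns ! j)))"

definition composition_factor ::
  "('r, 'x) ring_scheme \<Rightarrow> ('r, 'v) module \<Rightarrow> ('r, 'v set) module \<Rightarrow> bool" where
  "composition_factor R M Q \<longleftrightarrow> (\<exists>Ns j. composition_series R M Ns \<and> Suc j < length Ns \<and>
     Q = subquotient M (Ns ! Suc j) (Ns ! j))"


section \<open>The simple modules \<open>L(m)\<close>\<close>

type_synonym 'v Ueps_module = "(falg set set, 'v) module"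

definition act :: "nat \<Rightarrow> nat \<Rightarrow> 'v Ueps_module \<Rightarrow> falg \<Rightarrow> 'v \<Rightarrow> 'v" where
  "act n l V f v = Ueps_class n l f \<odot>\<^bsub>V\<^esub> v"

definition fin_dim_module :: "nat \<Rightarrow> nat \<Rightarrow> 'v Ueps_module \<Rightarrow> bool" where
  "fin_dim_module n l V \<longleftrightarrow> left_module (Ueps n l) V \<and>
     (\<exists>B. finite B \<and> B \<subseteq> carrier V \<and>
        (\<forall>v \<in> carrier V. \<exists>c. v = (\<Oplus>\<^bsub>V\<^esub>b \<in> B. act n l V (cscal (c b)) b)))"

text \<open>Monomials with nonnegative exponents in the variables \<open>Y\<^bsub>i,b\<^esub>\<close>: the multiset contains \<open>(i, b)\<close>
  with multiplicity the exponent of \<open>Y\<^bsub>i,b\<^esub>\<close>, and products are sums of multisets.\<close>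

type_synonym monomial = "(nat \<times> complex) multiset"

definition dominant_monomial :: "nat \<Rightarrow> monomial \<Rightarrow> bool" where
  "dominant_monomial n m \<longleftrightarrow> (\<forall>(i, b) \<in># m. i \<in> {1..n} \<and> b \<noteq> 0)"

definition drinfeld_poly :: "monomial \<Rightarrow> nat \<Rightarrow> complex poly" where
  "drinfeld_poly m i = (\<Prod>(j, b) \<in># filter_mset (\<lambda>y. fst y = i) m. [:1, - b:])"

text \<open>If \<open>P\<close> is the product of the \<open>1 - b u\<close>, then \<open>signed_poly Neg P\<close> is the product of the
  \<open>1 - u / b\<close>.\<close>

fun signed_poly :: "sign \<Rightarrow> complex poly \<Rightarrow> complex poly" where
  "signed_poly Pos p = p"
| "signed_poly Neg p = Polynomial.smult (inverse (lead_coeff p)) (reflect_poly p)"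

definition highest_weight_vector :: "nat \<Rightarrow> nat \<Rightarrow> 'v Ueps_module \<Rightarrow> 'v \<Rightarrow> bool" where
  "highest_weight_vector n l V v \<longleftrightarrow> v \<in> carrier V \<and> v \<noteq> \<zero>\<^bsub>V\<^esub> \<and>
     (\<forall>i \<in> {1..n}. \<forall>r t. 0 < t \<longrightarrow> act n l V (div_pow (xplus n i r) t) v = \<zero>\<^bsub>V\<^esub>)"

text \<open>The action of the Cartan part on a highest weight vector with Drinfeld polynomials \<open>P\<^sub>i\<close>.
  The scalars \<open>q\<^sup>d\<close> and \<open>[d choose l]\<^sub>q\<close> act by their values at \<open>\<epsilon>\<close>; the first two equations say
  that the weight is of type \<open>1\<close>, with \<open>i\<close>-th component \<open>d = deg P\<^sub>i\<close>.\<close>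

definition has_loop_weight :: "nat \<Rightarrow> nat \<Rightarrow> 'v Ueps_module \<Rightarrow> monomial \<Rightarrow> 'v \<Rightarrow> bool" where
  "has_loop_weight n l V m v \<longleftrightarrow> (\<forall>i \<in> {1..n}. let p = drinfeld_poly m i; d = Polynomial.degree p in
     act n l V (ck Pos i) v = act n l V (scal (qq ^ d)) v \<and>
     act n l V (k_binom i l) v = act n l V (scal (qbinom d l)) v \<and>
     (\<forall>s r. act n l V (loop_P n s i r) v
        = act n l V (cscal (Polynomial.coeff (signed_poly s p) r)) v))"

text \<open>\<open>is_L n l m V\<close>: the module \<open>V\<close> is (isomorphic to) \<open>L(m)\<close>.  A highest weight vector of a
  finite-dimensional simple module exists and is unique up to a scalar, so one may ask for the
  loop weight of one or of all of them; with the latter, \<open>m\<close> is visibly determined by \<open>V\<close>.\<close>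

definition is_L :: "nat \<Rightarrow> nat \<Rightarrow> monomial \<Rightarrow> 'v Ueps_module \<Rightarrow> bool" where
  "is_L n l m V \<longleftrightarrow> dominant_monomial n m \<and> fin_dim_module n l V \<and> simple_module (Ueps n l) V \<and>
     (\<exists>v. highest_weight_vector n l V v) \<and>
     (\<forall>v. highest_weight_vector n l V v \<longrightarrow> has_loop_weight n l V m v)"


section \<open>The category and snake modules\<close>

definition points :: "nat \<Rightarrow> int \<Rightarrow> (nat \<times> int) set" where
  "points n \<aa> = {(i, s). i \<in> {1..n} \<and> (int i - s) mod 2 = \<aa> mod 2}"

definition Yvar :: "nat \<Rightarrow> complex \<Rightarrow> nat \<times> int \<Rightarrow> nat \<times> complex" where
  "Yvar l a = (\<lambda>(i, s). (i, a * epsilon l powi s))"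

definition in_category :: "nat \<Rightarrow> nat \<Rightarrow> complex \<Rightarrow> int \<Rightarrow> 'v Ueps_module \<Rightarrow> bool" where
  "in_category n l a \<aa> V \<longleftrightarrow> fin_dim_module n l V \<and>
     (\<forall>Q. composition_factor (Ueps n l) V Q \<longrightarrow>
        (\<exists>m. set_mset m \<subseteq> Yvar l a ` points n \<aa> \<and> is_L n l m Q))"

definition snake_position :: "nat \<times> int \<Rightarrow> nat \<times> int \<Rightarrow> bool" where
  "snake_position = (\<lambda>(i, s) (i', s').
     s' - s \<ge> \<bar>int i' - int i\<bar> + 2 \<and> (s' - s) mod 2 = \<bar>int i' - int i\<bar> mod 2)"

definition snake :: "nat \<Rightarrow> int \<Rightarrow> (nat \<times> int) list \<Rightarrow> bool" where
  "snake n \<aa> ts \<longleftrightarrow> set ts \<subseteq> points n \<aa> \<and>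
     (\<forall>t. Suc t < length ts \<longrightarrow> snake_position (ts ! t) (ts ! Suc t))"

definition snake_monomial :: "nat \<Rightarrow> complex \<Rightarrow> (nat \<times> int) list \<Rightarrow> monomial" where
  "snake_monomial l a ts = (\<Sum>t \<leftarrow> ts. {#Yvar l a t#})"

definition snake_module :: "nat \<Rightarrow> nat \<Rightarrow> complex \<Rightarrow> int \<Rightarrow> 'v Ueps_module \<Rightarrow> bool" where
  "snake_module n l a \<aa> V \<longleftrightarrow>
     (\<exists>ts. snake n \<aa> ts \<and> is_L n l (snake_monomial l a ts) V)"

end

theory Submission
  imports Defs
begin

text \<open>
  The combinatorial half of the theorem is short.  As \<open>epsilon l ^ (2 * l) = 1\<close>, the variable attached
  to \<open>(i, s)\<close> depends on \<open>s\<close> only modulo \<open>2 * l\<close>, and moving \<open>s\<close> by a multiple of \<open>2 * l\<close> keeps its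
  parity.  So the factors of a monomial can be listed in any order and pushed apart, one after the
  other, until consecutive ones are in snake position (\<open>monomial_as_snake\<close>).

  What remains is to find the monomial of a simple module \<open>V\<close> of the category.  The category is
  described by composition factors, and the only composition factor of \<open>V\<close> is the subquotient of \<open>V\<close>
  by zero, whose elements are the singletons \<open>{x}\<close>.  The map sending \<open>x\<close> to \<open>{x}\<close> is an isomorphism,
  but the action of a module record is constrained only on the carrier of the ring.  The loop weight
  therefore passes from the subquotient to \<open>V\<close> (\<open>is_L_from_factor\<close>) only once all the elements in
  terms of which it is defined are known to lie in the restricted form: the divided powers of the
  \<open>xplus n i r\<close>, the coefficients \<open>loop_P n s i r\<close> and the binomials \<open>k_binom i r\<close>.  Finally the Drinfeld
  polynomials, and hence the monomial, are recovered from any highest weight vector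
  (\<open>is_L_unique\<close>), because complex scalars act faithfully on a nonzero vector.

  The integrality theorem \<open>Drinfeld_elements_integral\<close> takes up most of the text.  It is proved in an
  arbitrary ring over a field with a generic element \<open>q\<close>, for a subring \<open>S\<close> stable under \<open>q\<close> and its
  inverse that contains the divided powers of the Chevalley generators.

  \<^item> Root vectors (\<open>path_pair_fold\<close>).  Walking around the affine cycle, each step is a \<open>q\<close>-bracket with
    a Chevalley generator.  The bracket is the top of a weight string of length two for the twisted
    adjoint action, and divided powers of the top of a string are obtained from those of its bottom
    by the highest divided power of the action (\<open>string_top_integral\<close>).  The walk ends in a vector
    that satisfies the cubic Serre relations with the node \<open>i\<close>, in both orders.

  \<^item> Loop generators (\<open>rank_one\<close>, \<open>loop_serre\<close>).  These relations, and the commutators of the two root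
    vectors with the two generators of node \<open>i\<close>, are enough to construct the two families of loop
    generators by iterated commutators, and to prove that consecutive members satisfy the quadratic
    relation.  Each member is, up to sign, the top of a string of length three that starts at a torus
    multiple of a member of the opposite family; hence all their divided powers are integral
    (\<open>loop_generators_integral\<close>).

  \<^item> Cartan part.  For \<open>k_binom\<close> one orders a product of divided powers of the two generators of node
    \<open>i\<close>, as in the finite case (\<open>xp_xm_divided\<close>).  For \<open>loop_P\<close> one straightens a product of divided
    powers of the generators of degree \<open>0\<close> and \<open>1\<close>.  This is the quantum form of Garland's identity:
    the result is a sum of terms of the shape lowering times Cartan times raising, in which the pure
    Cartan term is \<open>loop_P\<close> (\<open>straightening\<close>), and all other terms involve shorter Cartan factors, so
    that induction applies (\<open>pc_integral\<close>).

  To apply this to the quantum loop algebras, which are quotient records over a carrier, one type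
  \<open>ualg\<close> is introduced that contains all of them as coordinates.
\<close>

section \<open>Quantum integers over a field\<close>

definition qn :: "'k::field \<Rightarrow> int \<Rightarrow> 'k" where
  "qn q m = (q powi m - q powi (- m)) / (q - inverse q)"

definition qfac :: "'k::field \<Rightarrow> nat \<Rightarrow> 'k" where
  "qfac q n = (\<Prod>s = 1..n. qn q (int s))"

lemma qn_0 [simp]: "qn q 0 = 0"
  by (simp add: qn_def)

lemma qn_minus: "qn q (- m) = - qn q m"
  by (simp add: qn_def minus_divide_left)

lemma qn_inverse: "qn (inverse q) m = qn q m"
proof -
  have "(q powi (- m) - q powi m) / (inverse q - q) = (q powi m - q powi (- m)) / (q - inverse q)"
    by (metis minus_diff_eq minus_divide_divide)
  then show ?thesis
    by (simp add: qn_def power_int_inverse power_int_minus)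
qed

lemma qfac_inverse: "qfac (inverse q) n = qfac q n"
  by (simp add: qfac_def qn_inverse)

lemma qfac_0 [simp]: "qfac q 0 = 1"
  by (simp add: qfac_def)

lemma qfac_Suc: "qfac q (Suc n) = qn q (int (Suc n)) * qfac q n"
  by (simp add: qfac_def mult.commute)

locale generic_q =
  fixes q :: "'k::field_char_0"
  assumes q_nz [simp]: "q \<noteq> 0" and q_generic: "m > 0 \<Longrightarrow> q ^ m \<noteq> 1"
begin

abbreviation "p \<equiv> inverse q"

lemma q_powi_generic: "m \<noteq> 0 \<Longrightarrow> q powi m \<noteq> 1"
  using q_generic[of "nat \<bar>m\<bar>"]
  by (cases "m \<ge> 0") (auto simp: power_int_def field_simps)

lemma q_p [simp]: "q * p = 1" "p * q = 1" "q * (p * z) = z" "p * (q * z) = z"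
  by simp_all

lemma q_neq_p [simp]: "q \<noteq> p" "p \<noteq> q"
proof -
  have "q ^ 2 = 1" if "q = p"
    using that by (metis power2_eq_square q_p(1))
  then show "q \<noteq> p" "p \<noteq> q" using q_generic[of 2] by auto
qed

lemma qn_mult: "(q - p) * qn q m = q powi m - q powi (- m)"
  by (simp add: qn_def)

lemma qn_1 [simp]: "qn q 1 = 1"
  by (simp add: qn_def power_int_minus)

lemma qn_add: "qn q (m + n) = q powi n * qn q m + q powi (- m) * qn q n"
proof -
  have "q powi (m + n) - q powi (- (m + n))
      = q powi n * (q powi m - q powi (- m)) + q powi (- m) * (q powi n - q powi (- n))"
    by (simp add: power_int_add power_int_diff power_int_minus right_diff_distrib divide_inverse
        mult.commute)
  then show ?thesis
    by (simp add: qn_def add_divide_distrib)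
qed

lemma qn_nz: "m \<noteq> 0 \<Longrightarrow> qn q m \<noteq> 0"
proof -
  assume m: "m \<noteq> 0"
  have "q powi m \<noteq> q powi (- m)"
  proof
    assume "q powi m = q powi (- m)"
    then have "q powi m * q powi m = 1"
      by (metis power_int_minus power_int_eq_0_iff q_nz right_inverse)
    then have "q powi (2 * m) = 1"
      by (metis mult_2 power_int_add q_nz)
    then show False using q_powi_generic[of "2 * m"] m by simp
  qed
  then show ?thesis by (simp add: qn_def)
qed

lemma qn_Suc_nz [simp]: "qn q (int (Suc n)) \<noteq> 0" "qn q (1 + int n) \<noteq> 0"
  using qn_nz[of "int (Suc n)"] by simp_all

lemma qfac_nz [simp]: "qfac q n \<noteq> 0"
  using qn_nz by (auto simp: qfac_def)

lemma qn_2: "qn q 2 = q + p"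
  using qn_add[of 1 1] by simp

lemma qn_3: "qn q 3 = q * q + 1 + p * p"
  using qn_add[of 2 1] by (simp add: qn_2 power_int_minus power2_eq_square algebra_simps)

lemma qn_2_nz [simp]: "q + p \<noteq> 0" and qn_3_nz [simp]: "q * q + 1 + p * p \<noteq> 0"
  using qn_nz[of 2] qn_nz[of 3] by (simp_all add: qn_2 qn_3)

lemma qn_2_mult: "(q + p) * qn q m = qn q (m + 1) + qn q (m - 1)"
  using qn_add[of m 1] qn_add[of m "-1"] qn_minus[of q 1]
  by (simp add: algebra_simps power_int_minus)

lemma generic_inverse: "generic_q p"
  using q_generic by unfold_locales (auto simp: power_inverse)

end


section \<open>Algebras with central scalars\<close>

text \<open>The algebras below are rings with a central copy of the field.  The scalar action is derived from
  the embedding \<open>sc\<close>, so that ring types without a built-in scalar multiplication can be used.\<close>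

locale central_scalars =
  fixes sc :: "'k::field_char_0 \<Rightarrow> 'a::ring_1"
  assumes sc_add: "sc (a + b) = sc a + sc b"
    and sc_mult: "sc (a * b) = sc a * sc b"
    and sc_1 [simp]: "sc 1 = 1"
    and sc_central: "sc c * x = x * sc c"
begin

definition scl :: "'k \<Rightarrow> 'a \<Rightarrow> 'a" (infixr "\<cdot>" 75) where
  "c \<cdot> x = sc c * x"

sublocale V: vector_space scl
  by unfold_locales
    (simp_all add: scl_def sc_add sc_mult algebra_simps)

lemma scl_mult_left [simp]: "(c \<cdot> x) * y = c \<cdot> (x * y)"
  by (simp add: scl_def mult.assoc)

lemma scl_mult_right [simp]: "x * (c \<cdot> y) = c \<cdot> (x * y)"
  unfolding scl_def by (metis mult.assoc sc_central)

lemmas scl_simps = V.scale_right_distrib V.scale_right_diff_distrib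

lemma scl_left: "(a + b) \<cdot> x = a \<cdot> x + b \<cdot> x" "(a - b) \<cdot> x = a \<cdot> x - b \<cdot> x"
  by (simp_all add: V.scale_left_distrib V.scale_left_diff_distrib)

lemma scl_cancel: "c \<cdot> x = c \<cdot> y \<Longrightarrow> c \<noteq> 0 \<Longrightarrow> x = y"
  by simp

lemma scl_eq_0: "c \<cdot> x = 0 \<Longrightarrow> c \<noteq> 0 \<Longrightarrow> x = 0"
  by simp

lemma twice_eq_0: "x + x = (0::'a) \<Longrightarrow> x = 0"
  using scl_eq_0[of 2 x] by (simp add: V.scale_left_distrib[of 1 1, simplified])

lemma sc_eq_scl: "sc c = c \<cdot> 1"
  by (simp add: scl_def)

lemma sc_minus: "sc (- c) = - sc c" and sc_0 [simp]: "sc 0 = 0"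
  by (simp_all add: sc_eq_scl)

lemma scl_sum_left: "sum f A \<cdot> x = (\<Sum>i\<in>A. f i \<cdot> x)"
  by (rule V.scale_sum_left)

lemma scl_sum_right: "c \<cdot> sum f A = (\<Sum>i\<in>A. c \<cdot> f i)"
  by (rule V.scale_sum_right)

end

locale quantum = central_scalars sc + generic_q q
  for sc :: "'k::field_char_0 \<Rightarrow> 'a::ring_1" and q :: 'k
begin

definition dp :: "'a \<Rightarrow> nat \<Rightarrow> 'a" where
  "dp x n = (1 / qfac q n) \<cdot> x ^ n"

lemma dp_0 [simp]: "dp x 0 = 1"
  by (simp add: dp_def)

lemma dp_1 [simp]: "dp x (Suc 0) = x"
  by (simp add: dp_def qfac_Suc)

lemma dp_Suc: "qn q (int (Suc n)) \<cdot> dp x (Suc n) = x * dp x n"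
  by (simp add: dp_def qfac_Suc)

lemma dp_Suc': "qn q (int (Suc n)) \<cdot> dp x (Suc n) = dp x n * x"
  by (simp add: dp_def qfac_Suc power_commutes)

lemma dp_2: "(q + p) \<cdot> dp x 2 = x * x"
  using dp_Suc[of 1 x] by (simp add: numeral_2_eq_2[symmetric] qn_2)

lemma quantum_inverse: "quantum sc p"
  using generic_inverse central_scalars_axioms by (simp add: quantum_def)

end

context generic_q
begin

text \<open>The identity behind every recursion for \<open>q\<close>-binomial coefficients below; the three exponents are
  separate variables so that it can be applied before they are normalised.\<close>

lemma qn_comb:
  assumes "a = c + n" "b = c - m" "k = m + n"
  shows "q powi a * qn q m + q powi b * qn q n = q powi c * qn q k"
  by (simp add: assms qn_add[of m n] power_int_add power_int_diff power_int_minus divide_inverse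
      algebra_simps)

end

context generic_q
begin

lemma powi_merge: "q powi a * q powi b = q powi (a + b)" "q powi a * (q powi b * z) = q powi (a + b) * z"
  by (simp_all add: power_int_add)

end

context quantum
begin

lemma qn_cancel: "qn q (int (Suc n)) \<cdot> x = qn q (int (Suc n)) \<cdot> y \<Longrightarrow> x = y"
  by (rule scl_cancel[OF _ qn_Suc_nz(1)])

lemma qn_eq_0: "qn q (int (Suc n)) \<cdot> x = 0 \<Longrightarrow> x = 0"
  by (rule scl_eq_0[OF _ qn_Suc_nz(1)])

lemma sc_comm_scl: "sc c * (d \<cdot> x) = d \<cdot> (sc c * x)"
  by (simp add: scl_def[symmetric])

end

section \<open>The twisted adjoint action of a root vector\<close>

text \<open>The operator \<open>ad\<close> is the adjoint action of the root vector \<open>e\<close> of a Hopf algebra, written with the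
  conjugation \<open>tw\<close> by the torus, and the \<open>D n\<close> are its divided powers.\<close>

locale root_vector = quantum sc q
  for sc :: "'k::field_char_0 \<Rightarrow> 'a::ring_1" and q :: 'k +
  fixes e k ki :: 'a
  assumes k_ki [simp]: "k * ki = 1" and ki_k [simp]: "ki * k = 1"
    and ki_e_k: "ki * e * k = (p * p) \<cdot> e"
begin

lemma k_ki' [simp]: "k * (ki * x) = x" "ki * (k * x) = x"
  by (simp_all add: mult.assoc[symmetric])

definition tw :: "'a \<Rightarrow> 'a" where "tw z = ki * z * k"

definition wt :: "'a \<Rightarrow> int \<Rightarrow> bool" where "wt z w \<longleftrightarrow> tw z = q powi (- w) \<cdot> z"

definition ad :: "'a \<Rightarrow> 'a" where "ad z = e * z - tw z * e"

definition D :: "nat \<Rightarrow> 'a \<Rightarrow> 'a" where "D n z = (1 / qfac q n) \<cdot> (ad ^^ n) z"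

lemma tw_simps [simp]:
  "tw (x + y) = tw x + tw y" "tw (x - y) = tw x - tw y" "tw (- x) = - tw x"
  "tw (c \<cdot> x) = c \<cdot> tw x" "tw (x * y) = tw x * tw y" "tw 0 = 0" "tw 1 = 1"
  by (simp_all add: tw_def algebra_simps)

lemma ad_simps [simp]:
  "ad (x + y) = ad x + ad y" "ad (x - y) = ad x - ad y" "ad (- x) = - ad x"
  "ad (c \<cdot> x) = c \<cdot> ad x" "ad 0 = 0"
  by (simp_all add: ad_def algebra_simps V.scale_right_diff_distrib)

lemma ad_mult: "ad (x * y) = ad x * y + tw x * ad y"
  by (simp add: ad_def algebra_simps)

lemma ad_sum: "ad (\<Sum>i\<in>A. f i) = (\<Sum>i\<in>A. ad (f i))"
  by (induct A rule: infinite_finite_induct) simp_all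

lemma tw_e: "tw e = (p * p) \<cdot> e"
  by (simp add: tw_def ki_e_k)

lemma tw_ad: "tw (ad z) = (p * p) \<cdot> ad (tw z)"
  by (simp add: ad_def tw_e V.scale_right_diff_distrib)

lemma D_0 [simp]: "D 0 z = z"
  by (simp add: D_def)

lemma D_1: "D (Suc 0) z = ad z"
  by (simp add: D_def qfac_Suc)

lemma D_Suc: "qn q (int (Suc n)) \<cdot> D (Suc n) z = ad (D n z)"
  by (simp add: D_def qfac_Suc)

lemma D_2: "(q + p) \<cdot> D 2 z = ad (ad z)"
  using D_Suc[of 1 z] by (simp add: D_1 numeral_2_eq_2[symmetric] qn_2)

lemma D_simps [simp]:
  "D n (x + y) = D n x + D n y" "D n (x - y) = D n x - D n y" "D n (- x) = - D n x"
  "D n (c \<cdot> x) = c \<cdot> D n x" "D n 0 = 0"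
proof -
  have "(ad ^^ n) (x + y) = (ad ^^ n) x + (ad ^^ n) y" "(ad ^^ n) (x - y) = (ad ^^ n) x - (ad ^^ n) y"
    "(ad ^^ n) (- x) = - (ad ^^ n) x" "(ad ^^ n) (c \<cdot> x) = c \<cdot> (ad ^^ n) x" "(ad ^^ n) 0 = 0"
    by (induct n) simp_all
  then show "D n (x + y) = D n x + D n y" "D n (x - y) = D n x - D n y" "D n (- x) = - D n x"
    "D n (c \<cdot> x) = c \<cdot> D n x" "D n 0 = 0"
    by (simp_all add: D_def scl_simps mult.commute)
qed

lemma D_vanish:
  assumes "D (Suc a) z = 0" "n > a" shows "D n z = 0"
proof -
  have "D (Suc a + m) z = 0" for m
  proof (induct m)
    case (Suc m)
    have "qn q (int (Suc (Suc a + m))) \<cdot> D (Suc (Suc a + m)) z = 0"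
      unfolding D_Suc Suc by simp
    from qn_eq_0[OF this] show ?case by simp
  qed (use assms in simp)
  from this[of "n - Suc a"] assms(2) show ?thesis by simp
qed

lemma D_eq_0: "ad z = 0 \<Longrightarrow> n > 0 \<Longrightarrow> D n z = 0"
  using D_vanish[of 0] by (simp add: D_1)

lemma wt_D: "wt z w \<Longrightarrow> wt (D n z) (w + 2 * int n)"
proof (induct n)
  case (Suc n)
  have "qn q (int (Suc n)) \<cdot> tw (D (Suc n) z) = tw (ad (D n z))"
    by (simp only: D_Suc[symmetric] tw_simps)
  also have "\<dots> = (p * p) \<cdot> q powi (- (w + 2 * int n)) \<cdot> ad (D n z)"
    using Suc by (simp add: tw_ad wt_def)
  also have "\<dots> = qn q (int (Suc n)) \<cdot> q powi (- (w + 2 * int (Suc n))) \<cdot> D (Suc n) z"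
    by (simp add: D_Suc[symmetric] power_int_diff power_int_minus power_int_add field_simps power2_eq_square)
  finally show ?case unfolding wt_def by (rule qn_cancel)
qed simp

lemma wt_mult: "wt x v \<Longrightarrow> wt y w \<Longrightarrow> wt (x * y) (v + w)"
  by (simp add: wt_def power_int_diff power_int_minus power_int_add field_simps)

lemma wt_scl: "wt x v \<Longrightarrow> wt (c \<cdot> x) v"
  by (simp add: wt_def mult.commute)

lemma wt_diff: "wt x v \<Longrightarrow> wt y v \<Longrightarrow> wt (x - y) v"
  by (simp_all add: wt_def scl_simps)

lemma wt_1: "wt 1 0" and wt_e: "wt e 2"
  by (simp_all add: wt_def tw_e power_int_minus power2_eq_square)

lemma wt_power: "wt x v \<Longrightarrow> wt (x ^ n) (v * int n)"
  by (induct n) (auto simp: wt_1 algebra_simps intro: wt_mult)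

lemma wt_dp: "wt x v \<Longrightarrow> wt (dp x n) (v * int n)"
  by (simp add: dp_def wt_scl wt_power)

text \<open>The quantum Leibniz rule: \<open>ad\<close> is a derivation twisted by \<open>tw\<close>, and \<open>tw\<close> acts on \<open>D i x\<close> by a power of
  \<open>q\<close> that depends on the weight of \<open>x\<close> and on \<open>i\<close>.\<close>

lemma D_mult:
  assumes "wt x w"
  shows "D n (x * y) = (\<Sum>i\<le>n. q powi (- (int i * int (n - i)) - w * int (n - i)) \<cdot> (D i x * D (n - i) y))"
proof (induct n)
  case (Suc n)
  let ?F = "\<lambda>i. D i x * D (Suc n - i) y"
  let ?c = "\<lambda>n i. - (int i * (int n - int i)) - w * (int n - int i)"
  have IH: "D n (x * y) = (\<Sum>i\<le>n. q powi ?c n i \<cdot> (D i x * D (n - i) y))"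
    unfolding Suc by (rule sum.cong) (auto simp: of_nat_diff)
  have tw: "tw (D i x) = q powi (- (w + 2 * int i)) \<cdot> D i x" for i
    using wt_D[OF assms, of i] by (simp add: wt_def)
  have "qn q (int (Suc n)) \<cdot> D (Suc n) (x * y) = ad (D n (x * y))"
    by (rule D_Suc)
  also have "\<dots> = (\<Sum>i\<le>n. q powi ?c n i \<cdot> (ad (D i x) * D (n - i) y + tw (D i x) * ad (D (n - i) y)))"
    by (simp only: IH ad_sum ad_simps ad_mult)
  also have "\<dots> = (\<Sum>i\<le>n. (q powi ?c n i * qn q (int (Suc i))) \<cdot> ?F (Suc i))
      + (\<Sum>i\<le>n. (q powi (?c n i - (w + 2 * int i)) * qn q (int (Suc n) - int i)) \<cdot> ?F i)"
    unfolding sum.distrib[symmetric]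
  proof (rule sum.cong[OF refl])
    fix i assume i: "i \<in> {..n}"
    have 1: "ad (D i x) = qn q (int (Suc i)) \<cdot> D (Suc i) x"
      by (simp only: D_Suc)
    have 2: "ad (D (n - i) y) = qn q (int (Suc n) - int i) \<cdot> D (Suc n - i) y"
      using D_Suc[of "n - i" y] i by (simp add: Suc_diff_le of_nat_diff algebra_simps)
    show "q powi ?c n i \<cdot> (ad (D i x) * D (n - i) y + tw (D i x) * ad (D (n - i) y))
      = (q powi ?c n i * qn q (int (Suc i))) \<cdot> ?F (Suc i)
      + (q powi (?c n i - (w + 2 * int i)) * qn q (int (Suc n) - int i)) \<cdot> ?F i"
      unfolding 1 2 tw by (simp add: V.scale_right_distrib powi_merge mult.assoc del: of_nat_Suc)
        (simp add: algebra_simps)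
  qed
  also have "(\<Sum>i\<le>n. (q powi ?c n i * qn q (int (Suc i))) \<cdot> ?F (Suc i))
      = (\<Sum>i\<le>Suc n. (q powi ?c n (i - 1) * qn q (int i)) \<cdot> ?F i)"
    unfolding sum.atMost_Suc_shift[of _ n] by simp
  also have "(\<Sum>i\<le>n. (q powi (?c n i - (w + 2 * int i)) * qn q (int (Suc n) - int i)) \<cdot> ?F i)
      = (\<Sum>i\<le>Suc n. (q powi (?c n i - (w + 2 * int i)) * qn q (int (Suc n) - int i)) \<cdot> ?F i)"
    by simp
  finally have "qn q (int (Suc n)) \<cdot> D (Suc n) (x * y) =
     (\<Sum>i\<le>Suc n. (q powi ?c n (i - 1) * qn q (int i) + q powi (?c n i - (w + 2 * int i)) * qn q (int (Suc n) - int i)) \<cdot> ?F i)"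
    by (simp only: sum.distrib[symmetric] scl_left)
  also have "\<dots> = (\<Sum>i\<le>Suc n. (q powi ?c (Suc n) i * qn q (int (Suc n))) \<cdot> ?F i)"
  proof (rule sum.cong[OF refl])
    fix i assume i: "i \<in> {..Suc n}"
    show "(q powi ?c n (i - 1) * qn q (int i) + q powi (?c n i - (w + 2 * int i)) * qn q (int (Suc n) - int i)) \<cdot> ?F i
      = (q powi ?c (Suc n) i * qn q (int (Suc n))) \<cdot> ?F i"
    proof (cases i)
      case 0
      have eq: "?c n 0 - (w + 2 * int 0) = ?c (Suc n) 0" by (simp add: algebra_simps)
      show ?thesis unfolding 0 eq by simp
    next
      case i: (Suc j)
      have "q powi ?c n (i - 1) * qn q (int i) + q powi (?c n i - (w + 2 * int i)) * qn q (int (Suc n) - int i)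
         = q powi ?c (Suc n) i * qn q (int (Suc n))"
        by (rule qn_comb) (simp_all add: i algebra_simps)
      then show ?thesis by simp
    qed
  qed
  also have "\<dots> = qn q (int (Suc n)) \<cdot> (\<Sum>i\<le>Suc n. q powi ?c (Suc n) i \<cdot> ?F i)"
    by (simp add: scl_sum_right scl_simps mult.commute)
  finally have "D (Suc n) (x * y) = (\<Sum>i\<le>Suc n. q powi ?c (Suc n) i \<cdot> ?F i)"
    by (rule qn_cancel)
  also have "\<dots> = (\<Sum>i\<le>Suc n. q powi (- (int i * int (Suc n - i)) - w * int (Suc n - i)) \<cdot> ?F i)"
    by (rule sum.cong) (auto simp: of_nat_diff)
  finally show ?case .
qed simp

text \<open>On a product of strings of lengths \<open>a + 1\<close> and \<open>b + 1\<close> only the term \<open>i = a\<close> of the Leibniz rule survives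
  in degree \<open>a + b\<close>.  Its power of \<open>q\<close> has exponent zero when \<open>x\<close> has weight \<open>- a\<close>, the weight of the bottom of its
  string.\<close>

lemma D_mult_top:
  assumes "wt x (- int a)" "\<And>i. i > a \<Longrightarrow> D i x = 0" "\<And>i. i > b \<Longrightarrow> D i y = 0"
  shows "D (a + b) (x * y) = D a x * D b y"
proof -
  have "D (a + b) (x * y) = (\<Sum>i\<le>a+b. if i = a then D a x * D b y else 0)"
    unfolding D_mult[OF assms(1)]
  proof (rule sum.cong[OF refl])
    fix i assume i: "i \<in> {..a+b}"
    show "q powi (- (int i * int (a + b - i)) - - int a * int (a + b - i)) \<cdot> (D i x * D (a + b - i) y)
      = (if i = a then D a x * D b y else 0)"
      using assms(2)[of i] assms(3)[of "a + b - i"] i by (cases i a rule: linorder_cases) auto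
  qed
  then show ?thesis by simp
qed

lemma D_mult_vanish:
  assumes "wt x w" "\<And>i. i > a \<Longrightarrow> D i x = 0" "\<And>i. i > b \<Longrightarrow> D i y = 0" "n > a + b"
  shows "D n (x * y) = 0"
  unfolding D_mult[OF assms(1)]
proof (rule sum.neutral, rule ballI)
  fix i assume "i \<in> {..n}"
  with assms(4) have "i > a \<or> n - i > b" by auto
  then show "q powi (- (int i * int (n - i)) - w * int (n - i)) \<cdot> (D i x * D (n - i) y) = 0"
    using assms(2,3) by auto
qed

lemma D_power:
  fixes a n :: nat
  assumes "wt x (- int a)" "\<And>i. i > a \<Longrightarrow> D i x = 0"
  shows "D (a * n) (x ^ n) = (D a x) ^ n \<and> (\<forall>i > a * n. D i (x ^ n) = 0)"
proof (induct n)
  case 0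
  have "ad 1 = 0" by (simp add: ad_def)
  then have "D i 1 = 0" if "i > 0" for i using that by (rule D_eq_0)
  then show ?case by simp
next
  case (Suc n)
  then have IH: "D (a * n) (x ^ n) = (D a x) ^ n" "\<And>i. i > a * n \<Longrightarrow> D i (x ^ n) = 0"
    by blast+
  have "D (a * Suc n) (x ^ Suc n) = (D a x) ^ Suc n"
    unfolding power_Suc mult_Suc_right IH(1)[symmetric] by (rule D_mult_top[OF assms IH(2)])
  moreover have "D i (x ^ Suc n) = 0" if "i > a * Suc n" for i
    unfolding power_Suc by (rule D_mult_vanish[OF assms IH(2)]) (use that in simp_all)
  ultimately show ?case by (intro conjI allI impI)
qed

lemma D_dp:
  fixes a n :: nat
  assumes "wt x (- int a)" "D (Suc a) x = 0"
  shows "D (a * n) (dp x n) = dp (D a x) n"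
  unfolding dp_def D_simps using D_power[OF assms(1) D_vanish[OF assms(2)], THEN conjunct1] by simp

text \<open>Expanding the commutators expresses \<open>D n z\<close> by divided powers of \<open>e\<close>, without denominators.  This
  makes the operators \<open>D n\<close> integral.\<close>

lemma D_expand:
  assumes "wt z w"
  shows "D n z = (\<Sum>s\<le>n. ((- 1) ^ s * q powi (- (int s * (w + int n - 1)))) \<cdot> (dp e (n - s) * z * dp e s))"
proof (induct n)
  case (Suc n)
  let ?T = "\<lambda>s. dp e (Suc n - s) * z * dp e s"
  let ?c = "\<lambda>n s. - (int s * (w + int n - 1))"
  have wtT: "tw (dp e (n - s) * z * dp e s) = q powi (- (w + 2 * int n)) \<cdot> (dp e (n - s) * z * dp e s)"
    if "s \<le> n" for s
  proof -
    have "wt (dp e (n - s) * z * dp e s) (2 * int (n - s) + w + 2 * int s)"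
      by (intro wt_mult wt_dp wt_e assms)
    then show ?thesis using that by (simp add: wt_def of_nat_diff algebra_simps)
  qed
  have "qn q (int (Suc n)) \<cdot> D (Suc n) z = ad (D n z)"
    by (rule D_Suc)
  also have "\<dots> = (\<Sum>s\<le>n. ((- 1) ^ s * q powi (?c n s)) \<cdot> ad (dp e (n - s) * z * dp e s))"
    by (simp only: Suc ad_sum ad_simps)
  also have "\<dots> = (\<Sum>s\<le>n. ((- 1) ^ s * q powi (?c n s) * qn q (int (Suc n) - int s)) \<cdot> ?T s)
     + (\<Sum>s\<le>n. ((- 1) ^ (Suc s) * q powi (?c n s - (w + 2 * int n)) * qn q (int (Suc s))) \<cdot> ?T (Suc s))"
    unfolding sum.distrib[symmetric]
  proof (rule sum.cong[OF refl])
    fix s assume s: "s \<in> {..n}"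
    have 1: "e * dp e (n - s) = qn q (int (Suc n) - int s) \<cdot> dp e (Suc n - s)"
      using dp_Suc[of "n - s" e] s by (simp add: Suc_diff_le of_nat_diff algebra_simps)
    have 2: "dp e s * e = qn q (int (Suc s)) \<cdot> dp e (Suc s)"
      by (simp only: dp_Suc')
    have "ad (dp e (n - s) * z * dp e s) = (e * dp e (n - s)) * z * dp e s
         - q powi (- (w + 2 * int n)) \<cdot> (dp e (n - s) * z * (dp e s * e))"
      unfolding ad_def using s by (subst wtT) (simp_all add: mult.assoc)
    then show "((- 1) ^ s * q powi (?c n s)) \<cdot> ad (dp e (n - s) * z * dp e s) =
      ((- 1) ^ s * q powi (?c n s) * qn q (int (Suc n) - int s)) \<cdot> ?T s +
      ((- 1) ^ (Suc s) * q powi (?c n s - (w + 2 * int n)) * qn q (int (Suc s))) \<cdot> ?T (Suc s)"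
      unfolding 1 2
      by (simp add: scl_simps power_int_diff power_int_add power_int_minus divide_inverse mult.assoc)
  qed
  also have "(\<Sum>s\<le>n. ((- 1) ^ (Suc s) * q powi (?c n s - (w + 2 * int n)) * qn q (int (Suc s))) \<cdot> ?T (Suc s))
     = (\<Sum>s\<le>Suc n. ((- 1) ^ s * q powi (?c n (s - 1) - (w + 2 * int n)) * qn q (int s)) \<cdot> ?T s)"
    unfolding sum.atMost_Suc_shift[of _ n] by simp
  also have "(\<Sum>s\<le>n. ((- 1) ^ s * q powi (?c n s) * qn q (int (Suc n) - int s)) \<cdot> ?T s)
     = (\<Sum>s\<le>Suc n. ((- 1) ^ s * q powi (?c n s) * qn q (int (Suc n) - int s)) \<cdot> ?T s)"
    by simp
  also have "(\<Sum>s\<le>Suc n. ((- 1) ^ s * q powi (?c n s) * qn q (int (Suc n) - int s)) \<cdot> ?T s)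
     + (\<Sum>s\<le>Suc n. ((- 1) ^ s * q powi (?c n (s - 1) - (w + 2 * int n)) * qn q (int s)) \<cdot> ?T s)
     = (\<Sum>s\<le>Suc n. ((- 1) ^ s * q powi (?c (Suc n) s) * qn q (int (Suc n))) \<cdot> ?T s)"
    unfolding sum.distrib[symmetric]
  proof (rule sum.cong[OF refl])
    fix s assume s: "s \<in> {..Suc n}"
    show "((- 1) ^ s * q powi (?c n s) * qn q (int (Suc n) - int s)) \<cdot> ?T s
     + ((- 1) ^ s * q powi (?c n (s - 1) - (w + 2 * int n)) * qn q (int s)) \<cdot> ?T s
     = ((- 1) ^ s * q powi (?c (Suc n) s) * qn q (int (Suc n))) \<cdot> ?T s"
    proof (cases s)
      case s': (Suc j)
      have "q powi (?c n s) * qn q (int (Suc n) - int s) + q powi (?c n (s - 1) - (w + 2 * int n)) * qn q (int s)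
         = q powi (?c (Suc n) s) * qn q (int (Suc n))"
        by (rule qn_comb) (simp_all add: s' algebra_simps)
      then have "(- 1) ^ s * q powi (?c n s) * qn q (int (Suc n) - int s) + (- 1) ^ s * q powi (?c n (s - 1) - (w + 2 * int n)) * qn q (int s)
         = (- 1) ^ s * q powi (?c (Suc n) s) * qn q (int (Suc n))"
        unfolding mult.assoc distrib_left[symmetric] by simp
      then show ?thesis by (simp only: scl_left(1)[symmetric])
    qed simp
  qed
  also have "\<dots> = qn q (int (Suc n)) \<cdot> (\<Sum>s\<le>Suc n. ((- 1) ^ s * q powi (?c (Suc n) s)) \<cdot> ?T s)"
    by (simp only: scl_sum_right V.scale_scale mult.commute[of "qn q (int (Suc n))"])
  finally show ?case
    by (rule qn_cancel)
qed simp

end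

section \<open>Integral forms\<close>

text \<open>The subring \<open>S\<close> plays the role of the restricted form over the Laurent polynomials.\<close>

locale integral_form = quantum sc q
  for sc :: "'k::field_char_0 \<Rightarrow> 'a::ring_1" and q :: 'k +
  fixes S :: "'a set"
  assumes S_1 [simp, intro]: "1 \<in> S"
    and S_diff [intro]: "x \<in> S \<Longrightarrow> y \<in> S \<Longrightarrow> x - y \<in> S"
    and S_mult [intro]: "x \<in> S \<Longrightarrow> y \<in> S \<Longrightarrow> x * y \<in> S"
    and S_q: "x \<in> S \<Longrightarrow> q \<cdot> x \<in> S" and S_p: "x \<in> S \<Longrightarrow> p \<cdot> x \<in> S"
begin

lemma S_0 [simp, intro]: "0 \<in> S"
  using S_diff[OF S_1 S_1] by simp

lemma S_minus [intro]: "x \<in> S \<Longrightarrow> - x \<in> S"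
  using S_diff[OF S_0] by force

lemma S_add [intro]: "x \<in> S \<Longrightarrow> y \<in> S \<Longrightarrow> x + y \<in> S"
  using S_diff[OF _ S_minus] by force

lemma S_sum [intro]: "(\<And>i. i \<in> A \<Longrightarrow> f i \<in> S) \<Longrightarrow> (\<Sum>i\<in>A. f i) \<in> S"
  by (induct A rule: infinite_finite_induct) auto

lemma S_power [intro]: "x \<in> S \<Longrightarrow> x ^ n \<in> S"
  by (induct n) auto

lemma S_q_power: "x \<in> S \<Longrightarrow> q ^ n \<cdot> x \<in> S" and S_p_power: "x \<in> S \<Longrightarrow> p ^ n \<cdot> x \<in> S"
  using S_q S_p by (induct n) (simp_all flip: V.scale_scale)

lemma S_powi [intro]: "x \<in> S \<Longrightarrow> q powi m \<cdot> x \<in> S"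
  using S_q_power S_p_power by (simp add: power_int_def)

lemma S_sign [intro]: "x \<in> S \<Longrightarrow> (- 1) ^ n \<cdot> x \<in> S"
  by (cases "even n") auto

lemma integral_form_inverse: "integral_form sc p S"
proof -
  interpret inv: quantum sc p by (rule quantum_inverse)
  show ?thesis by unfold_locales (auto intro: S_q S_p)
qed

lemma dp_scl: "dp (c \<cdot> x) n = c ^ n \<cdot> dp x n"
proof -
  have "(c \<cdot> x) ^ n = c ^ n \<cdot> x ^ n" by (induct n) (simp_all add: mult.commute)
  then show ?thesis by (simp add: dp_def mult.commute)
qed

text \<open>If \<open>ki\<close> rescales \<open>x\<close>, the divided powers of \<open>x * ki\<close> and \<open>x\<close> generate each other.\<close>

lemma dp_times_torus:
  assumes "ki * x = q powi m \<cdot> (x * ki)"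
  shows "dp (x * ki) n = q powi (m * int (n * (n - 1) div 2)) \<cdot> (dp x n * ki ^ n)"
proof -
  have 1: "ki ^ n * x = q powi (m * int n) \<cdot> (x * ki ^ n)" for n
  proof (induct n)
    case (Suc n)
    have "ki ^ Suc n * x = ki ^ n * (ki * x)" by (simp only: power_Suc2 mult.assoc)
    also have "\<dots> = q powi m \<cdot> (ki ^ n * x * ki)" by (simp add: assms mult.assoc)
    also have "\<dots> = q powi (m * int (Suc n)) \<cdot> (x * ki ^ Suc n)"
      unfolding Suc by (simp add: mult.assoc powi_merge power_Suc2 algebra_simps del: power_Suc)
    finally show ?case .
  qed simp
  have "(x * ki) ^ n = q powi (m * int (n * (n - 1) div 2)) \<cdot> (x ^ n * ki ^ n)"
  proof (induct n)
    case (Suc n)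
    have "Suc n * (Suc n - 1) div 2 = n * (n - 1) div 2 + n"
      by (cases n) (auto simp: algebra_simps)
    then have exp: "m * int (Suc n * (Suc n - 1) div 2) = m * int (n * (n - 1) div 2) + m * int n"
      by (simp add: algebra_simps del: of_nat_mult)
    have "(x * ki) ^ Suc n = (x * ki) ^ n * (x * ki)" by (simp only: power_Suc2)
    also have "\<dots> = q powi (m * int (n * (n - 1) div 2)) \<cdot> (x ^ n * (ki ^ n * x) * ki)"
      unfolding Suc by (simp add: mult.assoc)
    also have "\<dots> = q powi (m * int (Suc n * (Suc n - 1) div 2)) \<cdot> (x ^ Suc n * ki ^ Suc n)"
      unfolding 1 exp by (simp add: mult.assoc powi_merge power_Suc2 del: power_Suc)
    finally show ?case .
  qed simp
  then show ?thesis by (simp add: dp_def mult.commute)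
qed

end

context root_vector
begin

lemma D_integral:
  assumes "integral_form sc q S" "\<And>s. dp e s \<in> S" "z \<in> S" "wt z w"
  shows "D n z \<in> S"
proof -
  interpret integral_form sc q S by fact
  show ?thesis
    unfolding D_expand[OF assms(4)] V.scale_scale[symmetric] using assms(2,3) by blast
qed

text \<open>The top of a weight string inherits integral divided powers from its bottom: the quantum
  Leibniz rule has a single surviving term on the extremal element of a product of strings.\<close>

lemma string_top_integral:
  assumes "integral_form sc q S" "\<And>s. dp e s \<in> S" "\<And>s. dp x s \<in> S"
    and "wt x (- int a)" "D (Suc a) x = 0"
  shows "dp (D a x) t \<in> S"
  using D_integral[OF assms(1,2) assms(3)[of t] wt_dp[OF assms(4)]] D_dp[OF assms(4,5), of t]
  by metis

end


section \<open>Serre relations along a path\<close>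

context quantum
begin

text \<open>The quantum Serre relation of \<open>e\<close> and \<open>x\<close> in degree \<open>a + 1\<close>; only \<open>a \<le> 2\<close> occurs.\<close>

definition ser :: "nat \<Rightarrow> 'a \<Rightarrow> 'a \<Rightarrow> bool" where
  "ser a e x \<longleftrightarrow>
     (if a = 0 then e * x = x * e
      else if a = 1 then e * e * x - (q + p) \<cdot> (e * x * e) + x * e * e = 0
      else e * e * e * x - (q * q + 1 + p * p) \<cdot> (e * e * x * e)
             + (q * q + 1 + p * p) \<cdot> (e * x * e * e) - x * e * e * e = 0)"

definition qbr :: "'a \<Rightarrow> 'a \<Rightarrow> 'a" where
  "qbr c y = c * y - q \<cdot> (y * c)"

lemma qbr_rule: "c * y = qbr c y + q \<cdot> (y * c)" "c * (y * z) = qbr c y * z + q \<cdot> (y * (c * z))"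
  by (simp_all add: qbr_def algebra_simps flip: mult.assoc)

lemma ser_1_qbr_left:
  assumes "ser 1 c y"
  shows "c * qbr c y = p \<cdot> (qbr c y * c)" "c * (qbr c y * z) = p \<cdot> (qbr c y * (c * z))"
proof -
  show 1: "c * qbr c y = p \<cdot> (qbr c y * c)"
    using assms by (simp add: ser_def qbr_def algebra_simps scl_simps scl_left)
  show "c * (qbr c y * z) = p \<cdot> (qbr c y * (c * z))"
    using arg_cong[OF 1, of "\<lambda>u. u * z"] by (simp add: mult.assoc)
qed

lemma ser_1_qbr_right:
  assumes "ser 1 y c"
  shows "qbr c y * y = p \<cdot> (y * qbr c y)" "qbr c y * (y * z) = p \<cdot> (y * (qbr c y * z))"
proof -
  show 1: "qbr c y * y = p \<cdot> (y * qbr c y)"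
    using assms by (simp add: ser_def qbr_def algebra_simps scl_simps scl_left)
  show "qbr c y * (y * z) = p \<cdot> (y * (qbr c y * z))"
    using arg_cong[OF 1, of "\<lambda>u. u * z"] by (simp add: mult.assoc)
qed

lemma ser_commuting_left:
  assumes "c * x = x * c" "ser 1 x y" shows "ser 1 x (qbr c y)"
proof -
  have c: "x * c = c * x" "x * (c * z) = c * (x * z)" for z
    using assms(1) by (simp_all flip: mult.assoc)
  let ?R = "x * x * y - (q + p) \<cdot> (x * y * x) + y * x * x"
  have "?R = 0" using assms(2) by (simp add: ser_def)
  then have "qbr c ?R = 0" by (simp add: qbr_def)
  then show ?thesis
    by (simp add: ser_def qbr_def algebra_simps scl_simps c mult.commute)
qed

lemma ser_commuting_right:
  assumes "c * x = x * c" "ser 1 y x" "ser 1 c y" "ser 1 y c" shows "ser 1 (qbr c y) x"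
proof -
  let ?R = "y * y * x - (q + p) \<cdot> (y * x * y) + x * y * y"
  let ?n = "qbr c y"
  have c: "c * x = x * c" "c * (x * z) = x * (c * z)" for z
    using assms(1) by (simp_all flip: mult.assoc)
  note rules = qbr_rule[of c y] c ser_1_qbr_left[OF assms(3)] ser_1_qbr_right[OF assms(4)]
  have R: "?R = 0" using assms(2) by (simp add: ser_def)
  let ?R1 = "y * ?n * x - ?n * x * y - q \<cdot> (y * x * ?n) + x * y * ?n"
  have "c * ?R - (q * q) \<cdot> (?R * c) = (q + p) \<cdot> ?R1"
    by (simp add: algebra_simps scl_simps scl_left rules)
  with R have R1: "?R1 = 0" by simp
  have "c * ?R1 - ?R1 * c = ?n * ?n * x - (q + p) \<cdot> (?n * x * ?n) + x * ?n * ?n"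
    by (simp add: algebra_simps scl_simps scl_left rules)
  with R1 show ?thesis by (simp add: ser_def)
qed

text \<open>The three vectors form a path with \<open>c\<close> in the middle.  Extending \<open>y\<close> by \<open>c\<close> makes it a neighbour of \<open>x\<close>.\<close>

lemma ser_adjacent:
  assumes "y * x = x * y" "ser 1 c x" "ser 1 x c" "ser 1 c y" "ser 1 y c"
  shows "ser 1 (qbr c y) x" "ser 1 x (qbr c y)"
proof -
  let ?n = "qbr c y" and ?w = "qbr c x"
  note rules = qbr_rule[of c y] qbr_rule[of c x] ser_1_qbr_left[OF assms(2)] ser_1_qbr_left[OF assms(4)]
  let ?R1 = "?n * x + q \<cdot> (y * ?w) - ?w * y - q \<cdot> (x * ?n)"
  have "c * (y * x - x * y) - (q * q) \<cdot> ((y * x - x * y) * c) = ?R1"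
    by (simp add: algebra_simps scl_simps scl_left rules)
  then have R1: "?R1 = 0" using assms(1) by simp
  have "c * ?R1 - ?R1 * c = (q + p) \<cdot> (?n * ?w - ?w * ?n)"
    by (simp add: algebra_simps scl_simps scl_left rules)
  with R1 have "?n * ?w - ?w * ?n = 0" by simp
  then have nw: "?n * ?w = ?w * ?n" "?n * (?w * z) = ?w * (?n * z)" for z
    by (simp_all flip: mult.assoc)
  have yx: "y * x = x * y" "y * (x * z) = x * (y * z)" for z
    using assms(1) by (simp_all flip: mult.assoc)
  let ?u = "?w * y - q \<cdot> (y * ?w)"
  have u: "?n * x - q \<cdot> (x * ?n) = ?u"
    using R1 by (simp add: algebra_simps)
  have "?n * ?u = p \<cdot> (?u * ?n)"
    by (simp add: algebra_simps scl_simps nw ser_1_qbr_right[OF assms(5)])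
  then have "?n * (?n * x - q \<cdot> (x * ?n)) - p \<cdot> ((?n * x - q \<cdot> (x * ?n)) * ?n) = 0"
    unfolding u by simp
  then show "ser 1 ?n x"
    by (simp add: ser_def algebra_simps scl_simps scl_left)
  have "?u * x = p \<cdot> (x * ?u)"
    by (simp add: algebra_simps scl_simps yx ser_1_qbr_right[OF assms(3)])
  then have "(?n * x - q \<cdot> (x * ?n)) * x - p \<cdot> (x * (?n * x - q \<cdot> (x * ?n))) = 0"
    unfolding u by simp
  then show "ser 1 x ?n"
    by (simp add: ser_def algebra_simps scl_simps scl_left)
qed

text \<open>Here \<open>x\<close> is a neighbour of both ends, which is how the last node of the cycle sees the path; the
  two quadratic relations turn into a cubic one.\<close>

lemma ser_closing_left:
  assumes "ser 1 x c" "ser 1 x y" shows "ser 2 x (qbr c y)"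
proof -
  note rules = qbr_rule[of x c] qbr_rule[of x y] ser_1_qbr_left[OF assms(1)] ser_1_qbr_left[OF assms(2)]
  define F where "F z = x * x * x * z - (q * q + 1 + p * p) \<cdot> (x * x * z * x)
             + (q * q + 1 + p * p) \<cdot> (x * z * x * x) - z * x * x * x" for z
  have "F (c * y) = 0" "F (y * c) = 0"
    by (simp_all add: F_def algebra_simps scl_simps scl_left rules)
  moreover have "F (u - q \<cdot> v) = F u - q \<cdot> F v" for u v
    by (simp add: F_def right_diff_distrib left_diff_distrib mult.assoc scl_simps mult.commute)
  ultimately have "F (qbr c y) = 0" by (simp add: qbr_def)
  then show ?thesis by (simp add: ser_def F_def)
qed

lemma ser_closing_right:
  assumes "ser 1 y x" "ser 1 c x" "ser 1 c y" "ser 1 y c"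
  shows "ser 2 (qbr c y) x"
proof -
  let ?n = "qbr c y" and ?w = "qbr c x"
  note rules = qbr_rule[of c y] qbr_rule[of c x] ser_1_qbr_left[OF assms(2)] ser_1_qbr_left[OF assms(3)]
    ser_1_qbr_right[OF assms(4)]
  let ?R = "y * y * x - (q + p) \<cdot> (y * x * y) + x * y * y"
  let ?R1 = "(q + p) \<cdot> (y * ?n * x) + (q * q) \<cdot> (y * y * ?w)
     - (q + p) \<cdot> (?n * x * y + q \<cdot> (y * ?w * y) + (q * q) \<cdot> (y * x * ?n))
     + ?w * y * y + (q * (q + p)) \<cdot> (x * y * ?n)"
  let ?v = "?n * ?w - q \<cdot> (?w * ?n)"
  let ?x2 = "?n * ?n * x - (1 + q * q) \<cdot> (?n * x * ?n) + (q * q) \<cdot> (x * ?n * ?n)"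
  let ?R2 = "?x2 + (q + p) \<cdot> (q \<cdot> (y * ?v) - ?v * y)"
  have "c * ?R - (q * q * q) \<cdot> (?R * c) = ?R1"
    by (simp add: algebra_simps scl_simps scl_left rules)
  then have R1: "?R1 = 0" using assms(1) by (simp add: ser_def)
  have "c * ?R1 - q \<cdot> (?R1 * c) = (q + p) \<cdot> ?R2"
    by (simp add: algebra_simps scl_simps scl_left rules)
  then have R2: "?R2 = 0" unfolding R1 by simp
  have "c * ?R2 - p \<cdot> (?R2 * c) = (q * q + 1 + p * p) \<cdot> (?n * ?v - p \<cdot> (?v * ?n))"
    by (simp add: algebra_simps scl_simps scl_left rules)
  then have "?n * ?v - p \<cdot> (?v * ?n) = 0" unfolding R2 by simp
  then have v: "?n * ?v = p \<cdot> (?v * ?n)" by simp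
  have aux: "?n * (v * y - q \<cdot> (y * v)) - (p * p) \<cdot> ((v * y - q \<cdot> (y * v)) * ?n) = 0"
    if "?n * v = p \<cdot> (v * ?n)" for v
  proof -
    have "?n * (v * z) = p \<cdot> (v * (?n * z))" for z
      using arg_cong[OF that, of "\<lambda>u. u * z"] by (simp add: mult.assoc)
    then show ?thesis
      by (simp add: right_diff_distrib left_diff_distrib mult.assoc scl_simps that
        ser_1_qbr_right[OF assms(4)])
  qed
  have x2: "?x2 = (q + p) \<cdot> (?v * y - q \<cdot> (y * ?v))"
    using R2 by (simp add: scl_simps) (simp add: algebra_simps)
  have lin: "?n * (a \<cdot> u) - b \<cdot> ((a \<cdot> u) * ?n) = a \<cdot> (?n * u - b \<cdot> (u * ?n))" for a b u
    by (simp add: scl_simps mult.commute)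
  have "?n * ?x2 - (p * p) \<cdot> (?x2 * ?n) = 0"
    unfolding x2 lin aux[OF v] by simp
  then show ?thesis
    by (simp add: ser_def algebra_simps scl_simps scl_left)
qed

text \<open>One step of the walk: the exponents \<open>a\<close> and \<open>b\<close> are the numbers of edges from \<open>x\<close> to \<open>y\<close> and to \<open>c\<close>, and
  they add up when \<open>y\<close> is extended by \<open>c\<close>.\<close>

lemma ser_step:
  assumes "ser 1 c y" "ser 1 y c" "ser a x y" "ser a y x" "ser b c x" "ser b x c" "a \<le> 1" "b \<le> 1"
  shows "ser (a + b) x (qbr c y)" "ser (a + b) (qbr c y) x"
proof -
  have comm: "x * qbr c y = qbr c y * x" if "x * y = y * x" "c * x = x * c"
    using that by (simp add: qbr_def algebra_simps) (metis mult.assoc)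
  have "(a = 0 \<or> a = 1) \<and> (b = 0 \<or> b = 1)" using assms(7,8) by linarith
  then have "ser (a + b) x (qbr c y) \<and> ser (a + b) (qbr c y) x"
  proof (elim conjE disjE)
    assume [simp]: "a = 0" "b = 0"
    show ?thesis using comm assms by (simp add: ser_def)
  next
    assume ab: "a = 0" "b = 1"
    then have "y * x = x * y" "ser 1 c x" "ser 1 x c" using assms by (simp_all add: ser_def)
    then show ?thesis using ser_adjacent[OF _ _ _ assms(1,2)] ab by simp
  next
    assume ab: "a = 1" "b = 0"
    then have "c * x = x * c" "ser 1 x y" "ser 1 y x" using assms by (simp_all add: ser_def)
    then show ?thesis using ser_commuting_left ser_commuting_right assms(1,2) ab by simp
  next
    assume ab: "a = 1" "b = 1"
    then have "ser 2 x (qbr c y)" "ser 2 (qbr c y) x"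
      using ser_closing_left[of x c y] ser_closing_right[of y x c] assms by blast+
    then show ?thesis using ab by (simp add: numeral_2_eq_2)
  qed
  then show "ser (a + b) x (qbr c y)" "ser (a + b) (qbr c y) x" by blast+
qed

text \<open>The commutator of opposite root vectors stays in the torus when both are extended by opposite
  generators: \<open>l\<close> is the torus element of the root of \<open>y\<close>, and \<open>l * k\<close> the one of the extended root.
  The constant \<open>s\<close> records the factor \<open>- q\<close> collected by each step.\<close>

lemma qbr_commutator:
  fixes d s :: 'k
  assumes d: "d = 1 / (q - p)"
    and EF: "e * f = f * e + d \<cdot> (k - ki)" and yy: "y * y' = y' * y + (s * d) \<cdot> (l - li)"
    and yF: "y * f = f * y" and Ey: "e * y' = y' * e"
    and Ky: "k * y = p \<cdot> (y * k)" "ki * y = q \<cdot> (y * ki)" "k * y' = q \<cdot> (y' * k)" "ki * y' = p \<cdot> (y' * ki)"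
    and LE: "l * e = p \<cdot> (e * l)" "li * e = q \<cdot> (e * li)" "l * f = q \<cdot> (f * l)" "li * f = p \<cdot> (f * li)"
    and KL: "k * l = l * k" "ki * l = l * ki" "k * li = li * k" "ki * li = li * ki"
  shows "qbr e y * qbr f y' - qbr f y' * qbr e y = (- q * s * d) \<cdot> (l * k - li * ki)"
proof -
  have dqp: "d * (q - p) = 1" using d by simp
  let ?Y = "qbr e y"
  have "?Y * f - f * ?Y = (e * f - f * e) * y - q \<cdot> (y * (e * f - f * e)) + (e * (y * f - f * y) - q \<cdot> ((y * f - f * y) * e))"
    by (simp add: qbr_def algebra_simps scl_simps)
  also have "\<dots> = d \<cdot> ((k - ki) * y - q \<cdot> (y * (k - ki)))"
    unfolding yF EF by (simp add: scl_simps left_diff_distrib right_diff_distrib mult.commute)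
  also have "(k - ki) * y - q \<cdot> (y * (k - ki)) = - ((q - p) \<cdot> (y * k))"
    by (simp add: left_diff_distrib right_diff_distrib Ky scl_simps scl_left)
  also have "d \<cdot> - ((q - p) \<cdot> (y * k)) = - (y * k)"
    by (simp add: dqp)
  finally have Yf: "?Y * f - f * ?Y = - (y * k)" .
  have "?Y * y' - y' * ?Y = e * (y * y' - y' * y) - q \<cdot> ((y * y' - y' * y) * e) + ((e * y' - y' * e) * y - q \<cdot> (y * (e * y' - y' * e)))"
    by (simp add: qbr_def algebra_simps scl_simps)
  also have "\<dots> = (s * d) \<cdot> (e * (l - li) - q \<cdot> ((l - li) * e))"
    unfolding Ey yy by (simp add: scl_simps left_diff_distrib right_diff_distrib mult.commute mult.left_commute)
  also have "e * (l - li) - q \<cdot> ((l - li) * e) = (q * (q - p)) \<cdot> (e * li)"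
    by (simp add: left_diff_distrib right_diff_distrib LE scl_simps scl_left)
  also have "(s * d) \<cdot> (q * (q - p)) \<cdot> (e * li) = (s * q) \<cdot> (e * li)"
  proof -
    have "s * d * (q * (q - p)) = s * q * (d * (q - p))" by (simp only: mult.assoc mult.commute mult.left_commute)
    then show ?thesis unfolding V.scale_scale dqp by simp
  qed
  finally have Yy': "?Y * y' - y' * ?Y = (s * q) \<cdot> (e * li)" .
  have "x * qbr f y' - qbr f y' * x = (x * f - f * x) * y' + f * (x * y' - y' * x)
      - q \<cdot> ((x * y' - y' * x) * f + y' * (x * f - f * x))" for x
    unfolding qbr_def[of f y'] by (simp add: algebra_simps scl_simps)
  then have "?Y * qbr f y' - qbr f y' * ?Y = (?Y * f - f * ?Y) * y' + f * (?Y * y' - y' * ?Y)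
      - q \<cdot> ((?Y * y' - y' * ?Y) * f + y' * (?Y * f - f * ?Y))" .
  also have "\<dots> = - (q \<cdot> ((y * y' - y' * y) * k)) - (s * q) \<cdot> ((e * f - f * e) * li)"
    unfolding Yf Yy' by (simp add: mult.assoc Ky LE scl_simps left_diff_distrib mult.commute)
  also have "\<dots> = (- q * s * d) \<cdot> (l * k - li * ki)"
    unfolding yy EF by (simp add: scl_simps left_diff_distrib right_diff_distrib KL mult.commute mult.left_commute)
  finally show ?thesis .
qed

end

section \<open>The affine cycle\<close>

lemma cartan_0_right: "1 \<le> m \<Longrightarrow> m \<le> n \<Longrightarrow> cartan n m 0 = - (of_bool (m = 1) + of_bool (m = n))"
  by (cases "m = n") (auto simp: cartan_def)

lemma cartan_sym: "cartan n i j = cartan n j i"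
  by (simp add: cartan_def)

lemma cartan_diag: "n \<ge> 1 \<Longrightarrow> i \<le> n \<Longrightarrow> cartan n i i = 2"
  by (cases "i = n") (auto simp: cartan_def)

lemma cartan_inner: "1 \<le> j \<Longrightarrow> j < m \<Longrightarrow> m \<le> n \<Longrightarrow> cartan n m j = - of_bool (m = Suc j)"
  by (cases "m = n") (auto simp: cartan_def)

text \<open>The number of ends of the interval \<open>{lo..hi}\<close> at \<open>m\<close>.  Removing the interval from the cycle
  leaves a path, and this is the number of edges that join \<open>m\<close> to the path.\<close>

definition ends :: "nat \<Rightarrow> nat \<Rightarrow> nat \<Rightarrow> nat" where
  "ends lo hi m = of_bool (m = lo) + of_bool (m = hi)"

text \<open>Moving the boundary of the interval past a node transfers the edges at that node to the path.\<close>

lemma ends_step: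
  assumes "1 \<le> lo" "lo < hi" "hi \<le> n"
  shows "m \<in> {Suc lo..hi} \<Longrightarrow> ends (Suc lo) hi m = ends lo hi m + nat (- cartan n m lo)"
    and "m \<in> {lo..hi - 1} \<Longrightarrow> ends lo (hi - 1) m = ends lo hi m + nat (- cartan n m hi)"
  using assms cartan_inner[of lo m n] cartan_inner[of m hi n] cartan_sym[of n m hi]
  by (auto simp: ends_def)

lemma cartan_le_0:
  assumes "1 \<le> i" "1 \<le> j" "i \<le> n" "j \<le> n" "i \<noteq> j"
  shows "cartan n i j = - int (nat (- cartan n i j))" "nat (- cartan n i j) \<le> 1"
  using assms cartan_inner[of i j n] cartan_inner[of j i n] cartan_sym[of n i j]
  by (cases "i < j"; auto)+

context quantum
begin

lemma torus_qbr:
  assumes "k * c = a \<cdot> (c * k)" "k * y = b \<cdot> (y * k)"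
  shows "k * qbr c y = (a * b) \<cdot> (qbr c y * k)"
proof -
  have "k * (c * z) = a \<cdot> (c * (k * z))" "k * (y * z) = b \<cdot> (y * (k * z))" for z
    using arg_cong[OF assms(1), of "\<lambda>u. u * z"] arg_cong[OF assms(2), of "\<lambda>u. u * z"]
    by (simp_all add: mult.assoc)
  then show ?thesis
    by (simp add: qbr_def right_diff_distrib left_diff_distrib mult.assoc scl_simps assms mult.commute mult.left_commute)
qed

lemma inv_comm:
  assumes "k * ki = 1" "ki * k = 1" "k * x = a \<cdot> (x * k)" "a \<noteq> 0"
  shows "ki * x = inverse a \<cdot> (x * ki)"
proof -
  have "ki * (k * x) * ki = a \<cdot> (ki * x * (k * ki))"
    unfolding assms(3) by (simp add: mult.assoc)
  then have "x * ki = a \<cdot> (ki * x)"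
    using assms(1,2) by (simp flip: mult.assoc)
  then show ?thesis using assms(4) by simp
qed

lemma inv_comm_1:
  fixes k :: 'a
  assumes "k * ki = 1" "ki * k = 1" "k * x = x * k"
  shows "ki * x = x * ki"
  using inv_comm[of k ki x 1] assms by simp

end

text \<open>One half of the Chevalley generators, with the torus.  The other half satisfies the same axioms
  after exchanging \<open>kt\<close> and \<open>kti\<close>, so that every statement about one half serves for both.\<close>

locale affine_half = quantum sc q
  for sc :: "'k::field_char_0 \<Rightarrow> 'a::ring_1" and q :: 'k +
  fixes n :: nat and ev kt kti :: "nat \<Rightarrow> 'a"
  assumes n_pos: "1 \<le> n"
    and kt_kti: "i \<le> n \<Longrightarrow> kt i * kti i = 1" "i \<le> n \<Longrightarrow> kti i * kt i = 1"
    and kt_ev: "i \<le> n \<Longrightarrow> j \<le> n \<Longrightarrow> kt i * ev j = q powi cartan n i j \<cdot> (ev j * kt i)"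
    and serre: "i \<le> n \<Longrightarrow> j \<le> n \<Longrightarrow> i \<noteq> j \<Longrightarrow> ser (nat (- cartan n i j)) (ev i) (ev j)"
begin

text \<open>A root vector for the path that is the complement of the interval \<open>{lo..hi}\<close> in the cycle, as far as
  the remaining nodes can see it: its weight and its Serre relations with them.\<close>

definition path_vector :: "nat \<Rightarrow> nat \<Rightarrow> 'a \<Rightarrow> bool" where
  "path_vector lo hi y \<longleftrightarrow> (\<forall>m \<in> {lo..hi}. kt m * y = q powi (- int (ends lo hi m)) \<cdot> (y * kt m) \<and>
     ser (ends lo hi m) (ev m) y \<and> ser (ends lo hi m) y (ev m))"

lemma path_vector_0: "path_vector 1 n (ev 0)"
  unfolding path_vector_def
proof (intro ballI)
  fix m assume m: "m \<in> {1..n}"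
  then have c: "cartan n m 0 = - int (ends 1 n m)" "cartan n 0 m = - int (ends 1 n m)"
    using cartan_0_right[of m n] cartan_sym[of n m 0] by (auto simp: ends_def)
  show "kt m * ev 0 = q powi (- int (ends 1 n m)) \<cdot> (ev 0 * kt m) \<and>
     ser (ends 1 n m) (ev m) (ev 0) \<and> ser (ends 1 n m) (ev 0) (ev m)"
    using kt_ev[of m 0] serre[of m 0] serre[of 0 m] m c by simp
qed

lemma path_vector_step:
  assumes y: "path_vector lo hi y" and lh: "1 \<le> lo" "lo < hi" "hi \<le> n"
  shows "path_vector (Suc lo) hi (qbr (ev lo) y)" "path_vector lo (hi - 1) (qbr (ev hi) y)"
proof -
  have key: "kt m * qbr (ev j) y = q powi (- int (ends lo hi m + nat (- cartan n m j))) \<cdot> (qbr (ev j) y * kt m) \<and>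
     ser (ends lo hi m + nat (- cartan n m j)) (ev m) (qbr (ev j) y) \<and>
     ser (ends lo hi m + nat (- cartan n m j)) (qbr (ev j) y) (ev m)"
    if j: "j \<in> {lo, hi}" and m: "m \<in> {lo..hi}" "m \<noteq> j" for j m
  proof -
    have jj: "1 \<le> j" "j \<le> n" "1 \<le> m" "m \<le> n" "ends lo hi j = 1" "ends lo hi m \<le> 1" "j \<in> {lo..hi}"
      using j m lh by (auto simp: ends_def)
    note c = cartan_le_0[of m j n] jj(1-4) m(2)
    have yj: "ser 1 (ev j) y" "ser 1 y (ev j)"
      and ym: "ser (ends lo hi m) (ev m) y" "ser (ends lo hi m) y (ev m)"
        "kt m * y = q powi (- int (ends lo hi m)) \<cdot> (y * kt m)"
      using y jj m unfolding path_vector_def by (metis)+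
    have jm: "ser (nat (- cartan n m j)) (ev j) (ev m)" "ser (nat (- cartan n m j)) (ev m) (ev j)"
      using serre[of j m] serre[of m j] jj m(2) cartan_sym[of n m j] by auto
    have k: "kt m * ev j = q powi (- int (nat (- cartan n m j))) \<cdot> (ev j * kt m)"
      using kt_ev[of m j] jj c by simp
    have "kt m * qbr (ev j) y = (q powi (- int (nat (- cartan n m j))) * q powi (- int (ends lo hi m))) \<cdot> (qbr (ev j) y * kt m)"
      by (rule torus_qbr[OF k ym(3)])
    also have "q powi (- int (nat (- cartan n m j))) * q powi (- int (ends lo hi m)) = q powi (- int (ends lo hi m + nat (- cartan n m j)))"
      unfolding powi_merge by simp
    finally show ?thesis
      using ser_step[OF yj ym(1,2) jm jj(6)] c by blast
  qed
  show "path_vector (Suc lo) hi (qbr (ev lo) y)"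
    unfolding path_vector_def
  proof
    fix m assume m: "m \<in> {Suc lo..hi}"
    then have "m \<in> {lo..hi}" "m \<noteq> lo" by auto
    then show "kt m * qbr (ev lo) y = q powi (- int (ends (Suc lo) hi m)) \<cdot> (qbr (ev lo) y * kt m) \<and>
     ser (ends (Suc lo) hi m) (ev m) (qbr (ev lo) y) \<and> ser (ends (Suc lo) hi m) (qbr (ev lo) y) (ev m)"
      unfolding ends_step(1)[OF lh m] by (intro key) simp_all
  qed
  show "path_vector lo (hi - 1) (qbr (ev hi) y)"
    unfolding path_vector_def
  proof
    fix m assume m: "m \<in> {lo..hi - 1}"
    then have "m \<in> {lo..hi}" "m \<noteq> hi" using lh by auto
    then show "kt m * qbr (ev hi) y = q powi (- int (ends lo (hi - 1) m)) \<cdot> (qbr (ev hi) y * kt m) \<and>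
     ser (ends lo (hi - 1) m) (ev m) (qbr (ev hi) y) \<and> ser (ends lo (hi - 1) m) (qbr (ev hi) y) (ev m)"
      unfolding ends_step(2)[OF lh m] by (intro key) simp_all
  qed
qed

text \<open>An end of the interval is joined to the path by a single edge, so \<open>y\<close> is the bottom of a string of
  length two whose top is the bracket.\<close>

lemma path_vector_dp:
  assumes y: "path_vector lo hi y" and lh: "1 \<le> lo" "lo < hi" "hi \<le> n" and j: "j \<in> {lo, hi}"
    and S: "integral_form sc q S" "\<And>s. dp (ev j) s \<in> S" "\<And>s. dp y s \<in> S"
  shows "dp (qbr (ev j) y) t \<in> S"
proof -
  have jj: "j \<le> n" "ends lo hi j = 1" "j \<in> {lo..hi}"
    using j lh by (auto simp: ends_def)
  have ky: "kt j * y = p \<cdot> (y * kt j)" and ser: "ser 1 (ev j) y"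
    using bspec[OF y[unfolded path_vector_def] jj(3)] jj(2) by (simp_all add: power_int_minus)
  interpret R: root_vector sc q "ev j" "kt j" "kti j"
  proof unfold_locales
    have "kti j * (ev j * kt j) = kti j * ((p * p) \<cdot> (kt j * ev j))"
      using kt_ev[of j j] jj n_pos by (simp add: cartan_diag power2_eq_square mult.assoc)
    also have "\<dots> = (p * p) \<cdot> ev j"
      using kt_kti jj by (simp flip: mult.assoc)
    finally show "kti j * ev j * kt j = (p * p) \<cdot> ev j" by (simp add: mult.assoc)
  qed (use kt_kti jj in auto)
  have tw: "R.tw y = q \<cdot> y"
  proof -
    have "y * kt j = q \<cdot> (kt j * y)" unfolding ky by simp
    then show ?thesis by (simp add: R.tw_def mult.assoc)
  qed
  have ad: "R.ad y = qbr (ev j) y"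
    by (simp add: R.ad_def tw qbr_def)
  have "R.ad (qbr (ev j) y) = 0"
    using ser_1_qbr_left(1)[OF ser] R.tw_ad[of y] unfolding ad tw R.ad_simps
    by (simp add: R.ad_def mult.assoc)
  then have "R.D (Suc 1) y = 0"
    using qn_eq_0[of 1] R.D_Suc[of 1 y] by (simp add: R.D_1 ad)
  with S have "dp (R.D 1 y) t \<in> S"
    by (intro R.string_top_integral) (auto simp: R.wt_def tw)
  then show ?thesis by (simp add: R.D_1 ad)
qed

end


locale affine_nodes = P: affine_half sc q n ep kt kti + M: affine_half sc q n em kti kt
  for sc :: "'k::field_char_0 \<Rightarrow> 'a::ring_1" and q :: 'k and n ep em kt kti +
  assumes kt_comm: "i \<le> n \<Longrightarrow> j \<le> n \<Longrightarrow> kt i * kt j = kt j * kt i"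
    and ep_em: "i \<le> n \<Longrightarrow> j \<le> n \<Longrightarrow> ep i * em j - em j * ep i =
      (if i = j then (1 / (q - inverse q)) \<cdot> (kt i - kti i) else 0)"
    and kt_prod: "prod_list (map kt [0..<Suc n]) = 1"
begin

text \<open>Opposite root vectors for the same path, with the torus element \<open>l\<close> of their root.  As the product of all
  \<open>kt i\<close> is \<open>1\<close>, it is the inverse of the product over the interval.\<close>

definition path_pair :: "nat \<Rightarrow> nat \<Rightarrow> 'k \<Rightarrow> 'a \<Rightarrow> 'a \<Rightarrow> 'a \<Rightarrow> 'a \<Rightarrow> bool" where
  "path_pair lo hi s y y' l li \<longleftrightarrow> P.path_vector lo hi y \<and> M.path_vector lo hi y' \<and>
     l * li = 1 \<and> li * l = 1 \<and> (\<forall>m \<le> n. kt m * l = l * kt m) \<and>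
     l * prod_list (map kt [lo..<Suc hi]) = 1 \<and>
     y * y' - y' * y = (s * (1 / (q - P.p))) \<cdot> (l - li) \<and>
     (\<forall>m \<in> {lo..hi}. y * em m = em m * y \<and> ep m * y' = y' * ep m \<and>
        l * ep m = q powi (- int (ends lo hi m)) \<cdot> (ep m * l) \<and>
        l * em m = q powi int (ends lo hi m) \<cdot> (em m * l))"

lemma path_pair_step:
  assumes pair: "path_pair lo hi s y y' l li" and lh: "1 \<le> lo" "lo < hi" "hi \<le> n"
    and j: "j \<in> {lo, hi}"
    and lohi': "lo' = (if j = lo then Suc lo else lo)" "hi' = (if j = lo then hi else hi - 1)"
  shows "path_pair lo' hi' (- q * s) (P.qbr (ep j) y) (P.qbr (em j) y') (l * kt j) (li * kti j)"
proof -
  note pp = pair[unfolded path_pair_def]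
  have jj: "j \<le> n" "ends lo hi j = 1" "j \<in> {lo..hi}"
    using j lh by (auto simp: ends_def)
  have y: "P.path_vector lo hi y" and y': "M.path_vector lo hi y'"
    and lli: "l * li = 1" "li * l = 1" and ktl: "\<And>m. m \<le> n \<Longrightarrow> kt m * l = l * kt m"
    and prod: "l * prod_list (map kt [lo..<Suc hi]) = 1"
    and yy: "y * y' - y' * y = (s * (1 / (q - P.p))) \<cdot> (l - li)"
    and yem: "\<And>m. m \<in> {lo..hi} \<Longrightarrow> y * em m = em m * y"
    and epy: "\<And>m. m \<in> {lo..hi} \<Longrightarrow> ep m * y' = y' * ep m"
    and lep: "\<And>m. m \<in> {lo..hi} \<Longrightarrow> l * ep m = q powi (- int (ends lo hi m)) \<cdot> (ep m * l)"
    and lem: "\<And>m. m \<in> {lo..hi} \<Longrightarrow> l * em m = q powi int (ends lo hi m) \<cdot> (em m * l)"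
    using pp by blast+
  note kk = P.kt_kti[OF jj(1)]
  have ktli: "kt m * li = li * kt m" if "m \<le> n" for m
    using P.inv_comm_1[OF lli ktl[OF that, symmetric]] by simp
  have kty: "kt j * y = P.p \<cdot> (y * kt j)" and ktiy': "kti j * y' = P.p \<cdot> (y' * kti j)"
    using bspec[OF y[unfolded P.path_vector_def] jj(3)] bspec[OF y'[unfolded M.path_vector_def] jj(3)] jj(2)
    by (simp_all add: power_int_minus)
  have ktiy: "kti j * y = q \<cdot> (y * kti j)" and kty': "kt j * y' = q \<cdot> (y' * kt j)"
    using P.inv_comm[OF kk kty] P.inv_comm[OF kk(2,1) ktiy'] by simp_all
  have lj: "l * ep j = P.p \<cdot> (ep j * l)" "l * em j = q \<cdot> (em j * l)"
    using lep[OF jj(3)] lem[OF jj(3)] jj(2) by (simp_all add: power_int_minus)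
  have lij: "li * ep j = q \<cdot> (ep j * li)" "li * em j = P.p \<cdot> (em j * li)"
    using P.inv_comm[OF lli lj(1)] P.inv_comm[OF lli lj(2)] by simp_all
  have efj: "ep j * em j = em j * ep j + (1 / (q - P.p)) \<cdot> (kt j - kti j)"
    using ep_em[OF jj(1) jj(1)] by (simp add: algebra_simps)
  have yy2: "y * y' = y' * y + (s * (1 / (q - P.p))) \<cdot> (l - li)"
    using yy by (simp add: algebra_simps)
  have kl: "kt j * l = l * kt j" "kti j * l = l * kti j" "kt j * li = li * kt j" "kti j * li = li * kti j"
    using ktl ktli jj P.inv_comm_1[OF kk] by auto
  have c1: "P.qbr (ep j) y * P.qbr (em j) y' - P.qbr (em j) y' * P.qbr (ep j) y
      = (- q * s * (1 / (q - P.p))) \<cdot> (l * kt j - li * kti j)"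
    by (rule P.qbr_commutator[OF refl efj yy2 yem[OF jj(3)] epy[OF jj(3)] kty ktiy kty' ktiy' lj(1) lij(1) lj(2) lij(2) kl])
  have vec: "P.path_vector lo' hi' (P.qbr (ep j) y)" "M.path_vector lo' hi' (P.qbr (em j) y')"
    using P.path_vector_step[OF y lh] M.path_vector_step[OF y' lh] j lohi' by auto
  have inv: "l * kt j * (li * kti j) = 1" "li * kti j * (l * kt j) = 1"
  proof -
    have "l * kt j * (li * kti j) = l * (kt j * li) * kti j" by (simp add: mult.assoc)
    also have "\<dots> = l * li * (kt j * kti j)" unfolding kl by (simp add: mult.assoc)
    finally show "l * kt j * (li * kti j) = 1" using lli kk by simp
    have "li * kti j * (l * kt j) = li * (kti j * l) * kt j" by (simp add: mult.assoc)
    also have "\<dots> = li * l * (kti j * kt j)" unfolding kl by (simp add: mult.assoc)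
    finally show "li * kti j * (l * kt j) = 1" using lli kk by simp
  qed
  have ktn: "kt m * (l * kt j) = l * kt j * kt m" if "m \<le> n" for m
    using ktl[OF that] kt_comm[OF that jj(1)] by (metis mult.assoc)
  have kpr: "kt j * prod_list (map kt xs) = prod_list (map kt xs) * kt j" if "set xs \<subseteq> {..n}" for xs
    using that
  proof (induct xs)
    case (Cons x xs)
    then have "kt j * kt x = kt x * kt j" "kt j * prod_list (map kt xs) = prod_list (map kt xs) * kt j"
      using kt_comm jj by auto
    then show ?case by (simp add: mult.assoc) (metis mult.assoc)
  qed simp
  have pr: "l * kt j * prod_list (map kt [lo'..<Suc hi']) = 1"
  proof (cases "j = lo")
    case True
    then show ?thesis using prod lohi' lh by (simp add: upt_conv_Cons mult.assoc del: upt_Suc)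
  next
    case False
    with j have "j = hi" by simp
    then have "prod_list (map kt [lo..<Suc hi]) = prod_list (map kt [lo'..<Suc hi']) * kt j"
      using lohi' lh False by simp
    moreover have "set [lo'..<Suc hi'] \<subseteq> {..n}" using lohi' lh False by auto
    note kpr[OF this, symmetric]
    ultimately show ?thesis using prod by (simp add: mult.assoc del: upt_Suc)
  qed
  have rest: "P.qbr (ep j) y * em m = em m * P.qbr (ep j) y \<and> ep m * P.qbr (em j) y' = P.qbr (em j) y' * ep m \<and>
        l * kt j * ep m = q powi (- int (ends lo' hi' m)) \<cdot> (ep m * (l * kt j)) \<and>
        l * kt j * em m = q powi int (ends lo' hi' m) \<cdot> (em m * (l * kt j))" if m: "m \<in> {lo'..hi'}" for m
  proof -
    have mm: "m \<in> {lo..hi}" "m \<noteq> j" "m \<le> n" "1 \<le> m" "1 \<le> j"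
      using m lohi' j lh by (auto split: if_splits)
    have ends: "ends lo' hi' m = ends lo hi m + nat (- cartan n m j)"
      using ends_step[OF lh, of m] m lohi' j by (auto split: if_splits)
    have c: "cartan n j m = - int (nat (- cartan n m j))"
      using cartan_le_0(1)[of m j n] mm jj cartan_sym[of n j m] by simp
    have e1: "ep j * em m = em m * ep j" "ep m * em j = em j * ep m"
      using ep_em[of j m] ep_em[of m j] mm jj by auto
    have 1: "kt j * ep m = q powi (- int (nat (- cartan n m j))) \<cdot> (ep m * kt j)"
      using P.kt_ev[of j m] jj mm c by simp
    have "kti j * em m = q powi (- int (nat (- cartan n m j))) \<cdot> (em m * kti j)"
      using M.kt_ev[of j m] jj mm c by simp
    from P.inv_comm[OF kk(2,1) this]
    have 2: "kt j * em m = q powi int (nat (- cartan n m j)) \<cdot> (em m * kt j)"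
      by (simp add: power_int_minus)
    have A: "P.qbr (ep j) y * em m = em m * P.qbr (ep j) y"
    proof -
      have "ep j * y * em m = em m * (ep j * y)" "y * ep j * em m = em m * (y * ep j)"
        using yem[OF mm(1)] e1 by (metis mult.assoc)+
      then show ?thesis by (simp add: P.qbr_def left_diff_distrib right_diff_distrib)
    qed
    have B: "ep m * P.qbr (em j) y' = P.qbr (em j) y' * ep m"
    proof -
      have "em j * y' * ep m = ep m * (em j * y')" "y' * em j * ep m = ep m * (y' * em j)"
        using epy[OF mm(1)] e1 by (metis mult.assoc)+
      then show ?thesis by (simp add: P.qbr_def left_diff_distrib right_diff_distrib)
    qed
    have C: "l * kt j * ep m = q powi (- int (ends lo' hi' m)) \<cdot> (ep m * (l * kt j))"
    proof -
      have "l * kt j * ep m = q powi (- int (nat (- cartan n m j))) \<cdot> (l * ep m * kt j)"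
        by (simp add: 1 mult.assoc)
      also have "\<dots> = q powi (- int (nat (- cartan n m j)) + - int (ends lo hi m)) \<cdot> (ep m * (l * kt j))"
        unfolding lep[OF mm(1)] by (simp add: P.powi_merge mult.assoc)
      finally show ?thesis unfolding ends by (simp add: algebra_simps)
    qed
    have D: "l * kt j * em m = q powi int (ends lo' hi' m) \<cdot> (em m * (l * kt j))"
    proof -
      have "l * kt j * em m = q powi int (nat (- cartan n m j)) \<cdot> (l * em m * kt j)"
        by (simp only: 2 mult.assoc P.scl_mult_right)
      also have "\<dots> = q powi (int (nat (- cartan n m j)) + int (ends lo hi m)) \<cdot> (em m * (l * kt j))"
        unfolding lem[OF mm(1)] by (simp only: P.scl_mult_left P.V.scale_scale P.powi_merge mult.assoc)
      finally show ?thesis unfolding ends by (simp only: of_nat_add add.commute)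
    qed
    show ?thesis using A B C D by blast
  qed
  show ?thesis
    unfolding path_pair_def using vec inv ktn pr c1 rest by blast
qed

lemma path_pair_0: "path_pair 1 n 1 (ep 0) (em 0) (kt 0) (kti 0)"
proof -
  have rest: "ep 0 * em m = em m * ep 0 \<and> ep m * em 0 = em 0 * ep m \<and>
      kt 0 * ep m = q powi (- int (ends 1 n m)) \<cdot> (ep m * kt 0) \<and>
      kt 0 * em m = q powi int (ends 1 n m) \<cdot> (em m * kt 0)" if m: "m \<in> {1..n}" for m
  proof -
    have c: "cartan n 0 m = - int (ends 1 n m)"
      using cartan_0_right[of m n] cartan_sym[of n m 0] m by (auto simp: ends_def)
    have "kti 0 * em m = q powi (- int (ends 1 n m)) \<cdot> (em m * kti 0)"
      using M.kt_ev[of 0 m] m c by simp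
    from P.inv_comm[OF P.kt_kti(2,1)[of 0] this]
    have "kt 0 * em m = q powi int (ends 1 n m) \<cdot> (em m * kt 0)"
      by (simp add: power_int_minus)
    then show ?thesis
      using ep_em[of 0 m] ep_em[of m 0] P.kt_ev[of 0 m] m c by simp
  qed
  have "kt 0 * prod_list (map kt [1..<Suc n]) = 1"
    using kt_prod by (simp add: upt_conv_Cons del: upt_Suc)
  moreover have "ep 0 * em 0 - em 0 * ep 0 = (1 * (1 / (q - P.p))) \<cdot> (kt 0 - kti 0)"
    using ep_em[of 0 0] by simp
  ultimately show ?thesis
    unfolding path_pair_def using P.path_vector_0 M.path_vector_0 P.kt_kti[of 0] kt_comm[of _ 0] rest
    by auto
qed

definition fold_ep :: "nat list \<Rightarrow> 'a" where
  "fold_ep js = foldl (\<lambda>y j. P.qbr (ep j) y) (ep 0) js"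

definition fold_em :: "nat list \<Rightarrow> 'a" where
  "fold_em js = foldl (\<lambda>y j. P.qbr (em j) y) (em 0) js"

text \<open>The walk along \<open>node_path n i\<close> removes the nodes different from \<open>0\<close> and \<open>i\<close> first from the lower and then from the
  upper end of the interval, until only \<open>i\<close> is left.\<close>

lemma path_pair_fold:
  assumes S: "integral_form sc q S" "\<And>j t. j \<le> n \<Longrightarrow> P.dp (ep j) t \<in> S" "\<And>j t. j \<le> n \<Longrightarrow> P.dp (em j) t \<in> S"
    and i: "1 \<le> i" "i \<le> n"
  shows "\<exists>l li. path_pair i i ((- q) ^ (n - 1)) (fold_ep (node_path n i)) (fold_em (node_path n i)) l li \<and>
     (\<forall>t. P.dp (fold_ep (node_path n i)) t \<in> S \<and> P.dp (fold_em (node_path n i)) t \<in> S)"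
proof -
  let ?P = "\<lambda>lo hi r js. \<exists>l li. path_pair lo hi ((- q) ^ r) (fold_ep js) (fold_em js) l li \<and>
     (\<forall>t. P.dp (fold_ep js) t \<in> S \<and> P.dp (fold_em js) t \<in> S)"
  have step: "?P (if j = lo then Suc lo else lo) (if j = lo then hi else hi - 1) (Suc r) (js @ [j])"
    if IH: "?P lo hi r js" and lh: "1 \<le> lo" "lo < hi" "hi \<le> n" "j \<in> {lo, hi}" for lo hi r js j
  proof -
    from IH obtain l li where pp: "path_pair lo hi ((- q) ^ r) (fold_ep js) (fold_em js) l li"
      and dp: "\<And>t. P.dp (fold_ep js) t \<in> S" "\<And>t. P.dp (fold_em js) t \<in> S" by blast
    have vec: "P.path_vector lo hi (fold_ep js)" "M.path_vector lo hi (fold_em js)"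
      using pp unfolding path_pair_def by blast+
    have j: "j \<le> n" using lh by auto
    have e: "fold_ep (js @ [j]) = P.qbr (ep j) (fold_ep js)" "fold_em (js @ [j]) = P.qbr (em j) (fold_em js)"
      by (simp_all add: fold_ep_def fold_em_def)
    have "P.dp (fold_ep (js @ [j])) t \<in> S \<and> P.dp (fold_em (js @ [j])) t \<in> S" for t
      unfolding e using P.path_vector_dp[OF vec(1) lh S(1) S(2)[OF j] dp(1)]
        M.path_vector_dp[OF vec(2) lh S(1) S(3)[OF j] dp(2)] by blast
    then show ?thesis
      unfolding e power_Suc using path_pair_step[OF pp lh refl refl] by blast
  qed
  have low: "?P (Suc r) n r [1..<Suc r]" if "r < n" for r
    using that
  proof (induct r)
    case 0
    then show ?case using path_pair_0 S(2,3)[of 0] by (auto simp: fold_ep_def fold_em_def)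
  next
    case (Suc r)
    then show ?case using step[of "Suc r" n r "[1..<Suc r]" "Suc r"] by simp
  qed
  have high: "?P i (n - d) (i - 1 + d) ([1..<i] @ rev [Suc (n - d)..<Suc n])" if "d \<le> n - i" for d
    using that
  proof (induct d)
    case 0
    then show ?case using low[of "i - 1"] i by simp
  next
    case (Suc d)
    then have "Suc (n - Suc d) = n - d" "i < n - d" by auto
    moreover have "rev [n - d..<Suc n] = rev [Suc (n - d)..<Suc n] @ [n - d]"
      using Suc(2) by (subst upt_conv_Cons) auto
    ultimately show ?case
      using step[of i "n - d" "i - 1 + d" "[1..<i] @ rev [Suc (n - d)..<Suc n]" "n - d"] Suc i
      by (simp del: upt_Suc)
  qed
  have "i - 1 + (n - i) = n - 1" using i by simp
  then show ?thesis using high[of "n - i"] i by (simp add: node_path_def del: upt_Suc)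
qed

end

section \<open>Loop generators of rank one\<close>

definition cm :: "'a::ring \<Rightarrow> 'a \<Rightarrow> 'a" where
  "cm a b = a * b - b * a"

lemma cm_simps:
  "cm a (x + y) = cm a x + cm a y" "cm a (x - y) = cm a x - cm a y" "cm a (- x) = - cm a x"
  "cm a (x * y) = cm a x * y + x * cm a y" "cm (x * y) a = cm x a * y + x * cm y a"
  "cm (x + y) a = cm x a + cm y a" "cm (x - y) a = cm x a - cm y a" "cm (- x) a = - cm x a"
  "cm a 0 = 0" "cm 0 a = 0" "cm a a = 0"
  by (simp_all add: cm_def algebra_simps)

lemma cm_swap: "cm a b = - cm b a"
  by (simp add: cm_def)

lemma cm_cm: "cm a (cm b x) = cm (cm a b) x + cm b (cm a x)"
  by (simp add: cm_def algebra_simps)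

lemma cm_eq_0: "cm a b = 0 \<longleftrightarrow> a * b = b * a"
  by (simp add: cm_def)

lemma int_constant:
  fixes f :: "int \<Rightarrow> 'b"
  assumes "\<And>r. f (r + 1) = f r" shows "f r = f 0"
proof (induct r rule: int_induct[of _ 0])
  case (step2 i)
  then show ?case using assms[of "i - 1"] by simp
qed (use assms in simp_all)

context central_scalars
begin

lemma cm_scl [simp]: "cm a (c \<cdot> x) = c \<cdot> cm a x" "cm (c \<cdot> a) x = c \<cdot> cm a x"
  by (simp_all add: cm_def V.scale_right_diff_distrib)

end

text \<open>Two families of vectors of weight \<open>2\<close> and \<open>- 2\<close>, indexed by the integers.  The elements \<open>phi1\<close>, \<open>phim1\<close> and
  \<open>kap\<close> are the commutators of total degree \<open>1\<close>, \<open>-1\<close> and \<open>0\<close> divided by their torus parts.\<close>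

locale loop_base = quantum sc q
  for sc :: "'k::field_char_0 \<Rightarrow> 'a::ring_1" and q :: 'k +
  fixes k ki :: 'a and xp xm :: "int \<Rightarrow> 'a"
  assumes k_ki [simp]: "k * ki = 1" and ki_k [simp]: "ki * k = 1"
    and k_xp: "k * xp r = (q * q) \<cdot> (xp r * k)"
    and k_xm: "k * xm r = (p * p) \<cdot> (xm r * k)"
begin

lemma k_ki' [simp]: "k * (ki * x) = x" "ki * (k * x) = x"
  by (simp_all add: mult.assoc[symmetric])

lemma ki_xp: "ki * xp r = (p * p) \<cdot> (xp r * ki)" and ki_xm: "ki * xm r = (q * q) \<cdot> (xm r * ki)"
  using inv_comm[OF k_ki ki_k k_xp] inv_comm[OF k_ki ki_k k_xm] by simp_all

lemma xp_k: "xp r * k = (p * p) \<cdot> (k * xp r)" and xm_k: "xm r * k = (q * q) \<cdot> (k * xm r)"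
  by (simp_all add: k_xp k_xm mult.assoc)

lemma xp_k': "xp r * (k * z) = (p * p) \<cdot> (k * (xp r * z))" and xm_k': "xm r * (k * z) = (q * q) \<cdot> (k * (xm r * z))"
  using arg_cong[OF xp_k, of "\<lambda>u. u * z"] arg_cong[OF xm_k, of "\<lambda>u. u * z"] by (simp_all add: mult.assoc)

definition Br :: "int \<Rightarrow> int \<Rightarrow> 'a" where "Br r s = cm (xp r) (xm s)"

definition "phi1 = ki * Br 0 1"
definition "phim1 = k * Br (- 1) 0"
definition "kap = (1 / (q - p)) \<cdot> (k - ki)"

lemma k_Br: "cm k (Br r s) = 0"
proof -
  have "k * (xp r * z) = (q * q) \<cdot> (xp r * (k * z))" "k * (xm s * z) = (p * p) \<cdot> (xm s * (k * z))" for z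
    using arg_cong[OF k_xp, of "\<lambda>u. u * z"] arg_cong[OF k_xm, of "\<lambda>u. u * z"] by (simp_all add: mult.assoc)
  note rules = this k_xp k_xm
  have 1: "k * (xp r * xm s) = xp r * xm s * k" and 2: "k * (xm s * xp r) = xm s * xp r * k"
    by (simp_all add: rules mult.assoc)
  show ?thesis
    by (simp add: Br_def cm_def right_diff_distrib left_diff_distrib 1 2)
qed

lemma ki_Br: "cm ki (Br r s) = 0"
  using k_Br[of r s] inv_comm_1[OF k_ki ki_k] by (simp add: cm_eq_0)

lemma k_ki_cm: "cm k ki = 0" "cm ki k = 0"
  by (simp_all add: cm_def)

lemma k_phi1: "cm k phi1 = 0" "cm ki phi1 = 0" and k_phim1: "cm k phim1 = 0" "cm ki phim1 = 0"
  by (simp_all add: phi1_def phim1_def cm_simps k_Br ki_Br k_ki_cm)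

text \<open>Commuting the relation for consecutive raising vectors with a lowering vector yields the
  action of the Cartan part.\<close>

lemma H_xp:
  assumes "xp (r + 1) * xp r = (q * q) \<cdot> (xp r * xp (r + 1))" "Br (r + 1) t = k * a" "Br r t = k * b"
  shows "cm a (xp r) = (q * q) \<cdot> (b * xp (r + 1)) - (p * p) \<cdot> (xp (r + 1) * b)"
proof -
  have "cm (xp (r + 1) * xp r) (xm t) = (q * q) \<cdot> cm (xp r * xp (r + 1)) (xm t)"
    by (simp add: assms(1))
  then have "xp (r + 1) * (k * b) + k * a * xp r = (q * q) \<cdot> (xp r * (k * a) + k * b * xp (r + 1))"
    using assms(2,3) unfolding Br_def by (simp add: cm_simps add.commute)
  then have "ki * (xp (r + 1) * (k * b) + k * a * xp r) = ki * ((q * q) \<cdot> (xp r * (k * a) + k * b * xp (r + 1)))"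
    by simp
  then show ?thesis
    by (simp add: cm_def algebra_simps scl_simps xp_k xp_k')
qed

lemma H_xm:
  assumes "xm s * xm (s + 1) = (q * q) \<cdot> (xm (s + 1) * xm s)" "Br t (s + 1) = k * a" "Br t s = k * b"
  shows "cm a (xm s) = (p * p) \<cdot> (b * xm (s + 1)) - (q * q) \<cdot> (xm (s + 1) * b)"
proof -
  have "cm (xp t) (xm s * xm (s + 1)) = (q * q) \<cdot> cm (xp t) (xm (s + 1) * xm s)"
    by (simp add: assms(1))
  then have "k * b * xm (s + 1) + xm s * (k * a) = (q * q) \<cdot> (k * a * xm s + xm (s + 1) * (k * b))"
    using assms(2,3) unfolding Br_def by (simp add: cm_simps)
  then have "(p * p) \<cdot> (ki * (k * b * xm (s + 1) + xm s * (k * a))) = (p * p) \<cdot> (ki * ((q * q) \<cdot> (k * a * xm s + xm (s + 1) * (k * b))))"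
    by simp
  then show ?thesis
    by (simp add: cm_def algebra_simps scl_simps xm_k xm_k')
qed

end

text \<open>The elements \<open>phi1\<close> and \<open>phim1\<close> shift the two families up and down.\<close>

locale loop_shift = loop_base +
  assumes phi1_xp: "cm phi1 (xp r) = (q + p) \<cdot> xp (r + 1)"
    and phi1_xm: "cm phi1 (xm r) = - ((q + p) \<cdot> xm (r + 1))"
    and phim1_xp: "cm phim1 (xp r) = (q + p) \<cdot> xp (r - 1)"
    and phim1_xm: "cm phim1 (xm r) = - ((q + p) \<cdot> xm (r - 1))"
    and Br_0_0: "Br 0 0 = kap" and Br_m1_1: "Br (- 1) 1 = kap"
begin

lemma phi1_Br: "cm phi1 (Br r s) = (q + p) \<cdot> (Br (r + 1) s - Br r (s + 1))"
  unfolding Br_def cm_cm[of phi1] phi1_xp phi1_xm by (simp add: cm_simps scl_simps)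

lemma phim1_Br: "cm phim1 (Br r s) = (q + p) \<cdot> (Br (r - 1) s - Br r (s - 1))"
  unfolding Br_def cm_cm[of phim1] phim1_xp phim1_xm by (simp add: cm_simps scl_simps)

lemma phi1_kap: "cm phi1 kap = 0" and phim1_kap: "cm phim1 kap = 0"
  using k_phi1 k_phim1 by (simp_all add: kap_def cm_simps cm_swap[of _ k] cm_swap[of _ ki])

lemma Br_0_1: "Br 0 1 = k * phi1" and Br_m1_0: "Br (- 1) 0 = ki * phim1"
  by (simp_all add: phi1_def phim1_def)

lemma phi1_phim1: "cm phi1 phim1 = 0"
proof -
  have "cm phi1 phim1 = k * cm phi1 (Br (- 1) 0)"
    unfolding phim1_def by (simp add: cm_simps cm_swap[of phi1 k] k_phi1)
  then show ?thesis by (simp add: phi1_Br Br_0_0 Br_m1_1)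
qed

lemma phim1_phi1: "cm phim1 phi1 = 0"
  using phi1_phim1 cm_swap[of phim1 phi1] by simp

lemma phi1_k_phi1: "cm phi1 (k * phi1) = 0" "cm phim1 (k * phi1) = 0" "cm phi1 (ki * phim1) = 0"
  using k_phi1 k_phim1 phim1_phi1 phi1_phim1
  by (simp_all add: cm_simps cm_swap[of _ k] cm_swap[of _ ki])

lemma Br_level: "Br r (- r) = kap" and Br_level_1: "Br r (1 - r) = k * phi1"
proof -
  have "Br r (- r) = kap \<and> Br r (1 - r) = k * phi1"
  proof (induct r rule: int_induct[of _ 0])
    case base
    show ?case by (simp add: Br_0_0 Br_0_1)
  next
    case (step1 r)
    have "Br (r + 1) (- r) = Br r (1 - r)"
      using phi1_Br[of r "- r"] step1 phi1_kap by (simp add: add.commute)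
    then have 1: "Br (r + 1) (1 - (r + 1)) = k * phi1" using step1 by simp
    have "Br r (- r) = Br (r + 1) (- (r + 1))"
      using phim1_Br[of "r + 1" "1 - (r + 1)"] 1 phi1_k_phi1 by simp
    then show ?case using 1 step1 by simp
  next
    case (step2 r)
    have "Br (r - 1) (1 - r) = Br r (- r)"
      using phim1_Br[of r "1 - r"] step2 phi1_k_phi1 by simp
    then have 1: "Br (r - 1) (- (r - 1)) = kap" using step2 by simp
    have e: "1 - (r - 1) = - (r - 1) + 1" by simp
    have "Br r (1 - r) = Br (r - 1) (1 - (r - 1))"
      using phi1_Br[of "r - 1" "- (r - 1)"] 1 phi1_kap unfolding e by simp
    then show ?case using 1 step2 by simp
  qed
  then show "Br r (- r) = kap" "Br r (1 - r) = k * phi1" by blast+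
qed

lemma Br_level_m1: "Br r (- 1 - r) = ki * phim1"
proof -
  have "Br (r + 1) (- 1 - (r + 1)) = Br r (- 1 - r)" for r
  proof -
    have e: "- 1 - (r + 1) = - (r + 1) - 1" "- 1 - r = - (r + 1)" by simp_all
    show ?thesis
      using phim1_Br[of "r + 1" "- (r + 1)"] unfolding e Br_level phim1_kap by simp
  qed
  from int_constant[of "\<lambda>r. Br r (- 1 - r)", OF this]
  have "Br r (- 1 - r) = Br 0 (- 1)" by simp
  moreover have "Br (- 1) 0 = Br 0 (- 1)"
    using phim1_Br[of 0 0] Br_0_0 phim1_kap by simp
  ultimately show ?thesis by (simp add: Br_m1_0)
qed

definition "phi2 = ki * Br 0 2"

lemma Br_level_2: "Br r (2 - r) = k * phi2"
proof -
  have "Br (r + 1) (2 - (r + 1)) = Br r (2 - r)" for r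
  proof -
    have e: "2 - (r + 1) = 1 - r" "2 - r = 1 - r + 1" by simp_all
    show ?thesis
      using phi1_Br[of r "1 - r"] unfolding e Br_level_1 phi1_k_phi1 by simp
  qed
  from int_constant[of "\<lambda>r. Br r (2 - r)", OF this]
  show ?thesis by (simp add: phi2_def)
qed

end


text \<open>Only the quadratic relations near degree \<open>0\<close> are assumed: they are the ones that Serre relations
  give directly.  All others follow, see \<open>Qp\<close> and \<open>Qm\<close>.\<close>

locale loop_serre = loop_shift +
  assumes Qp_base: "r \<in> {- 2, - 1, 0} \<Longrightarrow> xp (r + 1) * xp r = (q * q) \<cdot> (xp r * xp (r + 1))"
    and Qm_base: "r \<in> {- 1, 0, 1} \<Longrightarrow> xm r * xm (r + 1) = (q * q) \<cdot> (xm (r + 1) * xm r)"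
begin

text \<open>The commutator of \<open>phi2\<close> with \<open>Br 0 1\<close> is evaluated directly, as \<open>Br 0 1\<close> is a torus multiple of \<open>phi1\<close>, and by
  the Jacobi identity.  The results are different multiples of the commutator in question.\<close>

lemma phi1_phi2: "cm phi1 phi2 = 0"
proof -
  have swap: "phi1 * xp r = xp r * phi1 + (q + p) \<cdot> xp (r + 1)"
      "phi1 * xm r = xm r * phi1 - (q + p) \<cdot> xm (r + 1)" for r
    using phi1_xp[of r] phi1_xm[of r] by (simp_all add: cm_def algebra_simps)
  have A: "cm phi2 (xp 0) = (q * q - p * p) \<cdot> (xp 1 * phi1) + (q * q * (q + p)) \<cdot> xp 2"
    using H_xp[of 0 1 phi2 phi1] Qp_base[of 0] Br_level_2[of 1] Br_level_1[of 0]
    by (simp add: swap algebra_simps)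
  have B: "cm phi2 (xm 1) = (p * p - q * q) \<cdot> (xm 2 * phi1) - (p * p * (q + p)) \<cdot> xm 3"
    using H_xm[of 1 0 phi2 phi1] Qm_base[of 1] Br_level_2[of 0] Br_level_1[of 0]
    by (simp add: swap algebra_simps)
  define z where "z = cm phi1 phi2"
  define w where "w = (1 / (q + p)) \<cdot> (k * z)"
  have kz: "k * z = (q + p) \<cdot> w" by (simp add: w_def)
  have "cm phi1 (k * phi2) = (q + p) \<cdot> w"
    by (simp add: cm_simps cm_swap[of phi1 k] k_phi1 z_def[symmetric] kz)
  then have "(q + p) \<cdot> w = (q + p) \<cdot> (Br (r + 1) (2 - r) - Br r (3 - r))" for r
    using phi1_Br[of r "2 - r"] Br_level_2[of r] by simp
  then have wBr: "w = Br (r + 1) (2 - r) - Br r (3 - r)" for r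
    by simp
  have w1: "Br 2 1 = Br 1 2 + w" using wBr[of 1] by simp
  have w2: "Br 0 3 = Br 1 2 - w" using wBr[of 0] by simp
  have Br2: "Br 1 1 = Br 0 2"
    using Br_level_2[of 1] Br_level_2[of 0] by simp
  have "cm phi2 (Br 0 1) = cm (cm phi2 (xp 0)) (xm 1) + cm (xp 0) (cm phi2 (xm 1))"
    unfolding Br_def by (rule cm_cm)
  also have "\<dots> = (q * q - p * p) \<cdot> (Br 1 1 * phi1 + xp 1 * cm phi1 (xm 1)) + (q * q * (q + p)) \<cdot> Br 2 1
      + ((p * p - q * q) \<cdot> (Br 0 2 * phi1 - xm 2 * cm phi1 (xp 0)) - (p * p * (q + p)) \<cdot> Br 0 3)"
    unfolding A B Br_def by (simp add: cm_simps cm_swap[of "xp 0" phi1])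
  also have "\<dots> = (q * q - p * p) \<cdot> (- ((q + p) \<cdot> Br 1 2)) + (q * q * (q + p)) \<cdot> Br 2 1 - (p * p * (q + p)) \<cdot> Br 0 3"
    unfolding phi1_xp phi1_xm Br2 unfolding Br_def cm_def
    by (simp add: scl_simps scl_left algebra_simps)
  also have "\<dots> = ((q * q + p * p) * (q + p)) \<cdot> w"
    unfolding w1 w2 by (simp add: scl_simps scl_left algebra_simps)
  finally have RHS: "cm phi2 (Br 0 1) = ((q * q + p * p) * (q + p)) \<cdot> w" .
  have kphi2: "cm k phi2 = 0"
    by (simp add: phi2_def cm_simps k_Br k_ki_cm)
  have "cm phi2 (Br 0 1) = - (k * z)"
    unfolding Br_0_1 cm_simps cm_swap[of phi2] kphi2 z_def by simp
  with RHS have "((q * q + p * p) * (q + p)) \<cdot> w + (q + p) \<cdot> w = 0"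
    unfolding kz by (metis add.left_inverse)
  moreover have "((q + p) * (q * q + 1 + p * p)) \<cdot> w = ((q * q + p * p) * (q + p)) \<cdot> w + (q + p) \<cdot> w"
    unfolding scl_left(1)[symmetric] by (simp add: algebra_simps)
  ultimately have "((q + p) * (q * q + 1 + p * p)) \<cdot> w = 0" by simp
  then have "w = 0" by simp
  then have "k * z = 0" using kz by simp
  then have "z = 0" using k_ki'(2)[of z] by simp
  then show ?thesis by (simp add: z_def)
qed

lemma phim1_phi2: "cm phim1 phi2 = 0"
proof -
  have "cm phim1 (Br 0 2) = 0"
    using phim1_Br[of 0 2] Br_level_1[of "- 1"] Br_level_1[of 0] by simp
  then show ?thesis by (simp add: phi2_def cm_simps cm_swap[of phim1 ki] k_phim1)
qed

lemma phi2_xp: "cm phi2 (xp r) = (q * q) \<cdot> (phi1 * xp (r + 1)) - (p * p) \<cdot> (xp (r + 1) * phi1)"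
proof (induct r rule: int_induct[of _ 0])
  case base
  show ?case
    using H_xp[of 0 1 phi2 phi1] Qp_base[of 0] Br_level_2[of 1] Br_level_1[of 0] by simp
next
  case (step1 r)
  have "(q + p) \<cdot> cm phi2 (xp (r + 1)) = cm phi1 (cm phi2 (xp r))"
    unfolding cm_cm[of phi1] phi1_phi2 phi1_xp by (simp add: cm_simps)
  also have "\<dots> = (q + p) \<cdot> ((q * q) \<cdot> (phi1 * xp (r + 1 + 1)) - (p * p) \<cdot> (xp (r + 1 + 1) * phi1))"
    unfolding step1 by (simp add: cm_simps phi1_xp scl_simps mult.commute)
  finally show ?case by (rule scl_cancel) simp
next
  case (step2 r)
  have "(q + p) \<cdot> cm phi2 (xp (r - 1)) = cm phim1 (cm phi2 (xp r))"
    unfolding cm_cm[of phim1] phim1_phi2 phim1_xp by (simp add: cm_simps)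
  also have "\<dots> = (q + p) \<cdot> ((q * q) \<cdot> (phi1 * xp (r - 1 + 1)) - (p * p) \<cdot> (xp (r - 1 + 1) * phi1))"
    unfolding step2 by (simp add: cm_simps phim1_xp phim1_phi1 scl_simps mult.commute)
  finally show ?case by (rule scl_cancel) simp
qed

text \<open>Subtracting a multiple of the square of \<open>phi1\<close> turns \<open>phi2\<close> into an element \<open>th\<close> that shifts degrees by
  two.  With shifts by one alone the relations of one total degree would determine those of the next even degree
  only up to alternating signs.\<close>

definition "th = phi2 - ((q - p) / 2) \<cdot> (phi1 * phi1)"
definition "cth = (q + p) * (q * q + p * p) / 2"

lemma cth_nz: "cth \<noteq> 0"
proof -
  have "qn q 4 = (q + p) * (q * q + p * p)"
    using qn_add[of 2 2] by (simp add: qn_2 power_int_minus power2_eq_square algebra_simps)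
  then show ?thesis using qn_nz[of 4] by (simp add: cth_def)
qed

lemma th_xp: "cm th (xp r) = cth \<cdot> xp (r + 2)"
proof -
  have swap: "phi1 * xp s = xp s * phi1 + (q + p) \<cdot> xp (s + 1)" for s
    using phi1_xp[of s] by (simp add: cm_def algebra_simps)
  have A: "cm phi2 (xp r) = (q * q - p * p) \<cdot> (xp (r + 1) * phi1) + (q * q * (q + p)) \<cdot> xp (r + 2)"
    unfolding phi2_xp by (simp add: swap algebra_simps)
  have M: "cm (phi1 * phi1) (xp r) = ((q + p) + (q + p)) \<cdot> (xp (r + 1) * phi1) + ((q + p) * (q + p)) \<cdot> xp (r + 2)"
    unfolding cm_simps(5) phi1_xp scl_mult_left scl_mult_right swap V.scale_right_distrib V.scale_scale
      scl_left(1)[of "q + p" "q + p"] by (simp add: add.assoc)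
  have "(q - p) / 2 * ((q + p) + (q + p)) = (q - p) * (q + p)"
    unfolding distrib_left[of _ "q + p" "q + p"] times_divide_eq_left
    by (simp only: add_divide_distrib[symmetric] mult_2[symmetric]) simp
  then have c1: "(q - p) / 2 * ((q + p) + (q + p)) = q * q - p * p"
    by (simp add: algebra_simps)
  have "2 * (q * q * (q + p)) - (q - p) * ((q + p) * (q + p)) = (q + p) * (q * q + p * p)"
    by (simp add: algebra_simps)
  moreover have "q * q * (q + p) - (q - p) / 2 * ((q + p) * (q + p)) = (2 * (q * q * (q + p)) - (q - p) * ((q + p) * (q + p))) / 2"
    unfolding diff_divide_distrib[of "2 * _"] times_divide_eq_left by simp
  ultimately have c2: "cth = q * q * (q + p) - (q - p) / 2 * ((q + p) * (q + p))"
    by (simp add: cth_def)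
  show ?thesis
    unfolding th_def cm_simps(7) cm_scl A M V.scale_right_distrib V.scale_scale c1 c2 scl_left(2) by simp
qed

text \<open>The coefficients of the quadratic relation between two currents.  They are symmetric, and on the diagonal
  they are twice the defect of the relation between consecutive generators.\<close>

definition G :: "int \<Rightarrow> int \<Rightarrow> 'b" where
  "G r s = xp (r + 1) * xp s - (q * q) \<cdot> (xp s * xp (r + 1)) - (q * q) \<cdot> (xp r * xp (s + 1)) + xp (s + 1) * xp r"

lemma G_sym: "G r s = G s r"
  by (simp add: G_def)

lemma G_shift:
  "cm phi1 (G r s) = (q + p) \<cdot> (G (r + 1) s + G r (s + 1))"
  "cm phim1 (G r s) = (q + p) \<cdot> (G (r - 1) s + G r (s - 1))"
  "cm th (G r s) = cth \<cdot> (G (r + 2) s + G r (s + 2))"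
  by (simp_all add: G_def cm_simps phi1_xp phim1_xp th_xp scl_simps algebra_simps)

lemma G_neighbours:
  assumes "G r s = 0"
  shows "G (r + 1) s + G r (s + 1) = 0" "G (r - 1) s + G r (s - 1) = 0" "G (r + 2) s + G r (s + 2) = 0"
proof -
  note shift = G_shift[of r s, unfolded assms cm_simps(9), symmetric]
  show "G (r + 1) s + G r (s + 1) = 0" by (rule scl_eq_0[OF shift(1) qn_2_nz])
  show "G (r - 1) s + G r (s - 1) = 0" by (rule scl_eq_0[OF shift(2) qn_2_nz])
  show "G (r + 2) s + G r (s + 2) = 0" by (rule scl_eq_0[OF shift(3) cth_nz])
qed

lemma G_diagonals:
  assumes "G a a = 0"
  shows "G (a + int j) (a - int j) = 0 \<and> G (a + int j + 1) (a - int j) = 0"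
proof (induct j)
  case 0
  have "G (a + 1) a + G (a + 1) a = 0"
    using G_neighbours(1)[OF assms] unfolding G_sym[of a "a + 1"] .
  then have "G (a + 1) a = 0" by (rule twice_eq_0)
  then show ?case using assms by simp
next
  case (Suc j)
  have 1: "G (a + int j + 1) (a - int j - 1) = 0"
    using G_neighbours(2)[of "a + int j + 1" "a - int j"] Suc by simp
  have "G (a + int j + 1 + 1) (a - int j - 1) = 0"
    using G_neighbours(1)[OF 1] Suc by simp
  then show ?case using 1 by (simp add: algebra_simps)
qed

lemma G_level:
  assumes "G a a = 0" "r + s \<in> {2 * a, 2 * a + 1}"
  shows "G r s = 0"
proof -
  have *: "G r s = 0" if "r + s = 2 * a \<and> a \<le> r \<or> r + s = 2 * a + 1 \<and> a + 1 \<le> r" for r s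
    using that
  proof (elim disjE conjE)
    assume h: "r + s = 2 * a" "a \<le> r"
    then have "a + int (nat (r - a)) = r" "a - int (nat (r - a)) = s" by simp_all
    then show ?thesis using G_diagonals[OF assms(1), of "nat (r - a)"] by metis
  next
    assume h: "r + s = 2 * a + 1" "a + 1 \<le> r"
    then have "a + int (nat (r - a - 1)) + 1 = r" "a - int (nat (r - a - 1)) = s" by simp_all
    then show ?thesis using G_diagonals[OF assms(1), of "nat (r - a - 1)"] by metis
  qed
  consider "r + s = 2 * a \<and> a \<le> r \<or> r + s = 2 * a + 1 \<and> a + 1 \<le> r"
    | "s + r = 2 * a \<and> a \<le> s \<or> s + r = 2 * a + 1 \<and> a + 1 \<le> s"
    using assms(2) by fastforce
  then show ?thesis
  proof cases
    case 1
    then show ?thesis by (rule *)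
  next
    case 2
    then show ?thesis unfolding G_sym[of r s] by (rule *)
  qed
qed

text \<open>The three shifts applied to known zeros give \<open>x + y = 0\<close>, \<open>y + z = 0\<close> and \<open>x + z = 0\<close> for three neighbours,
  so all of them vanish.\<close>

lemma G_level_up: "r + s \<in> {2 * int m, 2 * int m + 1} \<Longrightarrow> G r s = 0"
proof (induct m arbitrary: r s)
  case 0
  have "G 0 0 = 0"
    using Qp_base[of 0] by (simp add: G_def)
  then show ?case by (rule G_level) (use 0 in simp)
next
  case (Suc m)
  have up: "G r s = 0" if h: "G (r - 2) s = 0" "G (r - 1) s = 0" "G (r - 2) (s + 1) = 0" for r s
  proof -
    define x y z where "x = G r s" and "y = G (r - 1) (s + 1)" and "z = G (r - 2) (s + 2)"
    have 1: "x + z = 0" using G_neighbours(3)[OF h(1)] by (simp add: x_def z_def)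
    have 2: "x + y = 0" using G_neighbours(1)[OF h(2)] by (simp add: x_def y_def)
    have 3: "y + z = 0" using G_neighbours(1)[OF h(3)] by (simp add: y_def z_def add.assoc)
    have "z = - x" "y = - x"
      using add.inverse_unique[OF 1] add.inverse_unique[OF 2] by metis+
    with 3 have "- (x + x) = 0" by (metis minus_add_distrib)
    then have "x + x = 0" by (metis neg_equal_0_iff_equal)
    then have "G r s + G r s = 0" by (simp only: x_def)
    then show ?thesis by (rule twice_eq_0)
  qed
  have even: "G r s = 0" if "r + s = 2 * int (Suc m)" for r s
    by (rule up; rule Suc(1); use that in simp)
  show ?case
  proof (cases "r + s = 2 * int (Suc m)")
    case False
    then have odd: "r + s = 2 * int m + 3" using Suc(2) by simp
    have "G (r - 2) s = 0" by (rule Suc(1)) (use odd in simp)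
    moreover have "G (r - 1) s = 0" "G (r - 2) (s + 1) = 0" by (rule even, use odd in simp)+
    ultimately show ?thesis by (rule up)
  qed (rule even)
qed

lemma Qp_up: "r \<ge> 0 \<Longrightarrow> xp (r + 1) * xp r = (q * q) \<cdot> (xp r * xp (r + 1))"
  using G_level_up[of r r "nat r"] twice_eq_0[of "xp (r + 1) * xp r - (q * q) \<cdot> (xp r * xp (r + 1))"]
  by (simp add: G_def algebra_simps)

text \<open>The axioms have symmetries.  This one reverses the degrees and the parameter and extends the
  quadratic relations to negative degrees.\<close>

lemma mirror_up: "loop_serre sc p ki k (\<lambda>r. xp (- r - 1)) (\<lambda>r. xm (1 - r))"
proof -
  interpret I: quantum sc p by (rule quantum_inverse)
  interpret B: loop_base sc p ki k "\<lambda>r. xp (- r - 1)" "\<lambda>r. xm (1 - r)"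
    by unfold_locales (simp_all add: ki_xp ki_xm)
  have [simp]: "B.Br r s = Br (- r - 1) (1 - s)" for r s
    by (simp add: B.Br_def Br_def)
  have [simp]: "B.phi1 = phim1" "B.phim1 = phi1" "B.kap = kap"
    by (simp_all add: B.phi1_def B.phim1_def phi1_def phim1_def B.kap_def kap_def scl_simps)
      (metis V.scale_minus_left divide_minus_right minus_diff_eq minus_divide_divide neg_equal_iff_equal V.scale_right_diff_distrib)
  show ?thesis
  proof unfold_locales
    fix r :: int
    show "cm B.phi1 (xp (- r - 1)) = (p + inverse p) \<cdot> xp (- (r + 1) - 1)"
      using phim1_xp[of "- r - 1"] by (simp add: algebra_simps)
    show "cm B.phi1 (xm (1 - r)) = - ((p + inverse p) \<cdot> xm (1 - (r + 1)))"
      using phim1_xm[of "1 - r"] by (simp add: algebra_simps)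
    show "cm B.phim1 (xp (- r - 1)) = (p + inverse p) \<cdot> xp (- (r - 1) - 1)"
      using phi1_xp[of "- r - 1"] by (simp add: algebra_simps)
    show "cm B.phim1 (xm (1 - r)) = - ((p + inverse p) \<cdot> xm (1 - (r - 1)))"
      using phi1_xm[of "1 - r"] by (simp add: algebra_simps)
    show "B.Br 0 0 = B.kap" "B.Br (- 1) 1 = B.kap"
      by (simp_all add: Br_0_0 Br_m1_1)
    show "xp (- (r + 1) - 1) * xp (- r - 1) = (p * p) \<cdot> (xp (- r - 1) * xp (- (r + 1) - 1))"
      if "r \<in> {- 2, - 1, 0}"
      using Qp_base[of "- r - 2"] that by (auto simp: mult.assoc)
    show "xm (1 - r) * xm (1 - (r + 1)) = (p * p) \<cdot> (xm (1 - (r + 1)) * xm (1 - r))"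
      if "r \<in> {- 1, 0, 1}"
      using Qm_base[of "- r"] that by (auto simp: mult.assoc)
  qed
qed

text \<open>This symmetry exchanges the two families, so that results on raising vectors apply to lowering
  vectors.\<close>

lemma mirror_swap: "loop_serre sc p k ki (\<lambda>r. xm (r + 1)) (\<lambda>r. xp (r - 1))"
proof -
  interpret I: quantum sc p by (rule quantum_inverse)
  interpret B: loop_base sc p k ki "\<lambda>r. xm (r + 1)" "\<lambda>r. xp (r - 1)"
    by unfold_locales (simp_all add: k_xp k_xm)
  have [simp]: "B.Br r s = - Br (s - 1) (r + 1)" for r s
    by (simp add: B.Br_def Br_def cm_def)
  have [simp]: "B.phi1 = - phi1" "B.phim1 = - phim1" "B.kap = - kap"
    by (simp_all add: B.phi1_def B.phim1_def phi1_def phim1_def B.kap_def kap_def)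
      (metis V.scale_minus_left divide_minus_right minus_diff_eq)
  show ?thesis
  proof unfold_locales
    fix r :: int
    show "cm B.phi1 (xm (r + 1)) = (p + inverse p) \<cdot> xm (r + 1 + 1)"
      by (simp add: cm_simps phi1_xp phi1_xm phim1_xp phim1_xm add.commute)
    show "cm B.phi1 (xp (r - 1)) = - ((p + inverse p) \<cdot> xp (r + 1 - 1))"
      by (simp add: cm_simps phi1_xp phi1_xm phim1_xp phim1_xm add.commute)
    show "cm B.phim1 (xm (r + 1)) = (p + inverse p) \<cdot> xm (r - 1 + 1)"
      by (simp add: cm_simps phi1_xp phi1_xm phim1_xp phim1_xm add.commute)
    show "cm B.phim1 (xp (r - 1)) = - ((p + inverse p) \<cdot> xp (r - 1 - 1))"
      by (simp add: cm_simps phi1_xp phi1_xm phim1_xp phim1_xm add.commute)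
    show "B.Br 0 0 = B.kap" "B.Br (- 1) 1 = B.kap"
      by (simp_all add: Br_0_0 Br_m1_1)
    show "xm (r + 1 + 1) * xm (r + 1) = (p * p) \<cdot> (xm (r + 1) * xm (r + 1 + 1))"
      if "r \<in> {- 2, - 1, 0}"
      using Qm_base[of "r + 1"] that by (auto simp: mult.assoc)
    show "xp (r - 1) * xp (r + 1 - 1) = (p * p) \<cdot> (xp (r + 1 - 1) * xp (r - 1))"
      if "r \<in> {- 1, 0, 1}"
      using Qp_base[of "r - 1"] that by (auto simp: mult.assoc)
  qed
qed

lemma Qp: "xp (r + 1) * xp r = (q * q) \<cdot> (xp r * xp (r + 1))"
proof -
  interpret N: loop_serre sc p ki k "\<lambda>r. xp (- r - 1)" "\<lambda>r. xm (1 - r)" by (rule mirror_up)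
  consider "r \<ge> 0" | "r = - 1" | "r \<le> - 2" by linarith
  then show ?thesis
  proof cases
    case 1
    then show ?thesis by (rule Qp_up)
  next
    case 2
    show ?thesis by (rule Qp_base) (simp add: 2)
  next
    case 3
    have e: "- (- r - 2) - 1 = r + 1" "- (- r - 2 + 1) - 1 = r" by simp_all
    from 3 show ?thesis using N.Qp_up[of "- r - 2"] unfolding e by (simp add: mult.assoc)
  qed
qed

lemma Qm: "xm r * xm (r + 1) = (q * q) \<cdot> (xm (r + 1) * xm r)"
proof -
  interpret N: loop_serre sc p k ki "\<lambda>r. xm (r + 1)" "\<lambda>r. xp (r - 1)" by (rule mirror_swap)
  show ?thesis using N.Qp[of "r - 1"] by (simp add: mult.assoc)
qed

end

section \<open>Generating functions\<close>

definition agree :: "nat \<Rightarrow> 'a::zero fps \<Rightarrow> 'a fps \<Rightarrow> bool" where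
  "agree m f g \<longleftrightarrow> (\<forall>n\<le>m. fps_nth f n = fps_nth g n)"

lemma agree_refl [simp]: "agree m f f"
  by (simp add: agree_def)

lemma agree_trans [trans]: "agree m f g \<Longrightarrow> agree m g h \<Longrightarrow> agree m f h"
  by (simp add: agree_def)

lemma agree_sym: "agree m f g \<Longrightarrow> agree m g f"
  by (simp add: agree_def)

lemma agree_mult:
  fixes f g h :: "'a::ring_1 fps"
  assumes "agree m f g" shows "agree m (h * f) (h * g)" "agree m (f * h) (g * h)"
proof -
  have "(\<Sum>i=0..n. fps_nth h i * fps_nth f (n - i)) = (\<Sum>i=0..n. fps_nth h i * fps_nth g (n - i))"
    "(\<Sum>i=0..n. fps_nth f i * fps_nth h (n - i)) = (\<Sum>i=0..n. fps_nth g i * fps_nth h (n - i))" if "n \<le> m" for n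
    using assms that by (auto simp: agree_def intro!: sum.cong)
  then show "agree m (h * f) (h * g)" "agree m (f * h) (g * h)"
    by (simp_all add: agree_def fps_mult_nth)
qed

lemma agree_add:
  fixes f g h k :: "'a::ring_1 fps"
  shows "agree m f g \<Longrightarrow> agree m h k \<Longrightarrow> agree m (f + h) (g + k)"
    and "agree m f g \<Longrightarrow> agree m h k \<Longrightarrow> agree m (f - h) (g - k)"
  by (simp_all add: agree_def)

lemma agree_all: "(\<And>m. agree m f g) \<Longrightarrow> f = g"
  by (auto simp: agree_def fps_eq_iff)

lemma X_comm: "fps_X * (f::'a::ring_1 fps) = f * fps_X"
  by (rule fps_mult_fps_X_commute)

lemma X_comm': "f * (fps_X * (g::'a::ring_1 fps)) = fps_X * (f * g)"
  by (metis X_comm mult.assoc)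

text \<open>Each application of the hypothesis produces a factor of the variable.\<close>

lemma agree_0_shift:
  fixes f :: "int \<Rightarrow> 'a::ring_1 fps"
  assumes "\<And>r. agree m (f r) (fps_const c * (fps_X * f (r + 1)))"
  shows "agree m (f r) 0"
proof -
  have "\<forall>r. n \<le> m \<longrightarrow> fps_nth (f r) n = 0" for n
  proof (induct n)
    case 0
    have "fps_nth (f r) 0 = fps_nth (fps_const c * (fps_X * f (r + 1))) 0" for r
      using assms[of r] unfolding agree_def by blast
    then show ?case by simp
  next
    case (Suc n)
    have "fps_nth (f r) (Suc n) = fps_nth (fps_const c * (fps_X * f (r + 1))) (Suc n)" if "Suc n \<le> m" for r
      using assms[of r] that unfolding agree_def by blast
    then show ?case using Suc by simp
  qed
  then show ?thesis by (simp add: agree_def)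
qed

context quantum
begin

definition fs :: "'k \<Rightarrow> 'a fps \<Rightarrow> 'a fps" (infixr "\<star>" 75) where
  "c \<star> f = fps_const (sc c) * f"

lemma fs_nth [simp]: "fps_nth (c \<star> f) n = c \<cdot> fps_nth f n"
  by (simp add: fs_def scl_def)

sublocale FV: vector_space fs
  by unfold_locales (simp_all add: fps_eq_iff algebra_simps)

lemma fs_mult_left [simp]: "(c \<star> f) * g = c \<star> (f * g)"
  by (simp add: fs_def mult.assoc)

lemma fs_mult_right [simp]: "f * (c \<star> g) = c \<star> (f * g)"
  by (auto simp: fps_eq_iff fps_mult_nth scl_sum_right intro!: sum.cong)

lemma fs_const: "c \<star> fps_const x = fps_const (c \<cdot> x)"
  by (simp add: fps_eq_iff)

lemma agree_fs: "agree m f g \<Longrightarrow> agree m (c \<star> f) (c \<star> g)"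
  by (simp add: agree_def)

definition dil :: "'k \<Rightarrow> 'a fps \<Rightarrow> 'a fps" where
  "dil c f = Abs_fps (\<lambda>n. c ^ n \<cdot> fps_nth f n)"

lemma dil_nth [simp]: "fps_nth (dil c f) n = c ^ n \<cdot> fps_nth f n"
  by (simp add: dil_def)

lemma dil_simps [simp]:
  "dil c (f + g) = dil c f + dil c g" "dil c (f - g) = dil c f - dil c g"
  "dil c (d \<star> f) = d \<star> dil c f" "dil c (fps_const x) = fps_const x" "dil c 1 = 1"
  "dil 1 f = f" "dil c (dil d f) = dil (c * d) f"
  by (auto simp: fps_eq_iff scl_simps mult.commute power_mult_distrib)

lemma dil_mult: "dil c (f * g) = dil c f * dil c g"
proof -
  have "c ^ n \<cdot> (\<Sum>i=0..n. fps_nth f i * fps_nth g (n - i)) =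
      (\<Sum>i=0..n. (c ^ i * c ^ (n - i)) \<cdot> (fps_nth f i * fps_nth g (n - i)))" for n
    by (auto simp: scl_sum_right simp flip: power_add intro!: sum.cong)
  then show ?thesis by (simp add: fps_eq_iff fps_mult_nth mult.commute)
qed

lemma dil_power: "dil c (f ^ n) = dil c f ^ n"
  by (induct n) (simp_all add: dil_mult)

lemma dil_agree: "agree m f g \<Longrightarrow> agree m (dil c f) (dil c g)"
  by (simp add: agree_def)

end

context loop_base
begin

definition phi :: "nat \<Rightarrow> 'a" where "phi m = ki * Br 0 (int m)"

lemma phi_1: "phi (Suc 0) = phi1"
  by (simp add: phi_def phi1_def)

lemma k_phi: "cm k (phi m) = 0" "cm ki (phi m) = 0"
  by (simp_all add: phi_def cm_simps k_Br ki_Br k_ki_cm)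

definition Psi :: "'a fps" where
  "Psi = Abs_fps (\<lambda>n. if n = 0 then 1 else (q - p) \<cdot> phi n)"

lemma Psi_nth: "fps_nth Psi 0 = 1" "n > 0 \<Longrightarrow> fps_nth Psi n = (q - p) \<cdot> phi n"
  by (simp_all add: Psi_def)

text \<open>The coefficients of the series that solves \<open>PP_equation\<close>; in a quantum loop algebra they are the
  coefficients of the series \<open>P\<^sub>i\<^sup>+(u)\<close>.\<close>

fun pc :: "nat \<Rightarrow> 'a" where
  "pc 0 = 1"
| "pc (Suc r) = - ((1 / qn q (int (Suc r))) \<cdot> (\<Sum>t\<le>r. q ^ (r - t) \<cdot> (phi (Suc t) * pc (r - t))))"

declare pc.simps(2) [simp del]

definition PP :: "'a fps" where "PP = Abs_fps pc"

lemma PP_nth [simp]: "fps_nth PP n = pc n"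
  by (simp add: PP_def)

lemma pc_Suc: "qn q (int (Suc r)) \<cdot> pc (Suc r) = - (\<Sum>t\<le>r. q ^ (r - t) \<cdot> (phi (Suc t) * pc (r - t)))"
  by (simp add: pc.simps(2))

lemma k_pc: "cm k (pc m) = 0"
proof (induct m rule: less_induct)
  case (less m)
  show ?case
  proof (cases m)
    case (Suc r)
    have "cm k (qn q (int (Suc r)) \<cdot> pc (Suc r)) = - (\<Sum>t\<le>r. cm k (q ^ (r - t) \<cdot> (phi (Suc t) * pc (r - t))))"
      unfolding pc_Suc cm_simps by (simp add: cm_def sum_distrib_left sum_distrib_right sum_subtractf)
    also have "\<dots> = 0"
      using less Suc by (simp add: cm_simps k_phi)
    finally show ?thesis using Suc qn_eq_0[of r] by simp
  qed (simp add: cm_def)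
qed

lemma PP_equation: "dil p PP = Psi * dil q PP"
proof (rule fps_ext)
  fix n
  show "fps_nth (dil p PP) n = fps_nth (Psi * dil q PP) n"
  proof (cases n)
    case 0
    then show ?thesis by (simp add: Psi_nth)
  next
    case (Suc r)
    have "fps_nth (Psi * dil q PP) n = q ^ n \<cdot> pc n + (\<Sum>i\<in>{Suc 0..n}. fps_nth Psi i * (q ^ (n - i) \<cdot> pc (n - i)))"
      unfolding fps_mult_nth by (simp add: sum.atLeast_Suc_atMost Psi_nth)
    also have "(\<Sum>i\<in>{Suc 0..n}. fps_nth Psi i * (q ^ (n - i) \<cdot> pc (n - i)))
        = (\<Sum>t\<le>r. fps_nth Psi (Suc t) * (q ^ (r - t) \<cdot> pc (r - t)))"
      unfolding Suc by (simp add: sum.atLeast_Suc_atMost_Suc_shift atMost_atLeast0 del: sum.cl_ivl_Suc)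
    also have "\<dots> = (q - p) \<cdot> (\<Sum>t\<le>r. q ^ (r - t) \<cdot> (phi (Suc t) * pc (r - t)))"
      by (auto simp: scl_sum_right Psi_nth mult.commute intro!: sum.cong)
    also have "\<dots> = - (((q - p) * qn q (int n)) \<cdot> pc n)"
      using pc_Suc[of r] unfolding Suc by (simp flip: V.scale_scale)
    also have "(q - p) * qn q (int n) = q ^ n - p ^ n"
      unfolding qn_mult by (simp add: power_int_minus power_inverse)
    finally show ?thesis by (simp add: scl_left)
  qed
qed

text \<open>Comparing coefficients of degree \<open>n > 0\<close> determines the \<open>n\<close>-th one, since \<open>q ^ n\<close> and \<open>p ^ n\<close> differ.\<close>

lemma PP_unique:
  assumes f: "agree m (dil p f) (Psi * dil q f)" and g: "agree m (dil p g) (Psi * dil q g)"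
    and 0: "fps_nth f 0 = fps_nth g 0"
  shows "agree m f g"
proof -
  have "n \<le> m \<longrightarrow> fps_nth (f - g) n = 0" for n
  proof (induct n rule: less_induct)
    case (less n)
    let ?h = "f - g"
    show ?case
    proof (cases "n = 0 \<or> n > m")
      case False
      then have n: "n > 0" "n \<le> m" by auto
      have "agree m (dil p ?h) (Psi * dil q ?h)"
        using agree_add(2)[OF f g] by (simp add: algebra_simps)
      then have "p ^ n \<cdot> fps_nth ?h n = fps_nth (Psi * dil q ?h) n"
        using n unfolding agree_def by (metis dil_nth)
      also have "\<dots> = q ^ n \<cdot> fps_nth ?h n + (\<Sum>i\<in>{Suc 0..n}. fps_nth Psi i * fps_nth (dil q ?h) (n - i))"
        unfolding fps_mult_nth by (subst sum.atLeast_Suc_atMost) (simp_all add: Psi_nth scl_simps)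
      also have "(\<Sum>i\<in>{Suc 0..n}. fps_nth Psi i * fps_nth (dil q ?h) (n - i)) = 0"
        using less n by (intro sum.neutral) (auto simp del: fps_sub_nth dil_simps)
      finally have "((q - p) * qn q (int n)) \<cdot> fps_nth ?h n = 0"
        unfolding qn_mult by (auto simp: power_int_minus power_inverse scl_left simp del: fps_sub_nth)
      then show ?thesis using qn_nz[of "int n"] n by (simp del: fps_sub_nth)
    qed (use 0 in auto)
  qed
  then show ?thesis by (simp add: agree_def)
qed

text \<open>Both sides solve the equation of \<open>PP\<close> and have the same constant term.\<close>

lemma PP_intertwine:
  assumes "agree m (Psi * dil q f) (dil p f * Psi)" "fps_nth f 0 = x"
  shows "agree m (PP * fps_const x) (f * PP)"
proof (rule PP_unique)
  show "agree m (dil p (PP * fps_const x)) (Psi * dil q (PP * fps_const x))"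
    by (simp add: dil_mult PP_equation mult.assoc)
  have "agree m (dil p f * Psi * dil q PP) (Psi * dil q f * dil q PP)"
    by (rule agree_mult(2)[OF agree_sym[OF assms(1)]])
  then show "agree m (dil p (f * PP)) (Psi * dil q (f * PP))"
    by (simp add: dil_mult PP_equation mult.assoc)
qed (use assms(2) in simp)

definition xi :: "int \<Rightarrow> 'a fps" where
  "xi r = fps_const (xp r) - (q + p) \<star> (fps_X * fps_const (xp (r + 1))) + fps_X * (fps_X * fps_const (xp (r + 2)))"

definition gs :: "(int \<Rightarrow> 'a) \<Rightarrow> int \<Rightarrow> 'k \<Rightarrow> 'a fps" where
  "gs x r c = Abs_fps (\<lambda>i. c ^ i \<cdot> x (r + int i))"

lemma gs_nth [simp]: "fps_nth (gs x r c) i = c ^ i \<cdot> x (r + int i)"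
  by (simp add: gs_def)

lemma gs_step: "gs x r c = fps_const (x r) + c \<star> (fps_X * gs x (r + 1) c)"
proof (rule fps_ext)
  fix n show "fps_nth (gs x r c) n = fps_nth (fps_const (x r) + c \<star> (fps_X * gs x (r + 1) c)) n"
    by (cases n) (simp_all add: algebra_simps)
qed

lemma dil_gs: "dil d (gs x r c) = gs x r (d * c)"
  by (simp add: fps_eq_iff power_mult_distrib)

text \<open>The hypothesis of the following lemmas is the action of \<open>Psi\<close> on the generators, up to degree \<open>m\<close>.\<close>

definition "Psi_acts m \<longleftrightarrow>
  (\<forall>r. agree m (Psi * (fps_const (xp r) - (q * q) \<star> (fps_X * fps_const (xp (r + 1)))))
               ((fps_const (xp r) - (p * p) \<star> (fps_X * fps_const (xp (r + 1)))) * Psi)) \<and>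
  (\<forall>r. agree m (Psi * (fps_const (xm r) - (p * p) \<star> (fps_X * fps_const (xm (r + 1)))))
               ((fps_const (xm r) - (q * q) \<star> (fps_X * fps_const (xm (r + 1)))) * Psi))"

lemma dil_X: "dil c (fps_X * f) = c \<star> (fps_X * dil c f)"
proof (rule fps_ext)
  fix n show "fps_nth (dil c (fps_X * f)) n = fps_nth (c \<star> (fps_X * dil c f)) n"
    by (cases n) simp_all
qed

text \<open>Moving a raising vector through \<open>PP\<close> produces a polynomial in the variable, whereas a lowering
  vector produces the infinite series \<open>yh\<close>: the two factors are inverse to each other.\<close>

lemma PP_xp:
  assumes "Psi_acts m" shows "agree m (PP * fps_const (xp r)) (xi r * PP)"
proof (rule PP_intertwine)
  define e where "e c r = fps_const (xp r) - c \<star> (fps_X * fps_const (xp (r + 1)))" for c r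
  have A: "agree m (Psi * e (q * q) r) (e (p * p) r * Psi)" for r
    using assms by (simp add: Psi_acts_def e_def)
  have 1: "dil q (xi r) = e (q * q) r - fps_X * e (q * q) (r + 1)"
    by (simp add: xi_def e_def dil_X algebra_simps)
  have 2: "dil p (xi r) = e (p * p) r - fps_X * e (p * p) (r + 1)"
    by (simp add: xi_def e_def dil_X algebra_simps)
  show "agree m (Psi * dil q (xi r)) (dil p (xi r) * Psi)"
    unfolding 1 2 right_diff_distrib left_diff_distrib X_comm' mult.assoc
    by (intro agree_add agree_mult A)
qed (simp add: xi_def)

lemma Psi_gs:
  assumes "Psi_acts m"
  shows "agree m (Psi * gs xm r (q * q)) (gs xm r (p * p) * Psi)"
    and "agree m (Psi * gs xm r 1) (((1 + q * q) \<star> gs xm r (p * p) - (q * q) \<star> gs xm r 1) * Psi)"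
proof -
  define y where "y r = fps_const (xm r)" for r
  define N where "N r = (q * q * (q * q)) \<star> y r + (1 - q * q * (q * q)) \<star> gs xm r (p * p)" for r
  note fs_X = fs_def[of "p * p", symmetric] fs_def[of "q * q", symmetric] fs_def[of 1, symmetric]
  have st: "gs xm r c = y r + c \<star> (fps_X * gs xm (r + 1) c)" for r c
    unfolding y_def by (rule gs_step)
  have H: "agree m (Psi * (y r - (p * p) \<star> (fps_X * y (r + 1)))) ((y r - (q * q) \<star> (fps_X * y (r + 1))) * Psi)" for r
    using assms by (simp add: Psi_acts_def y_def)
  have NN: "N r - (p * p) \<star> (fps_X * N (r + 1)) = y r - (q * q) \<star> (fps_X * y (r + 1))" for r
  proof -
    have "N r = y r + (p * p - q * q) \<star> (fps_X * gs xm (r + 1) (p * p))" for r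
      unfolding N_def st[of r] by (simp add: algebra_simps)
    moreover have "(p * p) \<star> (fps_X * N (r + 1)) = (q * q) \<star> (fps_X * y (r + 1)) + (p * p - q * q) \<star> (fps_X * gs xm (r + 1) (p * p))"
      unfolding N_def by (simp add: algebra_simps)
    ultimately show ?thesis by simp
  qed
  have E: "agree m (Psi * y r - N r * Psi) 0" for r
  proof (rule agree_0_shift[where f = "\<lambda>r. Psi * y r - N r * Psi"])
    fix r
    have "Psi * y r - N r * Psi = (p * p) \<star> (fps_X * (Psi * y (r + 1) - N (r + 1) * Psi))
      + (Psi * (y r - (p * p) \<star> (fps_X * y (r + 1))) - (N r - (p * p) \<star> (fps_X * N (r + 1))) * Psi)"
      by (simp add: algebra_simps X_comm')
    moreover have "agree m (Psi * (y r - (p * p) \<star> (fps_X * y (r + 1))) - (N r - (p * p) \<star> (fps_X * N (r + 1))) * Psi) 0"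
      unfolding NN using H[of r] by (simp add: agree_def)
    ultimately show "agree m (Psi * y r - N r * Psi) (fps_const (sc (p * p)) * (fps_X * (Psi * y (r + 1) - N (r + 1) * Psi)))"
      unfolding fs_X by (simp add: agree_def)
  qed
  have N: "N r = y r + (p * p - q * q) \<star> (fps_X * gs xm (r + 1) (p * p))" for r
    unfolding N_def st[of r] by (simp add: algebra_simps)
  have A: "agree m (Psi * gs xm r (q * q) - gs xm r (p * p) * Psi) 0"
  proof (rule agree_0_shift[where f = "\<lambda>r. Psi * gs xm r (q * q) - gs xm r (p * p) * Psi"])
    fix r
    have "Psi * gs xm r (q * q) - gs xm r (p * p) * Psi
      = (q * q) \<star> (fps_X * (Psi * gs xm (r + 1) (q * q) - gs xm (r + 1) (p * p) * Psi)) + (Psi * y r - N r * Psi)"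
      unfolding N st[of r] by (simp add: algebra_simps X_comm')
    then show "agree m (Psi * gs xm r (q * q) - gs xm r (p * p) * Psi)
       (fps_const (sc (q * q)) * (fps_X * (Psi * gs xm (r + 1) (q * q) - gs xm (r + 1) (p * p) * Psi)))"
      unfolding fs_X using E[of r] by (simp add: agree_def)
  qed
  have C: "agree m (Psi * gs xm r 1 - ((1 + q * q) \<star> gs xm r (p * p) - (q * q) \<star> gs xm r 1) * Psi) 0"
  proof (rule agree_0_shift[where f = "\<lambda>r. Psi * gs xm r 1 - ((1 + q * q) \<star> gs xm r (p * p) - (q * q) \<star> gs xm r 1) * Psi"])
    fix r
    have "Psi * gs xm r 1 - ((1 + q * q) \<star> gs xm r (p * p) - (q * q) \<star> gs xm r 1) * Psi
      = 1 \<star> (fps_X * (Psi * gs xm (r + 1) 1 - ((1 + q * q) \<star> gs xm (r + 1) (p * p) - (q * q) \<star> gs xm (r + 1) 1) * Psi)) + (Psi * y r - N r * Psi)"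
      unfolding N st[of r] by (simp add: algebra_simps X_comm')
    then show "agree m (Psi * gs xm r 1 - ((1 + q * q) \<star> gs xm r (p * p) - (q * q) \<star> gs xm r 1) * Psi)
       (fps_const (sc 1) * (fps_X * (Psi * gs xm (r + 1) 1 - ((1 + q * q) \<star> gs xm (r + 1) (p * p) - (q * q) \<star> gs xm (r + 1) 1) * Psi)))"
      unfolding fs_X using E[of r] by (simp add: agree_def)
  qed
  show "agree m (Psi * gs xm r (q * q)) (gs xm r (p * p) * Psi)"
    "agree m (Psi * gs xm r 1) (((1 + q * q) \<star> gs xm r (p * p) - (q * q) \<star> gs xm r 1) * Psi)"
    using A C by (simp_all add: agree_def)
qed

definition yh :: "int \<Rightarrow> 'a fps" where
  "yh r = Abs_fps (\<lambda>i. qn q (int i + 1) \<cdot> xm (r + int i))"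

lemma PP_xm:
  assumes "Psi_acts m" shows "agree m (PP * fps_const (xm r)) (yh r * PP)"
proof (rule PP_intertwine)
  have 1: "(q - p) \<star> dil q (yh r) = q \<star> gs xm r (q * q) - p \<star> gs xm r 1"
  proof (rule fps_ext)
    fix n
    have "(q - p) * (q ^ n * qn q (int n + 1)) = q ^ n * ((q - p) * qn q (int n + 1))" by (simp only: mult.left_commute)
    also have "\<dots> = q * (q * q) ^ n - p"
      unfolding qn_mult by (simp add: power_int_add power_int_minus power_int_diff power_mult_distrib algebra_simps)
    finally show "fps_nth ((q - p) \<star> dil q (yh r)) n = fps_nth (q \<star> gs xm r (q * q) - p \<star> gs xm r 1) n"
      by (simp add: yh_def scl_left)
  qed
  have 2: "(q - p) \<star> dil p (yh r) = q \<star> gs xm r 1 - p \<star> gs xm r (p * p)"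
  proof (rule fps_ext)
    fix n
    have "(q - p) * (p ^ n * qn q (int n + 1)) = p ^ n * ((q - p) * qn q (int n + 1))" by (simp only: mult.left_commute)
    also have "\<dots> = q - p * (p * p) ^ n"
      unfolding qn_mult by (simp add: power_int_add power_int_minus power_int_diff power_mult_distrib algebra_simps power_inverse divide_inverse)
    finally show "fps_nth ((q - p) \<star> dil p (yh r)) n = fps_nth (q \<star> gs xm r 1 - p \<star> gs xm r (p * p)) n"
      by (simp add: yh_def scl_left)
  qed
  have "agree m (q \<star> (Psi * gs xm r (q * q)) - p \<star> (Psi * gs xm r 1))
     (q \<star> (gs xm r (p * p) * Psi) - p \<star> (((1 + q * q) \<star> gs xm r (p * p) - (q * q) \<star> gs xm r 1) * Psi))"
    by (intro agree_add agree_fs Psi_gs assms)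
  also have "q \<star> (gs xm r (p * p) * Psi) - p \<star> (((1 + q * q) \<star> gs xm r (p * p) - (q * q) \<star> gs xm r 1) * Psi)
      = (q \<star> gs xm r 1 - p \<star> gs xm r (p * p)) * Psi"
    by (simp add: algebra_simps)
  finally have "agree m (Psi * ((q - p) \<star> dil q (yh r))) (((q - p) \<star> dil p (yh r)) * Psi)"
    unfolding 1 2 by (simp add: right_diff_distrib)
  then show "agree m (Psi * dil q (yh r)) (dil p (yh r) * Psi)"
    by (simp add: agree_def)
qed (simp add: yh_def)

end

context loop_serre
begin

definition const_level :: "nat \<Rightarrow> bool" where
  "const_level m \<longleftrightarrow> (\<forall>r. Br r (int m - r) = k * phi m)"

lemma const_level_1: "const_level 1"
  using Br_level_1 by (simp add: const_level_def phi_1)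

text \<open>The recursion \<open>H_xp\<close> between consecutive degrees is the coefficientwise form of the action of
  the generating function \<open>Psi\<close>.\<close>

lemma Psi_acts_levels:
  assumes "\<And>j. 1 \<le> j \<Longrightarrow> j \<le> m \<Longrightarrow> const_level j"
  shows "Psi_acts m"
proof -
  have L: "Br r t = k * phi j" if "1 \<le> j" "j \<le> m" "r + t = int j" for r t j
    using assms[OF that(1,2)] that(3) unfolding const_level_def by (metis add_diff_cancel_left')
  have X: "fps_nth (Psi * fps_const x) n = fps_nth Psi n * x" "fps_nth (fps_const x * Psi) n = x * fps_nth Psi n" for x n
    by simp_all
  have hp: "fps_nth Psi j * xp r - (q * q) \<cdot> (fps_nth Psi (j - 1) * xp (r + 1)) = xp r * fps_nth Psi j - (p * p) \<cdot> (xp (r + 1) * fps_nth Psi (j - 1))"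
    and hm: "fps_nth Psi j * xm r - (p * p) \<cdot> (fps_nth Psi (j - 1) * xm (r + 1)) = xm r * fps_nth Psi j - (q * q) \<cdot> (xm (r + 1) * fps_nth Psi (j - 1))"
    if j: "1 \<le> j" "j \<le> m" for j r
  proof -
    consider "j = 1" | i where "j = Suc i" "1 \<le> i" using j by (metis One_nat_def Suc_le_D le_SucE not_less_eq_eq)
    then have "fps_nth Psi j * xp r - (q * q) \<cdot> (fps_nth Psi (j - 1) * xp (r + 1)) = xp r * fps_nth Psi j - (p * p) \<cdot> (xp (r + 1) * fps_nth Psi (j - 1))
      \<and> fps_nth Psi j * xm r - (p * p) \<cdot> (fps_nth Psi (j - 1) * xm (r + 1)) = xm r * fps_nth Psi j - (q * q) \<cdot> (xm (r + 1) * fps_nth Psi (j - 1))"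
    proof cases
      case 1
      have c: "(q - p) * (q + p) = q * q - p * p" by (simp add: algebra_simps)
      have "(q - p) \<cdot> cm phi1 (xp r) = (q * q - p * p) \<cdot> xp (r + 1)" "(q - p) \<cdot> cm phi1 (xm r) = (p * p - q * q) \<cdot> xm (r + 1)"
        unfolding phi1_xp phi1_xm V.scale_minus_right V.scale_scale c by (simp_all add: scl_left)
      then show ?thesis using 1
        by (simp add: Psi_nth phi_1 cm_def algebra_simps)
    next
      case 2
      have a: "cm (phi j) (xp r) = (q * q) \<cdot> (phi i * xp (r + 1)) - (p * p) \<cdot> (xp (r + 1) * phi i)"
        using 2 j by (intro H_xp[OF Qp, where t = "int i - r"] L) auto
      have b: "cm (phi j) (xm r) = (p * p) \<cdot> (phi i * xm (r + 1)) - (q * q) \<cdot> (xm (r + 1) * phi i)"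
        using 2 j by (intro H_xm[OF Qm, where t = "int i - r"] L) auto
      have i: "j - 1 = i" "0 < j" "0 < i" using 2 by auto
      have "(q - p) \<cdot> cm (phi j) (xp r) = (q - p) \<cdot> ((q * q) \<cdot> (phi i * xp (r + 1)) - (p * p) \<cdot> (xp (r + 1) * phi i))"
        "(q - p) \<cdot> cm (phi j) (xm r) = (q - p) \<cdot> ((p * p) \<cdot> (phi i * xm (r + 1)) - (q * q) \<cdot> (xm (r + 1) * phi i))"
        unfolding a b by simp_all
      then show ?thesis unfolding i(1)
        by (simp add: Psi_nth i cm_def V.scale_right_diff_distrib mult.commute) (simp add: algebra_simps)
    qed
    then show "fps_nth Psi j * xp r - (q * q) \<cdot> (fps_nth Psi (j - 1) * xp (r + 1)) = xp r * fps_nth Psi j - (p * p) \<cdot> (xp (r + 1) * fps_nth Psi (j - 1))"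
      "fps_nth Psi j * xm r - (p * p) \<cdot> (fps_nth Psi (j - 1) * xm (r + 1)) = xm r * fps_nth Psi j - (q * q) \<cdot> (xm (r + 1) * fps_nth Psi (j - 1))"
      by blast+
  qed
  have "agree m (Psi * (fps_const (x r) - c \<star> (fps_X * fps_const (x (r + 1))))) ((fps_const (x r) - d \<star> (fps_X * fps_const (x (r + 1)))) * Psi)"
    if "\<And>j. 1 \<le> j \<Longrightarrow> j \<le> m \<Longrightarrow> fps_nth Psi j * x r - c \<cdot> (fps_nth Psi (j - 1) * x (r + 1)) = x r * fps_nth Psi j - d \<cdot> (x (r + 1) * fps_nth Psi (j - 1))"
    for x :: "int \<Rightarrow> 'b" and c d r
    unfolding agree_def
  proof (intro allI impI)
    fix n assume "n \<le> m"
    then show "fps_nth (Psi * (fps_const (x r) - c \<star> (fps_X * fps_const (x (r + 1))))) n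
      = fps_nth ((fps_const (x r) - d \<star> (fps_X * fps_const (x (r + 1)))) * Psi) n"
      using that[of n] by (cases n) (simp_all add: right_diff_distrib left_diff_distrib X_comm' mult.assoc Psi_nth)
  qed
  then show ?thesis
    unfolding Psi_acts_def using hp hm by blast
qed

lemma cartan_factor_nz:
  assumes "m \<ge> 2"
  shows "(q + p) - qn q (int m) * (2 * qn q (int m - 1) - (q + p) * qn q (int m)) \<noteq> 0"
proof -
  have d: "(q - p) * (qn q (int m + 1) - qn q (int m - 1)) = (q - p) * (q ^ m + p ^ m)"
    unfolding right_diff_distrib qn_mult
    by (simp add: power_int_add power_int_diff power_int_minus power_inverse algebra_simps divide_inverse)
  then have d: "qn q (int m + 1) - qn q (int m - 1) = q ^ m + p ^ m" by simp
  have "(q - p) * ((q + p) - qn q (int m) * (2 * qn q (int m - 1) - (q + p) * qn q (int m)))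
      = q * q - p * p + (q - p) * qn q (int m) * (qn q (int m + 1) - qn q (int m - 1))"
    unfolding qn_2_mult by (simp add: algebra_simps)
  also have "\<dots> = q * q - p * p + (q ^ m - p ^ m) * (q ^ m + p ^ m)"
    unfolding d qn_mult by (simp add: power_int_minus power_inverse)
  also have "\<dots> = (q * q ^ m - p * p ^ m) * (q ^ (m - 1) + p ^ (m - 1))"
  proof -
    obtain i where i: "m = Suc i" using assms by (cases m) auto
    have 1: "q ^ i * p ^ i = 1" by (simp flip: power_mult_distrib)
    then have 2: "q ^ i * (p ^ i * z) = z" for z by (simp flip: mult.assoc)
    show ?thesis unfolding i
      by (simp add: algebra_simps 1 2 mult.commute[of "p ^ i" "q ^ i"] mult.left_commute[of "p ^ i" "q ^ i"] del: power_inverse)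
  qed
  also have "\<dots> \<noteq> 0"
  proof -
    have pq: "p ^ j * q ^ j = 1" for j by (simp flip: power_mult_distrib)
    have "q * q ^ m \<noteq> p * p ^ m"
    proof
      assume "q * q ^ m = p * p ^ m"
      then have "q ^ Suc m * q ^ Suc m = 1" using pq[of "Suc m"] by simp
      then have "q ^ (Suc m + Suc m) = 1" by (simp only: power_add)
      then show False using q_generic[of "Suc m + Suc m"] by simp
    qed
    moreover have "q ^ (m - 1) + p ^ (m - 1) \<noteq> 0"
    proof
      assume "q ^ (m - 1) + p ^ (m - 1) = 0"
      then have "q ^ (m - 1) * q ^ (m - 1) = - 1"
        using pq[of "m - 1"] by (metis add.commute add_eq_0_iff minus_mult_left)
      then have "q ^ (m - 1 + (m - 1)) * q ^ (m - 1 + (m - 1)) = 1" by (simp add: power_add)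
      then have "q ^ (m - 1 + (m - 1) + (m - 1 + (m - 1))) = 1" by (simp only: power_add)
      then show False using q_generic[of "m - 1 + (m - 1) + (m - 1 + (m - 1))"] assms by simp
    qed
    ultimately show ?thesis by simp
  qed
  finally show ?thesis by auto
qed

text \<open>The series \<open>PP\<close> conjugates the bracket \<open>Br 0 1\<close> into \<open>cm (xi 0) (yh 1)\<close>.  In degree \<open>m\<close> this expresses the commutator of
  \<open>pc m\<close> with \<open>phi1\<close> by brackets of degree \<open>m + 1\<close>, which differ from each other by multiples of the unknown
  \<open>cm phi1 (phi m)\<close>; the recursion of \<open>pc\<close> gives a second expression.  Comparing them shows that the unknown is
  annihilated by the factor of \<open>cartan_factor_nz\<close>.\<close>

lemma phi1_phi_step:
  assumes m: "m \<ge> 2" and L: "\<And>j. 1 \<le> j \<Longrightarrow> j \<le> m \<Longrightarrow> const_level j"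
    and C: "\<And>j. 1 \<le> j \<Longrightarrow> j < m \<Longrightarrow> cm phi1 (phi j) = 0"
  shows "cm phi1 (phi m) = 0"
proof -
  have L': "Br r t = k * phi j" if "1 \<le> j" "j \<le> m" "r + t = int j" for r t j
    using L[OF that(1,2)] that(3) unfolding const_level_def by (metis add_diff_cancel_left')
  have acts: "Psi_acts m" by (rule Psi_acts_levels[OF L])
  define z where "z = k * cm phi1 (phi m)"
  define d where "d = (1 / (q + p)) \<cdot> z"
  have zd: "z = (q + p) \<cdot> d" by (simp add: d_def)
  have k1: "cm phi1 (k * x) = k * cm phi1 x" for x
    using k_phi1 by (simp add: cm_simps cm_swap[of phi1 k])
  have dBr: "Br (r + 1) t = Br r (t + 1) + d" if "r + t = int m" for r t
  proof -
    have "cm phi1 (Br r t) = z"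
      using L'[of m r t] that m k1 by (simp add: z_def)
    then have "(q + p) \<cdot> d = (q + p) \<cdot> (Br (r + 1) t - Br r (t + 1))"
      unfolding phi1_Br zd by simp
    then show ?thesis by simp
  qed
  have B1: "Br 1 (int m) = Br 0 (int m + 1) + d" using dBr[of 0 "int m"] by simp
  have B2: "Br 2 (int m - 1) = Br 0 (int m + 1) + d + d" using dBr[of 1 "int m - 1"] B1 by simp
  let ?C = "cm (xi 0) (yh 1)"
  have xi: "fps_nth (xi 0) i = (if i = 0 then xp 0 else if i = 1 then - ((q + p) \<cdot> xp 1) else if i = 2 then xp 2 else 0)" for i
    by (cases i; cases "i - 1"; cases "i - 2"; auto simp: xi_def)
  have C0: "fps_nth ?C 0 = Br 0 1"
    by (simp add: cm_def Br_def xi yh_def)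
  have Cn: "fps_nth ?C n = qn q (int n + 1) \<cdot> Br 0 (int n + 1) - ((q + p) * qn q (int n)) \<cdot> Br 1 (int n) + qn q (int n - 1) \<cdot> Br 2 (int n - 1)"
    if n: "n \<ge> 1" for n
  proof -
    have split: "(\<Sum>i=0..n. fps_nth (xi 0) i * g i) = xp 0 * g 0 - (q + p) \<cdot> (xp 1 * g 1) + (if n \<ge> 2 then xp 2 * g 2 else 0)" for g
    proof -
      have "(\<Sum>i=0..n. fps_nth (xi 0) i * g i) = (\<Sum>i\<in>{0, 1} \<union> (if n \<ge> 2 then {2} else {}). fps_nth (xi 0) i * g i)"
        using n by (intro sum.mono_neutral_right) (auto simp: xi split: if_splits)
      then show ?thesis by (auto simp: xi)
    qed
    have split': "(\<Sum>i=0..n. g i * fps_nth (xi 0) i) = g 0 * xp 0 - (q + p) \<cdot> (g 1 * xp 1) + (if n \<ge> 2 then g 2 * xp 2 else 0)" for g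
    proof -
      have "(\<Sum>i=0..n. g i * fps_nth (xi 0) i) = (\<Sum>i\<in>{0, 1} \<union> (if n \<ge> 2 then {2} else {}). g i * fps_nth (xi 0) i)"
        using n by (intro sum.mono_neutral_right) (auto simp: xi split: if_splits)
      then show ?thesis by (auto simp: xi)
    qed
    have rev: "(\<Sum>i=0..n. fps_nth (yh 1) i * fps_nth (xi 0) (n - i)) = (\<Sum>i=0..n. fps_nth (yh 1) (n - i) * fps_nth (xi 0) i)"
      by (subst sum.atLeastAtMost_rev) (auto intro!: sum.cong)
    have "fps_nth ?C n = qn q (int n + 1) \<cdot> Br 0 (int n + 1) - ((q + p) * qn q (int n)) \<cdot> Br 1 (int n)
       + (if n \<ge> 2 then qn q (int n - 1) \<cdot> Br 2 (int n - 1) else 0)"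
      unfolding cm_def fps_sub_nth fps_mult_nth rev split split' using n
      by (simp add: yh_def Br_def cm_def of_nat_diff scl_simps algebra_simps)
    moreover have "n = 1" if "\<not> n \<ge> 2" using n that by simp
    ultimately show ?thesis by auto
  qed
  have Cn0: "fps_nth ?C n = 0" if n: "1 \<le> n" "n < m" for n
  proof -
    have "fps_nth ?C n = (qn q (int n + 1) - (q + p) * qn q (int n) + qn q (int n - 1)) \<cdot> (k * phi (Suc n))"
      using n L'[of "Suc n" 0 "int n + 1"] L'[of "Suc n" 1 "int n"] L'[of "Suc n" 2 "int n - 1"]
      by (simp add: Cn scl_left)
    then show ?thesis unfolding qn_2_mult by simp
  qed
  have Cm: "fps_nth ?C m = (2 * qn q (int m - 1) - (q + p) * qn q (int m)) \<cdot> d"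
  proof -
    have "fps_nth ?C m = (qn q (int m + 1) - (q + p) * qn q (int m) + qn q (int m - 1)) \<cdot> Br 0 (int m + 1)
      + (qn q (int m - 1) \<cdot> d + qn q (int m - 1) \<cdot> d - ((q + p) * qn q (int m)) \<cdot> d)"
      using m by (simp add: Cn B1 B2 scl_simps scl_left)
    moreover have "qn q (int m + 1) - (q + p) * qn q (int m) + qn q (int m - 1) = 0"
      by (simp add: qn_2_mult)
    ultimately show ?thesis by (simp only: mult_2 scl_left V.scale_zero_left add_0_left)
  qed
  have "agree m (PP * fps_const (Br 0 1)) (?C * PP)"
  proof -
    have "agree m (PP * fps_const (xp 0) * fps_const (xm 1) - PP * fps_const (xm 1) * fps_const (xp 0))
       (xi 0 * PP * fps_const (xm 1) - yh 1 * PP * fps_const (xp 0))"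
      by (intro agree_add agree_mult PP_xp PP_xm acts)
    also have "agree m (xi 0 * PP * fps_const (xm 1) - yh 1 * PP * fps_const (xp 0)) (xi 0 * (yh 1 * PP) - yh 1 * (xi 0 * PP))"
      unfolding mult.assoc by (intro agree_add agree_mult PP_xp PP_xm acts)
    finally show ?thesis
      by (simp add: Br_def cm_def right_diff_distrib left_diff_distrib mult.assoc flip: fps_const_mult fps_const_sub)
  qed
  then have "fps_nth (PP * fps_const (Br 0 1)) m = fps_nth (?C * PP) m"
    unfolding agree_def by blast
  then have "pc m * Br 0 1 = (\<Sum>i=0..m. fps_nth ?C i * pc (m - i))"
    unfolding fps_mult_right_const_nth unfolding fps_mult_nth PP_nth .
  also have "\<dots> = (\<Sum>i\<in>{0, m}. fps_nth ?C i * pc (m - i))"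
    using Cn0 by (intro sum.mono_neutral_right) auto
  also have "\<dots> = Br 0 1 * pc m + fps_nth ?C m"
    using m C0 by simp
  finally have 1: "cm (pc m) (k * phi1) = (2 * qn q (int m - 1) - (q + p) * qn q (int m)) \<cdot> d"
    unfolding Cm by (simp add: cm_def Br_0_1)
  have pcm: "cm phi1 (pc j) = 0" if "j < m" for j
    using that
  proof (induct j rule: less_induct)
    case (less j)
    show ?case
    proof (cases j)
      case (Suc r)
      have "cm phi1 (qn q (int (Suc r)) \<cdot> pc (Suc r)) = - (\<Sum>t\<le>r. cm phi1 (q ^ (r - t) \<cdot> (phi (Suc t) * pc (r - t))))"
        unfolding pc_Suc cm_simps by (simp add: cm_def sum_distrib_left sum_distrib_right sum_subtractf)
      also have "\<dots> = 0"
        using less Suc by (simp add: cm_simps C)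
      finally show ?thesis using Suc qn_eq_0[of r] by simp
    qed (simp add: cm_def)
  qed
  obtain i where i: "m = Suc i" using m by (cases m) auto
  have "qn q (int m) \<cdot> cm phi1 (pc m) = - (\<Sum>t\<le>i. cm phi1 (q ^ (i - t) \<cdot> (phi (Suc t) * pc (i - t))))"
    unfolding i cm_scl(1)[symmetric] pc_Suc cm_simps by (simp add: cm_def sum_distrib_left sum_distrib_right sum_subtractf)
  also have "(\<Sum>t\<le>i. cm phi1 (q ^ (i - t) \<cdot> (phi (Suc t) * pc (i - t)))) = (\<Sum>t\<in>{i}. cm phi1 (phi m))"
    using i by (intro sum.mono_neutral_cong_right) (auto simp: cm_simps C pcm)
  finally have 2: "qn q (int m) \<cdot> cm phi1 (pc m) = - cm phi1 (phi m)" by simp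
  have "qn q (int m) \<cdot> cm (pc m) (k * phi1) = k * (- (qn q (int m) \<cdot> cm phi1 (pc m)))"
    using k_pc[of m] by (simp add: cm_simps cm_swap[of "pc m"])
  also have "\<dots> = (q + p) \<cdot> d"
    unfolding 2 zd[symmetric] z_def by simp
  finally have "((q + p) - qn q (int m) * (2 * qn q (int m - 1) - (q + p) * qn q (int m))) \<cdot> d = 0"
    unfolding 1 by (auto simp: scl_left(2)[of "q + p"])
  then have "d = 0" using cartan_factor_nz[OF m] by simp
  then have "z = 0" using zd by simp
  then show ?thesis using k_ki'(2)[of "cm phi1 (phi m)"] by (simp add: z_def)
qed

text \<open>That \<open>phi1\<close> commutes with \<open>phi i\<close> says that shifting both indices of a bracket of degree \<open>i + 1\<close> in
  opposite directions does not change it.  So the two claims are proved together.\<close>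

lemma levels: "m \<ge> 1 \<Longrightarrow> const_level m \<and> cm phi1 (phi m) = 0"
proof (induct m rule: less_induct)
  case (less m)
  show ?case
  proof (cases "m = 1")
    case True
    then show ?thesis using const_level_1 by (simp add: phi_1 cm_simps)
  next
    case False
    then obtain i where i: "m = Suc i" "1 \<le> i" using less(2) by (metis One_nat_def Suc_le_D le_SucE not_less_eq_eq)
    then have IH: "const_level i" "cm phi1 (phi i) = 0" using less(1)[of i] by auto
    have ki: "cm phi1 (k * phi i) = 0"
      using IH k_phi1 by (simp add: cm_simps cm_swap[of phi1 k])
    have "Br (r + 1) (int m - (r + 1)) = Br r (int m - r)" for r
    proof -
      have e: "int m - (r + 1) = int i - r" "int m - r = int i - r + 1" using i by simp_all
      have "Br r (int i - r) = k * phi i" using IH(1) by (simp add: const_level_def)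
      then show ?thesis using phi1_Br[of r "int i - r"] ki unfolding e by simp
    qed
    from int_constant[of "\<lambda>r. Br r (int m - r)", OF this]
    have Lm: "const_level m" by (simp add: const_level_def phi_def)
    have "cm phi1 (phi m) = 0"
    proof (rule phi1_phi_step)
      show "m \<ge> 2" using i by simp
      show "const_level j" if "1 \<le> j" "j \<le> m" for j using less(1)[of j] that Lm by (cases "j = m") auto
      show "cm phi1 (phi j) = 0" if "1 \<le> j" "j < m" for j using less(1)[of j] that by auto
    qed
    with Lm show ?thesis by blast
  qed
qed

lemma Br_phi: "m \<ge> 1 \<Longrightarrow> r + s = int m \<Longrightarrow> Br r s = k * phi m"
  using levels[of m] unfolding const_level_def by (metis add_diff_cancel_left')

lemma Psi_acts_all: "Psi_acts m"
  using levels by (intro Psi_acts_levels) blast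

end

section \<open>Powers of half currents\<close>

context loop_serre
begin

lemma G_0: "G r s = 0"
proof -
  have "G a a = 0" for a using Qp[of a] by (simp add: G_def)
  moreover have "r + s \<in> {2 * ((r + s) div 2), 2 * ((r + s) div 2) + 1}" by auto
  ultimately show ?thesis by (rule G_level)
qed

text \<open>All relations \<open>G_0\<close> of one total degree, added up with weights \<open>h\<close>.  With suitable weights this gives
  relations between products of half currents.\<close>

lemma quadratic_sum:
  assumes h0: "h 0 = 0" "h (Suc n) = 0" and sym: "\<And>i. i \<le> Suc n \<Longrightarrow> h (Suc n - i) = h i"
  shows "(\<Sum>i\<le>n. (h i - (q * q) * h (Suc i)) \<cdot> (xp (r + int i) * xp (r + int (n - i)))) = 0"
proof -
  define u where "u i = xp (r + int i) * xp (r + int (n - i))" for i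
  define w where "w i = xp (r + int (Suc i)) * xp (r + int (n - Suc i)) - (q * q) \<cdot> u i" for i
  have ww: "w i + w (n - Suc i) = 0" if "i < n" for i
  proof -
    have e: "r + int (n - Suc i) + 1 = r + int (n - i)" "n - (n - Suc i) = Suc i" "Suc (n - Suc i) = n - i"
      "n - (n - i) = i" "r + int i + 1 = r + int (Suc i)"
      using that by (auto simp: of_nat_diff)
    show ?thesis
      using G_0[of "r + int i" "r + int (n - Suc i)"] unfolding G_def w_def u_def e
      by (simp add: algebra_simps)
  qed
  have "(\<Sum>i\<le>n. (h i - (q * q) * h (Suc i)) \<cdot> u i) = (\<Sum>i\<le>n. h i \<cdot> u i) - (\<Sum>i\<le>n. h (Suc i) \<cdot> (q * q) \<cdot> u i)"
    by (simp add: scl_left sum_subtractf mult.commute)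
  also have "(\<Sum>i\<le>n. h i \<cdot> u i) = (\<Sum>i<n. h (Suc i) \<cdot> u (Suc i))"
    by (subst sum.atMost_shift) (simp add: h0)
  also have "(\<Sum>i\<le>n. h (Suc i) \<cdot> (q * q) \<cdot> u i) = (\<Sum>i<n. h (Suc i) \<cdot> (q * q) \<cdot> u i)"
    by (simp add: lessThan_Suc_atMost[symmetric] h0)
  also have "(\<Sum>i<n. h (Suc i) \<cdot> u (Suc i)) - (\<Sum>i<n. h (Suc i) \<cdot> (q * q) \<cdot> u i) = (\<Sum>i<n. h (Suc i) \<cdot> w i)"
    by (simp add: w_def u_def V.scale_right_diff_distrib sum_subtractf)
  finally have 1: "(\<Sum>i\<le>n. (h i - (q * q) * h (Suc i)) \<cdot> u i) = (\<Sum>i<n. h (Suc i) \<cdot> w i)" .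
  have "(\<Sum>i<n. h (Suc i) \<cdot> w i) = (\<Sum>i<n. h (Suc (n - Suc i)) \<cdot> w (n - Suc i))"
    by (rule sum.nat_diff_reindex[symmetric])
  also have "\<dots> = (\<Sum>i<n. h (Suc i) \<cdot> w (n - Suc i))"
  proof (rule sum.cong[OF refl])
    fix i assume "i \<in> {..<n}"
    then have "Suc (n - Suc i) = Suc n - Suc i" "Suc i \<le> Suc n" by auto
    then have "h (Suc (n - Suc i)) = h (Suc i)" using sym[of "Suc i"] by simp
    then show "h (Suc (n - Suc i)) \<cdot> w (n - Suc i) = h (Suc i) \<cdot> w (n - Suc i)" by simp
  qed
  finally have "(\<Sum>i<n. h (Suc i) \<cdot> w i) + (\<Sum>i<n. h (Suc i) \<cdot> w i) = (\<Sum>i<n. h (Suc i) \<cdot> (w i + w (n - Suc i)))"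
    by (simp add: sum.distrib scl_simps)
  also have "\<dots> = 0" by (rule sum.neutral) (simp add: ww)
  finally have "(\<Sum>i<n. h (Suc i) \<cdot> w i) = 0" by (rule twice_eq_0)
  then show ?thesis using 1 by (simp add: u_def)
qed

definition cur :: "int \<Rightarrow> 'b fps" where "cur r = gs xp r 1"

lemma cur_nth [simp]: "fps_nth (cur r) i = xp (r + int i)"
  by (simp add: cur_def)

lemma cur_step: "cur r = fps_const (xp r) + fps_X * cur (r + 1)"
  unfolding cur_def by (subst gs_step) simp

lemma cur_tail: "(q * q) \<star> (cur r * (fps_X * cur (r + 1))) = (fps_X * cur (r + 1)) * cur r"
proof (rule fps_ext)
  fix n
  define h :: "nat \<Rightarrow> 'a" where "h i = (if i = 0 \<or> i = Suc n then 0 else - 1)" for i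
  define T where "T = fps_X * cur (r + 1)"
  have t: "fps_nth T i = (if i = 0 then 0 else xp (r + int i))" for i
    unfolding T_def by (cases i) (auto simp: algebra_simps)
  have "(\<Sum>i\<le>n. (h i - (q * q) * h (Suc i)) \<cdot> (xp (r + int i) * xp (r + int (n - i)))) = 0"
    by (rule quadratic_sum) (auto simp: h_def)
  moreover have "fps_nth ((q * q) \<star> (cur r * T) - T * cur r) n
     = (\<Sum>i\<le>n. (h i - (q * q) * h (Suc i)) \<cdot> (xp (r + int i) * xp (r + int (n - i))))"
    unfolding fps_sub_nth fs_nth fps_mult_nth t atMost_atLeast0 cur_nth scl_sum_right sum_subtractf[symmetric]
    by (rule sum.cong) (auto simp: h_def scl_left)
  ultimately have "fps_nth ((q * q) \<star> (cur r * T) - T * cur r) n = 0"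
    by (rule trans[rotated])
  then show "fps_nth ((q * q) \<star> (cur r * (fps_X * cur (r + 1)))) n = fps_nth ((fps_X * cur (r + 1)) * cur r) n"
    unfolding T_def[symmetric] fps_sub_nth by (rule eq_iff_diff_eq_0[THEN iffD2])
qed

lemma cur_dil: "(1 + q * q) \<star> (dil (q * q) (cur r) * cur r)
   = (q * q) \<star> (dil (q * q) (cur r) * dil (q * q) (cur r)) + cur r * cur r"
proof (rule fps_ext)
  fix n
  let ?Q = "q * q" let ?A = "dil ?Q (cur r)"
  define h where "h i = (1 - ?Q ^ i) * (1 - ?Q ^ (Suc n - i))" for i
  have hh: "h i - ?Q * h (Suc i) = (1 - ?Q) * (1 + ?Q ^ Suc n - ?Q ^ i * (1 + ?Q))" if "i \<le> n" for i
  proof -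
    define j where "j = n - i"
    have j: "n = i + j" using that by (simp add: j_def)
    have gen: "(1 - x) * (1 - c * y) - c * ((1 - c * x) * (1 - y)) = (1 - c) * (1 + c * (x * y) - x * (1 + c))" for x y c :: 'a
      by (simp add: algebra_simps)
    have e: "Suc n - i = Suc j" "Suc n - Suc i = j" using j by auto
    have "?Q ^ Suc n = ?Q * (?Q ^ i * ?Q ^ j)" unfolding j by (simp only: power_Suc power_add)
    then show ?thesis unfolding h_def e power_Suc by (simp only: gen)
  qed
  have "(\<Sum>i\<le>n. ((1 - ?Q) * (1 + ?Q ^ Suc n - ?Q ^ i * (1 + ?Q))) \<cdot> (xp (r + int i) * xp (r + int (n - i))))
      = (\<Sum>i\<le>n. (h i - ?Q * h (Suc i)) \<cdot> (xp (r + int i) * xp (r + int (n - i))))"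
  proof (rule sum.cong[OF refl])
    fix i assume "i \<in> {..n}"
    then have "i \<le> n" by simp
    then show "((1 - ?Q) * (1 + ?Q ^ Suc n - ?Q ^ i * (1 + ?Q))) \<cdot> (xp (r + int i) * xp (r + int (n - i)))
      = (h i - ?Q * h (Suc i)) \<cdot> (xp (r + int i) * xp (r + int (n - i)))"
      by (simp only: hh)
  qed
  also have "\<dots> = 0"
    by (rule quadratic_sum) (auto simp: h_def mult.commute)
  finally have "(1 - ?Q) \<cdot> (\<Sum>i\<le>n. (1 + ?Q ^ Suc n - ?Q ^ i * (1 + ?Q)) \<cdot> (xp (r + int i) * xp (r + int (n - i)))) = 0"
    unfolding scl_sum_right V.scale_scale .
  moreover have "1 - ?Q \<noteq> 0" using q_generic[of 2] by (simp add: power2_eq_square)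
  ultimately have "(\<Sum>i\<le>n. (1 + ?Q ^ Suc n - ?Q ^ i * (1 + ?Q)) \<cdot> (xp (r + int i) * xp (r + int (n - i)))) = 0"
    by (rule scl_eq_0)
  moreover have "fps_nth (?Q \<star> (?A * ?A) + cur r * cur r - (1 + ?Q) \<star> (?A * cur r)) n
     = (\<Sum>i\<le>n. (1 + ?Q ^ Suc n - ?Q ^ i * (1 + ?Q)) \<cdot> (xp (r + int i) * xp (r + int (n - i))))"
    unfolding fps_sub_nth fps_add_nth fs_nth fps_mult_nth atMost_atLeast0 scl_sum_right sum_subtractf[symmetric] sum.distrib[symmetric]
  proof (rule sum.cong[OF refl])
    fix i assume "i \<in> {0..n}"
    then have "?Q ^ i * ?Q ^ (n - i) = ?Q ^ n" by (simp flip: power_add)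
    then have Q: "?Q * (?Q ^ i * ?Q ^ (n - i)) = ?Q ^ Suc n" by simp
    show "?Q \<cdot> (fps_nth ?A i * fps_nth ?A (n - i)) + fps_nth (cur r) i * fps_nth (cur r) (n - i) - (1 + ?Q) \<cdot> (fps_nth ?A i * fps_nth (cur r) (n - i))
      = (1 + ?Q ^ Suc n - ?Q ^ i * (1 + ?Q)) \<cdot> (xp (r + int i) * xp (r + int (n - i)))"
      unfolding Q[symmetric] by (simp add: V.scale_left_distrib V.scale_left_diff_distrib mult.assoc mult.commute mult.left_commute)
  qed
  ultimately have "fps_nth (?Q \<star> (?A * ?A) + cur r * cur r - (1 + ?Q) \<star> (?A * cur r)) n = 0"
    by (rule trans[rotated])
  then show "fps_nth ((1 + ?Q) \<star> (?A * cur r)) n = fps_nth (?Q \<star> (?A * ?A) + cur r * cur r) n"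
    unfolding fps_sub_nth by (rule eq_iff_diff_eq_0[THEN iffD2, symmetric])
qed

definition Xd :: "int \<Rightarrow> nat \<Rightarrow> 'b fps" where "Xd r j = (1 / qfac q j) \<star> cur r ^ j"

lemma Xd_0: "Xd r 0 = 1"
  by (simp add: Xd_def)

text \<open>The analogue of the difference quotient of a power.  For commuting variables the hypothesis would say that
  \<open>b = a\<close> or \<open>b = q * q * a\<close>; in general it is the relation between two specialisations of a half current.\<close>

lemma special_powers:
  assumes ab: "(1 + q * q) \<star> (a * b) = (q * q) \<star> (a * a) + b * b"
  shows "qn q (int (Suc j)) \<star> ((q \<star> a - p \<star> b) * b ^ j) = q ^ Suc j \<star> a ^ Suc j - p ^ Suc j \<star> b ^ Suc j"
proof (induct j)
  case (Suc j)
  have a2: "q \<star> (a * a) = (q + p) \<star> (a * b) - p \<star> (b * b)"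
  proof -
    have "(q * q) \<star> (a * a) = (1 + q * q) \<star> (a * b) - b * b" unfolding ab by simp
    then have "p \<star> ((q * q) \<star> (a * a)) = p \<star> ((1 + q * q) \<star> (a * b) - b * b)" by simp
    then show ?thesis by (simp add: FV.scale_right_diff_distrib mult.assoc distrib_left add.commute)
  qed
  have n: "qn q (int (Suc (Suc j))) = q * qn q (int (Suc j)) + p ^ Suc j"
    using qn_add[of "int (Suc j)" 1]
    by (simp add: power_int_minus power_int_diff divide_inverse power_inverse algebra_simps)
  have "q ^ Suc (Suc j) \<star> a ^ Suc (Suc j) = q \<star> (a * (q ^ Suc j \<star> a ^ Suc j))"
    by simp
  also have "q ^ Suc j \<star> a ^ Suc j = qn q (int (Suc j)) \<star> ((q \<star> a - p \<star> b) * b ^ j) + p ^ Suc j \<star> b ^ Suc j"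
    using Suc by simp
  also have "q \<star> (a * (qn q (int (Suc j)) \<star> ((q \<star> a - p \<star> b) * b ^ j) + p ^ Suc j \<star> b ^ Suc j))
     = qn q (int (Suc j)) \<star> (q \<star> ((q \<star> (a * a) - p \<star> (a * b)) * b ^ j)) + (q * p ^ Suc j) \<star> (a * b ^ Suc j)"
    by (simp add: distrib_left FV.scale_right_distrib right_diff_distrib mult.assoc[of a] mult.left_commute del: power_Suc)
       (simp add: mult.assoc[symmetric] left_diff_distrib right_diff_distrib del: power_Suc)
  also have "q \<star> (a * a) - p \<star> (a * b) = q \<star> (a * b) - p \<star> (b * b)"
    unfolding a2 by (simp add: algebra_simps)
  also have "qn q (int (Suc j)) \<star> (q \<star> ((q \<star> (a * b) - p \<star> (b * b)) * b ^ j)) + (q * p ^ Suc j) \<star> (a * b ^ Suc j)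
     = (q * qn q (int (Suc (Suc j)))) \<star> (a * b ^ Suc j) - qn q (int (Suc j)) \<star> b ^ Suc (Suc j)"
    unfolding n by (simp add: FV.scale_right_diff_distrib FV.scale_left_distrib left_diff_distrib mult.assoc algebra_simps del: of_nat_Suc)
  finally have 1: "q ^ Suc (Suc j) \<star> a ^ Suc (Suc j) = (q * qn q (int (Suc (Suc j)))) \<star> (a * b ^ Suc j) - qn q (int (Suc j)) \<star> b ^ Suc (Suc j)" .
  have n': "p * qn q (int (Suc (Suc j))) = qn q (int (Suc j)) + p ^ Suc (Suc j)"
    unfolding n by (simp add: distrib_left)
  have "qn q (int (Suc (Suc j))) \<star> ((q \<star> a - p \<star> b) * b ^ Suc j)
     = (q * qn q (int (Suc (Suc j)))) \<star> (a * b ^ Suc j) - (p * qn q (int (Suc (Suc j)))) \<star> b ^ Suc (Suc j)"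
    by (simp add: left_diff_distrib FV.scale_right_diff_distrib mult.commute del: of_nat_Suc)
  then show ?case unfolding 1 n' by (simp add: FV.scale_left_distrib del: of_nat_Suc power_Suc)
qed (simp add: algebra_simps)

text \<open>The step in which straightening collects one more raising vector: moving it past a lowering vector yields the
  coefficients on the left, and the sum is again a divided power of the half current.\<close>

lemma Xd_recursion:
  "fps_nth (Abs_fps (\<lambda>s. (q ^ s * qn q (int s + 1)) \<cdot> xp (int s)) * Xd 0 j) n
   = (q ^ n * qn q (int n + int j + 1)) \<cdot> fps_nth (Xd 0 (Suc j)) n"
proof -
  let ?E = "Abs_fps (\<lambda>s. (q ^ s * qn q (int s + 1)) \<cdot> xp (int s))"
  let ?A = "dil (q * q) (cur 0)"
  have pw: "(q - p) * (q ^ s * qn q (int s + int i + 1)) = q ^ Suc i * (q * q) ^ s - p ^ Suc i" for s i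
  proof -
    have "(q - p) * (q ^ s * qn q (int s + int i + 1)) = q ^ s * ((q - p) * qn q (int s + int i + 1))" by (simp only: mult.left_commute)
    also have "\<dots> = q ^ s * (q ^ (s + i + 1) - p ^ (s + i + 1))"
      unfolding qn_mult using power_int_of_nat[of q "s + i + 1"] power_int_minus[of q "int (s + i + 1)"]
      by (simp add: power_inverse del: power_int_of_nat power_Suc) (simp add: algebra_simps)
    also have "\<dots> = q ^ Suc i * (q * q) ^ s - p ^ Suc i"
      by (simp add: power_add power_mult_distrib right_diff_distrib mult_ac power_inverse)
    finally show ?thesis .
  qed
  have E: "(q - p) \<star> ?E = q \<star> ?A - p \<star> cur 0"
  proof (rule fps_ext)
    fix n
    show "fps_nth ((q - p) \<star> ?E) n = fps_nth (q \<star> ?A - p \<star> cur 0) n"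
      using pw[of n 0] by (simp add: scl_left)
  qed
  have "qn q (int (Suc j)) \<star> (((q - p) \<star> ?E) * cur 0 ^ j) = q ^ Suc j \<star> ?A ^ Suc j - p ^ Suc j \<star> cur 0 ^ Suc j"
    unfolding E by (rule special_powers[OF cur_dil])
  then have "fps_nth (qn q (int (Suc j)) \<star> (((q - p) \<star> ?E) * cur 0 ^ j)) n = fps_nth (q ^ Suc j \<star> ?A ^ Suc j - p ^ Suc j \<star> cur 0 ^ Suc j) n"
    by simp
  then have "(qn q (int (Suc j)) * (q - p)) \<cdot> fps_nth (?E * cur 0 ^ j) n = (q ^ Suc j * (q * q) ^ n - p ^ Suc j) \<cdot> fps_nth (cur 0 ^ Suc j) n"
    by (simp add: dil_power[symmetric] scl_left del: power_Suc)
  then have "(q - p) \<cdot> (qn q (int (Suc j)) \<cdot> fps_nth (?E * cur 0 ^ j) n) = (q - p) \<cdot> ((q ^ n * qn q (int n + int j + 1)) \<cdot> fps_nth (cur 0 ^ Suc j) n)"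
    unfolding pw[of n j, symmetric] by (simp add: mult.commute del: power_Suc)
  then have 1: "qn q (int (Suc j)) \<cdot> fps_nth (?E * cur 0 ^ j) n = (q ^ n * qn q (int n + int j + 1)) \<cdot> fps_nth (cur 0 ^ Suc j) n"
    by (rule scl_cancel) simp
  have "qn q (int (Suc j)) \<cdot> fps_nth (?E * Xd 0 j) n = (1 / qfac q j) \<cdot> (qn q (int (Suc j)) \<cdot> fps_nth (?E * cur 0 ^ j) n)"
    by (simp add: Xd_def mult.commute del: of_nat_Suc)
  also have "\<dots> = qn q (int (Suc j)) \<cdot> ((q ^ n * qn q (int n + int j + 1)) \<cdot> fps_nth (Xd 0 (Suc j)) n)"
    unfolding 1 by (simp add: Xd_def qfac_Suc mult.commute mult.left_commute del: of_nat_Suc power_Suc)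
  finally show ?thesis by (rule qn_cancel)
qed

end

context quantum
begin

lemma fs_cancel: "qn q (int (Suc n)) \<star> f = qn q (int (Suc n)) \<star> g \<Longrightarrow> f = g"
  using FV.scale_cancel_left[of "qn q (int (Suc n))" f g] qn_Suc_nz(1)[of n] by blast

text \<open>The \<open>q\<close>-binomial theorem, without denominators when written with divided powers.\<close>

lemma q_binomial:
  assumes "w * u = (p * p) \<star> (u * w)"
  shows "(1 / qfac q n) \<star> (u + w) ^ n =
    (\<Sum>i\<le>n. q powi (- (int i * int (n - i))) \<star> (((1 / qfac q i) \<star> u ^ i) * ((1 / qfac q (n - i)) \<star> w ^ (n - i))))"
proof (induct n)
  case (Suc n)
  define U where "U i = (1 / qfac q i) \<star> u ^ i" for i
  define W where "W i = (1 / qfac q i) \<star> w ^ i" for i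
  let ?c = "\<lambda>n i. - (int i * (int n - int i))"
  have Us: "u * U i = qn q (int (Suc i)) \<star> U (Suc i)" and Ws: "w * W i = qn q (int (Suc i)) \<star> W (Suc i)" for i
    by (simp_all add: U_def W_def qfac_Suc del: of_nat_Suc)
  have wU: "w * U i = q powi (- 2 * int i) \<star> (U i * w)" for i
  proof -
    have "w * u ^ i = q powi (- 2 * int i) \<star> (u ^ i * w)"
    proof (induct i)
      case (Suc i)
      have "w * u ^ Suc i = (w * u) * u ^ i" by (simp add: mult.assoc)
      also have "\<dots> = (p * p) \<star> (u * (w * u ^ i))" unfolding assms by (simp add: mult.assoc)
      also have "\<dots> = (p * p * q powi (- 2 * int i)) \<star> (u ^ Suc i * w)" unfolding Suc by (simp add: mult.assoc)
      also have "p * p * q powi (- 2 * int i) = q powi (- 2 * int (Suc i))"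
        by (simp add: power_int_diff power_int_minus power_int_add power2_eq_square field_simps)
      finally show ?case .
    qed simp
    then show ?thesis by (simp add: U_def mult.commute)
  qed
  have IH: "(1 / qfac q n) \<star> (u + w) ^ n = (\<Sum>i\<le>n. q powi ?c n i \<star> (U i * W (n - i)))"
    unfolding Suc U_def W_def by (rule sum.cong) (auto simp: of_nat_diff)
  have "qn q (int (Suc n)) \<star> ((1 / qfac q (Suc n)) \<star> (u + w) ^ Suc n) = (u + w) * ((1 / qfac q n) \<star> (u + w) ^ n)"
    by (simp add: qfac_Suc del: of_nat_Suc)
  also have "\<dots> = (\<Sum>i\<le>n. q powi ?c n i \<star> ((u * U i) * W (n - i) + (w * U i) * W (n - i)))"
    unfolding IH sum_distrib_left by (simp add: distrib_right mult.assoc)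
  also have "\<dots> = (\<Sum>i\<le>n. (q powi ?c n i * qn q (int (Suc i))) \<star> (U (Suc i) * W (Suc n - Suc i)))
     + (\<Sum>i\<le>n. (q powi (?c n i - 2 * int i) * qn q (int (Suc n) - int i)) \<star> (U i * W (Suc n - i)))"
    unfolding sum.distrib[symmetric]
  proof (rule sum.cong[OF refl])
    fix i assume i: "i \<in> {..n}"
    have "w * W (n - i) = qn q (int (Suc n) - int i) \<star> W (Suc n - i)"
      using Ws[of "n - i"] i by (simp add: Suc_diff_le of_nat_diff algebra_simps)
    then have 2: "(w * U i) * W (n - i) = (q powi (- 2 * int i) * qn q (int (Suc n) - int i)) \<star> (U i * W (Suc n - i))"
      unfolding wU by (simp add: mult.assoc del: of_nat_Suc)
    show "q powi ?c n i \<star> ((u * U i) * W (n - i) + (w * U i) * W (n - i))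
       = (q powi ?c n i * qn q (int (Suc i))) \<star> (U (Suc i) * W (Suc n - Suc i))
       + (q powi (?c n i - 2 * int i) * qn q (int (Suc n) - int i)) \<star> (U i * W (Suc n - i))"
      unfolding 2 Us using powi_merge(1)[of "?c n i" "- 2 * int i"]
      by (simp add: FV.scale_right_distrib mult.assoc[symmetric] del: of_nat_Suc)
  qed
  also have "(\<Sum>i\<le>n. (q powi ?c n i * qn q (int (Suc i))) \<star> (U (Suc i) * W (Suc n - Suc i)))
      = (\<Sum>i\<le>Suc n. (q powi ?c n (i - 1) * qn q (int i)) \<star> (U i * W (Suc n - i)))"
    unfolding sum.atMost_Suc_shift[of _ n] by simp
  also have "(\<Sum>i\<le>n. (q powi (?c n i - 2 * int i) * qn q (int (Suc n) - int i)) \<star> (U i * W (Suc n - i)))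
      = (\<Sum>i\<le>Suc n. (q powi (?c n i - 2 * int i) * qn q (int (Suc n) - int i)) \<star> (U i * W (Suc n - i)))"
    by simp
  also have "(\<Sum>i\<le>Suc n. (q powi ?c n (i - 1) * qn q (int i)) \<star> (U i * W (Suc n - i))) + (\<Sum>i\<le>Suc n. (q powi (?c n i - 2 * int i) * qn q (int (Suc n) - int i)) \<star> (U i * W (Suc n - i)))
      = (\<Sum>i\<le>Suc n. (q powi ?c (Suc n) i * qn q (int (Suc n))) \<star> (U i * W (Suc n - i)))"
    unfolding sum.distrib[symmetric]
  proof (rule sum.cong[OF refl])
    fix i assume "i \<in> {..Suc n}"
    show "(q powi ?c n (i - 1) * qn q (int i)) \<star> (U i * W (Suc n - i)) + (q powi (?c n i - 2 * int i) * qn q (int (Suc n) - int i)) \<star> (U i * W (Suc n - i))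
       = (q powi ?c (Suc n) i * qn q (int (Suc n))) \<star> (U i * W (Suc n - i))"
    proof (cases i)
      case i: (Suc j)
      have "q powi ?c n (i - 1) * qn q (int i) + q powi (?c n i - 2 * int i) * qn q (int (Suc n) - int i) = q powi ?c (Suc n) i * qn q (int (Suc n))"
        by (rule qn_comb) (simp_all add: i algebra_simps)
      then show ?thesis by (simp only: FV.scale_left_distrib[symmetric])
    qed simp
  qed
  also have "\<dots> = qn q (int (Suc n)) \<star> (\<Sum>i\<le>Suc n. q powi ?c (Suc n) i \<star> (U i * W (Suc n - i)))"
    by (simp only: FV.scale_sum_right FV.scale_scale mult.commute[of "qn q (int (Suc n))"])
  finally have "(1 / qfac q (Suc n)) \<star> (u + w) ^ Suc n = (\<Sum>i\<le>Suc n. q powi ?c (Suc n) i \<star> (U i * W (Suc n - i)))"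
    by (rule fs_cancel)
  also have "\<dots> = (\<Sum>i\<le>Suc n. q powi (- (int i * int (Suc n - i))) \<star> (U i * W (Suc n - i)))"
    by (rule sum.cong) (auto simp: of_nat_diff)
  finally show ?case unfolding U_def W_def .
qed simp

end

lemma X_power_nth: "fps_nth (fps_X ^ i * (f :: 'a::ring_1 fps)) n = (if n < i then 0 else fps_nth f (n - i))"
  by (rule fps_X_power_mult_nth)

lemma X_times_power: "(fps_X * (f :: 'a::ring_1 fps)) ^ i = fps_X ^ i * f ^ i"
proof (induct i)
  case (Suc i)
  have "f * fps_X ^ i = fps_X ^ i * f" by (metis fps_mult_fps_X_power_commute)
  then show ?case using Suc by (simp add: mult.assoc) (metis mult.assoc)
qed simp

context loop_serre
begin

text \<open>The half current is its constant term plus a multiple of the variable, and these two \<open>q\<close>-commute.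
  The \<open>q\<close>-binomial theorem therefore expresses each coefficient by divided powers of single generators and by coefficients of
  lower degree.\<close>

lemma Xd_integral:
  assumes S: "integral_form sc q S" and x: "\<And>r t. dp (xp r) t \<in> S"
  shows "fps_nth (Xd r j) n \<in> S"
proof (induct n arbitrary: r j rule: less_induct)
  case (less n)
  interpret I: integral_form sc q S by (rule S)
  let ?T = "fps_X * cur (r + 1)"
  have ser: "fps_const (xp r) = - ?T + cur r" using cur_step[of r] by simp
  have comm: "cur r * (- ?T) = (p * p) \<star> (- ?T * cur r)"
  proof -
    have "(p * p) \<star> ((q * q) \<star> (cur r * ?T)) = (p * p) \<star> (?T * cur r)" unfolding cur_tail ..
    then show ?thesis by (simp add: mult.assoc)
  qed
  have "fps_const (xp r) ^ j = fps_const (xp r ^ j)" by (induct j) simp_all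
  then have "fps_const (dp (xp r) j) = (1 / qfac q j) \<star> (- ?T + cur r) ^ j"
    unfolding ser[symmetric] by (simp add: dp_def fs_const)
  also have "\<dots> = (\<Sum>i\<le>j. q powi (- (int i * int (j - i))) \<star> (((1 / qfac q i) \<star> (- ?T) ^ i) * Xd r (j - i)))"
    unfolding q_binomial[OF comm] Xd_def ..
  also have "\<dots> = Xd r j + (\<Sum>i\<in>{1..j}. q powi (- (int i * int (j - i))) \<star> (((1 / qfac q i) \<star> (- ?T) ^ i) * Xd r (j - i)))"
    by (simp add: atMost_atLeast0 sum.atLeast_Suc_atMost)
  finally have 1: "fps_nth (Xd r j) n = fps_nth (fps_const (dp (xp r) j)) n
     - (\<Sum>i\<in>{1..j}. q powi (- (int i * int (j - i))) \<cdot> fps_nth (((1 / qfac q i) \<star> (- ?T) ^ i) * Xd r (j - i)) n)"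
    by (simp add: fps_sum_nth)
  have tail: "fps_nth ((1 / qfac q i) \<star> (- ?T) ^ i) l = (if l < i then 0 else (- 1) ^ i \<cdot> fps_nth (Xd (r + 1) i) (l - i))" for i l
  proof -
    have "(- ?T) ^ i = (- 1) ^ i \<star> (fps_X ^ i * cur (r + 1) ^ i)"
      unfolding X_times_power[symmetric] by (induct i) simp_all
    then show ?thesis by (simp add: Xd_def X_power_nth mult.commute)
  qed
  have "fps_nth (((1 / qfac q i) \<star> (- ?T) ^ i) * Xd r (j - i)) n \<in> S" if i: "i \<in> {1..j}" for i
    unfolding fps_mult_nth tail
  proof (rule I.S_sum)
    fix l assume l: "l \<in> {0..n}"
    show "(if l < i then 0 else (- 1) ^ i \<cdot> fps_nth (Xd (r + 1) i) (l - i)) * fps_nth (Xd r (j - i)) (n - l) \<in> S"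
    proof (cases "l < i")
      case False
      then have "l - i < n" "n - l < n" using i l by auto
      then have "fps_nth (Xd (r + 1) i) (l - i) \<in> S" "fps_nth (Xd r (j - i)) (n - l) \<in> S"
        using less by blast+
      then have "(- 1) ^ i \<cdot> (fps_nth (Xd (r + 1) i) (l - i) * fps_nth (Xd r (j - i)) (n - l)) \<in> S"
        by (intro I.S_sign I.S_mult)
      then show ?thesis using False by simp
    qed simp
  qed
  then have "(\<Sum>i\<in>{1..j}. q powi (- (int i * int (j - i))) \<cdot> fps_nth (((1 / qfac q i) \<star> (- ?T) ^ i) * Xd r (j - i)) n) \<in> S"
    by (intro I.S_sum I.S_powi)
  moreover have "fps_nth (fps_const (dp (xp r) j)) n \<in> S" using x by simp
  ultimately show ?case unfolding 1 by (rule I.S_diff[rotated])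
qed

end

section \<open>Integrality of the loop generators\<close>

context loop_serre
begin

text \<open>The vector \<open>xm (1 - r) * ki\<close> has weight \<open>-2\<close> for the twisted adjoint action of \<open>xp r\<close>, and its string is
  \<open>xm (1 - r) * ki\<close>, \<open>phi1\<close>, \<open>- xp (r + 1)\<close>, the string ending there by the quadratic relation \<open>Qp\<close>.\<close>

lemma xp_step_up:
  assumes S: "integral_form sc q S" "k \<in> S" "ki \<in> S"
    and x: "\<And>t. dp (xp r) t \<in> S" and y: "\<And>t. dp (xm (1 - r)) t \<in> S"
  shows "dp (xp (r + 1)) t \<in> S"
proof -
  interpret I: integral_form sc q S by (rule S(1))
  interpret R: root_vector sc q "xp r" k ki
    by unfold_locales (simp_all add: mult.assoc ki_xp xp_k)
  let ?z = "xm (1 - r) * ki"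
  have twz: "R.tw ?z = (q * q) \<cdot> ?z"
  proof -
    have "ki * ?z * k = ki * xm (1 - r) * (ki * k)" by (simp only: mult.assoc)
    then show ?thesis unfolding R.tw_def by (simp add: ki_xm)
  qed
  have ki_x: "ki * xp r = (p * p) \<cdot> (xp r * ki)" by (rule ki_xp)
  have "R.ad ?z = xp r * xm (1 - r) * ki - (q * q) \<cdot> (xm (1 - r) * (ki * xp r))"
    unfolding R.ad_def twz by (simp add: mult.assoc)
  also have "\<dots> = Br r (1 - r) * ki"
    unfolding ki_x by (simp add: Br_def cm_def left_diff_distrib mult.assoc)
  also have "\<dots> = phi1"
    using k_phi1(2) unfolding Br_level_1 by (simp add: cm_eq_0 mult.assoc) (metis k_ki'(1) mult.assoc)
  finally have ad1: "R.ad ?z = phi1" .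
  have tw1: "R.tw phi1 = phi1"
    using k_phi1(2) by (simp add: R.tw_def cm_eq_0 mult.assoc)
  have ad2: "R.ad phi1 = - ((q + p) \<cdot> xp (r + 1))"
    using phi1_xp[of r] by (simp add: R.ad_def tw1 cm_def algebra_simps)
  have "(q + p) \<cdot> R.D 2 ?z = (q + p) \<cdot> (- xp (r + 1))"
    unfolding R.D_2 ad1 ad2 by simp
  then have D2: "R.D 2 ?z = - xp (r + 1)" by (rule scl_cancel) simp
  have "R.tw (xp (r + 1)) = (p * p) \<cdot> xp (r + 1)"
    by (simp add: R.tw_def ki_xp mult.assoc)
  then have "R.ad (xp (r + 1)) = 0"
    using Qp[of r] by (simp add: R.ad_def mult.assoc)
  then have "qn q (int (Suc 2)) \<cdot> R.D (Suc 2) ?z = 0"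
    unfolding R.D_Suc D2 by simp
  then have D3: "R.D (Suc 2) ?z = 0" by (rule qn_eq_0)
  have "ki * xm (1 - r) = q powi 2 \<cdot> (xm (1 - r) * ki)"
    by (simp add: ki_xm power2_eq_square)
  then have "dp ?z s \<in> S" for s
    using I.dp_times_torus[of ki "xm (1 - r)" 2 s] y S by auto
  moreover have "R.wt ?z (- int 2)"
    unfolding R.wt_def twz by (simp add: power2_eq_square)
  ultimately have "dp (R.D 2 ?z) t \<in> S"
    using R.string_top_integral[OF S(1) x _ _ D3] by blast
  moreover have "dp (- xp (r + 1)) t = (- 1) ^ t \<cdot> dp (xp (r + 1)) t"
    using I.dp_scl[of "- 1" "xp (r + 1)" t] by simp
  ultimately have "(- 1) ^ t \<cdot> dp (xp (r + 1)) t \<in> S"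
    unfolding D2 by (simp only:)
  from I.S_sign[OF this, of t] show ?thesis by (simp add: power_mult_distrib[symmetric])
qed

text \<open>The remaining directions are mirror images of the previous one.\<close>

lemma xp_step_down:
  assumes S: "integral_form sc q S" "k \<in> S" "ki \<in> S"
    and x: "\<And>t. dp (xp r) t \<in> S" and y: "\<And>t. dp (xm (- 1 - r)) t \<in> S"
  shows "dp (xp (r - 1)) t \<in> S"
proof -
  interpret I: integral_form sc q S by (rule S(1))
  interpret N: loop_serre sc p ki k "\<lambda>r. xp (- r - 1)" "\<lambda>r. xm (1 - r)" by (rule mirror_up)
  have dp: "N.dp z s = dp z s" for z s by (simp add: N.dp_def dp_def qfac_inverse)
  have e: "- (- r - 1) - 1 = r" "1 - (1 - (- r - 1)) = - 1 - r" "- (- r - 1 + 1) - 1 = r - 1" by simp_all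
  show ?thesis
    using N.xp_step_up[of S "- r - 1" t, OF I.integral_form_inverse S(3,2)] x y unfolding dp e by blast
qed

lemma xm_step_up:
  assumes S: "integral_form sc q S" "k \<in> S" "ki \<in> S"
    and x: "\<And>t. dp (xm r) t \<in> S" and y: "\<And>t. dp (xp (1 - r)) t \<in> S"
  shows "dp (xm (r + 1)) t \<in> S"
proof -
  interpret I: integral_form sc q S by (rule S(1))
  interpret N: loop_serre sc p k ki "\<lambda>r. xm (r + 1)" "\<lambda>r. xp (r - 1)" by (rule mirror_swap)
  have dp: "N.dp z s = dp z s" for z s by (simp add: N.dp_def dp_def qfac_inverse)
  have e: "r - 1 + 1 = r" "1 - (r - 1) - 1 = 1 - r" "r - 1 + 1 + 1 = r + 1" by simp_all
  show ?thesis
    using N.xp_step_up[of S "r - 1" t, OF I.integral_form_inverse S(2,3)] x y unfolding dp e by blast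
qed

lemma xm_step_down:
  assumes S: "integral_form sc q S" "k \<in> S" "ki \<in> S"
    and x: "\<And>t. dp (xm r) t \<in> S" and y: "\<And>t. dp (xp (- 1 - r)) t \<in> S"
  shows "dp (xm (r - 1)) t \<in> S"
proof -
  interpret I: integral_form sc q S by (rule S(1))
  interpret N: loop_serre sc p k ki "\<lambda>r. xm (r + 1)" "\<lambda>r. xp (r - 1)" by (rule mirror_swap)
  have dp: "N.dp z s = dp z s" for z s by (simp add: N.dp_def dp_def qfac_inverse)
  have e: "r - 1 + 1 = r" "- 1 - (r - 1) - 1 = - 1 - r" "r - 1 - 1 + 1 = r - 1" by simp_all
  show ?thesis
    using N.xp_step_down[of S "r - 1" t, OF I.integral_form_inverse S(2,3)] x y unfolding dp e by blast
qed

lemma loop_generators_integral: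
  assumes S: "integral_form sc q S" "k \<in> S" "ki \<in> S"
    and base: "\<And>t. dp (xp 0) t \<in> S" "\<And>t. dp (xm 0) t \<in> S" "\<And>t. dp (xm 1) t \<in> S" "\<And>t. dp (xp (- 1)) t \<in> S"
  shows "dp (xp r) t \<in> S" "dp (xm r) t \<in> S"
proof -
  have main: "(\<forall>r \<in> {- int n - 1..int n}. \<forall>t. dp (xp r) t \<in> S) \<and> (\<forall>r \<in> {- int n..int n + 1}. \<forall>t. dp (xm r) t \<in> S)" for n
  proof (induct n)
    case 0
    have "{- int 0 - 1..int 0} = {- 1, 0}" "{- int 0..int 0 + 1} = {0, 1}" by auto
    then show ?case using base by auto
  next
    case (Suc n)
    then have P: "\<And>r t. - int n - 1 \<le> r \<Longrightarrow> r \<le> int n \<Longrightarrow> dp (xp r) t \<in> S"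
      and M: "\<And>r t. - int n \<le> r \<Longrightarrow> r \<le> int n + 1 \<Longrightarrow> dp (xm r) t \<in> S" by auto
    have 1: "dp (xp (int n + 1)) t \<in> S" for t by (rule xp_step_up[OF S]; rule P M; simp)
    have 2: "dp (xm (int n + 1 + 1)) t \<in> S" for t by (rule xm_step_up[OF S]; rule P M; simp)
    have 3: "dp (xp (- int n - 1 - 1)) t \<in> S" for t by (rule xp_step_down[OF S]; rule P M; simp)
    have 4: "dp (xm (- int n - 1)) t \<in> S" for t by (rule xm_step_down[OF S]; rule P M; simp)
    have a: "{- int (Suc n) - 1..int (Suc n)} = insert (- int n - 1 - 1) (insert (int n + 1) {- int n - 1..int n})"
      and b: "{- int (Suc n)..int (Suc n) + 1} = insert (- int n - 1) (insert (int n + 1 + 1) {- int n..int n + 1})"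
      by auto
    show ?case unfolding a b using Suc 1 2 3 4 by simp
  qed
  have "r \<in> {- int (nat \<bar>r\<bar>) - 1..int (nat \<bar>r\<bar>)}" "r \<in> {- int (nat \<bar>r\<bar>)..int (nat \<bar>r\<bar>) + 1}" by auto
  with main[of "nat \<bar>r\<bar>"] show "dp (xp r) t \<in> S" "dp (xm r) t \<in> S" by blast+
qed

end


section \<open>Integrality of the Cartan binomials\<close>

context loop_shift
begin

definition hb :: "int \<Rightarrow> 'b" where "hb c = q powi c \<cdot> k - q powi (- c) \<cdot> ki"

definition nb :: "int \<Rightarrow> nat \<Rightarrow> 'b" where "nb c t = prod_list (map (\<lambda>s. hb (c - int s)) [0..<t])"

definition dn :: "nat \<Rightarrow> 'a" where "dn t = (\<Prod>s = 1..t. q ^ s - p ^ s)"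

text \<open>Lusztig's elements \<open>[k; c choose t]\<close>.\<close>

definition Kb :: "int \<Rightarrow> nat \<Rightarrow> 'b" where "Kb c t = (1 / dn t) \<cdot> nb c t"

lemma q_sub_p_power_nz: "q ^ Suc s - p ^ Suc s \<noteq> 0"
proof -
  have "q ^ Suc s - p ^ Suc s = (q - p) * qn q (int (Suc s))"
    unfolding qn_mult using power_int_of_nat[of q "Suc s"] by (simp only: power_int_minus power_inverse)
  then show ?thesis by (simp del: power_Suc of_nat_Suc)
qed

lemma dn_Suc: "dn (Suc t) = (q ^ Suc t - p ^ Suc t) * dn t"
  by (simp add: dn_def mult.commute)

lemma nb_Suc: "nb c (Suc t) = nb c t * hb (c - int t)"
  by (simp add: nb_def)

lemma nb_Suc': "nb (c + 1) (Suc t) = hb (c + 1) * nb c t"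
proof -
  have "[0..<Suc t] = 0 # map Suc [0..<t]" by (simp add: map_Suc_upt upt_conv_Cons del: upt_Suc)
  then have "nb (c + 1) (Suc t) = hb (c + 1) * prod_list (map (\<lambda>s. hb (c + 1 - int (Suc s))) [0..<t])"
    by (simp add: nb_def o_def del: upt_Suc)
  then show ?thesis by (simp add: nb_def)
qed

lemma hb_comm: "hb c * hb d = hb d * hb c"
  by (simp add: hb_def left_diff_distrib right_diff_distrib scl_simps mult.commute mult.left_commute)

lemma nb_hb_comm: "nb c t * hb d = hb d * nb c t"
proof (induct t)
  case (Suc t)
  have "nb c (Suc t) * hb d = nb c t * hb d * hb (c - int t)"
    unfolding nb_Suc by (simp add: mult.assoc hb_comm[of _ d])
  then show ?case unfolding Suc nb_Suc by (simp add: mult.assoc)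
qed (simp add: nb_def)

lemma xp_hb: "xp r * hb c = hb (c - 2) * xp r"
proof -
  have 1: "xp r * ki = (q * q) \<cdot> (ki * xp r)" by (simp add: ki_xp mult.assoc)
  have 2: "q powi (c - 2) = q powi c * (p * p)" "q powi (- (c - 2)) = q powi (- c) * (q * q)"
    by (simp_all add: power_int_diff power_int_minus power2_eq_square field_simps)
  show ?thesis
    unfolding hb_def 2 by (simp add: left_diff_distrib right_diff_distrib xp_k 1)
qed

lemma xp_nb: "xp r * nb c t = nb (c - 2) t * xp r"
proof (induct t)
  case (Suc t)
  have e: "c - int t - 2 = c - 2 - int t" by simp
  have "xp r * nb c (Suc t) = nb (c - 2) t * (xp r * hb (c - int t))"
    unfolding nb_Suc mult.assoc[symmetric] Suc ..
  then show ?case unfolding xp_hb nb_Suc e by (simp add: mult.assoc)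
qed (simp add: nb_def)

lemma xp_xm_dp: "xp 0 * dp (xm 0) (Suc b) = dp (xm 0) (Suc b) * xp 0 + (1 / (q - p)) \<cdot> (dp (xm 0) b * hb (- int b))"
proof (induct b)
  case 0
  show ?case using Br_0_0 by (simp add: Br_def cm_def kap_def hb_def algebra_simps)
next
  case (Suc b)
  let ?f = "xm 0" and ?d = "1 / (q - p)"
  have ef: "xp 0 * ?f = ?f * xp 0 + ?d \<cdot> (k - ki)"
    using Br_0_0 by (simp add: Br_def cm_def kap_def algebra_simps)
  have kf: "(k - ki) * ?f ^ n = ?f ^ n * hb (- 2 * int n)" for n
  proof (induct n)
    case (Suc n)
    have 2: "q powi (- 2 * int (Suc n)) = q powi (- 2 * int n) * (p * p)" "q powi (- (- 2 * int (Suc n))) = q powi (- (- 2 * int n)) * (q * q)"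
      by (simp_all add: power_int_diff power_int_minus power_int_add power2_eq_square field_simps)
    have "(k - ki) * ?f ^ Suc n = ?f ^ n * (hb (- 2 * int n) * ?f)"
      using Suc by (simp only: power_Suc2 mult.assoc[symmetric])
    also have "hb (- 2 * int n) * ?f = ?f * hb (- 2 * int (Suc n))"
      unfolding hb_def 2 by (simp add: left_diff_distrib right_diff_distrib k_xm ki_xm)
    finally show ?case by (simp only: power_Suc2 mult.assoc)
  qed (simp add: hb_def)
  then have kf: "(k - ki) * dp ?f n = dp ?f n * hb (- 2 * int n)" for n by (simp add: dp_def)
  let ?n = "qn q (int (Suc (Suc b)))"
  have "?n \<cdot> (xp 0 * dp ?f (Suc (Suc b))) = xp 0 * ?f * dp ?f (Suc b)"
    unfolding scl_mult_right[symmetric] dp_Suc by (simp add: mult.assoc)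
  also have "\<dots> = ?f * (xp 0 * dp ?f (Suc b)) + ?d \<cdot> ((k - ki) * dp ?f (Suc b))"
    unfolding ef by (simp add: distrib_right mult.assoc)
  also have "\<dots> = ?f * dp ?f (Suc b) * xp 0 + ?d \<cdot> (?f * dp ?f b * hb (- int b)) + ?d \<cdot> (dp ?f (Suc b) * hb (- 2 * int (Suc b)))"
    unfolding kf Suc by (simp add: distrib_left mult.assoc)
  also have "\<dots> = ?n \<cdot> (dp ?f (Suc (Suc b)) * xp 0) + ?d \<cdot> (dp ?f (Suc b) * (qn q (int (Suc b)) \<cdot> hb (- int b) + hb (- 2 * int (Suc b))))"
    unfolding dp_Suc[symmetric] by (simp add: distrib_left scl_simps add.assoc)
  also have "qn q (int (Suc b)) \<cdot> hb (- int b) + hb (- 2 * int (Suc b)) = ?n \<cdot> hb (- int (Suc b))"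
  proof -
    have 1: "q powi (- 2 * int (Suc b)) * qn q 1 + q powi (- int b) * qn q (int (Suc b)) = q powi (- int (Suc b)) * ?n"
      using qn_comb[of "- int b" "- int (Suc b)" 1 "- 2 * int (Suc b)" "int (Suc b)" "int (Suc (Suc b))"] by (simp add: add.commute)
    have 2: "q powi (- (- 2 * int (Suc b))) * qn q 1 + q powi (- (- int b)) * qn q (int (Suc b)) = q powi (- (- int (Suc b))) * ?n"
      by (rule qn_comb) simp_all
    show ?thesis
      unfolding hb_def V.scale_right_diff_distrib V.scale_scale mult.commute[of ?n] 1[symmetric] 2[symmetric]
      by (simp add: scl_left mult.commute del: of_nat_Suc) 
  qed
  finally have "?n \<cdot> (xp 0 * dp ?f (Suc (Suc b))) = ?n \<cdot> (dp ?f (Suc (Suc b)) * xp 0 + ?d \<cdot> (dp ?f (Suc b) * hb (- int (Suc b))))"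
    by (simp add: scl_simps mult.commute del: of_nat_Suc)
  then show ?case by (rule qn_cancel)
qed

text \<open>The coefficient identity needed to raise \<open>a\<close> by one in \<open>xp_xm_divided\<close>.\<close>

lemma Kb_rec:
  assumes "c = 2 * int (Suc t) - 2 - int a - int b"
  shows "qn q (int a - int t) \<cdot> Kb c (Suc t) + (1 / (q - p)) \<cdot> (hb (int (Suc t) - int b) * Kb c t)
    = qn q (int (Suc a)) \<cdot> Kb (c + 1) (Suc t)"
proof -
  let ?d = "q ^ Suc t - p ^ Suc t"
  have d: "?d = (q - p) * qn q (int (Suc t))"
    unfolding qn_mult using power_int_of_nat[of q "Suc t"] by (simp only: power_int_minus power_inverse)
  have d1: "?d * (1 / dn (Suc t)) = 1 / dn t"
    unfolding dn_Suc using q_sub_p_power_nz[of t] by simp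
  have 1: "q powi (int (Suc t) - int b) * qn q (int (Suc t)) + q powi (c - int t) * qn q (int a - int t) = q powi (c + 1) * qn q (int (Suc a))"
    by (rule qn_comb) (simp_all add: assms)
  have 2: "q powi (- (c - int t)) * qn q (int a - int t) + q powi (- (int (Suc t) - int b)) * qn q (int (Suc t)) = q powi (- (c + 1)) * qn q (int (Suc a))"
    by (rule qn_comb) (simp_all add: assms)
  have h: "qn q (int a - int t) \<cdot> hb (c - int t) + qn q (int (Suc t)) \<cdot> hb (int (Suc t) - int b) = qn q (int (Suc a)) \<cdot> hb (c + 1)"
    unfolding hb_def V.scale_right_diff_distrib V.scale_scale mult.commute[of "qn q _"] 1[symmetric] 2[symmetric]
    by (simp add: scl_left algebra_simps del: of_nat_Suc)
  have "(1 / (q - p)) \<cdot> (hb (int (Suc t) - int b) * Kb c t) = (1 / (q - p)) \<cdot> ((?d * (1 / dn (Suc t))) \<cdot> (hb (int (Suc t) - int b) * nb c t))"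
    unfolding d1 by (simp add: Kb_def)
  also have "\<dots> = (1 / dn (Suc t)) \<cdot> (qn q (int (Suc t)) \<cdot> (hb (int (Suc t) - int b) * nb c t))"
    unfolding d by (simp del: of_nat_Suc)
  finally have A: "(1 / (q - p)) \<cdot> (hb (int (Suc t) - int b) * Kb c t) = (1 / dn (Suc t)) \<cdot> ((qn q (int (Suc t)) \<cdot> hb (int (Suc t) - int b)) * nb c t)"
    by simp
  have B: "qn q (int a - int t) \<cdot> Kb c (Suc t) = (1 / dn (Suc t)) \<cdot> ((qn q (int a - int t) \<cdot> hb (c - int t)) * nb c t)"
    by (simp add: Kb_def nb_Suc nb_hb_comm mult.commute)
  have "qn q (int a - int t) \<cdot> Kb c (Suc t) + (1 / (q - p)) \<cdot> (hb (int (Suc t) - int b) * Kb c t)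
      = (1 / dn (Suc t)) \<cdot> ((qn q (int a - int t) \<cdot> hb (c - int t) + qn q (int (Suc t)) \<cdot> hb (int (Suc t) - int b)) * nb c t)"
    unfolding A B by (simp add: distrib_right scl_simps)
  also have "\<dots> = qn q (int (Suc a)) \<cdot> Kb (c + 1) (Suc t)"
    unfolding h Kb_def nb_Suc' by (simp add: mult.commute del: of_nat_Suc)
  finally show ?thesis .
qed

lemma xp_xm_divided:
  "a \<le> b \<Longrightarrow> dp (xp 0) a * dp (xm 0) b = (\<Sum>t\<le>a. dp (xm 0) (b - t) * Kb (2 * int t - int a - int b) t * dp (xp 0) (a - t))"
proof (induct a)
  case 0
  show ?case by (simp add: Kb_def nb_def dn_def)
next
  case (Suc a)
  let ?e = "dp (xp 0)" and ?f = "dp (xm 0)" and ?c = "\<lambda>t. 2 * int t - 2 - int a - int b"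
  let ?U = "\<lambda>t. ?f (b - t) * (qn q (int (Suc a) - int t) \<cdot> Kb (?c t) t) * ?e (Suc a - t)"
  let ?V = "\<lambda>t. ?f (b - Suc t) * ((1 / (q - p)) \<cdot> (hb (int (Suc t) - int b) * Kb (?c (Suc t)) t)) * ?e (Suc a - Suc t)"
  have "qn q (int (Suc a)) \<cdot> (?e (Suc a) * ?f b) = xp 0 * (?e a * ?f b)"
    unfolding scl_mult_left[symmetric] dp_Suc by (simp add: mult.assoc)
  also have "\<dots> = (\<Sum>t\<le>a. xp 0 * ?f (b - t) * Kb (2 * int t - int a - int b) t * ?e (a - t))"
    using Suc by (simp add: sum_distrib_left mult.assoc)
  also have "\<dots> = (\<Sum>t\<le>a. ?U t) + (\<Sum>t\<le>a. ?V t)"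
    unfolding sum.distrib[symmetric]
  proof (rule sum.cong[OF refl])
    fix t assume t: "t \<in> {..a}"
    define b' where "b' = b - Suc t"
    have b': "b - t = Suc b'" using t Suc(2) by (simp add: b'_def)
    have e1: "xp 0 * ?e (a - t) = qn q (int (Suc a) - int t) \<cdot> ?e (Suc a - t)"
      using dp_Suc[of "a - t" "xp 0"] t by (simp add: Suc_diff_le of_nat_diff algebra_simps)
    have ib: "b - Suc t = b'" "- int b' = int (Suc t) - int b" using t Suc(2) by (simp_all add: b'_def of_nat_diff)
    have K: "xp 0 * Kb (2 * int t - int a - int b) t = Kb (?c t) t * xp 0"
      by (simp add: Kb_def xp_nb algebra_simps)
    have "xp 0 * ?f (b - t) * Kb (2 * int t - int a - int b) t * ?e (a - t)
       = ?f (b - t) * (xp 0 * Kb (2 * int t - int a - int b) t) * ?e (a - t)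
       + (1 / (q - p)) \<cdot> (?f b' * hb (- int b') * Kb (2 * int t - int a - int b) t * ?e (a - t))"
      unfolding b' xp_xm_dp by (simp add: distrib_right mult.assoc)
    also have "?f (b - t) * (xp 0 * Kb (2 * int t - int a - int b) t) * ?e (a - t) = ?f (b - t) * Kb (?c t) t * (xp 0 * ?e (a - t))"
      unfolding K by (simp add: mult.assoc)
    also have "\<dots> = ?U t"
      unfolding e1 by (simp add: mult.assoc)
    also have "(1 / (q - p)) \<cdot> (?f b' * hb (- int b') * Kb (2 * int t - int a - int b) t * ?e (a - t)) = ?V t"
      unfolding ib by (simp add: mult.assoc)
    finally show "xp 0 * ?f (b - t) * Kb (2 * int t - int a - int b) t * ?e (a - t) = ?U t + ?V t" .
  qed
  also have "(\<Sum>t\<le>a. ?U t) = ?U 0 + (\<Sum>t\<le>a. ?U (Suc t))"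
    using sum.atMost_Suc_shift[of ?U a] by simp
  also have "?U 0 + (\<Sum>t\<le>a. ?U (Suc t)) + (\<Sum>t\<le>a. ?V t) = ?U 0 + (\<Sum>t\<le>a. ?U (Suc t) + ?V t)"
    by (simp only: sum.distrib add.assoc)
  also have "(\<Sum>t\<le>a. ?U (Suc t) + ?V t) = (\<Sum>t\<le>a. qn q (int (Suc a)) \<cdot> (?f (b - Suc t) * Kb (?c (Suc t) + 1) (Suc t) * ?e (Suc a - Suc t)))"
  proof (rule sum.cong[OF refl])
    fix t assume "t \<in> {..a}"
    have "?U (Suc t) + ?V t = ?f (b - Suc t) * (qn q (int a - int t) \<cdot> Kb (?c (Suc t)) (Suc t) + (1 / (q - p)) \<cdot> (hb (int (Suc t) - int b) * Kb (?c (Suc t)) t)) * ?e (Suc a - Suc t)"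
      by (simp add: distrib_left distrib_right)
    then show "?U (Suc t) + ?V t = qn q (int (Suc a)) \<cdot> (?f (b - Suc t) * Kb (?c (Suc t) + 1) (Suc t) * ?e (Suc a - Suc t))"
      unfolding Kb_rec[OF refl] by (simp del: of_nat_Suc)
  qed
  also have "?U 0 + (\<Sum>t\<le>a. qn q (int (Suc a)) \<cdot> (?f (b - Suc t) * Kb (?c (Suc t) + 1) (Suc t) * ?e (Suc a - Suc t)))
     = (\<Sum>t\<le>Suc a. qn q (int (Suc a)) \<cdot> (?f (b - t) * Kb (2 * int t - int (Suc a) - int b) t * ?e (Suc a - t)))"
    unfolding sum.atMost_Suc_shift[of _ a]
    by (simp add: Kb_def nb_def dn_def del: of_nat_Suc) (simp add: algebra_simps del: V.scale_left_distrib)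
  finally have "qn q (int (Suc a)) \<cdot> (?e (Suc a) * ?f b) = qn q (int (Suc a)) \<cdot> (\<Sum>t\<le>Suc a. ?f (b - t) * Kb (2 * int t - int (Suc a) - int b) t * ?e (Suc a - t))"
    by (simp only: scl_sum_right)
  then show ?case by (rule qn_cancel)
qed

lemma Kb_pascal: "Kb (c + 1) (Suc t) = q ^ Suc t \<cdot> Kb c (Suc t) + q powi (int t - c) \<cdot> (ki * Kb c t)"
proof -
  let ?d = "q ^ Suc t - p ^ Suc t"
  have d1: "1 / dn t = ?d * (1 / dn (Suc t))"
    unfolding dn_Suc using q_sub_p_power_nz[of t] by simp
  have 1: "q powi (c + 1) = q ^ Suc t * q powi (c - int t)"
    by (simp add: power_int_add power_int_diff)
  have 2: "q powi (- (c + 1)) = q ^ Suc t * q powi (- (c - int t)) - q powi (int t - c) * ?d"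
  proof -
    have "q powi (int t - c) * p ^ Suc t = q powi (- (c + 1))"
      by (simp add: power_int_add power_int_diff power_int_minus power_inverse divide_inverse)
    then show ?thesis by (simp add: right_diff_distrib mult.commute)
  qed
  have h: "hb (c + 1) = q ^ Suc t \<cdot> hb (c - int t) + (q powi (int t - c) * ?d) \<cdot> ki"
    unfolding hb_def 1 2 by (simp add: scl_left scl_simps del: power_Suc)
  have "Kb (c + 1) (Suc t) = (1 / dn (Suc t)) \<cdot> (q ^ Suc t \<cdot> (hb (c - int t) * nb c t) + (q powi (int t - c) * ?d) \<cdot> (ki * nb c t))"
    unfolding Kb_def nb_Suc' h by (simp add: distrib_right del: power_Suc)
  also have "\<dots> = q ^ Suc t \<cdot> Kb c (Suc t) + q powi (int t - c) \<cdot> (ki * Kb c t)"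
    unfolding Kb_def nb_Suc nb_hb_comm d1 by (simp add: scl_simps mult.commute mult.left_commute del: power_Suc)
  finally show ?thesis .
qed

text \<open>The term \<open>t = r\<close> of \<open>xp_xm_divided\<close> for \<open>a = b = r\<close> is the element in question.  The other terms contain
  elements with smaller \<open>t\<close> and negative first argument, which the Pascal rule reduces to argument zero.\<close>

lemma Kb_integral:
  assumes S: "integral_form sc q S" "ki \<in> S" and dp: "\<And>t. dp (xp 0) t \<in> S" "\<And>t. dp (xm 0) t \<in> S"
  shows "Kb 0 r \<in> S"
proof (induct r rule: less_induct)
  case (less r)
  interpret I: integral_form sc q S by (rule S(1))
  have neg: "t < r \<longrightarrow> (\<forall>d. Kb (- int d) t \<in> S)" for t
  proof (induct t)
    case 0
    show ?case by (simp add: Kb_def nb_def dn_def)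
  next
    case IH: (Suc t)
    have "Kb (- int d) (Suc t) \<in> S" if r: "Suc t < r" for d
    proof (induct d)
      case 0
      then show ?case using less[of "Suc t"] r by simp
    next
      case (Suc d)
      have e: "- int (Suc d) + 1 = - int d" by simp
      have "p ^ Suc t \<cdot> (q ^ Suc t \<cdot> Kb (- int (Suc d)) (Suc t)) = p ^ Suc t \<cdot> (Kb (- int d) (Suc t) - q powi (int t - (- int (Suc d))) \<cdot> (ki * Kb (- int (Suc d)) t))"
        using Kb_pascal[of "- int (Suc d)" t] unfolding e by simp
      moreover have "p ^ Suc t * q ^ Suc t = 1" by (simp only: power_mult_distrib[symmetric] q_p(2) power_one)
      ultimately have "Kb (- int (Suc d)) (Suc t) = p ^ Suc t \<cdot> (Kb (- int d) (Suc t) - q powi (int t - (- int (Suc d))) \<cdot> (ki * Kb (- int (Suc d)) t))"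
        unfolding V.scale_scale by (simp only: V.scale_one)
      moreover have "Kb (- int (Suc d)) t \<in> S"
        by (rule IH[rule_format]) (use r in simp)
      then have "p ^ Suc t \<cdot> (Kb (- int d) (Suc t) - q powi (int t - (- int (Suc d))) \<cdot> (ki * Kb (- int (Suc d)) t)) \<in> S"
        by (intro I.S_p_power I.S_diff I.S_powi I.S_mult S(2) Suc)
      ultimately show ?case by (simp only:)
    qed
    then show ?case by blast
  qed
  have c: "2 * int t - int r - int r = - int (2 * r - 2 * t)" if "t \<le> r" for t using that by simp
  have "dp (xp 0) r * dp (xm 0) r = (\<Sum>t<r. dp (xm 0) (r - t) * Kb (2 * int t - int r - int r) t * dp (xp 0) (r - t)) + Kb 0 r"
    unfolding xp_xm_divided[OF order_refl] by (simp add: lessThan_Suc_atMost[symmetric])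
  then have "Kb 0 r = dp (xp 0) r * dp (xm 0) r - (\<Sum>t<r. dp (xm 0) (r - t) * Kb (2 * int t - int r - int r) t * dp (xp 0) (r - t))"
    by simp
  moreover have "dp (xm 0) (r - t) * Kb (2 * int t - int r - int r) t * dp (xp 0) (r - t) \<in> S" if t: "t < r" for t
  proof -
    have "Kb (2 * int t - int r - int r) t \<in> S"
      unfolding c[OF less_imp_le[OF t]] by (rule neg[rule_format, OF t])
    then show ?thesis by (intro I.S_mult dp)
  qed
  then have "(\<Sum>t<r. dp (xm 0) (r - t) * Kb (2 * int t - int r - int r) t * dp (xp 0) (r - t)) \<in> S"
    by (intro I.S_sum) simp
  then have "dp (xp 0) r * dp (xm 0) r - (\<Sum>t<r. dp (xm 0) (r - t) * Kb (2 * int t - int r - int r) t * dp (xp 0) (r - t)) \<in> S"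
    by (intro I.S_diff I.S_mult dp)
  ultimately show ?case by (simp only:)
qed

end

section \<open>Integrality of the loop Cartan elements\<close>

lemma triangle_sum:
  fixes f :: "nat \<Rightarrow> nat \<Rightarrow> 'c::comm_monoid_add"
  shows "(\<Sum>m\<le>b. \<Sum>l\<le>m. f l (m - l)) = (\<Sum>l\<le>b. \<Sum>s\<le>b - l. f l s)"
proof -
  have "(\<Sum>m\<le>b. \<Sum>l\<le>m. f l (m - l)) = (\<Sum>(i, j)\<in>{(i, j). i + j \<le> b}. f i j)"
    by (rule sum.triangle_reindex_eq[symmetric])
  also have "{(i, j). i + j \<le> b} = (SIGMA l:{..b}. {..b - l})" by auto
  finally show ?thesis by (simp add: sum.Sigma)
qed

lemma fps_power_nth_0: "fps_nth ((f :: 'a::ring_1 fps) ^ i) 0 = fps_nth f 0 ^ i"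
  by (induct i) simp_all

context quantum
begin

text \<open>The special form of \<open>special_powers\<close> in which powers of \<open>b\<close> are expressed through powers of \<open>c\<close> with at
  most one factor \<open>b\<close>.\<close>

lemma special_quotient:
  assumes cb: "(1 + q * q) \<star> (c * b) = (q * q) \<star> (c * c) + b * b"
  shows "p ^ Suc i \<star> b ^ Suc i = c ^ i * ((p * qn q (int (Suc i))) \<star> b - qn q (int i) \<star> c)"
proof (induct i)
  case (Suc i)
  have b2: "b * b = (1 + q * q) \<star> (c * b) - (q * q) \<star> (c * c)" unfolding cb by simp
  have n: "p * (p * (qn q (int (Suc i)) * (1 + q * q))) = p * (qn q (int (Suc (Suc i))) + qn q (int i))"
  proof -
    have "qn q (int (Suc (Suc i))) + qn q (int i) = (q + p) * qn q (int (Suc i))"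
      unfolding qn_2_mult by (simp add: add.commute)
    moreover have "p * (1 + q * q) = q + p" by (simp add: distrib_left)
    ultimately show ?thesis by (metis mult.commute mult.left_commute)
  qed
  have "p ^ Suc (Suc i) \<star> b ^ Suc (Suc i) = p \<star> ((p ^ Suc i \<star> b ^ Suc i) * b)"
    by (simp add: power_commutes mult.assoc)
  also have "\<dots> = c ^ i * ((p * (p * qn q (int (Suc i)))) \<star> (b * b) - (p * qn q (int i)) \<star> (c * b))"
    unfolding Suc by (simp add: mult.assoc left_diff_distrib FV.scale_right_diff_distrib right_diff_distrib del: of_nat_Suc)
  also have "(p * (p * qn q (int (Suc i)))) \<star> (b * b) - (p * qn q (int i)) \<star> (c * b)
     = (p * (p * (qn q (int (Suc i)) * (1 + q * q)))) \<star> (c * b) - (p * qn q (int i)) \<star> (c * b) - (p * (p * (qn q (int (Suc i)) * (q * q)))) \<star> (c * c)"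
    unfolding b2 FV.scale_right_diff_distrib FV.scale_scale mult.assoc by simp
  also have "\<dots> = (p * qn q (int (Suc (Suc i)))) \<star> (c * b) - qn q (int (Suc i)) \<star> (c * c)"
    unfolding n by (simp add: distrib_left FV.scale_left_distrib mult.left_commute[of "qn q _"] del: of_nat_Suc)
  also have "\<dots> = c * ((p * qn q (int (Suc (Suc i)))) \<star> b - qn q (int (Suc i)) \<star> c)"
    by (simp add: right_diff_distrib del: of_nat_Suc)
  finally show ?case by (simp only: mult.assoc power_Suc2)
qed simp

end

context loop_serre
begin

definition kic :: "'b fps" where "kic = fps_const ki"

definition Zc :: "'b fps" where "Zc = - (gs xm 1 1 * kic)"

text \<open>The half current of lowering vectors, starting in degree \<open>1\<close> and normalised by the torus.\<close>

definition Yc :: "'b fps" where "Yc = fps_X * Zc"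

abbreviation Ym :: "'b fps" where "Ym \<equiv> dil (p * p) Yc"

abbreviation e0 :: "'b fps" where "e0 \<equiv> fps_const (xp 0)"

definition xh :: "int \<Rightarrow> 'b fps" where
  "xh r = Abs_fps (\<lambda>i. qn q (int i + 1) \<cdot> xp (r + int i))"

lemma xp_PP: "fps_const (xp r) * PP = PP * xh r"
proof -
  define U where "U r = PP * xh r - fps_const (xp r) * PP" for r
  have xh3: "xh r - (q + p) \<star> (fps_X * xh (r + 1)) + fps_X * (fps_X * xh (r + 2)) = fps_const (xp r)" for r
  proof (rule fps_ext)
    fix n
    consider "n = 0" | "n = Suc 0" | i where "n = Suc (Suc i)" by (metis not0_implies_Suc)
    then show "fps_nth (xh r - (q + p) \<star> (fps_X * xh (r + 1)) + fps_X * (fps_X * xh (r + 2))) n = fps_nth (fps_const (xp r)) n"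
    proof cases
      case 2
      then show ?thesis using qn_2 by (simp add: xh_def)
    next
      case 3
      have e: "r + 1 + int (Suc i) = r + int (Suc (Suc i))" "r + 2 + int i = r + int (Suc (Suc i))" by simp_all
      have "(q + p) * qn q (int (Suc i) + 1) = qn q (int (Suc (Suc i)) + 1) + qn q (int i + 1)"
        unfolding qn_2_mult by (simp add: add.commute)
      then show ?thesis unfolding 3 by (simp add: xh_def e scl_left del: of_nat_Suc)
    qed (simp add: xh_def)
  qed
  have PPx: "PP * fps_const (xp r) = xi r * PP" for r
    by (rule agree_all) (rule PP_xp[OF Psi_acts_all])
  have U: "U r = (q + p) \<star> (fps_X * U (r + 1)) - fps_X * (fps_X * U (r + 2))" for r
  proof -
    have h1: "PP * xh r - (q + p) \<star> (fps_X * (PP * xh (r + 1))) + fps_X * (fps_X * (PP * xh (r + 2))) = xi r * PP"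
      unfolding PPx[symmetric] xh3[symmetric] by (simp add: distrib_left right_diff_distrib X_comm'[of PP])
    have h2: "xi r * PP = fps_const (xp r) * PP - (q + p) \<star> (fps_X * (fps_const (xp (r + 1)) * PP)) + fps_X * (fps_X * (fps_const (xp (r + 2)) * PP))"
      unfolding xi_def by (simp add: left_diff_distrib distrib_right mult.assoc)
    have "A - a = (B - b) - (C - c)" if h: "A - B + C = z" "z = a - b + c" for A B C a b c z :: "'b fps"
    proof -
      have "A = (A - B + C) + B - C" by simp
      also have "\<dots> = (a - b + c) + B - C" unfolding h ..
      finally show ?thesis by (simp add: algebra_simps)
    qed
    from this[OF h1 h2] show ?thesis
      unfolding U_def right_diff_distrib FV.scale_right_diff_distrib .
  qed
  have "fps_nth (U r) n = 0" for n r
  proof (induct n arbitrary: r rule: less_induct)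
    case (less n)
    have "fps_nth (U r) n = fps_nth ((q + p) \<star> (fps_X * U (r + 1)) - fps_X * (fps_X * U (r + 2))) n"
      by (subst U) (rule refl)
    also have "\<dots> = 0"
    proof (cases n)
      case (Suc m)
      then show ?thesis using less[of m "r + 1"] less[of "m - 1" "r + 2"] by (cases m) simp_all
    qed simp
    finally show ?case .
  qed
  then have "U r = 0" by (simp add: fps_eq_iff)
  then show ?thesis by (simp add: U_def)
qed

lemma kic_gs: "kic * gs xm r c = (q * q) \<star> (gs xm r c * kic)" "kic * (gs xm r c * f) = (q * q) \<star> (gs xm r c * (kic * f))"
proof -
  show 1: "kic * gs xm r c = (q * q) \<star> (gs xm r c * kic)"
    by (simp add: fps_eq_iff kic_def ki_xm mult.left_commute mult.commute)
  show "kic * (gs xm r c * f) = (q * q) \<star> (gs xm r c * (kic * f))"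
    using arg_cong[OF 1, of "\<lambda>u. u * f"] by (simp add: mult.assoc)
qed

lemma Ym_eq: "Ym = - ((p * p) \<star> (fps_X * (gs xm 1 (p * p) * kic)))"
proof -
  have "Yc = - (fps_X * (gs xm 1 1 * kic))" by (simp add: Yc_def Zc_def)
  moreover have "dil c (- f) = - dil c f" for c and f :: "'b fps" by (simp add: fps_eq_iff)
  moreover have "dil (p * p) kic = kic" by (simp add: kic_def)
  moreover have "dil c (gs xm 1 1 * f) = gs xm 1 c * dil c f" for c f by (simp add: dil_mult dil_gs)
  ultimately show ?thesis by (simp add: dil_X)
qed

lemma Psi_kic: "Psi * kic = kic * Psi"
  using k_phi(2) by (auto simp: fps_eq_iff kic_def Psi_def cm_eq_0)

lemma Psi_Yc: "Psi * Yc = ((q * q * q * (q + p)) \<star> Ym - (q * q) \<star> Yc) * Psi"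
proof -
  have 1: "Psi * gs xm 1 1 = ((1 + q * q) \<star> gs xm 1 (p * p) - (q * q) \<star> gs xm 1 1) * Psi"
    by (rule agree_all) (rule Psi_gs[OF Psi_acts_all])
  have c: "q * q * q * (q + p) * (p * p) = 1 + q * q"
    by (simp add: algebra_simps)
  have Y: "Yc = - (fps_X * (gs xm 1 1 * kic))" by (simp add: Yc_def Zc_def)
  have "Psi * Yc = - (fps_X * ((Psi * gs xm 1 1) * kic))"
    unfolding Y by (simp add: X_comm'[of Psi] mult.assoc)
  also have "\<dots> = - (fps_X * (((1 + q * q) \<star> gs xm 1 (p * p) - (q * q) \<star> gs xm 1 1) * kic * Psi))"
    unfolding 1 by (simp add: mult.assoc Psi_kic)
  also have "\<dots> = ((q * q * q * (q + p)) \<star> Ym - (q * q) \<star> Yc) * Psi"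
    unfolding Ym_eq unfolding Y FV.scale_minus_right FV.scale_scale c
    by (simp only: left_diff_distrib right_diff_distrib mult.assoc fs_mult_left fs_mult_right mult_minus_left) simp
  finally show ?thesis .
qed

lemma Yc_quadratic: "(1 + q * q) \<star> (Ym * Yc) = (q * q) \<star> (Ym * Ym) + Yc * Yc"
proof -
  let ?g = "gs xm 1 1" and ?h = "gs xm 1 (p * p)"
  have "(1 + p * p) \<star> (?h * ?g) = (p * p) \<star> (?h * ?h) + ?g * ?g"
  proof -
    interpret N: loop_serre sc p k ki "\<lambda>r. xm (r + 1)" "\<lambda>r. xp (r - 1)" by (rule mirror_swap)
    have c1: "N.cur 0 = ?g" by (simp add: fps_eq_iff add.commute)
    show ?thesis using N.cur_dil[of 0] unfolding c1 by (simp add: dil_gs)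
  qed
  then have "(q * q) \<star> ((1 + p * p) \<star> (?h * ?g)) = (q * q) \<star> ((p * p) \<star> (?h * ?h) + ?g * ?g)" by simp
  then have 1: "(1 + q * q) \<star> (?h * ?g) = ?h * ?h + (q * q) \<star> (?g * ?g)"
    by (simp add: FV.scale_right_distrib distrib_left mult.assoc add.commute)
  let ?W = "\<lambda>f. fps_X * (fps_X * (f * (kic * kic)))"
  have Y: "Yc = - (fps_X * (?g * kic))" by (simp add: Yc_def Zc_def)
  have a: "Ym * Yc = ?W (?h * ?g)" "Ym * Ym = ?W ((p * p) \<star> (?h * ?h))" "Yc * Yc = ?W ((q * q) \<star> (?g * ?g))"
    unfolding Ym_eq unfolding Y by (simp_all add: mult.assoc X_comm'[of "gs _ _ _"] X_comm'[of kic] kic_gs)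
  have "?W ((1 + q * q) \<star> (?h * ?g)) = ?W (?h * ?h) + ?W ((q * q) \<star> (?g * ?g))"
    unfolding 1 by (simp only: distrib_left distrib_right)
  then show ?thesis unfolding a by (simp add: mult.assoc)
qed

lemma e0_Yc: "(q - p) \<star> (e0 * Yc) = ((q - p) * (q * q)) \<star> (Yc * e0) - (Psi - 1)"
proof (rule fps_ext)
  fix n
  show "fps_nth ((q - p) \<star> (e0 * Yc)) n = fps_nth (((q - p) * (q * q)) \<star> (Yc * e0) - (Psi - 1)) n"
  proof (cases n)
    case 0
    then show ?thesis by (simp add: Yc_def Psi_nth)
  next
    case (Suc m)
    have Br: "cm (xp 0) (xm (1 + int m)) = k * phi (Suc m)"
      using Br_phi[of "Suc m" 0 "1 + int m"] by (simp add: Br_def)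
    have kk: "k * phi (Suc m) * ki = phi (Suc m)"
      using k_phi(2)[of "Suc m"] by (simp add: cm_eq_0 mult.assoc flip: \<open>cm ki (phi (Suc m)) = 0\<close>[unfolded cm_eq_0])
    have "xp 0 * (xm (1 + int m) * ki) - (q * q) \<cdot> (xm (1 + int m) * (ki * xp 0)) = cm (xp 0) (xm (1 + int m)) * ki"
      by (simp add: ki_xp cm_def left_diff_distrib mult.assoc)
    then have "xp 0 * (xm (1 + int m) * ki) = (q * q) \<cdot> (xm (1 + int m) * (ki * xp 0)) + phi (Suc m)"
      unfolding Br kk by (simp add: algebra_simps)
    then show ?thesis
      unfolding Suc by (simp add: Yc_def Zc_def kic_def Psi_nth mult.assoc scl_simps)
  qed
qed

text \<open>The commutator of \<open>xp 0\<close> with one factor \<open>Yc\<close> is \<open>Psi\<close>, up to a constant.  Moving this \<open>Psi\<close> to the right through the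
  other factors turns \<open>Yc\<close> into a combination of \<open>Yc\<close> and \<open>Ym\<close>, which \<open>special_quotient\<close> reduces to
  two terms.\<close>

lemma e0_Yc_power:
  "(q - p) \<star> (e0 * Yc ^ Suc m) = ((q - p) * q ^ (2 * Suc m)) \<star> (Yc ^ Suc m * e0)
     - ((q ^ (3 * m) * qn q (int (Suc m))) \<star> (Ym ^ m * Psi) - (q ^ m * qn q (int (Suc m))) \<star> Yc ^ m)"
proof (induct m)
  case 0
  show ?case using e0_Yc by (simp add: power2_eq_square)
next
  case (Suc m)
  let ?n = "qn q (int (Suc m))" and ?n2 = "qn q (int (Suc (Suc m)))" and ?nz = "qn q (int m)"
  have n2: "?n2 + ?nz = (q + p) * ?n"
  proof -
    have e: "int (Suc m) + 1 = int (Suc (Suc m))" "int (Suc m) - 1 = int m" by simp_all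
    have "(q + p) * ?n = ?n2 + ?nz" using qn_2_mult[of "int (Suc m)"] unfolding e .
    then show ?thesis by (rule sym)
  qed
  have n2': "q ^ Suc m * ?n2 = q ^ (2 * Suc m) + q ^ m * ?n"
  proof -
    have "?n2 = q ^ Suc m + p * ?n"
      using qn_add[of 1 "int (Suc m)"] power_int_of_nat[of q "Suc m"] by (simp add: power_int_minus del: power_int_of_nat power_Suc of_nat_Suc) simp
    then show ?thesis by (simp add: distrib_left mult_2 power_add mult.assoc mult.left_commute del: of_nat_Suc)
  qed
  have "(q - p) \<star> (e0 * Yc ^ Suc (Suc m)) = ((q - p) \<star> (e0 * Yc ^ Suc m)) * Yc"
    by (simp only: power_Suc2 fs_mult_left mult.assoc)
  also have "\<dots> = q ^ (2 * Suc m) \<star> (Yc ^ Suc m * ((q - p) \<star> (e0 * Yc)))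
     - ((q ^ (3 * m) * ?n) \<star> (Ym ^ m * (Psi * Yc)) - (q ^ m * ?n) \<star> Yc ^ Suc m)"
    unfolding Suc by (simp only: left_diff_distrib[of _ _ Yc] fs_mult_left fs_mult_right mult.assoc FV.scale_scale power_Suc2 mult.commute[of "q - p"])
  also have "Yc ^ Suc m * ((q - p) \<star> (e0 * Yc)) = ((q - p) * (q * q)) \<star> (Yc ^ Suc (Suc m) * e0) - Yc ^ Suc m * Psi + Yc ^ Suc m"
    unfolding e0_Yc by (simp only: right_diff_distrib fs_mult_right mult.assoc power_Suc2 mult_1_right) simp
  also have "Ym ^ m * (Psi * Yc) = (Ym ^ m * ((q * q * q * (q + p)) \<star> Ym - (q * q) \<star> Yc)) * Psi"
    unfolding Psi_Yc by (simp only: mult.assoc)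
  finally have 1: "(q - p) \<star> (e0 * Yc ^ Suc (Suc m)) = ((q - p) * (q ^ (2 * Suc m) * (q * q))) \<star> (Yc ^ Suc (Suc m) * e0)
     - (q ^ (2 * Suc m) \<star> Yc ^ Suc m + (q ^ (3 * m) * ?n) \<star> (Ym ^ m * ((q * q * q * (q + p)) \<star> Ym - (q * q) \<star> Yc))) * Psi
     + (q ^ (2 * Suc m) + q ^ m * ?n) \<star> Yc ^ Suc m"
    by (simp add: FV.scale_right_diff_distrib FV.scale_right_distrib FV.scale_left_distrib distrib_right mult.assoc mult.commute mult.left_commute del: power_Suc of_nat_Suc mult_Suc_right)
  have Y: "Yc ^ Suc m = q ^ Suc m \<star> (Ym ^ m * ((p * ?n) \<star> Yc - ?nz \<star> Ym))"
  proof -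
    have "q ^ Suc m \<star> (p ^ Suc m \<star> Yc ^ Suc m) = q ^ Suc m \<star> (Ym ^ m * ((p * ?n) \<star> Yc - ?nz \<star> Ym))"
      unfolding special_quotient[OF Yc_quadratic, of m] ..
    moreover have "q ^ Suc m * p ^ Suc m = 1" by (simp only: power_mult_distrib[symmetric] q_p(1) power_one)
    ultimately show ?thesis unfolding FV.scale_scale by (simp only: FV.scale_one)
  qed
  have q3: "q ^ (2 * Suc m) * q ^ Suc m = q ^ (3 * Suc m)" "q ^ (3 * m) * (q * q * q) = q ^ (3 * Suc m)"
    "q ^ (3 * m) * (q * q) = q ^ (3 * Suc m) * p"
    by (simp_all add: power_add[symmetric] algebra_simps power3_eq_cube numeral_3_eq_3)
  have "q ^ (2 * Suc m) \<star> Yc ^ Suc m + (q ^ (3 * m) * ?n) \<star> (Ym ^ m * ((q * q * q * (q + p)) \<star> Ym - (q * q) \<star> Yc))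
     = Ym ^ m * (((q ^ (2 * Suc m) * q ^ Suc m) * (p * ?n)) \<star> Yc - ((q ^ (2 * Suc m) * q ^ Suc m) * ?nz) \<star> Ym)
     + Ym ^ m * (((q ^ (3 * m) * (q * q * q)) * ((q + p) * ?n)) \<star> Ym - ((q ^ (3 * m) * (q * q)) * ?n) \<star> Yc)"
    unfolding Y by (simp add: FV.scale_right_diff_distrib right_diff_distrib mult.assoc mult.left_commute[of ?n] mult.commute[of ?n] del: power_Suc of_nat_Suc mult_Suc_right)
  also have "\<dots> = Ym ^ m * ((q ^ (3 * Suc m) * ((q + p) * ?n) - q ^ (3 * Suc m) * ?nz) \<star> Ym)"
    unfolding q3 by (simp add: FV.scale_left_diff_distrib right_diff_distrib mult.assoc del: power_Suc of_nat_Suc mult_Suc_right)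
  also have "q ^ (3 * Suc m) * ((q + p) * ?n) - q ^ (3 * Suc m) * ?nz = q ^ (3 * Suc m) * ?n2"
    unfolding n2[symmetric] by (simp add: distrib_left del: of_nat_Suc)
  finally have 2: "q ^ (2 * Suc m) \<star> Yc ^ Suc m + (q ^ (3 * m) * ?n) \<star> (Ym ^ m * ((q * q * q * (q + p)) \<star> Ym - (q * q) \<star> Yc))
     = (q ^ (3 * Suc m) * ?n2) \<star> Ym ^ Suc m"
    by (simp only: fs_mult_right power_Suc2)
  have q2: "q ^ (2 * Suc m) * (q * q) = q ^ (2 * Suc (Suc m))" by simp
  show ?case unfolding 1 2 q2 n2'[symmetric] by (simp only: fs_mult_left diff_diff_eq2 diff_add_eq)
qed

text \<open>The generating function of the products of \<open>m\<close> lowering vectors and a Cartan factor.  The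
  rescalings of its two factors are chosen so that commuting with \<open>xp 0\<close> becomes \<open>e0_Wc\<close>.\<close>

definition Wc :: "nat \<Rightarrow> 'b fps" where
  "Wc m = (q powi (- (int m * (int m - 1))) / qfac q m) \<star> (dil (q powi (int m - 1)) Yc ^ m * dil (q ^ m) PP)"

lemma Wc_0: "Wc 0 = PP"
  by (simp add: Wc_def)

lemma e0_Wc:
  "(q - p) \<star> (e0 * Wc (Suc m)) = ((q - p) * q ^ (2 * Suc m)) \<star> (Wc (Suc m) * dil (q ^ Suc m) (xh 0))
     - (q powi int m \<star> dil p (Wc m) - q powi (- int m) \<star> dil q (Wc m))"
proof -
  let ?n = "qn q (int (Suc m))" and ?c = "q ^ m"
  have eP: "e0 * dil q PP = dil q PP * dil q (xh 0)"
    using arg_cong[OF xp_PP[of 0], of "dil q"] by (simp add: dil_mult)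
  have "(q - p) \<star> (e0 * Yc ^ Suc m) * dil q PP = (((q - p) * q ^ (2 * Suc m)) \<star> (Yc ^ Suc m * e0)
     - ((q ^ (3 * m) * ?n) \<star> (Ym ^ m * Psi) - (q ^ m * ?n) \<star> Yc ^ m)) * dil q PP"
    unfolding e0_Yc_power ..
  then have "(q - p) \<star> (e0 * (Yc ^ Suc m * dil q PP)) = ((q - p) * q ^ (2 * Suc m)) \<star> (Yc ^ Suc m * dil q PP * dil q (xh 0))
     - ((q ^ (3 * m) * ?n) \<star> (Ym ^ m * dil p PP) - (q ^ m * ?n) \<star> (Yc ^ m * dil q PP))"
    unfolding PP_equation by (simp only: left_diff_distrib fs_mult_left mult.assoc eP)
  then have "dil ?c ((q - p) \<star> (e0 * (Yc ^ Suc m * dil q PP))) = dil ?c (((q - p) * q ^ (2 * Suc m)) \<star> (Yc ^ Suc m * dil q PP * dil q (xh 0))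
     - ((q ^ (3 * m) * ?n) \<star> (Ym ^ m * dil p PP) - (q ^ m * ?n) \<star> (Yc ^ m * dil q PP)))"
    by (simp only:)
  moreover have qq: "?c * q = q ^ Suc m" by simp
  ultimately have A: "(q - p) \<star> (e0 * (dil ?c Yc ^ Suc m * dil (q ^ Suc m) PP)) = ((q - p) * q ^ (2 * Suc m)) \<star> (dil ?c Yc ^ Suc m * dil (q ^ Suc m) PP * dil (q ^ Suc m) (xh 0))
     - ((q ^ (3 * m) * ?n) \<star> (dil (?c * (p * p)) Yc ^ m * dil (?c * p) PP) - (q ^ m * ?n) \<star> (dil ?c Yc ^ m * dil (q ^ Suc m) PP))"
    by (simp only: dil_simps dil_mult dil_power qq)
  define w where "w = q powi (- (int (Suc m) * int m)) / qfac q (Suc m)"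
  define v where "v = q powi (- (int m * (int m - 1))) / qfac q m"
  have W1: "Wc (Suc m) = w \<star> (dil ?c Yc ^ Suc m * dil (q ^ Suc m) PP)"
    by (simp add: Wc_def w_def del: power_Suc of_nat_Suc) simp
  have c1: "q * q powi (int m - 1) = ?c" "p * q powi (int m - 1) = ?c * (p * p)"
    by (simp_all add: power_int_diff field_simps)
  have W2: "dil q (Wc m) = v \<star> (dil ?c Yc ^ m * dil (q ^ Suc m) PP)" "dil p (Wc m) = v \<star> (dil (?c * (p * p)) Yc ^ m * dil (?c * p) PP)"
    by (simp_all add: Wc_def v_def dil_mult dil_power c1 mult.commute)
  have wn: "w * ?n = q powi (- 2 * int m) * v"
  proof -
    have "w * ?n = q powi (- (int (Suc m) * int m)) / qfac q m"
      unfolding w_def qfac_Suc using qn_Suc_nz(1)[of m] by (simp del: of_nat_Suc)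
    also have "- (int (Suc m) * int m) = - 2 * int m + - (int m * (int m - 1))" by (simp add: algebra_simps)
    finally show ?thesis unfolding v_def powi_merge(1)[symmetric] by simp
  qed
  have w3: "w * (q ^ (3 * m) * ?n) = q powi int m * v" "w * (q ^ m * ?n) = q powi (- int m) * v"
  proof -
    have "w * (q ^ (3 * m) * ?n) = q powi int (3 * m) * (q powi (- 2 * int m) * v)"
      unfolding power_int_of_nat wn[symmetric] by (simp only: mult.left_commute mult.commute mult.assoc)
    then show "w * (q ^ (3 * m) * ?n) = q powi int m * v" unfolding powi_merge by simp
    have "w * (q ^ m * ?n) = q powi int m * (q powi (- 2 * int m) * v)"
      unfolding power_int_of_nat wn[symmetric] by (simp only: mult.left_commute mult.commute mult.assoc)
    then show "w * (q ^ m * ?n) = q powi (- int m) * v" unfolding powi_merge by simp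
  qed
  have f1: "w \<star> ((q - p) \<star> (e0 * (dil ?c Yc ^ Suc m * dil (q ^ Suc m) PP))) = (q - p) \<star> (e0 * Wc (Suc m))"
    unfolding W1 by (simp only: FV.scale_scale fs_mult_right mult.commute)
  have f2: "w \<star> (((q - p) * q ^ (2 * Suc m)) \<star> (dil ?c Yc ^ Suc m * dil (q ^ Suc m) PP * dil (q ^ Suc m) (xh 0))) = ((q - p) * q ^ (2 * Suc m)) \<star> (Wc (Suc m) * dil (q ^ Suc m) (xh 0))"
    unfolding W1 by (simp only: FV.scale_scale fs_mult_left mult.commute)
  have f3: "w \<star> ((q ^ (3 * m) * ?n) \<star> (dil (?c * (p * p)) Yc ^ m * dil (?c * p) PP)) = q powi int m \<star> dil p (Wc m)"
    "w \<star> ((q ^ m * ?n) \<star> (dil ?c Yc ^ m * dil (q ^ Suc m) PP)) = q powi (- int m) \<star> dil q (Wc m)"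
    unfolding W2 FV.scale_scale w3 by (rule refl)+
  show ?thesis
    unfolding f1[symmetric] A unfolding FV.scale_right_diff_distrib f2 f3 ..
qed

lemma e0_Wc_nth:
  "xp 0 * fps_nth (Wc (Suc i)) m = qn q (int m - int i) \<cdot> fps_nth (Wc i) m
    + q ^ (2 * Suc i) \<cdot> (\<Sum>l\<le>m. (q ^ (Suc i * (m - l)) * qn q (int (m - l) + 1)) \<cdot> (fps_nth (Wc (Suc i)) l * xp (int (m - l))))"
proof -
  have "(q - p) \<cdot> (xp 0 * fps_nth (Wc (Suc i)) m) = fps_nth ((q - p) \<star> (e0 * Wc (Suc i))) m" by simp
  also have "\<dots> = ((q - p) * q ^ (2 * Suc i)) \<cdot> fps_nth (Wc (Suc i) * dil (q ^ Suc i) (xh 0)) m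
     - (q powi int i * p ^ m - q powi (- int i) * q ^ m) \<cdot> fps_nth (Wc i) m"
    unfolding e0_Wc by (simp add: scl_left del: power_Suc mult_Suc_right)
  also have "q powi int i * p ^ m - q powi (- int i) * q ^ m = - ((q - p) * qn q (int m - int i))"
    unfolding qn_mult by (simp add: power_int_diff power_int_minus power_inverse divide_inverse)
  finally have "(q - p) \<cdot> (xp 0 * fps_nth (Wc (Suc i)) m) = (q - p) \<cdot> (qn q (int m - int i) \<cdot> fps_nth (Wc i) m
    + q ^ (2 * Suc i) \<cdot> fps_nth (Wc (Suc i) * dil (q ^ Suc i) (xh 0)) m)"
    by (simp only: V.scale_minus_left V.scale_right_distrib V.scale_scale diff_minus_eq_add add.commute)
  then have 1: "xp 0 * fps_nth (Wc (Suc i)) m = qn q (int m - int i) \<cdot> fps_nth (Wc i) m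
    + q ^ (2 * Suc i) \<cdot> fps_nth (Wc (Suc i) * dil (q ^ Suc i) (xh 0)) m"
    by (rule scl_cancel) simp
  have "fps_nth (Wc (Suc i) * dil (q ^ Suc i) (xh 0)) m
     = (\<Sum>l\<le>m. (q ^ (Suc i * (m - l)) * qn q (int (m - l) + 1)) \<cdot> (fps_nth (Wc (Suc i)) l * xp (int (m - l))))"
    unfolding fps_mult_nth atMost_atLeast0 by (simp add: xh_def power_mult del: power_Suc mult_Suc)
  then show ?thesis unfolding 1 by (simp only:)
qed

lemma Wc_low: "m < i \<Longrightarrow> fps_nth (Wc i) m = 0" and Wc_diag: "fps_nth (Wc i) i = dp (- (xm 1 * ki)) i"
proof -
  define c where "c = q powi (int i - 1)"
  have "dil c Yc ^ i = fps_X ^ i * (c \<star> dil c Zc) ^ i"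
    unfolding Yc_def dil_X fs_mult_right[symmetric] by (rule X_times_power)
  then have W: "Wc i = (q powi (- (int i * (int i - 1))) / qfac q i) \<star> (fps_X ^ i * ((c \<star> dil c Zc) ^ i * dil (q ^ i) PP))"
    unfolding Wc_def c_def by (simp add: mult.assoc)
  show "m < i \<Longrightarrow> fps_nth (Wc i) m = 0" unfolding W by (simp add: X_power_nth)
  have ci: "c ^ i = q powi (int i * (int i - 1))"
    unfolding c_def power_int_of_nat[symmetric] power_int_mult[symmetric] by (simp add: mult.commute)
  have power_c: "(c \<cdot> y) ^ n = c ^ n \<cdot> y ^ n" for n y by (induct n) (simp_all add: mult.commute)
  have "fps_nth (c \<star> dil c Zc) 0 = c \<cdot> (- (xm 1 * ki))" by (simp add: Zc_def kic_def)
  then have c0: "fps_nth ((c \<star> dil c Zc) ^ i * dil (q ^ i) PP) 0 = (c \<cdot> (- (xm 1 * ki))) ^ i"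
    by (simp only: fps_mult_nth_0 fps_power_nth_0 dil_nth PP_nth pc.simps power_0 V.scale_one mult_1_right)
  then show "fps_nth (Wc i) i = dp (- (xm 1 * ki)) i"
    unfolding W fs_nth X_power_nth
    by (simp only: less_irrefl if_False diff_self_eq_0 c0 power_c V.scale_scale ci dp_def) (simp add: power_int_minus)
qed

text \<open>The terms with \<open>i\<close> lowering and \<open>j\<close> raising vectors and total degree \<open>b\<close>.  The sums \<open>Ta\<close> and \<open>Tb\<close> arise
  from multiplying such a term by \<open>xp 0\<close>: in \<open>Ta\<close> a lowering vector has been consumed, in \<open>Tb\<close> a raising
  vector has been added.\<close>

definition Tc :: "nat \<Rightarrow> nat \<Rightarrow> nat \<Rightarrow> 'b" where
  "Tc b i j = (\<Sum>m\<le>b. q powi ((1 - int i) * int m + int i * int b + int i * int j + int b * int j)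
       \<cdot> (fps_nth (Wc i) m * fps_nth (Xd 0 j) (b - m)))"

definition Ta :: "nat \<Rightarrow> nat \<Rightarrow> nat \<Rightarrow> 'b" where
  "Ta b i j = (\<Sum>m\<le>b. (q powi (- (int i * int m) + (int i + 1) * int b + (int i + 1) * int j + int b * int j) * qn q (int m - int i))
       \<cdot> (fps_nth (Wc i) m * fps_nth (Xd 0 j) (b - m)))"

definition Tb :: "nat \<Rightarrow> nat \<Rightarrow> nat \<Rightarrow> 'b" where
  "Tb b i j = (\<Sum>m\<le>b. (q powi (2 * int i + (1 - int i) * int m + int i * int b + int i * (int j - 1) + int b * (int j - 1) + int b - int m) * qn q (int b - int m + int j))
       \<cdot> (fps_nth (Wc i) m * fps_nth (Xd 0 j) (b - m)))"

lemma xp_Tc: "xp 0 * Tc b (Suc i) j = Ta b i j + Tb b (Suc i) (Suc j)"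
proof -
  define al where "al m = (1 - int (Suc i)) * int m + int (Suc i) * int b + int (Suc i) * int j + int b * int j" for m
  let ?X = "\<lambda>j n. fps_nth (Xd 0 j) n" and ?W = "\<lambda>i m. fps_nth (Wc i) m"
  let ?g = "\<lambda>l s. (q powi (al (l + s)) * q ^ (2 * Suc i) * (q ^ (Suc i * s) * qn q (int s + 1))) \<cdot> (?W (Suc i) l * (xp (int s) * ?X j (b - l - s)))"
  have "xp 0 * Tc b (Suc i) j = (\<Sum>m\<le>b. q powi (al m) \<cdot> ((xp 0 * ?W (Suc i) m) * ?X j (b - m)))"
    unfolding Tc_def al_def sum_distrib_left by (simp only: scl_mult_right mult.assoc)
  also have "\<dots> = (\<Sum>m\<le>b. q powi (al m) \<cdot> ((qn q (int m - int i) \<cdot> ?W i m) * ?X j (b - m)))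
      + (\<Sum>m\<le>b. \<Sum>l\<le>m. ?g l (m - l))"
    unfolding e0_Wc_nth sum.distrib[symmetric]
  proof (rule sum.cong[OF refl])
    fix m assume m: "m \<in> {..b}"
    have "q powi (al m) \<cdot> ((q ^ (2 * Suc i) \<cdot> (\<Sum>l\<le>m. (q ^ (Suc i * (m - l)) * qn q (int (m - l) + 1)) \<cdot> (?W (Suc i) l * xp (int (m - l))))) * ?X j (b - m))
       = (\<Sum>l\<le>m. ?g l (m - l))"
      unfolding scl_mult_left sum_distrib_right scl_sum_right V.scale_scale
      by (rule sum.cong) (auto simp: mult.assoc)
    then show "q powi (al m) \<cdot> ((qn q (int m - int i) \<cdot> ?W i m + q ^ (2 * Suc i) \<cdot> (\<Sum>l\<le>m. (q ^ (Suc i * (m - l)) * qn q (int (m - l) + 1)) \<cdot> (?W (Suc i) l * xp (int (m - l))))) * ?X j (b - m))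
       = q powi (al m) \<cdot> ((qn q (int m - int i) \<cdot> ?W i m) * ?X j (b - m)) + (\<Sum>l\<le>m. ?g l (m - l))"
      by (simp only: distrib_right V.scale_right_distrib)
  qed
  also have "(\<Sum>m\<le>b. q powi (al m) \<cdot> ((qn q (int m - int i) \<cdot> ?W i m) * ?X j (b - m))) = Ta b i j"
  proof -
    have "al m = - (int i * int m) + (int i + 1) * int b + (int i + 1) * int j + int b * int j" for m
      by (simp add: al_def algebra_simps)
    then show ?thesis unfolding Ta_def by (simp only: scl_mult_left V.scale_scale)
  qed
  also have "(\<Sum>m\<le>b. \<Sum>l\<le>m. ?g l (m - l)) = (\<Sum>l\<le>b. \<Sum>s\<le>b - l. ?g l s)"
    by (rule triangle_sum)
  also have "\<dots> = Tb b (Suc i) (Suc j)"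
    unfolding Tb_def
  proof (rule sum.cong[OF refl])
    fix l assume l: "l \<in> {..b}"
    have al: "q powi (al (l + s)) * q ^ (2 * Suc i) * (q ^ (Suc i * s) * c) = q powi (al l + 2 * int (Suc i)) * (q ^ s * c)" for s c
    proof -
      have e: "al (l + s) + int (2 * Suc i) + int (Suc i * s) = al l + 2 * int (Suc i) + int s"
        by (simp add: al_def algebra_simps)
      have "q powi (al (l + s)) * q powi int (2 * Suc i) * (q powi int (Suc i * s) * c) = q powi (al l + 2 * int (Suc i)) * (q powi int s * c)"
        unfolding mult.assoc powi_merge(2) add.assoc[symmetric] e ..
      then show ?thesis unfolding power_int_of_nat .
    qed
    have n: "int (b - l) = int b - int l" using l by (simp add: of_nat_diff)
    have "(\<Sum>s\<le>b - l. ?g l s) = q powi (al l + 2 * int (Suc i)) \<cdot> (?W (Suc i) l * (\<Sum>s\<le>b - l. (q ^ s * qn q (int s + 1)) \<cdot> (xp (int s) * ?X j (b - l - s))))"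
      unfolding al by (simp only: sum_distrib_left scl_sum_right scl_mult_right V.scale_scale)
    also have "(\<Sum>s\<le>b - l. (q ^ s * qn q (int s + 1)) \<cdot> (xp (int s) * ?X j (b - l - s)))
       = (q ^ (b - l) * qn q (int (b - l) + int j + 1)) \<cdot> ?X (Suc j) (b - l)"
      unfolding Xd_recursion[symmetric] fps_mult_nth atMost_atLeast0 by simp
    also have "q powi (al l + 2 * int (Suc i)) \<cdot> (?W (Suc i) l * ((q ^ (b - l) * qn q (int (b - l) + int j + 1)) \<cdot> ?X (Suc j) (b - l)))
      = (q powi (al l + 2 * int (Suc i) + int (b - l)) * qn q (int (b - l) + int j + 1)) \<cdot> (?W (Suc i) l * ?X (Suc j) (b - l))"
      unfolding scl_mult_right V.scale_scale power_int_of_nat[symmetric] powi_merge(2) ..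
    also have "al l + 2 * int (Suc i) + int (b - l) = 2 * int (Suc i) + (1 - int (Suc i)) * int l + int (Suc i) * int b + int (Suc i) * (int (Suc j) - 1) + int b * (int (Suc j) - 1) + int b - int l"
      unfolding n al_def by (simp add: algebra_simps)
    also have "int (b - l) + int j + 1 = int b - int l + int (Suc j)" unfolding n by simp
    finally show "(\<Sum>s\<le>b - l. ?g l s) = (q powi (2 * int (Suc i) + (1 - int (Suc i)) * int l + int (Suc i) * int b + int (Suc i) * (int (Suc j) - 1) + int b * (int (Suc j) - 1) + int b - int l) * qn q (int b - int l + int (Suc j)))
       \<cdot> (?W (Suc i) l * ?X (Suc j) (b - l))" .
  qed
  finally show ?thesis .
qed

lemma Ta_Tb:
  assumes "int a + 1 = int b - int i + int j"
  shows "Ta b i j + Tb b i j = qn q (int (Suc a)) \<cdot> Tc b i j"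
  unfolding Ta_def Tb_def Tc_def scl_sum_right sum.distrib[symmetric] V.scale_scale scl_left(1)[symmetric]
proof (rule sum.cong[OF refl])
  fix m
  have "q powi (- (int i * int m) + (int i + 1) * int b + (int i + 1) * int j + int b * int j) * qn q (int m - int i)
     + q powi (2 * int i + (1 - int i) * int m + int i * int b + int i * (int j - 1) + int b * (int j - 1) + int b - int m) * qn q (int b - int m + int j)
     = q powi ((1 - int i) * int m + int i * int b + int i * int j + int b * int j) * qn q (int (Suc a))"
    by (rule qn_comb) (use assms in \<open>simp_all add: algebra_simps\<close>)
  then show "(q powi (- (int i * int m) + (int i + 1) * int b + (int i + 1) * int j + int b * int j) * qn q (int m - int i)
     + q powi (2 * int i + (1 - int i) * int m + int i * int b + int i * (int j - 1) + int b * (int j - 1) + int b - int m) * qn q (int b - int m + int j))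
       \<cdot> (fps_nth (Wc i) m * fps_nth (Xd 0 j) (b - m))
     = (qn q (int (Suc a)) * q powi ((1 - int i) * int m + int i * int b + int i * int j + int b * int j))
       \<cdot> (fps_nth (Wc i) m * fps_nth (Xd 0 j) (b - m))"
    by (simp only: mult.commute)
qed

lemma Ta_top: "Ta b b j = 0"
  unfolding Ta_def
proof (rule sum.neutral, rule ballI)
  fix m assume "m \<in> {..b}"
  then consider "m < b" | "m = b" by fastforce
  then show "(q powi (- (int b * int m) + (int b + 1) * int b + (int b + 1) * int j + int b * int j) * qn q (int m - int b))
       \<cdot> (fps_nth (Wc b) m * fps_nth (Xd 0 j) (b - m)) = 0"
    by cases (simp_all add: Wc_low)
qed

lemma Tb_bottom: "Tb b i 0 = 0"
  unfolding Tb_def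
proof (rule sum.neutral, rule ballI)
  fix m assume "m \<in> {..b}"
  then consider "m < b" | "m = b" by fastforce
  then show "(q powi (2 * int i + (1 - int i) * int m + int i * int b + int i * (int 0 - 1) + int b * (int 0 - 1) + int b - int m) * qn q (int b - int m + int 0))
       \<cdot> (fps_nth (Wc i) m * fps_nth (Xd 0 0) (b - m)) = 0"
    by cases (simp_all add: Xd_0)
qed

lemma Tc_no_raising: "Tc b i 0 = q powi (int b + (int i * int b - int i * int b)) \<cdot> fps_nth (Wc i) b"
proof -
  have "Tc b i 0 = (\<Sum>m\<le>b. if m = b then q powi ((1 - int i) * int b + int i * int b) \<cdot> fps_nth (Wc i) b else 0)"
    unfolding Tc_def by (rule sum.cong) (auto simp: Xd_0)
  then show ?thesis by (simp add: algebra_simps)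
qed

text \<open>A quantum form of Garland's identity.  In the induction on \<open>a\<close>, each \<open>Tc b i j\<close> of the next stage is
  reached from two sides, and the contributions add up by \<open>Ta_Tb\<close>.\<close>

theorem straightening:
  "a \<le> b \<Longrightarrow> q ^ b \<cdot> (dp (xp 0) a * dp (- (xm 1 * ki)) b) = (\<Sum>j\<le>a. Tc b (b - a + j) j)"
proof (induct a)
  case 0
  show ?case by (simp add: Tc_no_raising Wc_diag)
next
  case (Suc a)
  let ?y = "dp (- (xm 1 * ki)) b"
  define c where "c = b - Suc a"
  have c: "b - a = Suc c" "b = c + Suc a" using Suc(2) by (simp_all add: c_def)
  have "qn q (int (Suc a)) \<cdot> (q ^ b \<cdot> (dp (xp 0) (Suc a) * ?y)) = q ^ b \<cdot> ((qn q (int (Suc a)) \<cdot> dp (xp 0) (Suc a)) * ?y)"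
    by (simp only: scl_mult_left V.scale_scale mult.commute)
  also have "\<dots> = xp 0 * (q ^ b \<cdot> (dp (xp 0) a * ?y))"
    unfolding dp_Suc by (simp only: scl_mult_right mult.assoc)
  also have "\<dots> = xp 0 * (\<Sum>j\<le>a. Tc b (b - a + j) j)" using Suc by simp
  also have "\<dots> = (\<Sum>j\<le>a. Ta b (c + j) j + Tb b (c + Suc j) (Suc j))"
    unfolding sum_distrib_left c(1) add_Suc add_Suc_right xp_Tc ..
  also have "\<dots> = (\<Sum>j\<le>Suc a. Ta b (c + j) j) + (\<Sum>j\<le>Suc a. Tb b (c + j) j)"
  proof -
    have "c + Suc a = b" using c(2) by simp
    then have 1: "(\<Sum>j\<le>Suc a. Ta b (c + j) j) = (\<Sum>j\<le>a. Ta b (c + j) j)" by (simp add: Ta_top)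
    have 2: "(\<Sum>j\<le>Suc a. Tb b (c + j) j) = (\<Sum>j\<le>a. Tb b (c + Suc j) (Suc j))"
      unfolding sum.atMost_Suc_shift[of _ a] by (simp add: Tb_bottom)
    show ?thesis unfolding 1 2 by (rule sum.distrib)
  qed
  also have "\<dots> = (\<Sum>j\<le>Suc a. qn q (int (Suc a)) \<cdot> Tc b (c + j) j)"
    unfolding sum.distrib[symmetric]
  proof (rule sum.cong[OF refl])
    fix j
    show "Ta b (c + j) j + Tb b (c + j) j = qn q (int (Suc a)) \<cdot> Tc b (c + j) j"
      by (rule Ta_Tb) (simp add: c(2))
  qed
  finally have "qn q (int (Suc a)) \<cdot> (q ^ b \<cdot> (dp (xp 0) (Suc a) * ?y)) = qn q (int (Suc a)) \<cdot> (\<Sum>j\<le>Suc a. Tc b (c + j) j)"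
    by (simp only: scl_sum_right)
  then show ?case unfolding c_def by (rule qn_cancel)
qed

text \<open>For \<open>a = b = r\<close> the term \<open>j = 0\<close> of \<open>straightening\<close> is \<open>pc r\<close> up to a power of \<open>q\<close>.  For \<open>j > 0\<close> the
  generating function \<open>Wc j\<close> starts in degree \<open>j\<close>, hence involves only \<open>pc s\<close> with \<open>s < r\<close>.\<close>

lemma pc_integral:
  assumes S: "integral_form sc q S" "k \<in> S" "ki \<in> S"
    and x: "\<And>r t. dp (xp r) t \<in> S" and y: "\<And>r t. dp (xm r) t \<in> S"
  shows "pc r \<in> S"
proof (induct r rule: less_induct)
  case (less r)
  interpret I: integral_form sc q S by (rule S(1))
  have NX: "fps_nth ((1 / qfac q j) \<star> gs xm 1 1 ^ j) n \<in> S" for j n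
  proof -
    interpret N: loop_serre sc p k ki "\<lambda>r. xm (r + 1)" "\<lambda>r. xp (r - 1)" by (rule mirror_swap)
    have Ndp: "N.dp z s = dp z s" for z s by (simp add: N.dp_def dp_def qfac_inverse)
    have g: "N.cur 0 = gs xm 1 1" by (simp add: fps_eq_iff add.commute)
    have "fps_nth (N.Xd 0 j) n \<in> S"
      by (rule N.Xd_integral[OF I.integral_form_inverse]) (simp add: Ndp y)
    then show ?thesis unfolding N.Xd_def g qfac_inverse .
  qed
  have Yn: "fps_nth ((1 / qfac q j) \<star> Yc ^ j) n \<in> S" for j n
  proof -
    have kg: "kic ^ j * gs xm 1 1 = (q * q) ^ j \<star> (gs xm 1 1 * kic ^ j)" for j
    proof (induct j)
      case (Suc j)
      have "kic ^ Suc j * gs xm 1 1 = kic * (kic ^ j * gs xm 1 1)" by (simp add: mult.assoc)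
      also have "\<dots> = (q * q) ^ j \<star> ((kic * gs xm 1 1) * kic ^ j)" unfolding Suc by (simp add: mult.assoc)
      also have "\<dots> = (q * q) ^ Suc j \<star> (gs xm 1 1 * kic ^ Suc j)"
        unfolding kic_gs(1) by (simp add: mult.assoc mult.commute)
      finally show ?case .
    qed simp
    have pw: "\<exists>m. (gs xm 1 1 * kic) ^ j = q ^ m \<star> (gs xm 1 1 ^ j * kic ^ j)" for j
    proof (induct j)
      case 0
      show ?case by (rule exI[of _ 0]) simp
    next
      case (Suc j)
      then obtain m where m: "(gs xm 1 1 * kic) ^ j = q ^ m \<star> (gs xm 1 1 ^ j * kic ^ j)" by blast
      have "(gs xm 1 1 * kic) ^ Suc j = q ^ m \<star> (gs xm 1 1 ^ j * (kic ^ j * gs xm 1 1) * kic)"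
        unfolding power_Suc2 m by (simp add: mult.assoc)
      also have "\<dots> = (q ^ m * (q * q) ^ j) \<star> (gs xm 1 1 ^ Suc j * kic ^ Suc j)"
        unfolding kg power_Suc2 by (simp add: mult.assoc)
      also have "q ^ m * (q * q) ^ j = q ^ (m + 2 * j)" by (simp add: power_add power_mult power2_eq_square)
      finally show ?case by blast
    qed
    then obtain m where m: "(gs xm 1 1 * kic) ^ j = q ^ m \<star> (gs xm 1 1 ^ j * kic ^ j)" by blast
    have "Yc ^ j = (- 1) ^ j \<star> (fps_X ^ j * (gs xm 1 1 * kic) ^ j)"
      unfolding X_times_power[symmetric] Yc_def Zc_def by (induct j) simp_all
    then have "(1 / qfac q j) \<star> Yc ^ j = (- 1) ^ j \<star> (q ^ m \<star> (fps_X ^ j * (((1 / qfac q j) \<star> gs xm 1 1 ^ j) * kic ^ j)))"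
      unfolding m by (simp add: mult.commute mult.left_commute)
    moreover have "kic ^ j = fps_const (ki ^ j)" unfolding kic_def by (induct j) simp_all
    ultimately have "fps_nth ((1 / qfac q j) \<star> Yc ^ j) n = (- 1) ^ j \<cdot> (q ^ m \<cdot> (if n < j then 0 else fps_nth (((1 / qfac q j) \<star> gs xm 1 1 ^ j)) (n - j) * ki ^ j))"
      by (simp add: X_power_nth)
    moreover have "(if n < j then 0 else fps_nth (((1 / qfac q j) \<star> gs xm 1 1 ^ j)) (n - j) * ki ^ j) \<in> S"
      using I.S_mult[OF NX I.S_power[OF S(3)]] by (simp only: I.S_0 split: if_split) simp
    ultimately show ?thesis by (simp only: I.S_sign I.S_q_power)
  qed
  have Y0: "fps_nth ((1 / qfac q j) \<star> Yc ^ j) n = 0" if "n < j" for j n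
    using that unfolding Yc_def X_times_power by (simp add: X_power_nth)
  have Wn: "fps_nth (Wc j) n \<in> S" if j: "1 \<le> j" "n \<le> r" for j n
  proof -
    define c where "c = q powi (int j - 1)"
    have W: "Wc j = q powi (- (int j * (int j - 1))) \<star> (dil c ((1 / qfac q j) \<star> Yc ^ j) * dil (q ^ j) PP)"
      unfolding Wc_def c_def by (simp add: dil_power)
    have "fps_nth (dil c ((1 / qfac q j) \<star> Yc ^ j)) i * fps_nth (dil (q ^ j) PP) (n - i) \<in> S" if i: "i \<in> {0..n}" for i
    proof (cases "i < j")
      case True
      then show ?thesis using Y0 by (simp only: dil_nth V.scale_zero_right mult_zero_left I.S_0)
    next
      case False
      then have "n - i < r" using i j by auto
      then have "pc (n - i) \<in> S" by (rule less)
      then have P: "(q ^ j) ^ (n - i) \<cdot> pc (n - i) \<in> S" unfolding power_mult[symmetric] by (rule I.S_q_power)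
      have "c ^ i = q powi ((int j - 1) * int i)" unfolding c_def power_int_mult power_int_of_nat ..
      then have "c ^ i \<cdot> fps_nth ((1 / qfac q j) \<star> Yc ^ j) i \<in> S" using I.S_powi[OF Yn] by (simp only:)
      then show ?thesis unfolding dil_nth PP_nth using P by (rule I.S_mult)
    qed
    then have "fps_nth (dil c ((1 / qfac q j) \<star> Yc ^ j) * dil (q ^ j) PP) n \<in> S"
      unfolding fps_mult_nth by (rule I.S_sum)
    then show ?thesis unfolding W fs_nth by (rule I.S_powi)
  qed
  have Tn: "Tc r j j \<in> S" if "1 \<le> j" for j
    unfolding Tc_def
  proof (intro I.S_sum I.S_powi I.S_mult)
    fix m assume "m \<in> {..r}"
    then show "fps_nth (Wc j) m \<in> S" using Wn that by simp
    show "fps_nth (Xd 0 j) (r - m) \<in> S" by (rule Xd_integral[OF S(1) x])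
  qed
  have "ki * xm 1 = q powi 2 \<cdot> (xm 1 * ki)" by (simp add: ki_xm power2_eq_square)
  then have "dp (xm 1 * ki) s \<in> S" for s
    using I.dp_times_torus[of ki "xm 1" 2 s] y S by auto
  moreover have "dp (- (xm 1 * ki)) s = (- 1) ^ s \<cdot> dp (xm 1 * ki) s" for s
    using I.dp_scl[of "- 1" "xm 1 * ki" s] by simp
  ultimately have yr: "dp (- (xm 1 * ki)) s \<in> S" for s by (simp only: I.S_sign)
  have "q ^ r \<cdot> (dp (xp 0) r * dp (- (xm 1 * ki)) r) = (\<Sum>j\<le>r. Tc r j j)"
    using straightening[of r r] by simp
  also have "\<dots> = Tc r 0 0 + (\<Sum>j\<in>{1..r}. Tc r j j)"
    by (simp add: atMost_atLeast0 sum.atLeast_Suc_atMost)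
  also have "Tc r 0 0 = q ^ r \<cdot> pc r"
    unfolding Tc_no_raising Wc_0 by simp
  finally have "q ^ r \<cdot> pc r = q ^ r \<cdot> (dp (xp 0) r * dp (- (xm 1 * ki)) r) - (\<Sum>j\<in>{1..r}. Tc r j j)" by simp
  moreover have "q ^ r \<cdot> (dp (xp 0) r * dp (- (xm 1 * ki)) r) - (\<Sum>j\<in>{1..r}. Tc r j j) \<in> S"
    by (intro I.S_diff I.S_q_power I.S_mult I.S_sum x yr Tn) simp
  ultimately have "p ^ r \<cdot> (q ^ r \<cdot> pc r) \<in> S" by (simp only: I.S_p_power)
  moreover have "p ^ r * q ^ r = 1" by (simp only: power_mult_distrib[symmetric] q_p(2) power_one)
  ultimately show ?case unfolding V.scale_scale by (simp only: V.scale_one)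
qed

end

section \<open>Loop generators from a pair of opposite root vectors\<close>

text \<open>The elements obtained from \<open>x\<close> by iterating \<open>D\<close>, and in negative degrees \<open>D'\<close>.  The choice of the
  operator stands inside the iteration because this is the form of \<open>xplus\<close>.\<close>

definition orbit :: "('c \<Rightarrow> 'c) \<Rightarrow> ('c \<Rightarrow> 'c) \<Rightarrow> 'c \<Rightarrow> int \<Rightarrow> 'c" where
  "orbit D D' x r = ((if 0 \<le> r then D else D') ^^ nat \<bar>r\<bar>) x"

text \<open>It is enough that the operators commute and are inverse to each other at the single point \<open>x\<close>.\<close>

lemma orbit_step:
  assumes c: "\<And>z. D (D' z) = D' (D z)" and x: "D (D' x) = x"
  shows "D (orbit D D' x r) = orbit D D' x (r + 1)" "D' (orbit D D' x r) = orbit D D' x (r - 1)"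
proof -
  have gen: "F (orbit F F' x r) = orbit F F' x (r + 1)"
    if c: "\<And>z. F (F' z) = F' (F z)" and x: "F (F' x) = x" for F F' r
  proof (cases "0 \<le> r")
    case True
    then have "nat \<bar>r + 1\<bar> = Suc (nat \<bar>r\<bar>)" by simp
    with True show ?thesis by (simp add: orbit_def)
  next
    case False
    define m where "m = nat \<bar>r + 1\<bar>"
    have m: "nat \<bar>r\<bar> = Suc m" using False by (simp add: m_def)
    have o: "orbit F F' x (r + 1) = (F' ^^ m) x" using False by (auto simp: orbit_def m_def)
    have F: "F ((F' ^^ m) z) = (F' ^^ m) (F z)" for z by (induct m) (simp_all add: c)
    have "orbit F F' x r = (F' ^^ Suc m) x" unfolding orbit_def m using False by simp
    then have "F (orbit F F' x r) = F ((F' ^^ m) (F' x))" by (simp add: funpow_swap1)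
    also have "\<dots> = (F' ^^ m) x" unfolding F x ..
    finally show ?thesis unfolding o .
  qed
  have sw: "orbit D D' x r = orbit D' D x (- r)" for r by (auto simp: orbit_def)
  show "D (orbit D D' x r) = orbit D D' x (r + 1)" by (rule gen[where F = D and F' = D', OF c x])
  have "D' (orbit D' D x (- r)) = orbit D' D x (- r + 1)"
    by (rule gen) (simp_all add: c[symmetric] x)
  then show "D' (orbit D D' x r) = orbit D D' x (r - 1)" unfolding sw by simp
qed

lemma orbit_0 [simp]: "orbit D D' x 0 = x" "orbit D D' x 1 = D x" "orbit D D' x (- 1) = D' x"
  by (simp_all add: orbit_def)

context quantum
begin

lemma ser_2_scl: "ser 2 e x \<Longrightarrow> ser 2 e (c \<cdot> x)" "ser 2 e x \<Longrightarrow> ser 2 (c \<cdot> e) x"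
proof -
  assume *: "ser 2 e x"
  define K where "K = q * q + 1 + p * p"
  let ?R = "\<lambda>e x. e * e * e * x - K \<cdot> (e * e * x * e) + K \<cdot> (e * x * e * e) - x * e * e * e"
  have ser: "ser 2 e x \<longleftrightarrow> ?R e x = 0" for e x by (simp add: ser_def K_def)
  have "?R e (c \<cdot> x) = c \<cdot> ?R e x"
    by (simp only: scl_mult_left scl_mult_right scl_simps V.scale_scale mult.commute)
  then show "ser 2 e (c \<cdot> x)" using * unfolding ser by (simp only: V.scale_zero_right)
  have "?R (c \<cdot> e) x = (c * (c * c)) \<cdot> ?R e x"
    by (simp only: scl_mult_left scl_mult_right scl_simps V.scale_scale mult.commute mult.left_commute)
  then show "ser 2 (c \<cdot> e) x" using * unfolding ser by (simp only: V.scale_zero_right)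
qed

text \<open>A cubic relation with coefficients \<open>1, [3], [3], 1\<close> factors into a \<open>q\<close>-commutator of a quadratic
  one, in two ways.\<close>

lemma ser_2_bracket:
  assumes "ser 2 a b"
  shows "(b * a * a - (1 + q * q) \<cdot> (a * b * a) + (q * q) \<cdot> (a * a * b)) * a
       = (p * p) \<cdot> (a * (b * a * a - (1 + q * q) \<cdot> (a * b * a) + (q * q) \<cdot> (a * a * b)))" (is "?T * a = _")
    and "(b * a * a - (1 + p * p) \<cdot> (a * b * a) + (p * p) \<cdot> (a * a * b)) * a
       = (q * q) \<cdot> (a * (b * a * a - (1 + p * p) \<cdot> (a * b * a) + (p * p) \<cdot> (a * a * b)))" (is "?U * a = _")
proof -
  have R: "a * a * a * b - (q * q + 1 + p * p) \<cdot> (a * a * b * a)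
             + (q * q + 1 + p * p) \<cdot> (a * b * a * a) - b * a * a * a = 0" (is "?R = 0") using assms by (simp add: ser_def)
  have "?T * a - (p * p) \<cdot> (a * ?T) = - ?R"
    by (simp add: algebra_simps scl_simps scl_left)
  then show "?T * a = (p * p) \<cdot> (a * ?T)"
    unfolding R minus_zero by (rule eq_iff_diff_eq_0[THEN iffD2])
  have "?U * a - (q * q) \<cdot> (a * ?U) = - ?R"
    by (simp add: algebra_simps scl_simps scl_left)
  then show "?U * a = (q * q) \<cdot> (a * ?U)"
    unfolding R minus_zero by (rule eq_iff_diff_eq_0[THEN iffD2])
qed

end

text \<open>A copy of the relations of the quantum affine algebra of rank one: \<open>e\<close>, \<open>f\<close> belong to the node, and \<open>y\<close>, \<open>y'\<close>
  to the walk around the rest of the cycle.\<close>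

locale rank_one = quantum sc q
  for sc :: "'k::field_char_0 \<Rightarrow> 'a::ring_1" and q :: 'k +
  fixes k ki e f y y' :: 'a
  assumes k_ki: "k * ki = 1" "ki * k = 1"
    and k_e: "k * e = (q * q) \<cdot> (e * k)" and k_f: "k * f = (p * p) \<cdot> (f * k)"
    and k_y: "k * y = (p * p) \<cdot> (y * k)" and k_y': "k * y' = (q * q) \<cdot> (y' * k)"
    and e_f: "e * f - f * e = (1 / (q - p)) \<cdot> (k - ki)"
    and y_y': "y * y' - y' * y = - ((1 / (q - p)) \<cdot> (k - ki))"
    and y_f: "y * f = f * y" and e_y': "e * y' = y' * e"
    and ser_ey: "ser 2 e y" "ser 2 y e" and ser_fy': "ser 2 f y'" "ser 2 y' f"
begin

definition ph :: 'a where "ph = e * y - (q * q) \<cdot> (y * e)"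
definition ph' :: 'a where "ph' = y' * f - (p * p) \<cdot> (f * y')"
definition ka :: 'a where "ka = (1 / (q - p)) \<cdot> (k - ki)"

lemma ki_k' [simp]: "k * (ki * x) = x" "ki * (k * x) = x"
  using k_ki by (simp_all add: mult.assoc[symmetric])

declare k_ki [simp]

lemma ki_vectors:
  "ki * e = (p * p) \<cdot> (e * ki)" "ki * f = (q * q) \<cdot> (f * ki)" "ki * y = (q * q) \<cdot> (y * ki)" "ki * y' = (p * p) \<cdot> (y' * ki)"
  using inv_comm[OF k_ki k_e] inv_comm[OF k_ki k_f] inv_comm[OF k_ki k_y] inv_comm[OF k_ki k_y'] by simp_all

lemmas torus = k_e k_f k_y k_y' ki_vectors

lemma torus':
  "k * (e * x) = (q * q) \<cdot> (e * (k * x))" "k * (f * x) = (p * p) \<cdot> (f * (k * x))"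
  "k * (y * x) = (p * p) \<cdot> (y * (k * x))" "k * (y' * x) = (q * q) \<cdot> (y' * (k * x))"
  "ki * (e * x) = (p * p) \<cdot> (e * (ki * x))" "ki * (f * x) = (q * q) \<cdot> (f * (ki * x))"
  "ki * (y * x) = (q * q) \<cdot> (y * (ki * x))" "ki * (y' * x) = (p * p) \<cdot> (y' * (ki * x))"
  using torus by (simp_all add: mult.assoc[symmetric])

lemma cm_facts: "cm e f = ka" "cm f e = - ka" "cm y y' = - ka" "cm y' y = ka" "cm y f = 0" "cm f y = 0" "cm e y' = 0" "cm y' e = 0"
  using e_f y_y' y_f e_y' by (simp_all add: cm_def ka_def) (metis minus_diff_eq)+

lemma k_ph: "cm k ph = 0" "cm ki ph = 0" "cm k ph' = 0" "cm ki ph' = 0" "cm ph k = 0" "cm ph ki = 0" "cm ph' k = 0" "cm ph' ki = 0"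
  by (simp_all add: cm_def ph_def ph'_def torus torus' algebra_simps)

lemma cancel_ka: "(q - p) \<cdot> ka = k - ki"
  by (simp add: ka_def)

lemma ph_f: "cm ph f = - ((q + p) \<cdot> (y * k))"
proof (rule scl_cancel)
  have "cm ph f = ka * y - (q * q) \<cdot> (y * ka)"
    by (simp add: ph_def cm_simps cm_facts)
  then have "(q - p) \<cdot> cm ph f = ((q - p) \<cdot> ka) * y - (q * q) \<cdot> (y * ((q - p) \<cdot> ka))"
    by (simp add: scl_simps mult.commute)
  also have "\<dots> = (q - p) \<cdot> (- ((q + p) \<cdot> (y * k)))"
    unfolding cancel_ka by (simp add: torus algebra_simps scl_simps scl_left)
  finally show "(q - p) \<cdot> cm ph f = (q - p) \<cdot> (- ((q + p) \<cdot> (y * k)))" .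
qed simp

lemma ph'_e: "cm ph' e = (q + p) \<cdot> (ki * y')"
proof (rule scl_cancel)
  have "cm ph' e = (p * p) \<cdot> (ka * y') - y' * ka"
    by (simp add: ph'_def cm_simps cm_facts)
  then have "(q - p) \<cdot> cm ph' e = (p * p) \<cdot> (((q - p) \<cdot> ka) * y') - y' * ((q - p) \<cdot> ka)"
    by (simp add: scl_simps mult.commute)
  also have "\<dots> = (q - p) \<cdot> ((q + p) \<cdot> (ki * y'))"
    unfolding cancel_ka by (simp add: torus algebra_simps scl_simps scl_left)
  finally show "(q - p) \<cdot> cm ph' e = (q - p) \<cdot> ((q + p) \<cdot> (ki * y'))" .
qed simp

lemma ph_y': "cm ph (ki * y') = (q + p) \<cdot> e"
proof (rule scl_cancel)
  have "cm ph y' = (q * q) \<cdot> (ka * e) - e * ka"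
    by (simp add: ph_def cm_simps cm_facts)
  then have "cm ph (ki * y') = ki * ((q * q) \<cdot> (ka * e) - e * ka)"
    by (simp add: cm_simps k_ph)
  then have "(q - p) \<cdot> cm ph (ki * y') = ki * ((q * q) \<cdot> (((q - p) \<cdot> ka) * e) - e * ((q - p) \<cdot> ka))"
    by (simp add: scl_simps left_diff_distrib right_diff_distrib mult.commute)
  also have "\<dots> = (q - p) \<cdot> ((q + p) \<cdot> e)"
    unfolding cancel_ka by (simp add: torus torus' algebra_simps scl_simps scl_left)
  finally show "(q - p) \<cdot> cm ph (ki * y') = (q - p) \<cdot> ((q + p) \<cdot> e)" .
qed simp

lemma ph'_y: "cm ph' (y * k) = - ((q + p) \<cdot> f)"
proof (rule scl_cancel)
  have "cm ph' y = ka * f - (p * p) \<cdot> (f * ka)"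
    by (simp add: ph'_def cm_simps cm_facts)
  then have "cm ph' (y * k) = (ka * f - (p * p) \<cdot> (f * ka)) * k"
    by (simp add: cm_simps k_ph)
  then have "(q - p) \<cdot> cm ph' (y * k) = (((q - p) \<cdot> ka) * f - (p * p) \<cdot> (f * ((q - p) \<cdot> ka))) * k"
    by (simp add: scl_simps left_diff_distrib right_diff_distrib mult.commute)
  also have "\<dots> = (q - p) \<cdot> (- ((q + p) \<cdot> f))"
    unfolding cancel_ka by (simp add: torus torus' algebra_simps scl_simps scl_left)
  finally show "(q - p) \<cdot> cm ph' (y * k) = (q - p) \<cdot> (- ((q + p) \<cdot> f))" .
qed simp

lemma ka_opposite: "cm (ki * y') (y * k) = ka"
proof -
  have "cm (ki * y') (y * k) = y' * y - y * y'"
    by (simp add: cm_def torus torus' mult.assoc)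
  then show ?thesis using cm_facts(4) by (simp add: cm_def)
qed

text \<open>By the Jacobi identity the commutator is the difference of the two brackets of degree zero, and
  both are equal to \<open>ka\<close>.\<close>

lemma ph_ph': "cm ph ph' = 0"
proof -
  have "ph' = k * cm (ki * y') f"
    by (simp add: cm_def ph'_def torus torus' algebra_simps)
  then have "cm ph ph' = k * (cm (cm ph (ki * y')) f + cm (ki * y') (cm ph f))"
    by (simp only: cm_simps(4)[of ph k "cm (ki * y') f"] k_ph cm_cm[of ph] mult_zero_left add_0)
  also have "\<dots> = k * ((q + p) \<cdot> (cm e f - cm (ki * y') (y * k)))"
    unfolding ph_y' ph_f by (simp add: cm_simps(3) scl_simps)
  finally show ?thesis unfolding ka_opposite cm_facts by simp
qed

lemma ph_bracket: "ph = ki * cm e (y * k)" "ph' = k * cm (ki * y') f"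
  by (simp_all add: cm_def ph_def ph'_def torus torus' algebra_simps)

definition up :: "'a \<Rightarrow> 'a" where "up z = (1 / (q + p)) \<cdot> cm ph z"
definition dwn :: "'a \<Rightarrow> 'a" where "dwn z = (1 / (q + p)) \<cdot> cm ph' z"

definition lxp :: "int \<Rightarrow> 'a" where "lxp = orbit up dwn e"
definition lxm :: "int \<Rightarrow> 'a" where "lxm = orbit (\<lambda>z. - up z) (\<lambda>z. - dwn z) f"

lemma qp_nz: "q + p \<noteq> 0"
  using qn_2 qn_nz[of 2] by simp

lemma up_dwn: "up (dwn z) = dwn (up z)"
  unfolding up_def dwn_def using cm_cm[of ph ph' z] by (simp add: ph_ph' cm_simps)

lemma up_base: "up (ki * y') = e" "dwn e = ki * y'" "- up f = y * k" "- dwn (y * k) = f"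
  using qp_nz by (simp_all add: up_def dwn_def ph_y' ph'_e ph_f ph'_y)

lemma lxp_base: "lxp 0 = e" "lxp (- 1) = ki * y'" and lxm_base: "lxm 0 = f" "lxm 1 = y * k"
  by (simp_all add: lxp_def lxm_def up_base)

lemma up_dwn_minus: "up (- z) = - up z" "dwn (- z) = - dwn z"
  by (simp_all add: up_def dwn_def cm_simps)

lemma lxp_step: "up (lxp r) = lxp (r + 1)" "dwn (lxp r) = lxp (r - 1)"
  unfolding lxp_def by (rule orbit_step; simp add: up_dwn up_base)+

lemma lxm_step: "- up (lxm r) = lxm (r + 1)" "- dwn (lxm r) = lxm (r - 1)"
proof -
  have 1: "- up (- dwn z) = - dwn (- up z)" for z by (simp add: up_dwn_minus up_dwn)
  have 2: "- up (- dwn f) = f" unfolding 1 up_base ..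
  show "- up (lxm r) = lxm (r + 1)" "- dwn (lxm r) = lxm (r - 1)"
    unfolding lxm_def using orbit_step[of "\<lambda>z. - up z" "\<lambda>z. - dwn z", OF 1 2] by simp_all
qed

lemma weight_lxp: "k * lxp r = (q * q) \<cdot> (lxp r * k)" and weight_lxm: "k * lxm r = (p * p) \<cdot> (lxm r * k)"
proof -
  have up: "k * up z = c \<cdot> (up z * k)" and dwn: "k * dwn z = c \<cdot> (dwn z * k)" if "k * z = c \<cdot> (z * k)" for z c
  proof -
    have kz: "k * cm x z = c \<cdot> (cm x z * k)" if "cm k x = 0" for x
    proof -
      have x: "k * x = x * k" "k * (x * u) = x * (k * u)" for u
        using that by (simp_all add: cm_eq_0 flip: mult.assoc)
      have z: "k * (z * u) = c \<cdot> (z * (k * u))" for u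
        using \<open>k * z = _\<close> by (simp flip: mult.assoc)
      show ?thesis by (simp add: cm_def x z \<open>k * z = _\<close> algebra_simps)
    qed
    show "k * up z = c \<cdot> (up z * k)" "k * dwn z = c \<cdot> (dwn z * k)"
      using kz[OF k_ph(1)] kz[OF k_ph(3)] by (simp_all add: up_def dwn_def mult.commute)
  qed
  show "k * lxp r = (q * q) \<cdot> (lxp r * k)"
  proof (induct r rule: int_induct[of _ 0])
    case (step1 i) then show ?case using up lxp_step(1) by metis
  next
    case (step2 i) then show ?case using dwn lxp_step(2) by metis
  qed (simp add: lxp_base k_e)
  have m: "k * - z = c \<cdot> (- z * k)" if "k * z = c \<cdot> (z * k)" for z c using that by simp
  show "k * lxm r = (p * p) \<cdot> (lxm r * k)"
  proof (induct r rule: int_induct[of _ 0])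
    case (step1 i) then show ?case using m[OF up] lxm_step(1) by metis
  next
    case (step2 i) then show ?case using m[OF dwn] lxm_step(2) by metis
  qed (simp add: lxm_base k_f)
qed

lemma cm_ph_step:
  "cm ph (lxp r) = (q + p) \<cdot> lxp (r + 1)" "cm ph (lxm r) = - ((q + p) \<cdot> lxm (r + 1))"
  "cm ph' (lxp r) = (q + p) \<cdot> lxp (r - 1)" "cm ph' (lxm r) = - ((q + p) \<cdot> lxm (r - 1))"
  unfolding lxp_step[symmetric] lxm_step[symmetric] using qp_nz by (simp_all add: up_def dwn_def)

text \<open>The second member of the family is proportional to a quadratic expression in \<open>e\<close>, and its
  \<open>q\<close>-commutator with \<open>e\<close> is the Serre relation.  The next three lemmas are the same for the other three vectors.\<close>

lemma quadratic_e: "lxp 1 * lxp 0 = (q * q) \<cdot> (lxp 0 * lxp 1)"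
proof -
  let ?T = "y * e * e - (1 + p * p) \<cdot> (e * y * e) + (p * p) \<cdot> (e * e * y)"
  have "cm ph e = - ((q * q) \<cdot> ?T)"
    by (simp add: cm_def ph_def algebra_simps scl_simps scl_left)
  then have "lxp 1 = (- (1 / (q + p)) * (q * q)) \<cdot> ?T"
    using lxp_step(1)[of 0] by (simp add: lxp_base up_def)
  then show ?thesis using ser_2_bracket(2)[OF ser_ey(1)] by (simp add: lxp_base mult.commute)
qed

lemma quadratic_f: "lxm (- 1) * lxm 0 = (q * q) \<cdot> (lxm 0 * lxm (- 1))"
proof -
  let ?T = "y' * f * f - (1 + p * p) \<cdot> (f * y' * f) + (p * p) \<cdot> (f * f * y')"
  have "cm ph' f = ?T"
    by (simp add: cm_def ph'_def algebra_simps scl_simps scl_left)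
  then have "lxm (- 1) = (- (1 / (q + p))) \<cdot> ?T"
    using lxm_step(2)[of 0] by (simp add: lxm_base dwn_def)
  then show ?thesis using ser_2_bracket(2)[OF ser_fy'(1)] by (simp add: lxm_base mult.commute)
qed

lemma quadratic_y: "lxm 1 * lxm 2 = (q * q) \<cdot> (lxm 2 * lxm 1)"
proof -
  define T where "T = e * y * y - (1 + q * q) \<cdot> (y * e * y) + (q * q) \<cdot> (y * y * e)"
  have "cm ph y = T"
    by (simp add: cm_def ph_def T_def algebra_simps scl_simps scl_left)
  then have "cm ph (y * k) = T * k" by (simp add: cm_simps k_ph)
  then have 2: "lxm 2 = (- (1 / (q + p))) \<cdot> (T * k)"
    using lxm_step(1)[of 1] by (simp add: lxm_base up_def)
  have kT: "k * (T * x) = (p * p) \<cdot> (T * (k * x))" for x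
    by (simp add: T_def torus' algebra_simps scl_simps scl_left)
  have Ty: "T * (y * x) = (p * p) \<cdot> (y * (T * x))" for x
    using arg_cong[OF ser_2_bracket(1)[OF ser_ey(2)], of "\<lambda>u. u * x"] unfolding T_def[symmetric] by (simp add: mult.assoc)
  show ?thesis unfolding 2 lxm_base by (simp add: mult.assoc kT Ty torus' k_y mult.commute)
qed

lemma quadratic_y': "lxp (- 1) * lxp (- 2) = (q * q) \<cdot> (lxp (- 2) * lxp (- 1))"
proof -
  define T where "T = f * y' * y' - (1 + q * q) \<cdot> (y' * f * y') + (q * q) \<cdot> (y' * y' * f)"
  have "cm ph' y' = - ((p * p) \<cdot> T)"
    by (simp add: cm_def ph'_def T_def algebra_simps scl_simps scl_left)
  then have "cm ph' (ki * y') = - ((p * p) \<cdot> (ki * T))" by (simp add: cm_simps k_ph)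
  then have 2: "lxp (- 2) = (- (1 / (q + p)) * (p * p)) \<cdot> (ki * T)"
    using lxp_step(2)[of "- 1"] by (simp add: lxp_base dwn_def)
  have kT: "ki * (T * x) = (p * p) \<cdot> (T * (ki * x))" for x
    by (simp add: T_def torus' algebra_simps scl_simps scl_left)
  have kT0: "ki * T = (p * p) \<cdot> (T * ki)" using kT[of 1] by simp
  have Ty: "T * (y' * x) = (p * p) \<cdot> (y' * (T * x))" for x
    using arg_cong[OF ser_2_bracket(1)[OF ser_fy'(2)], of "\<lambda>u. u * x"] unfolding T_def[symmetric] by (simp add: mult.assoc)
  show ?thesis unfolding 2 lxp_base by (simp add: mult.assoc kT kT0 Ty torus torus' mult.commute)
qed

theorem loop_serre_orbits: "loop_serre sc q k ki lxp lxm"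
proof -
  interpret B: loop_base sc q k ki lxp lxm
    by unfold_locales (simp_all add: weight_lxp weight_lxm)
  have B1: "B.phi1 = ph" "B.phim1 = ph'"
    unfolding B.phi1_def B.phim1_def B.Br_def lxp_base lxm_base
    by (simp_all add: cm_def ph_def ph'_def torus torus' algebra_simps)
  have ka: "B.kap = ka" by (simp add: B.kap_def ka_def)
  interpret H: loop_shift sc q k ki lxp lxm
    by unfold_locales
       (simp_all add: B1 ka cm_ph_step B.Br_def lxp_base lxm_base cm_facts ka_opposite)
  show ?thesis
  proof unfold_locales
    fix r :: int
    show "lxp (r + 1) * lxp r = (q * q) \<cdot> (lxp r * lxp (r + 1))" if r: "r \<in> {- 2, - 1, 0}"
    proof -
      consider "r = - 2" | "r = - 1" | "r = 0" using r by blast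
      then show ?thesis
      proof cases
        case 2
        then show ?thesis using arg_cong[OF e_y', of "\<lambda>u. u * ki"] by (simp add: lxp_base torus torus' mult.assoc)
      qed (use quadratic_y' quadratic_e in simp_all)
    qed
    show "lxm r * lxm (r + 1) = (q * q) \<cdot> (lxm (r + 1) * lxm r)" if r: "r \<in> {- 1, 0, 1}"
    proof -
      consider "r = - 1" | "r = 0" | "r = 1" using r by blast
      then show ?thesis
      proof cases
        case 2
        then show ?thesis using arg_cong[OF y_f, of "\<lambda>u. u * k"] by (simp add: lxm_base torus torus' mult.assoc)
      qed (use quadratic_y quadratic_f in simp_all)
    qed
  qed
qed

end

context loop_serre
begin

text \<open>Reversing the degrees in both families.  This turns statements on positive degrees, such as those
  on \<open>pc\<close>, into statements on negative degrees.\<close>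

lemma mirror_invert: "loop_serre sc p ki k (\<lambda>r. xp (- r)) (\<lambda>r. xm (- r))"
proof -
  interpret I: quantum sc p by (rule quantum_inverse)
  interpret B: loop_base sc p ki k "\<lambda>r. xp (- r)" "\<lambda>r. xm (- r)"
    by unfold_locales (simp_all add: ki_xp ki_xm)
  have Br: "B.Br r s = Br (- r) (- s)" for r s by (simp add: B.Br_def Br_def)
  have ph: "B.phi1 = phim1" "B.phim1 = phi1"
    using Br_level_m1[of 0] Br_level_1[of 1] by (simp_all add: B.phi1_def B.phim1_def Br)
  have "1 / (q - p) = - (1 / (p - q))" by (metis minus_diff_eq minus_divide_right)
  then have kap: "B.kap = kap" by (simp add: B.kap_def kap_def scl_simps)
  have i: "p + inverse p = q + p" by (simp add: add.commute)
  have e: "- r - 1 + 1 = - r" "- (r + 1) = - r - 1" "- (r - 1) = - r + 1" for r :: int by simp_all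
  show ?thesis
  proof unfold_locales
    fix r :: int
    show "cm B.phi1 (xp (- r)) = (p + inverse p) \<cdot> xp (- (r + 1))"
      unfolding ph i e by (rule phim1_xp)
    show "cm B.phi1 (xm (- r)) = - ((p + inverse p) \<cdot> xm (- (r + 1)))"
      unfolding ph i e by (rule phim1_xm)
    show "cm B.phim1 (xp (- r)) = (p + inverse p) \<cdot> xp (- (r - 1))"
      unfolding ph i e by (rule phi1_xp)
    show "cm B.phim1 (xm (- r)) = - ((p + inverse p) \<cdot> xm (- (r - 1)))"
      unfolding ph i e by (rule phi1_xm)
    show "B.Br 0 0 = B.kap" "B.Br (- 1) 1 = B.kap"
      unfolding kap Br using Br_level[of 0] Br_level[of 1] by simp_all
    show "xp (- (r + 1)) * xp (- r) = (p * p) \<cdot> (xp (- r) * xp (- (r + 1)))"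
      using Qp[of "- r - 1"] unfolding e by (simp add: mult.assoc)
    show "xm (- r) * xm (- (r + 1)) = (p * p) \<cdot> (xm (- (r + 1)) * xm (- r))"
      using Qm[of "- r - 1"] unfolding e by (simp add: mult.assoc)
  qed
qed

end

section \<open>The quantum loop algebra inside a ring type\<close>

instance fract :: ("{idom, ring_char_0}") field_char_0
proof
  show "inj (of_nat :: nat \<Rightarrow> 'a fract)"
  proof (rule injI)
    fix m n :: nat
    assume "of_nat m = (of_nat n :: 'a fract)"
    then have "Fract (of_nat m) (1::'a) = Fract (of_nat n) 1" by (simp add: of_nat_fract)
    then show "m = n" by (simp add: eq_fract)
  qed
qed

lemma ratfun_of_poly_hom:
  "ratfun_of_poly (f + g) = ratfun_of_poly f + ratfun_of_poly g"
  "ratfun_of_poly (f * g) = ratfun_of_poly f * ratfun_of_poly g"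
  "ratfun_of_poly 1 = 1" "ratfun_of_poly 0 = 0"
  "ratfun_of_poly f = ratfun_of_poly g \<longleftrightarrow> f = g"
  by (simp_all add: ratfun_of_poly_def One_fract_def Zero_fract_def eq_fract)

lemma ratfun_of_poly_power: "ratfun_of_poly (f ^ m) = ratfun_of_poly f ^ m"
  by (induct m) (simp_all add: ratfun_of_poly_hom)

lemma qq_generic: "generic_q qq"
proof
  show "qq \<noteq> 0"
    using ratfun_of_poly_hom(5)[of "[:0, 1:]" 0] by (simp add: qq_def ratfun_of_poly_hom)
  fix m :: nat assume m: "m > 0"
  have "[:0, 1::complex:] ^ m = Polynomial.monom 1 m" by (simp add: monom_altdef)
  then have "[:0, 1::complex:] ^ m \<noteq> 1"
    using m by (metis degree_1 degree_monom_eq less_irrefl zero_neq_one)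
  then show "qq ^ m \<noteq> 1"
    unfolding qq_def ratfun_of_poly_power[symmetric] ratfun_of_poly_hom(3)[symmetric] ratfun_of_poly_hom(5) .
qed

interpretation Q: generic_q qq by (rule qq_generic)

lemma qint_qn: "qint r = qn qq r" and qfact_qfac: "qfact m = qfac qq m"
  by (simp_all add: qint_def qn_def qfact_def qfac_def)

subsection \<open>The free algebra\<close>

abbreviation F :: "nat \<Rightarrow> falg set" where "F n \<equiv> carrier (free_alg n)"

lemma F_iff: "f \<in> F n \<longleftrightarrow> (\<forall>w \<in> Poly_Mapping.keys f. \<forall>g \<in> set (letters w). gen_index g \<le> n)"
  by (simp add: free_alg_def)

lemma free_alg_simps [simp]:
  "f \<oplus>\<^bsub>free_alg n\<^esub> g = f + g" "f \<otimes>\<^bsub>free_alg n\<^esub> g = f * g" "\<zero>\<^bsub>free_alg n\<^esub> = 0" "\<one>\<^bsub>free_alg n\<^esub> = 1"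
  by (simp_all add: free_alg_def)

lemma F_zero [simp]: "0 \<in> F n" and F_one [simp]: "1 \<in> F n" and F_scal [simp]: "scal c \<in> F n"
  by (simp_all add: F_iff zero_word_def scal_def)

lemma F_gen [simp]: "gen g \<in> F n \<longleftrightarrow> gen_index g \<le> n"
  by (simp add: F_iff gen_def)

lemma F_add [simp]: "f \<in> F n \<Longrightarrow> g \<in> F n \<Longrightarrow> f + g \<in> F n"
  using keys_add[of f g] unfolding F_iff by blast

lemma F_mult [simp]: "f \<in> F n \<Longrightarrow> g \<in> F n \<Longrightarrow> f * g \<in> F n"
  using keys_mult[of f g] unfolding F_iff plus_word_def by fastforce

lemma scal_minus_1: "scal (- 1) * f = - f"
proof -
  have "scal (- 1) + 1 = 0"
    unfolding scal_def single_one[symmetric] single_add[symmetric] by simp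
  then have "scal (- 1) = - 1" by (simp add: eq_neg_iff_add_eq_0)
  then show ?thesis by simp
qed

lemma F_minus [simp]: "f \<in> F n \<Longrightarrow> - f \<in> F n"
  unfolding scal_minus_1[symmetric] by simp

lemma F_diff [simp]: "f \<in> F n \<Longrightarrow> g \<in> F n \<Longrightarrow> f - g \<in> F n"
  using F_add[of f n "- g"] by simp

lemma F_power [simp]: "f \<in> F n \<Longrightarrow> f ^ m \<in> F n"
  by (induct m) simp_all

lemma F_sum [simp]: "(\<And>r. r \<in> A \<Longrightarrow> h r \<in> F n) \<Longrightarrow> (\<Sum>r\<in>A. h r) \<in> F n"
  by (induct A rule: infinite_finite_induct) simp_all

lemma F_prod_list: "(\<And>x. x \<in> set xs \<Longrightarrow> h x \<in> F n) \<Longrightarrow> prod_list (map h xs) \<in> F n"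
  by (induct xs) simp_all

lemma scal_hom: "scal (a + b) = scal a + scal b" "scal (a * b) = scal a * scal b" "scal 1 = 1" "scal 0 = 0"
  by (simp_all add: scal_def single_add mult_single)

lemma scal_central: "scal c * f = f * scal c"
proof (induct f rule: update_induct)
  case (update f w a)
  then have "Poly_Mapping.update w a f = f + Poly_Mapping.single w a"
    by (intro poly_mapping_eqI) (auto simp: lookup_update lookup_add lookup_single not_in_keys_iff_lookup_eq_zero when_def)
  then show ?case using update
    by (simp add: distrib_left distrib_right scal_def mult_single mult.commute)
qed simp

lemma free_alg_ring: "ring (free_alg n)"
proof (rule ringI)
  show "abelian_group (free_alg n)"
  proof (rule abelian_groupI)
    fix x assume "x \<in> F n"
    then show "\<exists>y\<in>F n. y \<oplus>\<^bsub>free_alg n\<^esub> x = \<zero>\<^bsub>free_alg n\<^esub>"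
      by (intro bexI[of _ "- x"]) simp_all
  qed (simp_all add: add.assoc add.commute)
  show "monoid (free_alg n)" by (rule monoidI) (simp_all add: mult.assoc)
qed (simp_all add: distrib_left distrib_right)

interpretation A: ring "free_alg n" for n by (rule free_alg_ring)

lemma free_alg_minus: "x \<in> F n \<Longrightarrow> y \<in> F n \<Longrightarrow> x \<ominus>\<^bsub>free_alg n\<^esub> y = x - y"
proof -
  assume x: "x \<in> F n" "y \<in> F n"
  then have "\<ominus>\<^bsub>free_alg n\<^esub> y = - y" by (intro A.minus_equality) simp_all
  then show ?thesis by (simp add: a_minus_def)
qed

lemma relations_F: "relations n \<subseteq> F n"
proof -
  have "prod_list (map (ck Pos) [0..<Suc n]) \<in> F n"
    by (rule F_prod_list) auto
  then show ?thesis
    unfolding relations_def comm_def by (auto simp: mult.assoc)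
qed

lemma Uq_ideal: "ideal (Uq_ideal n) (free_alg n)"
  unfolding Uq_ideal_def by (rule A.genideal_ideal[OF relations_F])

lemma Uq_ring: "ring (Uq n)"
  unfolding Uq_def by (rule ideal.quotient_is_ring[OF Uq_ideal])

interpretation U: ring "Uq n" for n by (rule Uq_ring)

lemma class_hom: "Uq_class n \<in> ring_hom (free_alg n) (Uq n)"
  using ideal.rcos_ring_hom[OF Uq_ideal[of n]] unfolding Uq_def Uq_class_def[abs_def] .

lemma class_closed [simp]: "f \<in> F n \<Longrightarrow> Uq_class n f \<in> carrier (Uq n)"
  by (rule ring_hom_closed[OF class_hom])

lemma class_add: "f \<in> F n \<Longrightarrow> g \<in> F n \<Longrightarrow> Uq_class n (f + g) = Uq_class n f \<oplus>\<^bsub>Uq n\<^esub> Uq_class n g"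
  and class_mult: "f \<in> F n \<Longrightarrow> g \<in> F n \<Longrightarrow> Uq_class n (f * g) = Uq_class n f \<otimes>\<^bsub>Uq n\<^esub> Uq_class n g"
  and class_one: "Uq_class n 1 = \<one>\<^bsub>Uq n\<^esub>"
  using ring_hom_add[OF class_hom[of n], of f g] ring_hom_mult[OF class_hom[of n], of f g] ring_hom_one[OF class_hom[of n]] by simp_all

lemma class_zero: "Uq_class n 0 = \<zero>\<^bsub>Uq n\<^esub>"
  using class_add[of 0 n 0] U.add.r_cancel_one[of "Uq_class n 0" n "Uq_class n 0"] by simp

lemma class_minus: "f \<in> F n \<Longrightarrow> Uq_class n (- f) = \<ominus>\<^bsub>Uq n\<^esub> Uq_class n f"
proof -
  assume f: "f \<in> F n"
  have "Uq_class n (- f) \<oplus>\<^bsub>Uq n\<^esub> Uq_class n f = \<zero>\<^bsub>Uq n\<^esub>"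
    using class_add[of "- f" n f] f class_zero[of n] by simp
  then show ?thesis by (intro U.minus_equality[symmetric]) (simp_all add: f)
qed

lemma class_surj: "X \<in> carrier (Uq n) \<Longrightarrow> \<exists>f \<in> F n. X = Uq_class n f"
  unfolding Uq_def FactRing_def A_RCOSETS_def' Uq_class_def by auto

lemma class_eq: "f - g \<in> relations n \<Longrightarrow> f \<in> F n \<Longrightarrow> g \<in> F n \<Longrightarrow> Uq_class n f = Uq_class n g"
proof -
  assume f: "f - g \<in> relations n" "f \<in> F n" "g \<in> F n"
  have "f - g \<in> Uq_ideal n"
    unfolding Uq_ideal_def by (rule subsetD[OF A.genideal_self[OF relations_F] f(1)])
  then have "f \<ominus>\<^bsub>free_alg n\<^esub> g \<in> Uq_ideal n" unfolding free_alg_minus[OF f(2,3)] .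
  then show ?thesis
    unfolding Uq_class_def by (rule A.quotient_eq_iff_same_a_r_cos[OF Uq_ideal f(2,3), THEN iffD1])
qed

subsection \<open>A ring type containing all the quantum loop algebras\<close>

text \<open>The classes that the preceding parts use live on types, whereas the quantum loop algebra
  depends on \<open>n\<close>.  A product over all \<open>n\<close> is one type.  The additional component holds the value of the counit; it makes
  zero and one distinct without knowing that any of the algebras is nonzero.\<close>

typedef ualg = "{(f :: nat \<Rightarrow> falg set, c :: ratfun). \<forall>m. f m \<in> carrier (Uq m)}"
  morphisms coords of_coords
  by (rule exI[of _ "(\<lambda>m. \<zero>\<^bsub>Uq m\<^esub>, 0)"]) simp

definition pr :: "nat \<Rightarrow> ualg \<Rightarrow> falg set" where "pr m z = fst (coords z) m"
definition cu :: "ualg \<Rightarrow> ratfun" where "cu z = snd (coords z)"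
definition mk :: "(nat \<Rightarrow> falg set) \<Rightarrow> ratfun \<Rightarrow> ualg" where "mk f c = of_coords (f, c)"

lemma pr_closed [simp]: "pr m z \<in> carrier (Uq m)"
  using coords[of z] by (auto simp: pr_def)

lemma mk_simps [simp]:
  assumes "\<And>m. f m \<in> carrier (Uq m)" shows "pr m (mk f c) = f m" "cu (mk f c) = c"
  using assms by (simp_all add: pr_def cu_def mk_def of_coords_inverse)

lemma ualg_eqI: "(\<And>m. pr m x = pr m y) \<Longrightarrow> cu x = cu y \<Longrightarrow> x = y"
  unfolding pr_def cu_def by (metis coords_inject ext prod.collapse)

instantiation ualg :: ring_1
begin
definition "0 = mk (\<lambda>m. \<zero>\<^bsub>Uq m\<^esub>) 0"
definition "1 = mk (\<lambda>m. \<one>\<^bsub>Uq m\<^esub>) 1"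
definition "x + y = mk (\<lambda>m. pr m x \<oplus>\<^bsub>Uq m\<^esub> pr m y) (cu x + cu y)"
definition "x * y = mk (\<lambda>m. pr m x \<otimes>\<^bsub>Uq m\<^esub> pr m y) (cu x * cu y)"
definition "- x = mk (\<lambda>m. \<ominus>\<^bsub>Uq m\<^esub> pr m x) (- cu x)"
definition "x - y = x + - (y::ualg)"

lemma ualg_simps [simp]:
  "pr m 0 = \<zero>\<^bsub>Uq m\<^esub>" "cu 0 = 0" "pr m 1 = \<one>\<^bsub>Uq m\<^esub>" "cu 1 = 1"
  "pr m (x + y) = pr m x \<oplus>\<^bsub>Uq m\<^esub> pr m y" "cu (x + y) = cu x + cu y"
  "pr m (x * y) = pr m x \<otimes>\<^bsub>Uq m\<^esub> pr m y" "cu (x * y) = cu x * cu y"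
  "pr m (- x) = \<ominus>\<^bsub>Uq m\<^esub> pr m x" "cu (- x) = - cu x"
  by (simp_all add: zero_ualg_def one_ualg_def plus_ualg_def times_ualg_def uminus_ualg_def)

instance
proof
  fix x y z :: ualg
  show "x + y = y + x" by (rule ualg_eqI) (simp_all add: U.a_comm add.commute)
  show "x + y + z = x + (y + z)" by (rule ualg_eqI) (simp_all add: U.a_assoc add.assoc)
  show "0 + x = x" by (rule ualg_eqI) simp_all
  show "- x + x = 0" by (rule ualg_eqI) (simp_all add: U.l_neg)
  show "x - y = x + - y" by (simp add: minus_ualg_def)
  show "x * y * z = x * (y * z)" by (rule ualg_eqI) (simp_all add: U.m_assoc mult.assoc)
  show "1 * x = x" "x * 1 = x" by (rule ualg_eqI; simp)+
  show "(x + y) * z = x * z + y * z" "x * (y + z) = x * y + x * z"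
    by (rule ualg_eqI; simp add: U.l_distr U.r_distr distrib_left distrib_right)+
  have "cu 0 \<noteq> cu 1" by simp
  then show "(0::ualg) \<noteq> 1" by metis
qed

end

text \<open>An element of the free algebra together with its image under the counit.  Away from the
  coordinate \<open>n\<close> it is the scalar given by the counit.\<close>

definition emb :: "nat \<Rightarrow> falg \<Rightarrow> ratfun \<Rightarrow> ualg" where
  "emb n f d = mk (\<lambda>m. if m = n then Uq_class n f else Uq_class m (scal d)) d"

lemma emb_simps:
  assumes "f \<in> F n" shows "pr n (emb n f d) = Uq_class n f" "m \<noteq> n \<Longrightarrow> pr m (emb n f d) = Uq_class m (scal d)" "cu (emb n f d) = d"
proof -
  have *: "(if m = n then Uq_class n f else Uq_class m (scal d)) \<in> carrier (Uq m)" for m using assms by simp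
  show "pr n (emb n f d) = Uq_class n f" "m \<noteq> n \<Longrightarrow> pr m (emb n f d) = Uq_class m (scal d)" "cu (emb n f d) = d"
    unfolding emb_def by (simp_all add: mk_simps[OF *] del: mk_simps)
qed

lemma emb_eqI:
  assumes "f \<in> F n" "cu z = d" "pr n z = Uq_class n f" "\<And>m. m \<noteq> n \<Longrightarrow> pr m z = Uq_class m (scal d)"
  shows "emb n f d = z"
proof (rule ualg_eqI)
  fix m show "pr m (emb n f d) = pr m z" using assms by (cases "m = n") (simp_all add: emb_simps)
qed (simp add: assms emb_simps)

lemma emb_add: "f \<in> F n \<Longrightarrow> g \<in> F n \<Longrightarrow> emb n (f + g) (c + d) = emb n f c + emb n g d"
  by (rule emb_eqI) (simp_all add: emb_simps class_add scal_hom)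

lemma emb_mult: "f \<in> F n \<Longrightarrow> g \<in> F n \<Longrightarrow> emb n (f * g) (c * d) = emb n f c * emb n g d"
  by (rule emb_eqI) (simp_all add: emb_simps class_mult scal_hom)

lemma emb_one: "emb n 1 1 = 1"
  by (rule emb_eqI) (simp_all add: class_one scal_hom)

lemma scal_uminus: "scal (- c) = - scal c"
  using scal_hom(2)[of "- 1" c] by (simp add: scal_minus_1)

lemma emb_minus: "f \<in> F n \<Longrightarrow> emb n (- f) (- c) = - emb n f c"
  by (rule emb_eqI) (simp_all add: emb_simps class_minus scal_uminus)

lemma emb_diff: "f \<in> F n \<Longrightarrow> g \<in> F n \<Longrightarrow> emb n (f - g) (c - d) = emb n f c - emb n g d"
  using emb_add[of f n "- g" c "- d"] by (simp add: emb_minus)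

lemma emb_power: "f \<in> F n \<Longrightarrow> emb n (f ^ m) (c ^ m) = emb n f c ^ m"
  by (induct m) (simp_all add: emb_one emb_mult)

lemma emb_zero: "emb n 0 0 = 0"
  by (rule emb_eqI) (simp_all add: class_zero scal_hom)

lemma emb_rel: "f - g \<in> relations n \<Longrightarrow> f \<in> F n \<Longrightarrow> g \<in> F n \<Longrightarrow> emb n f d = emb n g d"
  using class_eq[of f g n] by (simp add: emb_def cong: if_cong)

definition scu :: "ratfun \<Rightarrow> ualg" where "scu c = emb 0 (scal c) c"

lemma emb_scal: "emb n (scal c) c = scu c"
  unfolding scu_def by (rule emb_eqI) (simp_all add: emb_simps, (metis F_scal emb_simps(1,2))+)

lemma scu_central: "central_scalars scu"
proof
  fix a b c :: ratfun and x :: ualg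
  show "scu (a + b) = scu a + scu b" "scu (a * b) = scu a * scu b" "scu 1 = 1"
    unfolding scu_def by (simp_all add: scal_hom emb_add emb_mult emb_one)
  show "scu c * x = x * scu c"
  proof (rule ualg_eqI)
    fix m
    obtain f where f: "f \<in> F m" "pr m x = Uq_class m f" using class_surj[OF pr_closed] by blast
    have "pr m (scu c) = Uq_class m (scal c)" unfolding emb_scal[symmetric, of c m] by (simp add: emb_simps)
    then show "pr m (scu c * x) = pr m (x * scu c)"
      using f class_mult[of "scal c" m f] class_mult[of f m "scal c"] by (simp add: scal_central)
  qed (simp add: mult.commute)
qed

interpretation L: quantum scu qq
  using scu_central qq_generic by (rule quantum.intro)

lemma scl_emb: "f \<in> F n \<Longrightarrow> L.scl c (emb n f d) = emb n (scal c * f) (c * d)"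
  by (simp add: L.scl_def emb_scal[symmetric, of _ n] emb_mult)

lemma emb_prod_list: "(\<And>x. x \<in> set xs \<Longrightarrow> h x \<in> F n) \<Longrightarrow> emb n (prod_list (map h xs)) 1 = prod_list (map (\<lambda>x. emb n (h x) 1) xs)"
proof (induct xs)
  case (Cons x xs)
  then show ?case using emb_mult[of "h x" n "prod_list (map h xs)" 1 1] by (simp add: F_prod_list)
qed (simp add: emb_one)

lemma qbinom_small:
  "qbinom d 0 = 1" "qbinom 1 1 = 1" "qbinom 2 1 = qq + inverse qq" "qbinom 2 2 = 1"
  "qbinom 3 1 = qq * qq + 1 + inverse qq * inverse qq" "qbinom 3 2 = qq * qq + 1 + inverse qq * inverse qq" "qbinom 3 3 = 1"
proof -
  have i: "{1..1::nat} = {1}" "{1..2::nat} = {1, 2}" "{1..3::nat} = {1, 2, 3}" by auto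
  show "qbinom d 0 = 1" "qbinom 1 1 = 1" "qbinom 2 1 = qq + inverse qq" "qbinom 2 2 = 1"
    "qbinom 3 1 = qq * qq + 1 + inverse qq * inverse qq" "qbinom 3 2 = qq * qq + 1 + inverse qq * inverse qq" "qbinom 3 3 = 1"
    unfolding qbinom_def qint_qn i using Q.qn_nz[of 2] Q.qn_nz[of 3] Q.qn_2 Q.qn_3
    by (simp_all add: atLeastAtMost_singleton)
qed

definition uE :: "nat \<Rightarrow> sign \<Rightarrow> nat \<Rightarrow> ualg" where "uE n s i = emb n (ce s i) 0"
definition uK :: "nat \<Rightarrow> sign \<Rightarrow> nat \<Rightarrow> ualg" where "uK n s i = emb n (ck s i) 1"

lemma uK_inverse: "i \<le> n \<Longrightarrow> uK n s i * uK n (opp s) i = 1"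
proof -
  assume i: "i \<le> n"
  have "ck s i * ck (opp s) i - 1 \<in> relations n" unfolding relations_def using i by blast
  from emb_rel[OF this, of 1] show ?thesis
    using i emb_mult[of "ck s i" n "ck (opp s) i" 1 1] by (simp add: uK_def emb_one)
qed

lemma uK_comm: "i \<le> n \<Longrightarrow> j \<le> n \<Longrightarrow> uK n Pos i * uK n Pos j = uK n Pos j * uK n Pos i"
proof -
  assume i: "i \<le> n" "j \<le> n"
  have "ck Pos i * ck Pos j - ck Pos j * ck Pos i \<in> relations n" unfolding relations_def comm_def using i by blast
  from emb_rel[OF this, of 1] show ?thesis
    using i emb_mult[of "ck Pos i" n "ck Pos j" 1 1] emb_mult[of "ck Pos j" n "ck Pos i" 1 1] by (simp add: uK_def)
qed

lemma uK_uE: "i \<le> n \<Longrightarrow> j \<le> n \<Longrightarrow> uK n Pos i * uE n s j * uK n Neg i = L.scl (qq powi (sgn_int s * cartan n i j)) (uE n s j)"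
proof -
  assume i: "i \<le> n" "j \<le> n"
  let ?c = "qq powi (sgn_int s * cartan n i j)"
  have "ck Pos i * ce s j * ck Neg i - scal ?c * ce s j \<in> relations n" unfolding relations_def using i by blast
  from emb_rel[OF this, of 0] show ?thesis
    using i emb_mult[of "ck Pos i * ce s j" n "ck Neg i" 0 1] emb_mult[of "ck Pos i" n "ce s j" 1 0] scl_emb[of "ce s j" n ?c 0]
    by (simp add: uK_def uE_def)
qed

lemma uE_comm: "i \<le> n \<Longrightarrow> j \<le> n \<Longrightarrow> uE n Pos i * uE n Neg j - uE n Neg j * uE n Pos i
   = (if i = j then L.scl (1 / (qq - inverse qq)) (uK n Pos i - uK n Neg i) else 0)"
proof -
  assume i: "i \<le> n" "j \<le> n"
  let ?r = "if i = j then scal (1 / (qq - inverse qq)) * (ck Pos i - ck Neg i) else 0"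
  have "(ce Pos i * ce Neg j - ce Neg j * ce Pos i) - ?r \<in> relations n" unfolding relations_def comm_def using i by blast
  from emb_rel[OF this, of 0]
  have "emb n (ce Pos i * ce Neg j - ce Neg j * ce Pos i) 0 = emb n ?r 0" using i by simp
  moreover have "emb n (ce Pos i * ce Neg j - ce Neg j * ce Pos i) 0 = uE n Pos i * uE n Neg j - uE n Neg j * uE n Pos i"
    using i emb_diff[of "ce Pos i * ce Neg j" n "ce Neg j * ce Pos i" 0 0] emb_mult[of "ce Pos i" n "ce Neg j" 0 0] emb_mult[of "ce Neg j" n "ce Pos i" 0 0]
    by (simp add: uE_def)
  moreover have "emb n ?r 0 = (if i = j then L.scl (1 / (qq - inverse qq)) (uK n Pos i - uK n Neg i) else 0)"
    using i emb_diff[of "ck Pos i" n "ck Neg i" 1 1] scl_emb[of "ck Pos i - ck Neg i" n "1 / (qq - inverse qq)" 0]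
    by (cases "i = j") (simp_all add: uK_def emb_zero)
  ultimately show ?thesis by simp
qed

lemma uE_serre:
  assumes i: "i \<le> n" "j \<le> n" "i \<noteq> j"
  shows "L.ser (nat (- cartan n i j)) (uE n s i) (uE n s j)"
proof -
  define a where "a = nat (- cartan n i j)"
  have le: "cartan n i j \<le> 0" "cartan n i j \<ge> - 2" using i by (simp_all add: cartan_def)
  have a: "nat (1 - cartan n i j) = Suc a" "a \<le> 2" using le by (simp_all add: a_def)
  let ?t = "\<lambda>r. scal ((- 1) ^ r * qbinom (Suc a) r) * ce s i ^ r * ce s j * ce s i ^ (Suc a - r)"
  let ?u = "\<lambda>r. L.scl ((- 1) ^ r * qbinom (Suc a) r) (uE n s i ^ r * uE n s j * uE n s i ^ (Suc a - r))"
  have "(\<Sum>r\<le>Suc a. ?t r) \<in> relations n"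
    unfolding relations_def a(1)[symmetric] using i by blast
  then have e1: "emb n (\<Sum>r\<le>Suc a. ?t r) 0 = 0"
    using emb_rel[of "\<Sum>r\<le>Suc a. ?t r" 0 n 0] i by (simp add: emb_zero)
  have e2: "emb n (\<Sum>r\<in>A. ?t r) 0 = (\<Sum>r\<in>A. ?u r)" if "finite A" for A
    using that
  proof (induct A)
    case (insert r A)
    have "emb n (?t r) 0 = ?u r"
      using i emb_mult[of "scal ((- 1) ^ r * qbinom (Suc a) r) * ce s i ^ r * ce s j" n "ce s i ^ (Suc a - r)" 0 "0 ^ (Suc a - r)"]
        emb_mult[of "scal ((- 1) ^ r * qbinom (Suc a) r) * ce s i ^ r" n "ce s j" "((- 1) ^ r * qbinom (Suc a) r) * 0 ^ r" 0]
        emb_mult[of "scal ((- 1) ^ r * qbinom (Suc a) r)" n "ce s i ^ r" "(- 1) ^ r * qbinom (Suc a) r" "0 ^ r"]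
        emb_power[of "ce s i" n _ 0] emb_scal[of n "(- 1) ^ r * qbinom (Suc a) r"]
      by (simp add: uE_def L.scl_def mult.assoc)
    then show ?case using insert i emb_add[of "?t r" n "\<Sum>r\<in>A. ?t r" 0 0] by simp
  qed (simp add: emb_zero)
  have R: "(\<Sum>r\<le>Suc a. ?u r) = 0" using e1 unfolding e2[OF finite_atMost] .
  consider "a = 0" | "a = 1" | "a = 2" using a(2) by linarith
  then have "L.ser a (uE n s i) (uE n s j)"
  proof cases
    case 1
    then show ?thesis using R qbinom_small(1,2) by (simp add: L.ser_def)
  next
    case 2
    then have S: "{..Suc a} = {0, 1, 2}" "Suc a = 2" by auto
    let ?e = "uE n s i" and ?x = "uE n s j"
    have R2: "(\<Sum>r\<in>{0, 1, 2}. L.scl ((- 1) ^ r * qbinom 2 r) (?e ^ r * ?x * ?e ^ (2 - r))) = 0"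
      using R unfolding S(1) unfolding S(2) .
    have "?e * ?e * ?x - L.scl (qbinom 2 1) (?e * ?x * ?e) + ?x * ?e * ?e
       = (\<Sum>r\<in>{0, 1, 2}. L.scl ((- 1) ^ r * qbinom 2 r) (?e ^ r * ?x * ?e ^ (2 - r)))"
      using qbinom_small(1)[of 2] qbinom_small(4) by (simp add: power2_eq_square mult.assoc)
    then show ?thesis unfolding 2 L.ser_def R2 qbinom_small(3) by simp
  next
    case 3
    then have S: "{..Suc a} = {0, 1, 2, 3}" "Suc a = 3" by auto
    let ?e = "uE n s i" and ?x = "uE n s j"
    have R3: "(\<Sum>r\<in>{0, 1, 2, 3}. L.scl ((- 1) ^ r * qbinom 3 r) (?e ^ r * ?x * ?e ^ (3 - r))) = 0"
      using R unfolding S(1) unfolding S(2) .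
    have "?e * ?e * ?e * ?x - L.scl (qbinom 3 2) (?e * ?e * ?x * ?e) + L.scl (qbinom 3 1) (?e * ?x * ?e * ?e) - ?x * ?e * ?e * ?e
       = - (\<Sum>r\<in>{0, 1, 2, 3}. L.scl ((- 1) ^ r * qbinom 3 r) (?e ^ r * ?x * ?e ^ (3 - r)))"
      using qbinom_small(1)[of 3] qbinom_small(7) by (simp add: power2_eq_square power3_eq_cube mult.assoc)
    then show ?thesis unfolding 3 L.ser_def R3 qbinom_small(5,6) by simp
  qed
  then show ?thesis unfolding a_def .
qed

lemma uK_prod: "prod_list (map (uK n Pos) [0..<Suc n]) = 1"
proof -
  have "prod_list (map (ck Pos) [0..<Suc n]) - 1 \<in> relations n" unfolding relations_def by blast
  moreover have F: "ck Pos i \<in> F n" if "i \<in> set [0..<Suc n]" for i using that by auto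
  ultimately have "emb n (prod_list (map (ck Pos) [0..<Suc n])) 1 = emb n 1 1"
    by (intro emb_rel F_prod_list) simp_all
  moreover have "emb n (prod_list (map (ck Pos) [0..<Suc n])) 1 = prod_list (map (\<lambda>i. emb n (ck Pos i) 1) [0..<Suc n])"
    by (rule emb_prod_list) (rule F)
  ultimately show ?thesis by (simp only: uK_def[abs_def] emb_one)
qed

text \<open>Away from the coordinate \<open>n\<close> the elements act as their counits \<open>0\<close> and \<open>1\<close>, for which all relations
  are trivial; at the coordinate \<open>n\<close> they are the defining relations.\<close>

lemma affine_nodes_Uq:
  assumes n: "1 \<le> n"
  shows "affine_nodes scu qq n (uE n Pos) (uE n Neg) (uK n Pos) (uK n Neg)"
proof -
  have KK: "uK n Pos i * uK n Neg i = 1" "uK n Neg i * uK n Pos i = 1" if "i \<le> n" for i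
    using uK_inverse[OF that, of Pos] uK_inverse[OF that, of Neg] by simp_all
  have KE: "uK n Pos i * uE n s j = L.scl (qq powi (sgn_int s * cartan n i j)) (uE n s j * uK n Pos i)"
    if i: "i \<le> n" "j \<le> n" for s i j
  proof -
    have "uK n Pos i * uE n s j = (uK n Pos i * uE n s j * uK n Neg i) * uK n Pos i"
      using KK(2)[OF i(1)] by (simp add: mult.assoc)
    then show ?thesis unfolding uK_uE[OF i] by simp
  qed
  have KE': "uK n Neg i * uE n Neg j = L.scl (qq powi cartan n i j) (uE n Neg j * uK n Neg i)"
    if i: "i \<le> n" "j \<le> n" for i j
    using L.inv_comm[OF KK(1)[OF i(1)] KK(2)[OF i(1)] KE[OF i, of Neg]] by (simp add: power_int_minus)
  show ?thesis
    by unfold_locales (use n in \<open>simp_all add: KK KE KE' uE_serre uK_comm uE_comm uK_prod del: upt_Suc\<close>)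
qed

section \<open>Drinfeld's elements lie in the restricted form\<close>

subsection \<open>Laurent polynomials\<close>

lemma laurentI: "x = ratfun_of_poly f / qq ^ k \<Longrightarrow> x \<in> laurent_polys"
  unfolding laurent_polys_def by blast

lemma laurent_mult: "a \<in> laurent_polys \<Longrightarrow> b \<in> laurent_polys \<Longrightarrow> a * b \<in> laurent_polys"
proof -
  assume "a \<in> laurent_polys" "b \<in> laurent_polys"
  then obtain f k g m where "a = ratfun_of_poly f / qq ^ k" "b = ratfun_of_poly g / qq ^ m"
    unfolding laurent_polys_def by blast
  then have "a * b = ratfun_of_poly (f * g) / qq ^ (k + m)" by (simp add: ratfun_of_poly_hom power_add)
  then show ?thesis by (rule laurentI)
qed

lemma laurent_add: "a \<in> laurent_polys \<Longrightarrow> b \<in> laurent_polys \<Longrightarrow> a + b \<in> laurent_polys"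
proof -
  assume "a \<in> laurent_polys" "b \<in> laurent_polys"
  then obtain f k g m where "a = ratfun_of_poly f / qq ^ k" "b = ratfun_of_poly g / qq ^ m"
    unfolding laurent_polys_def by blast
  then have "a + b = ratfun_of_poly (f * [:0, 1:] ^ m + g * [:0, 1:] ^ k) / qq ^ (k + m)"
    by (simp only: ratfun_of_poly_hom ratfun_of_poly_power qq_def[symmetric]) (simp add: field_simps power_add)
  then show ?thesis by (rule laurentI)
qed

lemma laurent_poly: "ratfun_of_poly f \<in> laurent_polys"
  by (rule laurentI[of _ f 0]) simp

lemma laurent_powi: "qq powi m \<in> laurent_polys"
proof (cases "0 \<le> m")
  case True
  then have "qq powi m = ratfun_of_poly ([:0, 1:] ^ nat m)"
    unfolding ratfun_of_poly_power qq_def[symmetric] by (simp add: power_int_def)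
  then show ?thesis by (simp only: laurent_poly)
next
  case False
  then have "qq powi m = ratfun_of_poly 1 / qq ^ nat (- m)"
    by (simp add: power_int_def ratfun_of_poly_hom power_inverse divide_inverse)
  then show ?thesis by (rule laurentI)
qed

text \<open>Splitting \<open>[d + 1]\<close> as \<open>[(d - r) + (r + 1)]\<close>.  It shows that Gaussian binomial coefficients are Laurent
  polynomials.\<close>

lemma qbinom_pascal:
  "qbinom (Suc d) (Suc r) = qq powi int (Suc r) * qbinom d (Suc r) + qq powi (- (int d - int r)) * qbinom d r"
proof -
  define N where "N d r = (\<Prod>s = 1..r. qn qq (int d + 1 - int s))" for d r
  have b: "qbinom d r = N d r / qfac qq r" for d r
    unfolding qbinom_def N_def qfac_def qint_qn by (rule prod_dividef)
  have N1: "N d (Suc r) = N d r * qn qq (int d - int r)" for d r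
    by (simp add: N_def)
  have N2: "N (Suc d) (Suc r) = qn qq (int (Suc d)) * N d r" for d r
  proof (induct r)
    case (Suc r)
    have e: "int (Suc d) - int (Suc r) = int d - int r" by simp
    show ?case unfolding N1[of "Suc d" "Suc r"] Suc unfolding N1[of d r] e by (simp only: mult.assoc)
  qed (simp add: N_def)
  have s: "int (Suc d) = (int d - int r) + int (Suc r)" by simp
  have "qn qq (int (Suc d)) = qq powi int (Suc r) * qn qq (int d - int r) + qq powi (- (int d - int r)) * qn qq (int (Suc r))"
    unfolding s by (rule Q.qn_add)
  then have "qbinom (Suc d) (Suc r) = (qq powi int (Suc r) * qn qq (int d - int r) + qq powi (- (int d - int r)) * qn qq (int (Suc r))) * N d r / qfac qq (Suc r)"
    unfolding b N2 by simp
  also have "\<dots> = qq powi int (Suc r) * (N d r * qn qq (int d - int r)) / qfac qq (Suc r) + qq powi (- (int d - int r)) * (qn qq (int (Suc r)) * N d r / qfac qq (Suc r))"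
    by (simp only: distrib_left distrib_right add_divide_distrib mult.assoc mult.commute mult.left_commute times_divide_eq_right)
  also have "qn qq (int (Suc r)) * N d r / qfac qq (Suc r) = N d r / qfac qq r"
    unfolding qfac_Suc using Q.qn_nz[of "int (Suc r)"] by (simp del: of_nat_Suc)
  finally show ?thesis unfolding b N1[of d r] by simp
qed

lemma laurent_qbinom: "qbinom d r \<in> laurent_polys"
proof (induct d arbitrary: r)
  case 0
  show ?case
  proof (cases r)
    case (Suc m)
    have "qbinom 0 r = 0" unfolding Suc qbinom_def by (rule prod_zero) (auto intro!: bexI[of _ "1::nat"] simp: qint_qn)
    then show ?thesis using laurent_poly[of 0] by (simp add: ratfun_of_poly_hom)
  qed (use laurent_poly[of 1] in \<open>simp add: qbinom_small ratfun_of_poly_hom\<close>)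
next
  case (Suc d)
  show ?case
  proof (cases r)
    case (Suc m)
    show ?thesis unfolding Suc qbinom_pascal
      by (intro laurent_add laurent_mult laurent_powi \<open>\<And>r. qbinom d r \<in> laurent_polys\<close>)
  qed (use laurent_poly[of 1] in \<open>simp add: qbinom_small ratfun_of_poly_hom\<close>)
qed

subsection \<open>The restricted form as an integral form\<close>

lemma Ures_generators: "Uq_class n ` (scal ` laurent_polys \<union> res_generators n) \<subseteq> carrier (Uq n)"
  unfolding res_generators_def div_pow_def by auto

lemma Ures_subring: "subring (carrier (Ures n)) (Uq n)"
  unfolding Ures_def using U.generate_ring_is_subring[OF Ures_generators[of n]] by simp

lemma Ures_scal: "c \<in> laurent_polys \<Longrightarrow> Uq_class n (scal c) \<in> carrier (Ures n)"
  and Ures_res: "g \<in> res_generators n \<Longrightarrow> Uq_class n g \<in> carrier (Ures n)"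
  unfolding Ures_def by (auto intro!: generate_ring.incl)

text \<open>Only the coordinate \<open>n\<close> matters for integrality.\<close>

definition Sint :: "nat \<Rightarrow> ualg set" where "Sint n = {z. pr n z \<in> carrier (Ures n)}"

lemma pr_scl: "pr n (L.scl c z) = Uq_class n (scal c) \<otimes>\<^bsub>Uq n\<^esub> pr n z"
  by (simp add: L.scl_def emb_scal[of n c, symmetric] emb_simps)

lemma Sint_integral: "integral_form scu qq (Sint n)"
proof (rule integral_form.intro[OF L.quantum_axioms integral_form_axioms.intro])
  interpret S: subring "carrier (Ures n)" "Uq n" by (rule Ures_subring)
  show "1 \<in> Sint n" by (simp add: Sint_def)
  fix x y assume x: "x \<in> Sint n"
  show "L.scl qq x \<in> Sint n"
    using x Ures_scal[OF laurent_powi[of 1], of n] by (simp add: Sint_def pr_scl)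
  show "L.scl (inverse qq) x \<in> Sint n"
    using x Ures_scal[OF laurent_powi[of "- 1"], of n] by (simp add: Sint_def pr_scl power_int_minus)
  assume y: "y \<in> Sint n"
  show "x * y \<in> Sint n" using x y by (simp add: Sint_def)
  have "pr n (x - y) = pr n x \<oplus>\<^bsub>Uq n\<^esub> (\<ominus>\<^bsub>Uq n\<^esub> pr n y)" unfolding diff_conv_add_uminus ualg_simps ..
  then show "x - y \<in> Sint n"
    using x y subringE(5,7)[OF Ures_subring[of n]] by (simp add: Sint_def)
qed

interpretation I: integral_form scu qq "Sint n" for n by (rule Sint_integral)

text \<open>The bridge between representatives in the free algebra and elements of the ring type; it is
  compatible with all operations, so that formulas can be transferred term by term.\<close>

definition represents :: "nat \<Rightarrow> falg \<Rightarrow> ualg \<Rightarrow> bool" where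
  "represents n f z \<longleftrightarrow> f \<in> F n \<and> pr n z = Uq_class n f"

lemma represents_Sint: "represents n f z \<Longrightarrow> z \<in> Sint n \<Longrightarrow> Uq_class n f \<in> carrier (Ures n)"
  and Sint_represents: "represents n f z \<Longrightarrow> Uq_class n f \<in> carrier (Ures n) \<Longrightarrow> z \<in> Sint n"
  by (simp_all add: represents_def Sint_def)

lemma represents_add: "represents n f z \<Longrightarrow> represents n g w \<Longrightarrow> represents n (f + g) (z + w)"
  and represents_mult: "represents n f z \<Longrightarrow> represents n g w \<Longrightarrow> represents n (f * g) (z * w)"
  and represents_minus: "represents n f z \<Longrightarrow> represents n (- f) (- z)"
  and represents_one: "represents n 1 1" and represents_zero: "represents n 0 0"
  and represents_scl: "represents n f z \<Longrightarrow> represents n (scal c * f) (L.scl c z)"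
  by (simp_all add: represents_def class_add class_mult class_minus class_one class_zero pr_scl)

lemma represents_diff: "represents n f z \<Longrightarrow> represents n g w \<Longrightarrow> represents n (f - g) (z - w)"
  unfolding diff_conv_add_uminus by (intro represents_add represents_minus)

lemma represents_power: "represents n f z \<Longrightarrow> represents n (f ^ m) (z ^ m)"
  by (induct m) (simp_all add: represents_one represents_mult)

lemma represents_sum: "finite A \<Longrightarrow> (\<And>t. t \<in> A \<Longrightarrow> represents n (h t) (g t)) \<Longrightarrow> represents n (\<Sum>t\<in>A. h t) (\<Sum>t\<in>A. g t)"
  by (induct A rule: finite_induct) (simp_all add: represents_zero represents_add)

lemma represents_comm: "represents n f z \<Longrightarrow> represents n g w \<Longrightarrow> represents n (comm f g) (cm z w)"
  unfolding comm_def cm_def by (intro represents_diff represents_mult)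

lemma represents_funpow:
  "(\<And>f z. represents n f z \<Longrightarrow> represents n (h f) (g z)) \<Longrightarrow> represents n f z \<Longrightarrow> represents n ((h ^^ m) f) ((g ^^ m) z)"
  by (induct m) simp_all

lemma sign_scal: "(- 1 :: falg) ^ m = scal ((- 1) ^ m)"
  by (induct m) (simp_all add: scal_hom scal_uminus)

lemma represents_sign: "represents n f z \<Longrightarrow> represents n ((- 1) ^ m * f) (L.scl ((- 1) ^ m) z)"
  unfolding sign_scal by (rule represents_scl)

lemma represents_gen: "i \<le> n \<Longrightarrow> represents n (ce s i) (uE n s i)" "i \<le> n \<Longrightarrow> represents n (ck s i) (uK n s i)"
  by (simp_all add: represents_def uE_def uK_def emb_simps)

lemma represents_div_pow: "represents n f z \<Longrightarrow> represents n (div_pow f t) (L.dp z t)"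
  unfolding div_pow_def L.dp_def qfact_qfac by (intro represents_scl represents_power)

lemma uE_integral: "i \<le> n \<Longrightarrow> L.dp (uE n s i) t \<in> Sint n"
proof (cases "t = 0")
  case False
  assume i: "i \<le> n"
  have "0 < t" using False by simp
  with i have "div_pow (ce s i) t \<in> res_generators n" unfolding res_generators_def by blast
  from Sint_represents[OF represents_div_pow[OF represents_gen(1)[OF i]] Ures_res[OF this]] show ?thesis .
qed simp

lemma uK_integral: "i \<le> n \<Longrightarrow> uK n s i \<in> Sint n"
proof -
  assume i: "i \<le> n"
  then have "ck s i \<in> res_generators n" unfolding res_generators_def by auto
  from Sint_represents[OF represents_gen(2)[OF i] Ures_res[OF this]] show ?thesis .
qed

text \<open>The brackets of \<open>xminus_one\<close> are \<open>qbr\<close> times \<open>- 1 / q\<close>; those of \<open>xplus_minus_one\<close> are \<open>qbr\<close> itself.\<close>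

lemma represents_fold_ep:
  assumes "affine_nodes scu qq n (uE n Pos) (uE n Neg) (uK n Pos) (uK n Neg)" "set js \<subseteq> {..n}"
  shows "represents n (foldl (\<lambda>y j. qcomm (inverse qq) y (ce Pos j)) (ce Pos 0) js)
     (L.scl ((- inverse qq) ^ length js) (affine_nodes.fold_ep scu qq (uE n Pos) js))" (is "represents n (?f js) (?z js)")
    and "represents n (foldl (\<lambda>y j. qcomm qq (ce Neg j) y) (ce Neg 0) js)
     (affine_nodes.fold_em scu qq (uE n Neg) js)"  (is "represents n (?g js) (?w js)")
proof -
  interpret A: affine_nodes scu qq n "uE n Pos" "uE n Neg" "uK n Pos" "uK n Neg" by (rule assms(1))
  have "represents n (?f js) (?z js) \<and> represents n (?g js) (?w js)"
    using assms(2)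
  proof (induct js rule: rev_induct)
    case Nil
    show ?case using represents_gen(1)[of 0 n] by (simp add: A.fold_ep_def A.fold_em_def)
  next
    case (snoc j js)
    then have IH: "represents n (?f js) (?z js)" "represents n (?g js) (?w js)" and j: "j \<le> n" by simp_all
    have "?z (js @ [j]) = ?z js * uE n Pos j - L.scl (inverse qq) (uE n Pos j * ?z js)"
      by (simp add: A.fold_ep_def L.qbr_def L.scl_simps mult.assoc[symmetric] mult.commute)
    moreover have "represents n (?f js * ce Pos j - scal (inverse qq) * (ce Pos j * ?f js)) (?z js * uE n Pos j - L.scl (inverse qq) (uE n Pos j * ?z js))"
      by (intro represents_diff represents_mult represents_scl IH represents_gen(1) j)
    ultimately have 1: "represents n (?f (js @ [j])) (?z (js @ [j]))"
      by (simp add: qcomm_def mult.assoc)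
    have "represents n (ce Neg j * ?g js - scal qq * (?g js * ce Neg j)) (uE n Neg j * ?w js - L.scl qq (?w js * uE n Neg j))"
      by (intro represents_diff represents_mult represents_scl IH represents_gen(1) j)
    then have "represents n (?g (js @ [j])) (?w (js @ [j]))"
      by (simp add: qcomm_def A.fold_em_def L.qbr_def mult.assoc)
    with 1 show ?case ..
  qed
  then show "represents n (?f js) (?z js)" "represents n (?g js) (?w js)" by simp_all
qed

text \<open>The recursions of \<open>loop_P\<close> and \<open>pc\<close> agree because a bracket depends only on its total degree.  The parameter \<open>c\<close> is
  \<open>qq\<close> for positive degrees and its inverse for negative ones.\<close>

lemma loop_P_integral:
  assumes N: "loop_serre scu c kk kki X Xm"
    and c: "\<And>m::nat. qq powi (sgn_int s * int m) = c ^ m" "\<And>m. qn qq m = qn c m" "qfac qq = qfac c"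
    and S: "integral_form scu c (Sint n)" "kk \<in> Sint n" "kki \<in> Sint n"
      "\<And>r t. L.dp (X r) t \<in> Sint n" "\<And>r t. L.dp (Xm r) t \<in> Sint n"
    and rep: "represents n (ck (opp s) i) kki" "represents n (ce Neg i) (Xm 0)"
      "\<And>t::nat. represents n (xplus n i (sgn_int s * int (Suc t))) (X (int (Suc t)))"
  shows "Uq_class n (loop_P n s i r) \<in> carrier (Ures n)"
proof -
  have ex: "\<exists>P. (\<forall>r. represents n (loop_P n s i r) (P r)) \<and> (\<forall>r. P r \<in> Sint n)"
  proof -
    interpret N: loop_serre scu c kk kki X Xm by (rule N)
    have dp: "N.dp z t = L.dp z t" for z t by (simp add: N.dp_def L.dp_def c)
    have int: "N.pc r \<in> Sint n" for r
      by (rule N.pc_integral[OF S(1-3)]) (simp_all only: dp S(4,5))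
    have phi: "N.phi (Suc t) = kki * cm (X (int (Suc t))) (Xm 0)" for t
      using N.Br_phi[of "Suc t" "int (Suc t)" 0] by (simp add: N.Br_def del: of_nat_Suc)
    have "represents n (loop_P n s i r) (N.pc r)" for r
    proof (induct r rule: less_induct)
      case (less r)
      show ?case
      proof (cases r)
        case (Suc m)
        let ?h = "\<lambda>t. scal (c ^ (m - t)) * ((ck (opp s) i * comm (xplus n i (sgn_int s * int (Suc t))) (ce Neg i)) * loop_P n s i (m - t))"
        let ?g = "\<lambda>t. L.scl (c ^ (m - t)) (N.phi (Suc t) * N.pc (m - t))"
        have "represents n (- (scal (1 / qn c (int (Suc m))) * (\<Sum>t\<le>m. ?h t))) (- (L.scl (1 / qn c (int (Suc m))) (\<Sum>t\<le>m. ?g t)))"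
          unfolding phi
          by (intro represents_minus represents_scl represents_sum represents_mult represents_comm rep less) (simp_all add: Suc)
        then show ?thesis unfolding Suc loop_P.simps c(1) qint_qn c(2) N.pc.simps(2)
          by (simp only: mult.assoc mult_minus_left)
      qed (simp add: represents_one)
    qed
    with int show ?thesis by blast
  qed
  then show ?thesis using represents_Sint by blast
qed

theorem Drinfeld_elements_integral:
  assumes i: "i \<in> {1..n}"
  shows "Uq_class n (div_pow (xplus n i r) t) \<in> carrier (Ures n)"
    and "Uq_class n (loop_P n s i m) \<in> carrier (Ures n)"
    and "Uq_class n (k_binom i m) \<in> carrier (Ures n)"
proof -
  have n: "1 \<le> n" "1 \<le> i" "i \<le> n" using i by auto
  have AN: "affine_nodes scu qq n (uE n Pos) (uE n Neg) (uK n Pos) (uK n Neg)" by (rule affine_nodes_Uq[OF n(1)])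
  interpret A: affine_nodes scu qq n "uE n Pos" "uE n Neg" "uK n Pos" "uK n Neg" by (rule AN)
  let ?p = "inverse qq"
  let ?e = "uE n Pos i" and ?f = "uE n Neg i" and ?k = "uK n Pos i" and ?ki = "uK n Neg i"
  let ?y = "A.fold_ep (node_path n i)" and ?y' = "A.fold_em (node_path n i)"
  have kk: "?k * ?ki = 1" "?ki * ?k = 1" using uK_inverse[OF n(3), of Pos] uK_inverse[OF n(3), of Neg] by simp_all
  have "\<exists>l li. A.path_pair i i ((- qq) ^ (n - 1)) ?y ?y' l li \<and> (\<forall>t. L.dp ?y t \<in> Sint n \<and> L.dp ?y' t \<in> Sint n)"
    by (rule A.path_pair_fold[OF Sint_integral]) (use n in \<open>simp_all add: uE_integral\<close>)
  then obtain l li where pp: "A.path_pair i i ((- qq) ^ (n - 1)) ?y ?y' l li"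
    and dpy: "\<And>t. L.dp ?y t \<in> Sint n" "\<And>t. L.dp ?y' t \<in> Sint n" by blast
  have P: "A.P.path_vector i i ?y" "A.M.path_vector i i ?y'" and l: "l * li = 1" "li * l = 1" "l * ?k = 1"
    and yy: "?y * ?y' - ?y' * ?y = L.scl ((- qq) ^ (n - 1) * (1 / (qq - ?p))) (l - li)"
    and com: "?y * ?f = ?f * ?y" "?e * ?y' = ?y' * ?e"
    using pp unfolding A.path_pair_def by simp_all
  have ky: "?k * ?y = L.scl (qq powi (- 2)) (?y * ?k)" "L.ser 2 ?e ?y" "L.ser 2 ?y ?e"
    and ky': "?ki * ?y' = L.scl (qq powi (- 2)) (?y' * ?ki)" "L.ser 2 ?f ?y'" "L.ser 2 ?y' ?f"
    using P unfolding A.P.path_vector_def A.M.path_vector_def by (simp_all add: ends_def numeral_2_eq_2)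
  have lk: "l = ?ki" "li = ?k"
  proof -
    have "l = l * (?k * ?ki)" unfolding kk by simp
    then show "l = ?ki" unfolding mult.assoc[symmetric] l by simp
    then show "li = ?k" using l(1) kk by (metis mult.assoc mult_1_left mult_1_right)
  qed
\<comment> \<open>The signs and powers of \<open>q\<close> that turn the brackets of the walk into those of Drinfeld's generators;
    with them the commutator of the two root vectors is free of constants.\<close>
  define c1 where "c1 = (- 1) ^ i * (- ?p) ^ (n - 1)"
  define y where "y = L.scl c1 ?y"
  define y' where "y' = L.scl ((- 1) ^ i) ?y'"
  have pm2: "qq powi (- 2) = ?p * ?p" by (simp add: power_int_minus power2_eq_square)
  have kE: "?k * ?e = L.scl (qq * qq) (?e * ?k)" "?ki * ?f = L.scl (qq * qq) (?f * ?ki)"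
    using A.P.kt_ev[OF n(3) n(3)] A.M.kt_ev[OF n(3) n(3)] by (simp_all add: cartan_diag[OF n(1) n(3)] power2_eq_square)
  have kf: "?k * ?f = L.scl (?p * ?p) (?f * ?k)" using L.inv_comm[OF kk(2,1) kE(2)] by simp
  have kY': "?k * ?y' = L.scl (qq * qq) (?y' * ?k)" using L.inv_comm[OF kk(2,1) ky'(1)] by (simp add: power_int_minus power2_eq_square)
  have c12: "(- 1) ^ i * (c1 * (- qq) ^ (n - 1)) = 1"
  proof -
    have "(- ?p) ^ (n - 1) * (- qq) ^ (n - 1) = 1" by (simp add: power_mult_distrib[symmetric])
    moreover have "(- 1 :: ratfun) ^ i * (- 1) ^ i = 1" by (simp add: power_mult_distrib[symmetric])
    ultimately show ?thesis unfolding c1_def by (metis mult.assoc mult_1_left mult.right_neutral)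
  qed
  have ep_em: "?e * ?f - ?f * ?e = L.scl (1 / (qq - ?p)) (?k - ?ki)"
    using uE_comm[OF n(3) n(3)] by simp
  have yy': "y * y' - y' * y = - L.scl (1 / (qq - ?p)) (?k - ?ki)"
  proof -
    have "y * y' - y' * y = L.scl ((- 1) ^ i * c1) (?y * ?y' - ?y' * ?y)"
      unfolding y_def y'_def by (simp add: L.scl_simps mult.commute)
    also have "\<dots> = L.scl ((- 1) ^ i * (c1 * (- qq) ^ (n - 1)) * (1 / (qq - ?p))) (?ki - ?k)"
      unfolding yy lk by (simp only: L.V.scale_scale mult.assoc)
    finally show ?thesis unfolding c12 by (simp add: L.scl_simps)
  qed
  have RO: "rank_one scu qq ?k ?ki ?e ?f y y'"
  proof (rule rank_one.intro[OF L.quantum_axioms rank_one_axioms.intro])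
    show "?k * ?ki = 1" "?ki * ?k = 1" by (rule kk)+
    show "?k * ?e = L.scl (qq * qq) (?e * ?k)" "?k * ?f = L.scl (?p * ?p) (?f * ?k)" by (rule kE kf)+
    show "?k * y = L.scl (?p * ?p) (y * ?k)" unfolding y_def using ky(1) unfolding pm2 by (simp add: mult.commute)
    show "?k * y' = L.scl (qq * qq) (y' * ?k)" unfolding y'_def using kY' by (simp add: mult.commute)
    show "?e * ?f - ?f * ?e = L.scl (1 / (qq - ?p)) (?k - ?ki)" by (rule ep_em)
    show "y * y' - y' * y = - L.scl (1 / (qq - ?p)) (?k - ?ki)" by (rule yy')
    show "y * ?f = ?f * y" "?e * y' = y' * ?e" unfolding y_def y'_def using com by simp_all
    show "L.ser 2 ?e y" "L.ser 2 y ?e" unfolding y_def by (rule L.ser_2_scl(1)[OF ky(2)] L.ser_2_scl(2)[OF ky(3)])+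
    show "L.ser 2 ?f y'" "L.ser 2 y' ?f" unfolding y'_def by (rule L.ser_2_scl(1)[OF ky'(2)] L.ser_2_scl(2)[OF ky'(3)])+
  qed
  interpret R: rank_one scu qq ?k ?ki ?e ?f y y' by (rule RO)
  have LS: "loop_serre scu qq ?k ?ki R.lxp R.lxm" by (rule R.loop_serre_orbits)

  have KS: "?k \<in> Sint n" "?ki \<in> Sint n" using uK_integral[OF n(3)] by simp_all
  have dp_y: "L.dp y t \<in> Sint n" for t
  proof -
    have "c1 = (- 1) ^ (i + (n - 1)) * ?p ^ (n - 1)"
      unfolding c1_def power_add power_minus[of ?p] by simp
    then have "c1 ^ t = (- 1) ^ ((i + (n - 1)) * t) * ?p ^ ((n - 1) * t)"
      by (simp only: power_mult_distrib power_mult)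
    then show ?thesis unfolding y_def I.dp_scl
      using I.S_sign[OF I.S_p_power[OF dpy(1)[of t]]] by (simp only: L.V.scale_scale)
  qed
  have dp_y': "L.dp y' t \<in> Sint n" for t
    unfolding y'_def I.dp_scl power_mult[symmetric] by (rule I.S_sign[OF dpy(2)])
  have dp_x1: "L.dp (R.lxm 1) t \<in> Sint n" for t
    unfolding R.lxm_base using I.dp_times_torus[of ?k y "- 2" t] R.k_y
    unfolding pm2 using I.S_powi[OF I.S_mult[OF dp_y I.S_power[OF KS(1)]]] by simp
  have dp_xm1: "L.dp (R.lxp (- 1)) t \<in> Sint n" for t
  proof -
    have k: "?ki * y' = L.scl (qq powi (- 2)) (y' * ?ki)" using R.ki_vectors(4) unfolding pm2 .
    have "(qq powi (- 2)) ^ t = qq powi (- 2 * int t)" unfolding power_int_mult power_int_of_nat ..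
    then have "L.dp (?ki * y') t = L.scl (qq powi (- 2 * int t)) (L.dp (y' * ?ki) t)"
      unfolding k I.dp_scl by (simp only:)
    then show ?thesis unfolding R.lxp_base I.dp_times_torus[OF k]
      using I.S_powi[OF I.S_powi[OF I.S_mult[OF dp_y' I.S_power[OF KS(2)]]]] by (simp only:)
  qed
  note gens = loop_serre.loop_generators_integral[OF LS Sint_integral KS]
  have base: "\<And>t. L.dp (R.lxp 0) t \<in> Sint n" "\<And>t. L.dp (R.lxm 0) t \<in> Sint n"
    unfolding R.lxp_base R.lxm_base using n by (simp_all add: uE_integral)
  have lx: "L.dp (R.lxp r) t \<in> Sint n" "L.dp (R.lxm r) t \<in> Sint n" for r t
    by (rule gens[OF base dp_x1 dp_xm1])+

  have path: "set (node_path n i) \<subseteq> {..n}" "length (node_path n i) = n - 1"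
    using n by (auto simp: node_path_def)
  have rk: "represents n (ce Pos i) ?e" "represents n (ce Neg i) ?f" "represents n (ck Pos i) ?k" "represents n (ck Neg i) ?ki"
    using represents_gen n(3) by blast+
  have r1: "represents n (xminus_one n i) (y * ?k)"
  proof -
    have "represents n ((- 1) ^ i * foldl (\<lambda>y j. qcomm ?p y (ce Pos j)) (ce Pos 0) (node_path n i) * ck Pos i)
       (L.scl ((- 1) ^ i) (L.scl ((- ?p) ^ length (node_path n i)) ?y) * ?k)"
      by (intro represents_mult[OF represents_sign rk(3)] represents_fold_ep(1)[OF AN path(1)])
    then show ?thesis unfolding xminus_one_def y_def c1_def path(2) L.V.scale_scale .
  qed
  have r2: "represents n (xplus_minus_one n i) (?ki * y')"
  proof -
    have "represents n ((- 1) ^ i * (ck Neg i * foldl (\<lambda>y j. qcomm qq (ce Neg j) y) (ce Neg 0) (node_path n i)))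
       (L.scl ((- 1) ^ i) (?ki * ?y'))"
      by (intro represents_mult[OF rk(4)] represents_sign represents_fold_ep(2)[OF AN path(1)])
    then show ?thesis unfolding xplus_minus_one_def y'_def L.scl_mult_right .
  qed
  have h: "represents n (h_one n Pos i) R.ph" "represents n (h_one n Neg i) R.ph'"
    unfolding h_one.simps R.ph_bracket by (intro represents_mult represents_comm rk r1 r2)+
  have ud: "represents n (scal (1 / qint 2) * comm (h_one n Pos i) g) (R.up z)"
    "represents n (scal (1 / qint 2) * comm (h_one n Neg i) g) (R.dwn z)" if "represents n g z" for g z
    unfolding qint_qn Q.qn_2 R.up_def R.dwn_def by (intro represents_scl represents_comm h that)+
  have rx: "represents n (xplus n i r) (R.lxp r)" for r
  proof (cases "0 \<le> r")
    case True
    show ?thesis unfolding xplus_def R.lxp_def orbit_def if_P[OF True]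
      by (rule represents_funpow[OF _ rk(1)]) (erule ud(1))
  next
    case False
    show ?thesis unfolding xplus_def R.lxp_def orbit_def if_not_P[OF False]
      by (rule represents_funpow[OF _ rk(1)]) (erule ud(2))
  qed
  show "Uq_class n (div_pow (xplus n i r) t) \<in> carrier (Ures n)"
    by (rule represents_Sint[OF represents_div_pow[OF rx] lx(1)])

  have f0: "represents n (ce Neg i) (R.lxm 0)" unfolding R.lxm_base by (rule rk(2))
  show "Uq_class n (loop_P n s i m) \<in> carrier (Ures n)"
  proof (cases s)
    case Pos
    show ?thesis
      unfolding Pos
      by (rule loop_P_integral[OF LS _ _ _ Sint_integral KS lx]) (use rk(4) f0 rx in simp_all)
  next
    case Neg
    have MI: "loop_serre scu ?p ?ki ?k (\<lambda>r. R.lxp (- r)) (\<lambda>r. R.lxm (- r))"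
      by (rule loop_serre.mirror_invert[OF LS])
    show ?thesis
      unfolding Neg
    proof (rule loop_P_integral[OF MI _ _ _ I.integral_form_inverse KS(2,1) lx])
      show "represents n (xplus n i (sgn_int Neg * int (Suc t))) (R.lxp (- int (Suc t)))" for t
        using rx[of "- int (Suc t)"] by simp
      show "represents n (ck (opp Neg) i) ?k" using rk(3) by simp
      show "represents n (ce Neg i) (R.lxm (- 0))" using f0 by simp
    qed (simp_all add: power_int_minus power_inverse qn_inverse qfac_inverse fun_eq_iff)
  qed

  have "\<exists>P. represents n (k_binom i m) (P m) \<and> (\<forall>m. P m \<in> Sint n)"
  proof -
    interpret N: loop_serre scu qq ?k ?ki R.lxp R.lxm by (rule LS)
    have "represents n (k_binom i m) (N.Kb 0 m)"
    proof (induct m)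
      case 0
      show ?case by (simp add: k_binom_def N.Kb_def N.nb_def N.dn_def represents_one)
    next
      case (Suc m)
      let ?c = "1 / (qq ^ Suc m - ?p ^ Suc m)"
      have f: "represents n (scal ?c * (scal (qq powi (0 - int m)) * ck Pos i - scal (qq powi (- (0 - int m))) * ck Neg i)) (L.scl ?c (N.hb (0 - int m)))"
        unfolding N.hb_def by (intro represents_scl represents_diff rk)
      have K: "N.Kb 0 (Suc m) = N.Kb 0 m * L.scl ?c (N.hb (0 - int m))"
        by (simp add: N.Kb_def N.nb_def N.dn_def mult.commute)
      have u: "[1..<Suc (Suc m)] = [1..<Suc m] @ [Suc m]" by simp
      have e: "qq powi int (Suc m) - qq powi (- int (Suc m)) = qq ^ Suc m - ?p ^ Suc m"
        "1 - int (Suc m) = 0 - int m" "int (Suc m) - 1 = - (0 - int m)"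
        by (simp_all only: power_int_minus power_int_of_nat power_inverse)
      have k: "k_binom i (Suc m) = k_binom i m * (scal ?c * (scal (qq powi (0 - int m)) * ck Pos i - scal (qq powi (- (0 - int m))) * ck Neg i))"
        by (simp only: k_binom_def u map_append list.map prod_list.append prod_list.Cons prod_list.Nil mult_1_right e)
      show ?case unfolding K k by (rule represents_mult[OF Suc f])
    qed
    moreover have "N.Kb 0 m \<in> Sint n" for m
      by (rule N.Kb_integral[OF Sint_integral KS(2)]) (simp_all add: base)
    ultimately show ?thesis by blast
  qed
  then show "Uq_class n (k_binom i m) \<in> carrier (Ures n)" using represents_Sint by blast
qed

section \<open>Modules over the specialisation\<close>

lemma Ures_ring: "ring (Ures n)"
proof -
  have "Ures n = (Uq n)\<lparr>carrier := carrier (Ures n)\<rparr>" by (simp add: Ures_def)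
  then show ?thesis using U.subring_is_ring[OF Ures_subring[of n]] by simp
qed

lemma Ures_simps: "x \<oplus>\<^bsub>Ures n\<^esub> y = x \<oplus>\<^bsub>Uq n\<^esub> y" "x \<otimes>\<^bsub>Ures n\<^esub> y = x \<otimes>\<^bsub>Uq n\<^esub> y" "\<one>\<^bsub>Ures n\<^esub> = \<one>\<^bsub>Uq n\<^esub>"
  by (simp_all add: Ures_def)

lemma Ueps_ideal: "ideal (Ueps_ideal n l) (Ures n)"
proof -
  have "Uq_class n ` scal ` laurent_vanishing (epsilon l) \<subseteq> carrier (Ures n)"
    using Ures_scal unfolding laurent_vanishing_def laurent_polys_def by fastforce
  then show ?thesis unfolding Ueps_ideal_def by (rule ring.genideal_ideal[OF Ures_ring])
qed

text \<open>Representatives whose image in the specialisation is meaningful.\<close>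

definition integral_rep :: "nat \<Rightarrow> falg \<Rightarrow> bool" where
  "integral_rep n f \<longleftrightarrow> f \<in> F n \<and> Uq_class n f \<in> carrier (Ures n)"

lemma Ueps_hom: "(\<lambda>X. Ueps_ideal n l +>\<^bsub>Ures n\<^esub> X) \<in> ring_hom (Ures n) (Ueps n l)"
  using ideal.rcos_ring_hom[OF Ueps_ideal] unfolding Ueps_def .

lemma Ueps_class_closed: "Uq_class n f \<in> carrier (Ures n) \<Longrightarrow> Ueps_class n l f \<in> carrier (Ueps n l)"
  unfolding Ueps_class_def by (rule ring_hom_closed[OF Ueps_hom])

lemma cscal_integral: "integral_rep n (cscal c)"
  unfolding integral_rep_def cscal_def using Ures_scal[OF laurent_poly] by simp

lemma Ueps_class_hom:
  assumes "integral_rep n f" "integral_rep n g"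
  shows "Ueps_class n l (f + g) = Ueps_class n l f \<oplus>\<^bsub>Ueps n l\<^esub> Ueps_class n l g"
    "Ueps_class n l (f * g) = Ueps_class n l f \<otimes>\<^bsub>Ueps n l\<^esub> Ueps_class n l g"
    "Ueps_class n l 1 = \<one>\<^bsub>Ueps n l\<^esub>"
  using assms ring_hom_add[OF Ueps_hom, of "Uq_class n f" n "Uq_class n g" l] ring_hom_mult[OF Ueps_hom, of "Uq_class n f" n "Uq_class n g" l]
    ring_hom_one[OF Ueps_hom, of n l]
  unfolding integral_rep_def Ueps_class_def by (simp_all add: class_add class_mult class_one Ures_simps)

lemma cscal_hom: "cscal (a + b) = cscal a + cscal b" "cscal (a * b) = cscal a * cscal b" "cscal 1 = 1"
  unfolding cscal_def scal_hom[symmetric] ratfun_of_poly_hom(1,2)[symmetric] by (simp_all add: ratfun_of_poly_hom scal_hom mult.commute flip: one_pCons)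

lemma (in left_module) smult_r_null: "a \<in> carrier R \<Longrightarrow> a \<odot>\<^bsub>M\<^esub> \<zero>\<^bsub>M\<^esub> = \<zero>\<^bsub>M\<^esub>"
proof -
  assume a: "a \<in> carrier R"
  have c: "a \<odot>\<^bsub>M\<^esub> \<zero>\<^bsub>M\<^esub> \<in> carrier M" by (rule smult_closed[OF a M.zero_closed])
  have "a \<odot>\<^bsub>M\<^esub> \<zero>\<^bsub>M\<^esub> = a \<odot>\<^bsub>M\<^esub> \<zero>\<^bsub>M\<^esub> \<oplus>\<^bsub>M\<^esub> a \<odot>\<^bsub>M\<^esub> \<zero>\<^bsub>M\<^esub>"
    using smult_r_distr[OF a M.zero_closed M.zero_closed] by simp
  then show ?thesis using M.add.r_cancel_one'[OF c c] by simp
qed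

text \<open>If two scalars act equally, so does their difference by zero, and that difference is invertible.\<close>

lemma cscal_faithful:
  assumes V: "left_module (Ueps n l) V" and v: "v \<in> carrier V" "v \<noteq> \<zero>\<^bsub>V\<^esub>"
    and eq: "act n l V (cscal a) v = act n l V (cscal b) v"
  shows "a = b"
proof (rule ccontr)
  assume ab: "a \<noteq> b"
  interpret V: left_module "Ueps n l" V by (rule V)
  define c where "c = inverse (a - b)"
  have cl: "Ueps_class n l (cscal x) \<in> carrier (Ueps n l)" for x
    using cscal_integral[of n x] unfolding integral_rep_def by (blast intro: Ueps_class_closed)
  have ac: "act n l V (cscal x) v \<in> carrier V" for x unfolding act_def by (rule V.smult_closed[OF cl v(1)])
  have "act n l V (cscal a) v = act n l V (cscal (a - b) + cscal b) v" unfolding cscal_hom(1)[symmetric] by simp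
  also have "\<dots> = act n l V (cscal (a - b)) v \<oplus>\<^bsub>V\<^esub> act n l V (cscal b) v"
    unfolding act_def Ueps_class_hom(1)[OF cscal_integral cscal_integral] by (rule V.smult_l_distr[OF cl cl v(1)])
  finally have "act n l V (cscal (a - b)) v = \<zero>\<^bsub>V\<^esub>"
    unfolding eq using V.M.add.r_cancel_one'[OF ac ac, of b "a - b"] by simp
  then have "act n l V (cscal (c * (a - b))) v = \<zero>\<^bsub>V\<^esub>"
    unfolding act_def cscal_hom(2) Ueps_class_hom(2)[OF cscal_integral cscal_integral] V.smult_assoc[OF cl cl v(1)]
    by (simp add: V.smult_r_null[OF cl])
  moreover have "c * (a - b) = 1" using ab by (simp add: c_def)
  ultimately have "act n l V 1 v = \<zero>\<^bsub>V\<^esub>" by (simp add: cscal_hom(3))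
  then have "v = \<zero>\<^bsub>V\<^esub>"
    unfolding act_def Ueps_class_hom(3)[OF cscal_integral cscal_integral] by (simp add: V.smult_one[OF v(1)])
  with v(2) show False by simp
qed

subsection \<open>A simple module is its own composition factor\<close>

text \<open>A name under which the facts on the subquotient by the zero submodule are collected.\<close>

locale module_by_zero = left_module R V
  for R :: "('r, 'x) ring_scheme" and V :: "('r, 'v) module"
begin

abbreviation Q :: "('r, 'v set) module" where "Q \<equiv> subquotient V (carrier V) {\<zero>\<^bsub>V\<^esub>}"

lemma coset_zero: "x \<in> carrier V \<Longrightarrow> {\<zero>\<^bsub>V\<^esub>} +>\<^bsub>V\<^esub> x = {x}"
  by (simp add: a_r_coset_def')

lemma Q_carrier: "carrier Q = (\<lambda>x. {x}) ` carrier V"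
  using coset_zero by (auto simp: subquotient_def A_RCOSETS_def')

lemma Q_zero: "\<zero>\<^bsub>Q\<^esub> = {\<zero>\<^bsub>V\<^esub>}"
  by (simp add: subquotient_def)

lemma Q_add: "{x} \<oplus>\<^bsub>Q\<^esub> {y} = {x \<oplus>\<^bsub>V\<^esub> y}"
  by (simp add: subquotient_def set_add_def')

lemma Q_smult: "a \<in> carrier R \<Longrightarrow> x \<in> carrier V \<Longrightarrow> a \<odot>\<^bsub>Q\<^esub> {x} = {a \<odot>\<^bsub>V\<^esub> x}"
  by (simp add: subquotient_def coset_zero smult_closed)

lemma Q_module: "left_module R Q"
proof (rule left_module.intro[OF R.ring_axioms _ left_module_axioms.intro])
  show "abelian_group Q"
  proof (rule abelian_groupI)
    fix X assume "X \<in> carrier Q"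
    then obtain x where x: "X = {x}" "x \<in> carrier V" unfolding Q_carrier by blast
    have "{\<ominus>\<^bsub>V\<^esub> x} \<oplus>\<^bsub>Q\<^esub> X = \<zero>\<^bsub>Q\<^esub>" unfolding x(1) Q_add Q_zero using x(2) by (simp add: M.l_neg)
    moreover have "{\<ominus>\<^bsub>V\<^esub> x} \<in> carrier Q" unfolding Q_carrier using x(2) by simp
    ultimately show "\<exists>Y\<in>carrier Q. Y \<oplus>\<^bsub>Q\<^esub> X = \<zero>\<^bsub>Q\<^esub>" by blast
  qed (auto simp: Q_carrier Q_zero Q_add M.a_ac)
qed (auto simp: Q_carrier Q_add Q_smult smult_closed smult_l_distr smult_r_distr smult_assoc smult_one)

lemma submodule_lift:
  assumes N: "submodule N R Q" shows "submodule {x \<in> carrier V. {x} \<in> N} R V" (is "submodule ?N R V")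
proof -
  interpret N: submodule N R Q by (rule N)
  interpret Q: left_module R Q by (rule Q_module)
  have inv: "\<ominus>\<^bsub>Q\<^esub> {x} = {\<ominus>\<^bsub>V\<^esub> x}" if x: "x \<in> carrier V" for x
  proof (rule Q.M.minus_equality)
    show "{\<ominus>\<^bsub>V\<^esub> x} \<oplus>\<^bsub>Q\<^esub> {x} = \<zero>\<^bsub>Q\<^esub>" unfolding Q_add Q_zero using x by (simp add: M.l_neg)
  qed (use x in \<open>simp_all add: Q_carrier\<close>)
  show ?thesis
  proof (intro submodule.intro submodule_axioms.intro subgroup.intro)
    show "?N \<subseteq> carrier (add_monoid V)" by auto
    show "x \<otimes>\<^bsub>add_monoid V\<^esub> y \<in> ?N" if "x \<in> ?N" "y \<in> ?N" for x y
      using that N.m_closed[of "{x}" "{y}"] by (simp add: Q_add)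
    show "\<one>\<^bsub>add_monoid V\<^esub> \<in> ?N" using N.one_closed by (simp add: Q_zero)
    show "inv\<^bsub>add_monoid V\<^esub> x \<in> ?N" if "x \<in> ?N" for x
      using that N.m_inv_closed[of "{x}"] inv[of x] unfolding a_inv_def[symmetric] by simp
    show "a \<odot>\<^bsub>V\<^esub> x \<in> ?N" if "a \<in> carrier R" "x \<in> ?N" for a x
      using that N.smult_closed[of a "{x}"] by (simp add: Q_smult smult_closed)
  qed
qed

lemma Q_simple:
  assumes S: "simple_module R V" shows "simple_module R Q"
  unfolding simple_module_def
proof (intro conjI allI impI)
  show "left_module R Q" by (rule Q_module)
  have "inj (\<lambda>x. {x})" by (rule injI) simp
  moreover have "carrier V \<noteq> {\<zero>\<^bsub>V\<^esub>}" using S unfolding simple_module_def by blast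
  ultimately show "carrier Q \<noteq> {\<zero>\<^bsub>Q\<^esub>}"
    unfolding Q_carrier Q_zero by (auto dest: arg_cong[of _ _ "\<lambda>X. \<Union>X"])
  fix N assume N: "submodule N R Q"
  then interpret N: submodule N R Q .
  have sub: "N \<subseteq> (\<lambda>x. {x}) ` carrier V" using N.subset unfolding Q_carrier[symmetric] by simp
  then have NN: "N = (\<lambda>x. {x}) ` {x \<in> carrier V. {x} \<in> N}" by blast
  have "{x \<in> carrier V. {x} \<in> N} = {\<zero>\<^bsub>V\<^esub>} \<or> {x \<in> carrier V. {x} \<in> N} = carrier V"
    using S submodule_lift[OF N] unfolding simple_module_def by blast
  then show "N = {\<zero>\<^bsub>Q\<^esub>} \<or> N = carrier Q"
  proof
    assume *: "{x \<in> carrier V. {x} \<in> N} = {\<zero>\<^bsub>V\<^esub>}"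
    have "N = {{\<zero>\<^bsub>V\<^esub>}}" by (subst NN, subst *) simp
    then show ?thesis unfolding Q_zero ..
  next
    assume *: "{x \<in> carrier V. {x} \<in> N} = carrier V"
    have "N = (\<lambda>x. {x}) ` carrier V" by (subst NN, subst *) (rule refl)
    then show ?thesis unfolding Q_carrier ..
  qed
qed

lemma Q_factor:
  assumes S: "simple_module R V" shows "composition_factor R V Q"
proof -
  have g: "group (add_monoid V)" by (rule M.a_group)
  have "subgroup {\<zero>\<^bsub>V\<^esub>} (add_monoid V)" using group.triv_subgroup[OF g] by simp
  then have s0: "submodule {\<zero>\<^bsub>V\<^esub>} R V"
    by (intro submodule.intro submodule_axioms.intro) (simp_all add: smult_r_null)
  have "subgroup (carrier V) (add_monoid V)" using group.subgroup_self[OF g] by simp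
  then have s1: "submodule (carrier V) R V"
    by (intro submodule.intro submodule_axioms.intro) (simp_all add: smult_closed)
  have "composition_series R V [{\<zero>\<^bsub>V\<^esub>}, carrier V]"
    unfolding composition_series_def using s0 s1 Q_simple[OF S] by simp
  then show ?thesis
    unfolding composition_factor_def by (intro exI[of _ "[{\<zero>\<^bsub>V\<^esub>}, carrier V]"] exI[of _ 0]) simp
qed

end

text \<open>The action on singletons agrees with the action on elements for all elements of the specialisation,
  and by \<open>Drinfeld_elements_integral\<close> only such elements enter the definition of a loop weight.\<close>

lemma is_L_from_factor:
  assumes V: "simple_module (Ueps n l) V" "fin_dim_module n l V"
    and L: "is_L n l m (subquotient V (carrier V) {\<zero>\<^bsub>V\<^esub>})"
  shows "is_L n l m V"
proof -
  interpret M: module_by_zero "Ueps n l" V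
    using V(1) unfolding simple_module_def module_by_zero_def by blast
  have act: "act n l M.Q f {x} = {act n l V f x}" if "Uq_class n f \<in> carrier (Ures n)" "x \<in> carrier V" for f x
    unfolding act_def by (rule M.Q_smult[OF Ueps_class_closed[OF that(1)] that(2)])
  note D = Drinfeld_elements_integral
  have hw: "highest_weight_vector n l M.Q {x} \<longleftrightarrow> highest_weight_vector n l V x" if x: "x \<in> carrier V" for x
    unfolding highest_weight_vector_def M.Q_zero using x by (auto simp: act[OF D(1) x] M.Q_carrier)
  have k: "Uq_class n (ck Pos i) \<in> carrier (Ures n)" if "i \<in> {1..n}" for i
    using that by (intro Ures_res) (auto simp: res_generators_def)
  have sc: "Uq_class n (scal (qq ^ d)) \<in> carrier (Ures n)" "Uq_class n (scal (qbinom d r)) \<in> carrier (Ures n)"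
    "Uq_class n (cscal c) \<in> carrier (Ures n)" for d r c
    using laurent_powi[of "int d"] laurent_qbinom laurent_poly unfolding cscal_def by (auto intro!: Ures_scal)
  have lw: "has_loop_weight n l M.Q m {x} \<longleftrightarrow> has_loop_weight n l V m x" if x: "x \<in> carrier V" for x
    unfolding has_loop_weight_def Let_def
    by (rule ball_cong[OF refl]) (simp add: act[OF k x] act[OF D(2) x] act[OF D(3) x] act[OF sc(1) x] act[OF sc(2) x] act[OF sc(3) x])
  have dom: "dominant_monomial n m" and ex: "\<exists>w. highest_weight_vector n l M.Q w"
    and all: "\<And>w. highest_weight_vector n l M.Q w \<Longrightarrow> has_loop_weight n l M.Q m w"
    using L unfolding is_L_def by blast+
  obtain w where w: "highest_weight_vector n l M.Q w" using ex by blast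
  then obtain v where v: "w = {v}" "v \<in> carrier V" unfolding highest_weight_vector_def M.Q_carrier by blast
  have "highest_weight_vector n l V v" using w hw[OF v(2)] unfolding v(1) by blast
  moreover have "has_loop_weight n l V m x" if h: "highest_weight_vector n l V x" for x
  proof -
    have x: "x \<in> carrier V" using h unfolding highest_weight_vector_def by blast
    show ?thesis using all[of "{x}"] h hw[OF x] lw[OF x] by blast
  qed
  ultimately show ?thesis unfolding is_L_def using dom V by blast
qed

section \<open>Drinfeld polynomials determine the monomial\<close>

lemma drinfeld_poly_empty: "drinfeld_poly {#} i = 1"
  and drinfeld_poly_add: "drinfeld_poly (add_mset (j, b) m) i = (if j = i then [:1, - b:] else 1) * drinfeld_poly m i"
  by (simp_all add: drinfeld_poly_def)

lemma drinfeld_poly_nz: "drinfeld_poly m i \<noteq> 0"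
proof (induct m)
  case (add x m)
  then show ?case by (cases x) (simp add: drinfeld_poly_add)
qed (simp add: drinfeld_poly_empty)

lemma order_root_factor:
  assumes "b \<noteq> 0" "c \<noteq> (0::complex)" shows "Polynomial.order (1 / b) [:1, - c:] = (if c = b then 1 else 0)"
proof (cases "c = b")
  case True
  have "[:1, - b:] = Polynomial.smult (- b) ([:- (1 / b), 1:] ^ 1)" using assms by simp
  then have "Polynomial.order (1 / b) [:1, - b:] = 1"
    using assms order_power_n_n[of "1 / b" 1] by (simp only: order_smult neg_equal_0_iff_equal not_False_eq_True)
  with True show ?thesis by simp
next
  case False
  then have "poly [:1, - c:] (1 / b) \<noteq> 0" using assms by (simp add: field_simps)
  with False show ?thesis by (simp add: order_0I)
qed

text \<open>The exponents of a monomial are the multiplicities of the roots of its polynomials; roots are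
  nonzero, which is why \<open>b\<close> is recovered as an inverse.\<close>

lemma order_drinfeld_poly:
  assumes "b \<noteq> 0" "\<forall>(j, c) \<in># m. c \<noteq> 0"
  shows "Polynomial.order (1 / b) (drinfeld_poly m i) = count m (i, b)"
  using assms(2)
proof (induct m)
  case (add x m)
  obtain j c where x: "x = (j, c)" by (cases x)
  have IH: "Polynomial.order (1 / b) (drinfeld_poly m i) = count m (i, b)" and c: "c \<noteq> 0" using add x by auto
  have nz: "(if j = i then [:1, - c:] else 1) * drinfeld_poly m i \<noteq> 0"
    using drinfeld_poly_nz[of m i] by simp
  show ?case
    unfolding x drinfeld_poly_add order_mult[OF nz] IH
    using order_root_factor[OF assms(1) c] by (auto simp: order_0I)
qed (simp add: drinfeld_poly_empty order_0I)

lemma is_L_unique: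
  assumes L: "is_L n l m V" "is_L n l m' V" shows "m = m'"
proof -
  have V: "left_module (Ueps n l) V" using L(1) unfolding is_L_def simple_module_def by blast
  obtain v where v: "highest_weight_vector n l V v" using L(1) unfolding is_L_def by blast
  then have vc: "v \<in> carrier V" "v \<noteq> \<zero>\<^bsub>V\<^esub>" unfolding highest_weight_vector_def by blast+
  have w: "has_loop_weight n l V m v" "has_loop_weight n l V m' v" using L v unfolding is_L_def by blast+
  have d: "dominant_monomial n m" "dominant_monomial n m'" using L unfolding is_L_def by blast+
  have P: "drinfeld_poly m i = drinfeld_poly m' i" if i: "i \<in> {1..n}" for i
  proof (rule poly_eqI)
    fix r
    have "act n l V (loop_P n Pos i r) v = act n l V (cscal (Polynomial.coeff (signed_poly Pos (drinfeld_poly m i)) r)) v"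
      "act n l V (loop_P n Pos i r) v = act n l V (cscal (Polynomial.coeff (signed_poly Pos (drinfeld_poly m' i)) r)) v"
      using w i unfolding has_loop_weight_def Let_def by blast+
    then show "Polynomial.coeff (drinfeld_poly m i) r = Polynomial.coeff (drinfeld_poly m' i) r"
      by (intro cscal_faithful[OF V vc]) simp
  qed
  show ?thesis
  proof (rule multiset_eqI)
    fix x :: "nat \<times> complex"
    obtain i b where x: "x = (i, b)" by (cases x)
    have nz: "\<forall>(j, c) \<in># m. c \<noteq> 0" "\<forall>(j, c) \<in># m'. c \<noteq> 0" using d unfolding dominant_monomial_def by auto
    show "count m x = count m' x"
    proof (cases "i \<in> {1..n} \<and> b \<noteq> 0")
      case True
      then show ?thesis
        unfolding x using order_drinfeld_poly[of b m i] order_drinfeld_poly[of b m' i] nz P[of i] by simp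
    next
      case False
      then have "x \<notin># m" "x \<notin># m'" using d unfolding dominant_monomial_def x by auto
      then show ?thesis by (simp add: not_in_iff)
    qed
  qed
qed

section \<open>Stretching a monomial into a snake\<close>

lemma epsilon_power: "l \<ge> 1 \<Longrightarrow> epsilon l ^ (2 * l) = 1"
proof -
  assume l: "l \<ge> 1"
  have 1: "exp (of_real pi * \<i> / of_nat l) ^ (2 * l) = (1 :: complex)"
  proof -
    have "of_nat (2 * l) * (of_real pi * \<i> / of_nat l) = 2 * of_real pi * \<i>" using l by simp
    then show ?thesis unfolding exp_of_nat_mult[symmetric] by (simp only: exp_two_pi_i)
  qed
  have sq: "exp (2 * of_real pi * \<i> / of_nat l) = exp (of_real pi * \<i> / of_nat l :: complex) ^ 2"
    unfolding exp_of_nat_mult[symmetric] by (simp add: mult.assoc)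
  have 2: "exp (2 * of_real pi * \<i> / of_nat l) ^ (2 * l) = (1 :: complex)"
    unfolding sq power_mult[symmetric] mult.commute[of 2 "2 * l"] unfolding power_mult[of _ "2 * l" 2] 1 by simp
  show ?thesis unfolding epsilon_def using 1 2 by simp
qed

lemma Yvar_periodic:
  assumes "l \<ge> 1" shows "Yvar l a (i, s + 2 * int l * int N) = Yvar l a (i, s)"
proof -
  have nz: "epsilon l \<noteq> 0" by (simp add: epsilon_def)
  have "epsilon l powi (2 * int l * int N) = (epsilon l ^ (2 * l)) ^ N"
  proof -
    have e: "2 * int l * int N = int (2 * l * N)" by simp
    show ?thesis unfolding e power_int_of_nat power_mult ..
  qed
  then show ?thesis
    using epsilon_power[OF assms] nz by (simp add: Yvar_def power_int_add)
qed

lemma snake_append: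
  assumes "snake n \<aa> ts" "x \<in> points n \<aa>" "ts \<noteq> [] \<Longrightarrow> snake_position (last ts) x"
  shows "snake n \<aa> (ts @ [x])"
proof -
  have "snake_position ((ts @ [x]) ! t) ((ts @ [x]) ! Suc t)" if t: "Suc t < length (ts @ [x])" for t
  proof (cases "Suc t < length ts")
    case True
    then show ?thesis using assms(1) unfolding snake_def by (simp add: nth_append)
  next
    case False
    with t have len: "length ts = Suc t" by simp
    then have "ts \<noteq> []" by auto
    then show ?thesis using assms(3) len by (simp add: nth_append last_conv_nth)
  qed
  then show ?thesis using assms(1,2) unfolding snake_def by simp
qed

lemma snake_position_shift:
  assumes l: "l \<ge> 1" and x: "(i, s) \<in> points n \<aa>" and y: "y \<in> points n \<aa>"
  shows "\<exists>N. snake_position y (i, s + 2 * int l * int N)"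
proof -
  obtain j k where jk: "y = (j, k)" by (cases y)
\<comment> \<open>As \<open>2 * l \<ge> 1\<close>, a shift by \<open>2 * l * N\<close> is at least \<open>N\<close>, which makes up for \<open>\<bar>k - s\<bar>\<close>.\<close>
  define N where "N = nat (\<bar>k - s\<bar> + \<bar>int i - int j\<bar> + 2)"
  have N: "int N = \<bar>k - s\<bar> + \<bar>int i - int j\<bar> + 2" by (simp add: N_def)
  have "1 * int N \<le> (2 * int l) * int N" using l by (intro mult_right_mono) simp_all
  then have "s + 2 * int l * int N - k \<ge> \<bar>int i - int j\<bar> + 2" using N by simp
  moreover have "(s + 2 * int l * int N - k) mod 2 = \<bar>int i - int j\<bar> mod 2"
  proof -
    have "(int i - s) mod 2 = \<aa> mod 2" "(int j - k) mod 2 = \<aa> mod 2"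
      using x y unfolding points_def jk by auto
    then have "(int i - s) mod 2 = (int j - k) mod 2" by simp
    moreover have "(int i - s) - (int j - k) = (int i - int j) - (s - k)" by simp
    ultimately have "(s - k) mod 2 = (int i - int j) mod 2" unfolding mod_eq_dvd_iff[where c = "2 :: int"] by (metis dvd_minus_iff minus_diff_eq)
    moreover have "(s + 2 * int l * int N - k) mod 2 = (s - k) mod 2"
      using mod_mult_self2[of "s - k" 2 "int l * int N"] by (simp add: algebra_simps)
    moreover have "(int i - int j) mod 2 = \<bar>int i - int j\<bar> mod 2" by (simp add: abs_if mod2_eq_if)
    ultimately show ?thesis by simp
  qed
  ultimately show ?thesis unfolding snake_position_def jk by auto
qed

lemma points_shift: "(i, s) \<in> points n \<aa> \<Longrightarrow> (i, s + 2 * int l * int N) \<in> points n \<aa>"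
proof -
  assume "(i, s) \<in> points n \<aa>"
  moreover have "(int i - (s + 2 * int l * int N)) mod 2 = (int i - s) mod 2"
    using mod_mult_self2[of "int i - s" 2 "- (int l * int N)"] by (simp add: algebra_simps)
  ultimately show ?thesis unfolding points_def by auto
qed

text \<open>Each new point is placed so far to the right that the distance to the last one exceeds the bound for
  snake position.\<close>

lemma monomial_as_snake:
  assumes l: "l \<ge> 1" and m: "set_mset m \<subseteq> Yvar l a ` points n \<aa>"
  shows "\<exists>ts. snake n \<aa> ts \<and> m = snake_monomial l a ts"
  using m
proof (induct m)
  case empty
  show ?case by (rule exI[of _ "[]"]) (simp add: snake_def snake_monomial_def)
next
  case (add x m)
  then obtain ts where ts: "snake n \<aa> ts" "m = snake_monomial l a ts" by auto
  from add have "x \<in> Yvar l a ` points n \<aa>" by auto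
  then obtain i s where x: "x = Yvar l a (i, s)" and p: "(i, s) \<in> points n \<aa>" by auto
  have "\<exists>N. ts \<noteq> [] \<longrightarrow> snake_position (last ts) (i, s + 2 * int l * int N)"
  proof (cases "ts = []")
    case False
    then have "last ts \<in> points n \<aa>" using ts(1) last_in_set[OF False] unfolding snake_def by blast
    then show ?thesis using snake_position_shift[OF l p] by blast
  qed simp
  then obtain N where N: "ts \<noteq> [] \<longrightarrow> snake_position (last ts) (i, s + 2 * int l * int N)" by blast
  have "snake n \<aa> (ts @ [(i, s + 2 * int l * int N)])"
    by (rule snake_append[OF ts(1) points_shift[OF p]]) (use N in blast)
  moreover have "add_mset x m = snake_monomial l a (ts @ [(i, s + 2 * int l * int N)])"
    unfolding snake_monomial_def ts(2) x by (simp add: Yvar_periodic[OF l])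
  ultimately show ?case by blast
qed

theorem theorem1p1:
  fixes n l :: nat and a :: complex and \<aa> :: int and V :: "'v Ueps_module"
  assumes "n \<ge> 1" and "l \<ge> 2" and "a \<noteq> 0" and "\<aa> \<in> {0, 1}"
    and "in_category n l a \<aa> V" and "simple_module (Ueps n l) V"
  shows "snake_module n l a \<aa> V \<and>
    (\<forall>m. is_L n l m V \<longrightarrow> (\<exists>ts. snake n \<aa> ts \<and> m = snake_monomial l a ts))"
proof -
  interpret M: module_by_zero "Ueps n l" V
    using assms(6) unfolding simple_module_def module_by_zero_def by blast
  have fin: "fin_dim_module n l V" using assms(5) unfolding in_category_def by blast
  obtain m where m: "set_mset m \<subseteq> Yvar l a ` points n \<aa>" "is_L n l m M.Q"
    using assms(5) M.Q_factor[OF assms(6)] unfolding in_category_def by blast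
  have L: "is_L n l m V" by (rule is_L_from_factor[OF assms(6) fin m(2)])
  obtain ts where ts: "snake n \<aa> ts" "m = snake_monomial l a ts"
    using monomial_as_snake[OF _ m(1)] assms(2) by auto
  show ?thesis
  proof (intro conjI allI impI)
    show "snake_module n l a \<aa> V" unfolding snake_module_def using ts L by blast
    show "\<exists>ts. snake n \<aa> ts \<and> m' = snake_monomial l a ts" if "is_L n l m' V" for m'
      using is_L_unique[OF that L] ts by blast
  qed
qed

end
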